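(* Let $K$ be an algebraically closed field and let $A$ be a finite-dimensional $K$-algebra with $\operatorname{gl.dim}(A) < \infty$. Then the following are equivalent: (i) $A$ is geometrically irreducible; (ii) $A$ is hereditary.
   Context: For $d \ge 0$ let $\operatorname{mod}(A,d)$ be the affine scheme of $d$-dimensional (left) $A$-modules, i.e. of $K$-algebra homomorphisms $A \to M_d(K)$. A finite-dimensional $K$-algebra $A$ is geometrically irreducible if for each $d \ge 0$ all connected components of $\operatorname{mod}(A,d)$ are irreducible. $A$ is hereditary if $\operatorname{gl.dim}(A) \le 1$. *)

theory Defs
  imports
    "HOL-Library.Poly_Mapping"
    "HOL-Library.Extended_Nat"
    "HOL-Computational_Algebra.Polynomial"
    "HOL-Algebra.QuotRing"
    "HOL-Analysis.Abstract_Topological_Spaces"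
    "Jordan_Normal_Form.Matrix_Kernel"
begin

section \<open>Irreducible spaces and the prime spectrum\<close>

definition irreducible_space :: "'a topology \<Rightarrow> bool" where
  "irreducible_space X \<longleftrightarrow>
     topspace X \<noteq> {} \<and>
     (\<forall>S T. closedin X S \<and> closedin X T \<and> S \<union> T = topspace X
        \<longrightarrow> S = topspace X \<or> T = topspace X)"

definition Spec :: "('r, 'm) ring_scheme \<Rightarrow> 'r set set" where
  "Spec R = {P. primeideal P R}"

definition zariski_topology :: "('r, 'm) ring_scheme \<Rightarrow> 'r set topology" where
  "zariski_topology R =
     topology (\<lambda>U. \<exists>S \<subseteq> carrier R. U = {P \<in> Spec R. \<not> S \<subseteq> P})"

text \<open>The following lemmas confirm that the argument of \<^const>\<open>topology\<close> above is
  indeed a topology, whose closed sets are the sets of primes containing a given \<open>S\<close>.\<close>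

lemma istopology_zariski:
  "istopology (\<lambda>U. \<exists>S \<subseteq> carrier R. U = {P \<in> Spec R. \<not> S \<subseteq> P})" (is "istopology ?op")
  unfolding istopology_def
proof (intro conjI allI impI)
  fix U V assume "?op U" "?op V"
  then obtain S T where S: "S \<subseteq> carrier R" "U = {P \<in> Spec R. \<not> S \<subseteq> P}"
    and T: "T \<subseteq> carrier R" "V = {P \<in> Spec R. \<not> T \<subseteq> P}" by auto
  let ?W = "{s \<otimes>\<^bsub>R\<^esub> t | s t. s \<in> S \<and> t \<in> T} \<inter> carrier R"
  have "(\<not> S \<subseteq> P \<and> \<not> T \<subseteq> P) = (\<not> ?W \<subseteq> P)" if P: "P \<in> Spec R" for P
  proof -
    interpret primeideal P R using P by (simp add: Spec_def)
    show ?thesis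
    proof
      assume "\<not> S \<subseteq> P \<and> \<not> T \<subseteq> P"
      then obtain s t where st: "s \<in> S" "s \<notin> P" "t \<in> T" "t \<notin> P" by auto
      have "s \<in> carrier R" "t \<in> carrier R" using st S T by auto
      then have "s \<otimes>\<^bsub>R\<^esub> t \<in> ?W" "s \<otimes>\<^bsub>R\<^esub> t \<notin> P" using st I_prime by auto
      then show "\<not> ?W \<subseteq> P" by blast
    next
      assume "\<not> ?W \<subseteq> P"
      then show "\<not> S \<subseteq> P \<and> \<not> T \<subseteq> P"
        using S(1) T(1) I_l_closed I_r_closed by blast
    qed
  qed
  then have "U \<inter> V = {P \<in> Spec R. \<not> ?W \<subseteq> P}" using S T by auto
  then show "?op (U \<inter> V)" by blast
next
  fix \<U> assume "\<forall>U\<in>\<U>. ?op U"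
  then obtain f where f: "\<And>U. U \<in> \<U> \<Longrightarrow> f U \<subseteq> carrier R \<and> U = {P \<in> Spec R. \<not> f U \<subseteq> P}"
    by metis
  have mem: "P \<in> U \<longleftrightarrow> P \<in> Spec R \<and> \<not> f U \<subseteq> P" if "U \<in> \<U>" for U P
  proof -
    have "U = {P \<in> Spec R. \<not> f U \<subseteq> P}" using f[OF that] ..
    then have "P \<in> U \<longleftrightarrow> P \<in> {P \<in> Spec R. \<not> f U \<subseteq> P}" by (rule arg_cong)
    then show ?thesis by (simp only: mem_Collect_eq)
  qed
  have "\<Union>\<U> = {P \<in> Spec R. \<not> (\<Union>U\<in>\<U>. f U) \<subseteq> P}"
  proof (rule Set.set_eqI)
    fix P
    have "P \<in> \<Union>\<U> \<longleftrightarrow> (\<exists>U\<in>\<U>. P \<in> Spec R \<and> \<not> f U \<subseteq> P)"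
      using mem by (simp only: Union_iff cong: bex_cong)
    then show "P \<in> \<Union>\<U> \<longleftrightarrow> P \<in> {P \<in> Spec R. \<not> (\<Union>U\<in>\<U>. f U) \<subseteq> P}"
      by (simp only: mem_Collect_eq UN_subset_iff) blast
  qed
  moreover have "(\<Union>U\<in>\<U>. f U) \<subseteq> carrier R" using f by blast
  ultimately show "?op (\<Union>\<U>)" by blast
qed

lemma openin_zariski:
  "openin (zariski_topology R) U \<longleftrightarrow> (\<exists>S \<subseteq> carrier R. U = {P \<in> Spec R. \<not> S \<subseteq> P})"
  unfolding zariski_topology_def by (simp only: topology_inverse'[OF istopology_zariski])

lemma topspace_zariski [simp]: "topspace (zariski_topology R) = Spec R"
proof -
  have "\<not> carrier R \<subseteq> P" if "P \<in> Spec R" for P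
  proof -
    interpret primeideal P R using that by (simp add: Spec_def)
    show ?thesis using I_notcarr Icarr by blast
  qed
  then have "openin (zariski_topology R) (Spec R)"
    unfolding openin_zariski by (intro exI[of _ "carrier R"]) auto
  moreover have "U \<subseteq> Spec R" if "openin (zariski_topology R) U" for U
    using that unfolding openin_zariski by (elim exE conjE) simp
  ultimately show ?thesis
    unfolding topspace_def by (intro equalityI Union_least Union_upper) simp_all
qed

lemma closedin_zariski:
  "closedin (zariski_topology R) C \<longleftrightarrow> (\<exists>S \<subseteq> carrier R. C = {P \<in> Spec R. S \<subseteq> P})"
proof -
  have eq: "C \<subseteq> Spec R \<and> Spec R - C = {P \<in> Spec R. \<not> S \<subseteq> P} \<longleftrightarrow> C = {P \<in> Spec R. S \<subseteq> P}" for S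
    by (auto simp only: set_eq_iff Diff_iff mem_Collect_eq subset_iff[of C])
  have "closedin (zariski_topology R) C \<longleftrightarrow>
      (\<exists>S. S \<subseteq> carrier R \<and> C \<subseteq> Spec R \<and> Spec R - C = {P \<in> Spec R. \<not> S \<subseteq> P})"
    unfolding closedin_def openin_zariski topspace_zariski by iprover
  then show ?thesis unfolding eq .
qed


section \<open>Polynomial rings\<close>

text \<open>A monomial in variables from \<open>'v\<close> is a finitely supported exponent function
  \<open>'v \<Rightarrow>\<^sub>0 nat\<close>, and a polynomial is a finitely supported function from monomials to \<open>'k\<close>.\<close>

type_synonym ('v, 'k) mpoly = "('v \<Rightarrow>\<^sub>0 nat) \<Rightarrow>\<^sub>0 'k"

definition Var :: "'v \<Rightarrow> ('v, 'k::comm_ring_1) mpoly" where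
  "Var x = Poly_Mapping.single (Poly_Mapping.single x 1) 1"

definition Const :: "'k \<Rightarrow> ('v, 'k::comm_ring_1) mpoly" where
  "Const c = Poly_Mapping.single 0 c"

definition poly_ring_in :: "'v set \<Rightarrow> ('v, 'k::comm_ring_1) mpoly ring" where
  "poly_ring_in V =
     \<lparr>carrier = {p. \<forall>m \<in> Poly_Mapping.keys p. Poly_Mapping.keys m \<subseteq> V},
      mult = (*), one = 1, zero = 0, add = (+)\<rparr>"

lemma cring_poly_ring_in: "cring (poly_ring_in V :: ('v, 'k::comm_ring_1) mpoly ring)"
proof -
  define C where "C = {p :: ('v, 'k) mpoly. \<forall>m \<in> Poly_Mapping.keys p. Poly_Mapping.keys m \<subseteq> V}"
  have CI: "p \<in> C" if "\<And>m. m \<in> Poly_Mapping.keys p \<Longrightarrow> Poly_Mapping.keys m \<subseteq> V" for p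
    using that unfolding C_def by (intro CollectI ballI)
  have CD: "Poly_Mapping.keys m \<subseteq> V" if "p \<in> C" "m \<in> Poly_Mapping.keys p" for p m
    using that unfolding C_def by (elim CollectE bspec)
  have add: "p + q \<in> C" if "p \<in> C" "q \<in> C" for p q
  proof (rule CI)
    fix m assume "m \<in> Poly_Mapping.keys (p + q)"
    then have "m \<in> Poly_Mapping.keys p \<union> Poly_Mapping.keys q"
      using Poly_Mapping.keys_add by (rule rev_subsetD)
    then show "Poly_Mapping.keys m \<subseteq> V"
      using CD[OF that(1)] CD[OF that(2)] by (elim UnE)
  qed
  have mult: "p * q \<in> C" if "p \<in> C" "q \<in> C" for p q
  proof (rule CI)
    fix m assume "m \<in> Poly_Mapping.keys (p * q)"
    then obtain a b where m: "m = a + b" "a \<in> Poly_Mapping.keys p" "b \<in> Poly_Mapping.keys q"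
      using keys_mult[of p q] by blast
    have "Poly_Mapping.keys m \<subseteq> Poly_Mapping.keys a \<union> Poly_Mapping.keys b"
      unfolding m(1) by (rule Poly_Mapping.keys_add)
    also have "\<dots> \<subseteq> V"
      using CD[OF that(1) m(2)] CD[OF that(2) m(3)] by (rule Un_least)
    finally show "Poly_Mapping.keys m \<subseteq> V" .
  qed
  have one: "1 \<in> C"
    by (rule CI) (simp flip: single_one)
  have zero: "0 \<in> C"
    by (rule CI) simp
  have neg: "- p \<in> C" if "p \<in> C" for p
    using CD[OF that] by (intro CI) (simp only: keys_minus)
  have R: "poly_ring_in V = \<lparr>carrier = C, mult = (*), one = 1, zero = 0, add = (+)\<rparr>"
    unfolding poly_ring_in_def C_def ..
  show ?thesis
    unfolding R
  proof (rule cringI)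
    show "abelian_group \<lparr>carrier = C, mult = (*), one = 1, zero = 0, add = (+)\<rparr>"
    proof (rule abelian_groupI; simp only: ring_record_simps)
      fix p assume "p \<in> C"
      then show "\<exists>q\<in>C. q + p = 0" using neg by (intro bexI[of _ "- p"]) simp_all
    qed (simp_all add: add zero add_ac)
    show "comm_monoid \<lparr>carrier = C, mult = (*), one = 1, zero = 0, add = (+)\<rparr>"
      by (rule comm_monoidI; simp only: ring_record_simps) (simp_all add: mult one mult_ac)
  qed (simp only: ring_record_simps distrib_right)
qed


section \<open>Finite-dimensional algebras and their module schemes\<close>

text \<open>Unital associative algebras over a field \<open>'k\<close>. The sort \<open>{ring, monoid_mult}\<close> is used
  instead of \<open>ring_1\<close> because the latter excludes the zero algebra.\<close>

locale fin_dim_algebra = vector_space scale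
  for scale :: "'k::field \<Rightarrow> 'a::{ring, monoid_mult} \<Rightarrow> 'a" +
  assumes scale_mult_left: "scale c a * b = scale c (a * b)"
    and scale_mult_right: "a * scale c b = scale c (a * b)"
    and finite_dim: "\<exists>B. finite B \<and> span B = UNIV"
begin

text \<open>The scheme of \<open>d\<close>-dimensional modules is represented by the quotient of the polynomial
  ring in the variables \<open>(a, i, j)\<close>, where \<open>a\<close> ranges over the algebra and \<open>i, j < d\<close>, by the
  relations which say that the generic matrices \<open>X\<^sub>a = (Var (a, i, j))\<^sub>i\<^sub>j\<close> depend on \<open>a\<close> as
  a \<open>K\<close>-algebra homomorphism. Homomorphisms from this ring to a commutative \<open>K\<close>-algebra \<open>L\<close>
  are thus the \<open>K\<close>-algebra homomorphisms from the algebra to the \<open>d \<times> d\<close> matrices over \<open>L\<close>.\<close>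

definition mod_vars :: "nat \<Rightarrow> ('a \<times> nat \<times> nat) set" where
  "mod_vars d = UNIV \<times> {..<d} \<times> {..<d}"

definition mod_relations :: "nat \<Rightarrow> ('a \<times> nat \<times> nat, 'k) mpoly set" where
  "mod_relations d =
     {Var (a + b, i, j) - (Var (a, i, j) + Var (b, i, j)) | a b i j. i < d \<and> j < d} \<union>
     {Var (scale c a, i, j) - Const c * Var (a, i, j) | c a i j. i < d \<and> j < d} \<union>
     {Var (a * b, i, j) - (\<Sum>l<d. Var (a, i, l) * Var (b, l, j)) | a b i j. i < d \<and> j < d} \<union>
     {Var (1, i, j) - (if i = j then 1 else 0) | i j. i < d \<and> j < d}"

definition mod_coordinate_ring :: "nat \<Rightarrow> ('a \<times> nat \<times> nat, 'k) mpoly set ring" where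
  "mod_coordinate_ring d =
     poly_ring_in (mod_vars d) Quot (Idl\<^bsub>poly_ring_in (mod_vars d)\<^esub> (mod_relations d))"

text \<open>The underlying topological space of the affine scheme \<open>mod(A, d)\<close>.\<close>

definition mod_space :: "nat \<Rightarrow> ('a \<times> nat \<times> nat, 'k) mpoly set set topology" where
  "mod_space d = zariski_topology (mod_coordinate_ring d)"

definition geometrically_irreducible :: bool where
  "geometrically_irreducible \<longleftrightarrow>
     (\<forall>d. \<forall>C \<in> connected_components_of (mod_space d).
        irreducible_space (subtopology (mod_space d) C))"


end


section \<open>Finite-dimensional modules and global dimension\<close>

text \<open>A \<open>d\<close>-dimensional left module is given on the space \<open>K^d\<close> of column vectors by a
  \<open>K\<close>-algebra homomorphism to the \<open>d \<times> d\<close> matrices.\<close>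

type_synonym ('a, 'k) rep = "nat \<times> ('a \<Rightarrow> 'k mat)"

context fin_dim_algebra
begin

definition is_module :: "('a, 'k) rep \<Rightarrow> bool" where
  "is_module M \<longleftrightarrow>
     (case M of (d, \<rho>) \<Rightarrow>
       (\<forall>a. \<rho> a \<in> carrier_mat d d) \<and>
       (\<forall>a b. \<rho> (a + b) = \<rho> a + \<rho> b) \<and>
       (\<forall>c a. \<rho> (scale c a) = c \<cdot>\<^sub>m \<rho> a) \<and>
       (\<forall>a b. \<rho> (a * b) = \<rho> a * \<rho> b) \<and>
       \<rho> 1 = 1\<^sub>m d)"

definition module_hom :: "('a, 'k) rep \<Rightarrow> ('a, 'k) rep \<Rightarrow> 'k mat set" where
  "module_hom M N =
     {f \<in> carrier_mat (fst N) (fst M). \<forall>a. f * snd M a = snd N a * f}"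

definition mat_image :: "'k mat \<Rightarrow> 'k vec set" where
  "mat_image f = (\<lambda>v. f *\<^sub>v v) ` carrier_vec (dim_col f)"

definition projective :: "('a, 'k) rep \<Rightarrow> bool" where
  "projective P \<longleftrightarrow>
     is_module P \<and>
     (\<forall>M N. is_module M \<and> is_module N \<longrightarrow>
        (\<forall>g \<in> module_hom M N. \<forall>f \<in> module_hom P N.
           mat_image g = carrier_vec (fst N) \<longrightarrow> (\<exists>h \<in> module_hom P M. g * h = f)))"

text \<open>An exact sequence \<open>0 \<rightarrow> P n \<rightarrow> \<dots> \<rightarrow> P 0 \<rightarrow> M \<rightarrow> 0\<close> with projective terms \<open>P i\<close>; it is
  extended by \<open>P i = 0\<close> for \<open>i > n\<close>, so that exactness at \<open>P n\<close> expresses injectivity.\<close>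

definition has_projective_resolution :: "('a, 'k) rep \<Rightarrow> nat \<Rightarrow> bool" where
  "has_projective_resolution M n \<longleftrightarrow>
     (\<exists>P \<epsilon> \<delta>.
        (\<forall>i. projective (P i)) \<and> (\<forall>i>n. fst (P i) = 0) \<and>
        \<epsilon> \<in> module_hom (P 0) M \<and> (\<forall>i. \<delta> i \<in> module_hom (P (Suc i)) (P i)) \<and>
        mat_image \<epsilon> = carrier_vec (fst M) \<and>
        mat_image (\<delta> 0) = mat_kernel \<epsilon> \<and>
        (\<forall>i. mat_image (\<delta> (Suc i)) = mat_kernel (\<delta> i)))"

definition proj_dim :: "('a, 'k) rep \<Rightarrow> enat" where
  "proj_dim M = (INF n \<in> {n. has_projective_resolution M n}. enat n)"

definition gl_dim :: enat where
  "gl_dim = (SUP M \<in> {M. is_module M}. proj_dim M)"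

definition hereditary :: bool where
  "hereditary \<longleftrightarrow> gl_dim \<le> 1"

end

end

theory Submission
  imports Defs "Jordan_Normal_Form.Determinant" "HOL-Library.Function_Algebras"
begin

text \<open>By the weak Nullstellensatz, the topology of \<open>mod(A, d)\<close> is controlled by its closed points, the
  \<open>d\<close>-dimensional modules.

  Let \<open>A\<close> be hereditary. Then the kernel of the free cover \<open>A\<^sup>d \<rightarrow> M\<close> of a \<open>d\<close>-dimensional module
  is projective. The modules with a fixed isomorphism class of this kernel form an open set, since
  embeddings of a projective module deform along with \<open>M\<close>, and an irreducible one, since two of them
  are joined by an open subset of the affine line of embeddings. So these disjoint sets are the
  connected components.

  Conversely, consider the end \<open>P2 \<rightarrow> P1 \<rightarrow> P0\<close> of a projective resolution of length at least two and
  let \<open>\<eta>\<close> be the class of \<open>P1\<close> as an extension of \<open>W = P1 / P2\<close> by \<open>P2\<close>. As \<open>W\<close> embeds into \<open>P0\<close>, it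
  embeds into a projective module \<open>F\<close> such that every map \<open>W \<rightarrow> P2\<close> extends to \<open>F\<close>; let \<open>Q = F / W\<close>.
  Both \<open>P2 \<oplus> F\<close> and \<open>P1 \<oplus> Q\<close> degenerate to \<open>P2 \<oplus> W \<oplus> Q\<close>, so they lie in one component. If it is
  irreducible, then any neighbourhood of \<open>P1 \<oplus> Q\<close> contains modules isomorphic to the projective, hence
  rigid, module \<open>P2 \<oplus> F\<close>, so that \<open>dim Hom(P2 \<oplus> F, P2) \<le> dim Hom(P1 \<oplus> Q, P2)\<close> by semicontinuity. But the
  choice of \<open>F\<close> gives the opposite strict inequality unless \<open>\<eta>\<close> splits, and in that case the resolution
  can be shortened.\<close>

section \<open>The weak Nullstellensatz\<close>

text \<open>The generators of the free module A^d give all free covers A^d \<rightarrow> M the same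
  linear section. A d-dimensional module thus amounts to a submodule of A^d complementary to one
  fixed subspace, and deforming modules becomes deforming embeddings, with inverses written by
  adjugates. The strict inequality is a count of maps into P2. Both modules carry filtrations with
  the factors P2, W, Q, which bounds the dimension of the space of maps by dim Hom(P2, P2) + dim
  Hom(W, P2) + dim Hom(Q, P2). For P2 \<oplus> F the bound is attained, because every map W
  \<rightarrow> P2 extends to F. For P1 \<oplus> Q it is attained only if every endomorphism of P2
  extends to P1, and an extension of the identity is a splitting of \<eta>. The end of the
  resolution is the place to argue because its last map is injective, which makes P1 an extension of
  W by P2. Finite global dimension supplies some finite resolution, and shortening by one step at a
  time brings any length down to one.\<close>

lemma infinite_UNIV_alg_closed: "infinite (UNIV :: 'k::alg_closed_field set)"
proof
  assume fin: "finite (UNIV :: 'k set)"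
  define p where "p = (\<Prod>a\<in>(UNIV :: 'k set). [:-a, 1:])"
  have "degree p = card (UNIV :: 'k set)"
    unfolding p_def by (subst degree_prod_sum_eq) auto
  moreover have "card (UNIV :: 'k set) > 0" using fin by (simp add: card_gt_0_iff)
  ultimately have "degree (p + 1) > 0" by (subst degree_add_eq_left) auto
  then obtain x where "poly (p + 1) x = 0" using alg_closed_imp_poly_has_root by blast
  moreover have "poly p x = 0" using fin by (auto simp: p_def poly_prod)
  ultimately show False by simp
qed

text \<open>The domain \<open>B / (B \<inter> Q)\<close> is represented by a subring \<open>B\<close> and a prime ideal \<open>Q\<close> of an ambient
  ring, so that adjoining an element changes only \<open>B\<close>.\<close>

locale prime_over_subring =
  fixes B Q :: "'r::comm_ring_1 set"
  assumes B_zero: "0 \<in> B" and B_one: "1 \<in> B"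
    and B_add: "\<lbrakk>a \<in> B; b \<in> B\<rbrakk> \<Longrightarrow> a + b \<in> B"
    and B_minus: "a \<in> B \<Longrightarrow> - a \<in> B"
    and B_mult: "\<lbrakk>a \<in> B; b \<in> B\<rbrakk> \<Longrightarrow> a * b \<in> B"
    and Q_zero: "0 \<in> Q"
    and Q_add: "\<lbrakk>a \<in> Q; b \<in> Q\<rbrakk> \<Longrightarrow> a + b \<in> Q"
    and Q_mult: "a \<in> Q \<Longrightarrow> r * a \<in> Q"
    and Q_one: "1 \<notin> Q"
    and Q_prime: "a * b \<in> Q \<Longrightarrow> a \<in> Q \<or> b \<in> Q"
begin

lemma Q_minus: "a \<in> Q \<Longrightarrow> - a \<in> Q"
  using Q_mult[of a "-1"] by simp

lemma Q_diff: "\<lbrakk>a \<in> Q; b \<in> Q\<rbrakk> \<Longrightarrow> a - b \<in> Q"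
  using Q_add[OF _ Q_minus[of b], of a] by simp

lemma Q_mult_right: "a \<in> Q \<Longrightarrow> a * r \<in> Q"
  using Q_mult[of a r] by (simp add: mult.commute)

lemma Q_sum: "(\<And>i. i \<in> I \<Longrightarrow> f i \<in> Q) \<Longrightarrow> sum f I \<in> Q"
  by (induction I rule: infinite_finite_induct) (auto intro: Q_zero Q_add)

lemma Q_power: "a \<notin> Q \<Longrightarrow> a ^ k \<notin> Q"
  by (induction k) (use Q_one Q_prime in auto)

lemma Q_diff_cong: "a - b \<in> Q \<Longrightarrow> a \<in> Q \<longleftrightarrow> b \<in> Q"
  using Q_add[of "a - b" b] Q_diff[of a "a - b"] by auto

lemma B_diff: "\<lbrakk>a \<in> B; b \<in> B\<rbrakk> \<Longrightarrow> a - b \<in> B"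
  using B_add[OF _ B_minus[of b], of a] by simp

lemma B_sum: "(\<And>i. i \<in> I \<Longrightarrow> f i \<in> B) \<Longrightarrow> sum f I \<in> B"
  by (induction I rule: infinite_finite_induct) (auto intro: B_zero B_add)

lemma B_power: "a \<in> B \<Longrightarrow> a ^ k \<in> B"
  by (induction k) (auto intro: B_one B_mult)

text \<open>Polynomials over the domain are represented by polynomials over the ambient ring with
  coefficients in \<open>B\<close>; equality over the domain means that the coefficients agree
  modulo \<open>Q\<close>.\<close>

definition polys :: "'r poly set" where "polys = {P. \<forall>i. coeff P i \<in> B}"

lemma polys_coeff: "P \<in> polys \<Longrightarrow> coeff P i \<in> B"
  by (simp add: polys_def)

lemma polys_add: "\<lbrakk>P \<in> polys; R \<in> polys\<rbrakk> \<Longrightarrow> P + R \<in> polys"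
  by (simp add: polys_def B_add)

lemma polys_diff: "\<lbrakk>P \<in> polys; R \<in> polys\<rbrakk> \<Longrightarrow> P - R \<in> polys"
  by (simp add: polys_def B_diff)

lemma polys_minus: "P \<in> polys \<Longrightarrow> - P \<in> polys"
  by (simp add: polys_def B_minus)

lemma polys_mult: "\<lbrakk>P \<in> polys; R \<in> polys\<rbrakk> \<Longrightarrow> P * R \<in> polys"
  by (simp add: polys_def coeff_mult B_sum B_mult)

lemma polys_smult: "\<lbrakk>c \<in> B; P \<in> polys\<rbrakk> \<Longrightarrow> Polynomial.smult c P \<in> polys"
  by (simp add: polys_def B_mult)

lemma polys_monom: "c \<in> B \<Longrightarrow> monom c n \<in> polys"
  by (simp add: polys_def B_zero)

lemma polys_zero: "0 \<in> polys"
  by (simp add: polys_def B_zero)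

lemma polys_const: "c \<in> B \<Longrightarrow> [:c:] \<in> polys"
  using polys_monom[of c 0] by (simp add: monom_0)

lemma poly_mem_Q: "(\<And>i. coeff P i \<in> Q) \<Longrightarrow> poly P x \<in> Q"
  by (simp add: poly_altdef Q_sum Q_mult_right)

text \<open>The degree over the quotient domain can be smaller than the degree of a representative.
  Dropping the terms above the last coefficient outside \<open>Q\<close> gives a representative
  whose leading coefficient is nonzero in the domain.\<close>

lemma truncate_poly:
  assumes "P \<in> polys" "coeff P j \<notin> Q"
  obtains P' where "P' \<in> polys" "degree P' \<le> degree P" "lead_coeff P' \<notin> Q"
    "\<And>i. coeff P i - coeff P' i \<in> Q"
proof -
  define n where "n = Max {i. coeff P i \<notin> Q}"
  have "{i. coeff P i \<notin> Q} \<subseteq> {..degree P}"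
    using Q_zero by (auto intro: le_degree)
  then have fin: "finite {i. coeff P i \<notin> Q}" by (rule finite_subset) simp
  then have n: "coeff P n \<notin> Q"
    using Max_in[OF fin] assms(2) by (auto simp: n_def)
  have max: "coeff P i \<in> Q" if "i > n" for i
    using that Max_ge[OF fin, of i] by (auto simp: n_def)
  define P' where "P' = (\<Sum>i\<le>n. monom (coeff P i) i)"
  have co: "coeff P' i = (if i \<le> n then coeff P i else 0)" for i
    by (simp add: P'_def coeff_sum)
  have "degree P' = n"
  proof (rule antisym)
    show "degree P' \<le> n" by (rule degree_le) (simp add: co)
    show "n \<le> degree P'" using n Q_zero by (intro le_degree) (auto simp: co)
  qed
  moreover have "n \<le> degree P" using n Q_zero by (intro le_degree) auto
  ultimately show ?thesis
    using assms n max by (intro that[of P']) (auto simp: co polys_def B_zero Q_zero)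
qed

text \<open>Each division step multiplies \<open>H\<close> by the leading coefficient of
  \<open>P\<close> instead of dividing by it, and \<open>k\<close> counts the steps. The power does
  no harm where that coefficient lies outside \<open>Q\<close> or has a nonzero value at a chosen
  point.\<close>

lemma pseudo_division:
  assumes P: "P \<in> polys" "degree P > 0" and H: "H \<in> polys"
  shows "\<exists>k. \<exists>A\<in>polys. \<exists>R\<in>polys. Polynomial.smult (lead_coeff P ^ k) H = A * P + R \<and> degree R < degree P"
  using H
proof (induction "degree H" arbitrary: H rule: less_induct)
  case less
  let ?b = "lead_coeff P"
  show ?case
  proof (cases "degree H < degree P")
    case True
    then show ?thesis using less.prems polys_zero by (intro exI[of _ 0] bexI[of _ 0] bexI[of _ H]) auto
  next
    case False
    define M where "M = monom (lead_coeff H) (degree H - degree P)"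
    define H' where "H' = Polynomial.smult ?b H - M * P"
    have M: "M \<in> polys" unfolding M_def by (intro polys_monom polys_coeff less.prems)
    have H': "H' \<in> polys"
      unfolding H'_def by (intro polys_diff polys_smult polys_mult M P polys_coeff less.prems)
    have "degree (M * P) \<le> degree H"
      using False degree_mult_le[of M P] degree_monom_le[of "lead_coeff H" "degree H - degree P"]
      unfolding M_def by linarith
    then have "degree H' \<le> degree H"
      unfolding H'_def by (intro degree_diff_le) (auto intro: order_trans[OF degree_smult_le])
    moreover have "coeff H' (degree H) = 0"
    proof -
      have "coeff (M * P) (degree H) = lead_coeff H * lead_coeff P"
        using False unfolding M_def by (subst coeff_monom_mult) simp
      then show ?thesis by (simp add: H'_def)
    qed
    ultimately have "degree H' < degree H"
      using False P(2) eq_zero_or_degree_less[of H' "degree H"] by auto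
    from less.hyps[OF this H'] obtain k A R where *: "A \<in> polys" "R \<in> polys"
      "Polynomial.smult (?b ^ k) H' = A * P + R" "degree R < degree P" by auto
    have "Polynomial.smult (?b ^ Suc k) H = Polynomial.smult (?b ^ k) (H' + M * P)"
      by (simp add: H'_def mult.commute)
    also have "\<dots> = (A + Polynomial.smult (?b ^ k) M) * P + R"
      by (simp add: smult_add_right *(3) algebra_simps)
    finally show ?thesis
      using * M P by (intro exI[of _ "Suc k"] bexI[of _ "A + Polynomial.smult (?b ^ k) M"] bexI[of _ R])
        (auto intro!: polys_add polys_smult B_power polys_coeff)
  qed
qed

definition adjoin :: "'r \<Rightarrow> 'r set" where
  "adjoin x = (\<lambda>P. poly P x) ` polys"

lemma adjoin_supset: "B \<subseteq> adjoin x"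
  unfolding adjoin_def using polys_const by (force intro!: image_eqI)

lemma adjoin_self: "x \<in> adjoin x"
  unfolding adjoin_def using polys_monom[OF B_one, of 1]
  by (intro image_eqI[of _ _ "monom 1 1"]) (auto simp: poly_monom)

lemma prime_over_adjoin: "prime_over_subring (adjoin x) Q"
proof
  show "0 \<in> adjoin x" "1 \<in> adjoin x" using adjoin_supset B_zero B_one by auto
  show "a + b \<in> adjoin x" "a * b \<in> adjoin x" if ab: "a \<in> adjoin x" "b \<in> adjoin x" for a b
  proof -
    obtain P R where "P \<in> polys" "R \<in> polys" "a = poly P x" "b = poly R x"
      using ab by (auto simp: adjoin_def)
    then have "a + b = poly (P + R) x" "P + R \<in> polys" "a * b = poly (P * R) x" "P * R \<in> polys"
      by (simp_all add: polys_add polys_mult)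
    then show "a + b \<in> adjoin x" "a * b \<in> adjoin x"
      unfolding adjoin_def by blast+
  qed
  show "- a \<in> adjoin x" if "a \<in> adjoin x" for a
    using that unfolding adjoin_def by (auto intro!: image_eqI[of _ _ "- P" for P] polys_minus)
qed (use Q_zero Q_add Q_mult Q_one Q_prime in auto)

text \<open>A \<open>K\<close>-algebra homomorphism from the domain
  \<open>B / (B \<inter> Q)\<close> to \<open>K\<close>, with arbitrary values outside
  \<open>B\<close>.\<close>

definition point :: "('k::field \<Rightarrow> 'r) \<Rightarrow> ('r \<Rightarrow> 'k) \<Rightarrow> bool" where
  "point \<iota> \<phi> \<longleftrightarrow> (\<forall>a\<in>B. \<forall>b\<in>B. \<phi> (a + b) = \<phi> a + \<phi> b \<and> \<phi> (a * b) = \<phi> a * \<phi> b) \<and>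
     (\<forall>c. \<phi> (\<iota> c) = c) \<and> (\<forall>q\<in>Q \<inter> B. \<phi> q = 0)"

text \<open>The invariant of the induction on generators. Mere existence of a point would not be
  inductive: extending a point over an algebraic element requires that it avoid the zeros of a
  leading coefficient.\<close>

definition enough_points :: "('k::field \<Rightarrow> 'r) \<Rightarrow> bool" where
  "enough_points \<iota> \<longleftrightarrow> (\<forall>f\<in>B - Q. \<exists>\<phi>. point \<iota> \<phi> \<and> \<phi> f \<noteq> 0)"

context
  fixes \<iota> :: "'k::field \<Rightarrow> 'r" and \<phi> :: "'r \<Rightarrow> 'k"
  assumes \<phi>: "point \<iota> \<phi>"
begin

lemma point_add: "\<lbrakk>a \<in> B; b \<in> B\<rbrakk> \<Longrightarrow> \<phi> (a + b) = \<phi> a + \<phi> b"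
  and point_mult: "\<lbrakk>a \<in> B; b \<in> B\<rbrakk> \<Longrightarrow> \<phi> (a * b) = \<phi> a * \<phi> b"
  and point_scalar: "\<phi> (\<iota> c) = c"
  and point_Q: "\<lbrakk>q \<in> Q; q \<in> B\<rbrakk> \<Longrightarrow> \<phi> q = 0"
  using \<phi> by (auto simp: point_def)

lemma point_zero: "\<phi> 0 = 0"
  using point_Q Q_zero B_zero by auto

lemma point_sum: "(\<And>i. i \<in> I \<Longrightarrow> f i \<in> B) \<Longrightarrow> \<phi> (sum f I) = (\<Sum>i\<in>I. \<phi> (f i))"
  by (induction I rule: infinite_finite_induct) (auto simp: point_zero point_add B_sum)

lemma point_diff: "\<lbrakk>a \<in> B; b \<in> B\<rbrakk> \<Longrightarrow> \<phi> (a - b) = \<phi> a - \<phi> b"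
  using point_add[of "a - b" b] B_diff[of a b] by simp

lemma point_power_notin: "\<lbrakk>a \<in> B; \<phi> a \<noteq> 0\<rbrakk> \<Longrightarrow> \<phi> (a ^ Suc k) \<noteq> 0"
  by (induction k) (simp_all add: point_mult B_mult B_power)

lemma point_map_poly_add:
  "\<lbrakk>P \<in> polys; R \<in> polys\<rbrakk> \<Longrightarrow> map_poly \<phi> (P + R) = map_poly \<phi> P + map_poly \<phi> R"
  by (intro poly_eqI) (simp add: coeff_map_poly point_zero point_add polys_coeff)

lemma point_map_poly_diff:
  "\<lbrakk>P \<in> polys; R \<in> polys\<rbrakk> \<Longrightarrow> map_poly \<phi> (P - R) = map_poly \<phi> P - map_poly \<phi> R"
  by (intro poly_eqI) (simp add: coeff_map_poly point_zero point_diff polys_coeff)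

lemma point_map_poly_mult:
  "\<lbrakk>P \<in> polys; R \<in> polys\<rbrakk> \<Longrightarrow> map_poly \<phi> (P * R) = map_poly \<phi> P * map_poly \<phi> R"
  by (intro poly_eqI) (simp add: coeff_map_poly point_zero coeff_mult point_sum point_mult B_mult polys_coeff)

lemma point_map_poly_smult:
  "\<lbrakk>c \<in> B; P \<in> polys\<rbrakk> \<Longrightarrow> map_poly \<phi> (Polynomial.smult c P) = Polynomial.smult (\<phi> c) (map_poly \<phi> P)"
  by (intro poly_eqI) (simp add: coeff_map_poly point_zero point_mult polys_coeff)

text \<open>The value \<open>\<xi>\<close> at \<open>x\<close> only has to satisfy the relations of
  \<open>x\<close> modulo \<open>Q\<close>. The hypothesis, applied to the difference of two
  polynomial expressions for the same element, shows that the arbitrary choice of expression does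
  not affect the value.\<close>

lemma extend_point:
  assumes \<iota>: "range \<iota> \<subseteq> B"
    and \<xi>: "\<And>H. \<lbrakk>H \<in> polys; poly H x \<in> Q\<rbrakk> \<Longrightarrow> poly (map_poly \<phi> H) \<xi> = 0"
  obtains \<psi> where "prime_over_subring.point (adjoin x) Q \<iota> \<psi>"
    "\<And>P. P \<in> polys \<Longrightarrow> \<psi> (poly P x) = poly (map_poly \<phi> P) \<xi>"
proof -
  define \<psi> where "\<psi> y = poly (map_poly \<phi> (SOME P. P \<in> polys \<and> poly P x = y)) \<xi>" for y
  have \<psi>: "\<psi> (poly P x) = poly (map_poly \<phi> P) \<xi>" if P: "P \<in> polys" for P
  proof -
    define R where "R = (SOME R. R \<in> polys \<and> poly R x = poly P x)"
    have R: "R \<in> polys \<and> poly R x = poly P x"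
      unfolding R_def by (rule someI[of _ P]) (use P in simp)
    have "poly (map_poly \<phi> (R - P)) \<xi> = 0"
      using R P Q_zero by (intro \<xi>) (auto simp: polys_diff)
    then show ?thesis
      using R P by (simp add: \<psi>_def R_def[symmetric] point_map_poly_diff)
  qed
  interpret ad: prime_over_subring "adjoin x" Q by (rule prime_over_adjoin)
  have "ad.point \<iota> \<psi>"
    unfolding ad.point_def
  proof (intro conjI ballI allI)
    fix a b assume "a \<in> adjoin x" "b \<in> adjoin x"
    then obtain P R where PR: "P \<in> polys" "R \<in> polys" "a = poly P x" "b = poly R x"
      by (auto simp: adjoin_def)
    show "\<psi> (a + b) = \<psi> a + \<psi> b"
      using PR \<psi>[of "P + R"] by (simp add: \<psi> polys_add point_map_poly_add)
    show "\<psi> (a * b) = \<psi> a * \<psi> b"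
      using PR \<psi>[of "P * R"] by (simp add: \<psi> polys_mult point_map_poly_mult)
  next
    fix c
    have "\<psi> (poly [:\<iota> c:] x) = poly (map_poly \<phi> [:\<iota> c:]) \<xi>"
      using \<iota> by (intro \<psi> polys_const) auto
    then show "\<psi> (\<iota> c) = c"
      by (simp add: map_poly_pCons point_zero point_scalar)
  next
    fix q assume "q \<in> Q \<inter> adjoin x"
    then show "\<psi> q = 0" by (auto simp: adjoin_def \<psi> \<xi>)
  qed
  with \<psi> that show ?thesis by blast
qed

end

text \<open>If \<open>x\<close> is transcendental over the domain, all but finitely many values of
  \<open>x\<close> keep \<open>f\<close> nonzero. If \<open>x\<close> is algebraic, \<open>f\<close>
  divides a nonzero element \<open>r\<close> of the domain; a point of \<open>B\<close> where
  \<open>r\<close> and the leading coefficient of a minimal relation do not vanish extends by a root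
  of the specialized relation.\<close>

lemma enough_points_adjoin:
  fixes \<iota> :: "'k::alg_closed_field \<Rightarrow> 'r"
  assumes N: "enough_points \<iota>" and \<iota>: "range \<iota> \<subseteq> B"
  shows "prime_over_subring.enough_points (adjoin x) Q \<iota>"
proof -
  interpret ad: prime_over_subring "adjoin x" Q by (rule prime_over_adjoin)
  have "\<exists>\<psi>. ad.point \<iota> \<psi> \<and> \<psi> f \<noteq> 0" if f: "f \<in> adjoin x" "f \<notin> Q" for f
  proof -
    obtain F where F: "F \<in> polys" "f = poly F x" using f by (auto simp: adjoin_def)
    have "\<exists>j. coeff F j \<notin> Q" using f F poly_mem_Q by blast
    then obtain j where j: "coeff F j \<notin> Q" ..
    show ?thesis
    proof (cases "\<forall>P\<in>polys. poly P x \<in> Q \<longrightarrow> (\<forall>i. coeff P i \<in> Q)")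
      case True
      obtain \<phi> where \<phi>: "point \<iota> \<phi>" "\<phi> (coeff F j) \<noteq> 0"
        using N j polys_coeff[OF F(1)] unfolding enough_points_def by auto
      have "coeff (map_poly \<phi> F) j \<noteq> 0"
        using \<phi> by (simp add: coeff_map_poly point_zero[OF \<phi>(1)])
      then have "map_poly \<phi> F \<noteq> 0" by auto
      then have "finite {\<xi>. poly (map_poly \<phi> F) \<xi> = 0}" by (rule poly_roots_finite)
      moreover have "infinite (UNIV :: 'k set)" by (rule infinite_UNIV_alg_closed)
      ultimately obtain \<xi> where \<xi>: "poly (map_poly \<phi> F) \<xi> \<noteq> 0"
        by (metis (mono_tags, lifting) UNIV_I finite_subset mem_Collect_eq subsetI)
      have "poly (map_poly \<phi> H) \<xi> = 0" if "H \<in> polys" "poly H x \<in> Q" for H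
      proof -
        have "map_poly \<phi> H = 0"
          using True that by (intro poly_eqI) (simp add: coeff_map_poly point_zero[OF \<phi>(1)] point_Q[OF \<phi>(1)] polys_coeff)
        then show ?thesis by simp
      qed
      from extend_point[OF \<phi>(1) \<iota> this] show ?thesis
        using \<xi> F by metis
    next
      case False
      \<comment> \<open>Relations of \<open>x\<close> with nonzero leading coefficient over the
        domain; one of least degree takes the place of the minimal polynomial.\<close>
      define bad where "bad P \<longleftrightarrow> P \<in> polys \<and> poly P x \<in> Q \<and> lead_coeff P \<notin> Q" for P
      have "\<exists>P. bad P"
      proof -
        obtain P j where "P \<in> polys" "poly P x \<in> Q" "coeff P j \<notin> Q" using False by auto
        with truncate_poly[OF this(1,3)] obtain P' where P': "P' \<in> polys" "lead_coeff P' \<notin> Q"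
          "\<And>i. coeff P i - coeff P' i \<in> Q" by metis
        have "poly (P - P') x \<in> Q" using P' by (intro poly_mem_Q) simp
        then have "poly P' x \<in> Q" using \<open>poly P x \<in> Q\<close> Q_diff_cong by simp
        with P' show ?thesis by (auto simp: bad_def)
      qed
      then obtain P where P: "bad P" and Pmin: "\<And>P'. bad P' \<Longrightarrow> degree P \<le> degree P'"
        using ex_has_least_nat[of bad _ degree] by blast
      have Pp: "P \<in> polys" "poly P x \<in> Q" "lead_coeff P \<notin> Q" using P by (auto simp: bad_def)
      have small: "coeff H i \<in> Q" if H: "H \<in> polys" "poly H x \<in> Q" "degree H < degree P" for H i
      proof (rule ccontr)
        assume "coeff H i \<notin> Q"
        from truncate_poly[OF H(1) this] obtain P' where P': "P' \<in> polys" "lead_coeff P' \<notin> Q"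
          "\<And>i. coeff H i - coeff P' i \<in> Q" "degree P' \<le> degree H" by metis
        have "poly (H - P') x \<in> Q" using P' by (intro poly_mem_Q) simp
        then have "poly P' x \<in> Q" using \<open>poly H x \<in> Q\<close> Q_diff_cong by simp
        with P' have "bad P'" by (auto simp: bad_def)
        from Pmin[OF this] H P' show False by simp
      qed
      have degP: "degree P > 0"
      proof (rule ccontr)
        assume "\<not> degree P > 0"
        then obtain c where "P = [:c:]" using degree_eq_zeroE by auto
        with Pp show False by simp
      qed
      \<comment> \<open>Polynomials in \<open>x\<close> of degree below \<open>P\<close> that
        represent multiples of \<open>f\<close> modulo \<open>Q\<close>. As in the Euclidean
        algorithm for \<open>F\<close> and \<open>P\<close>, one of least degree turns out to be a
        constant.\<close>
      define good where "good R \<longleftrightarrow> R \<in> polys \<and> lead_coeff R \<notin> Q \<and> degree R < degree P \<and>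
        (\<exists>U\<in>polys. poly U x * f - poly R x \<in> Q)" for R
      have mkgood: "\<exists>R'. good R' \<and> degree R' \<le> degree R"
        if R: "R \<in> polys" "degree R < degree P" "coeff R i \<notin> Q"
          "U \<in> polys" "poly U x * f - poly R x \<in> Q" for R U i
      proof -
        from truncate_poly[OF R(1,3)] obtain R' where R': "R' \<in> polys" "lead_coeff R' \<notin> Q"
          "\<And>i. coeff R i - coeff R' i \<in> Q" "degree R' \<le> degree R" by metis
        have "poly (R - R') x \<in> Q" using R' by (intro poly_mem_Q) simp
        from Q_add[OF R(5) this] have "poly U x * f - poly R' x \<in> Q" by simp
        with R R' show ?thesis by (auto simp: good_def)
      qed
      have "\<exists>R. good R"
      proof -
        obtain k A R where *: "A \<in> polys" "R \<in> polys" "Polynomial.smult (lead_coeff P ^ k) F = A * P + R"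
          "degree R < degree P"
          using pseudo_division[OF Pp(1) degP F(1)] by auto
        from arg_cong[OF *(3), of "\<lambda>p. poly p x"]
        have e: "poly [:lead_coeff P ^ k:] x * f - poly R x = poly A x * poly P x"
          by (simp add: F)
        then have q: "poly [:lead_coeff P ^ k:] x * f - poly R x \<in> Q" using Q_mult[OF Pp(2)] by simp
        have "poly R x \<notin> Q"
          using q Q_diff_cong Q_prime[of "lead_coeff P ^ k" f] Q_power[OF Pp(3)] f by auto
        then obtain i where "coeff R i \<notin> Q" using poly_mem_Q by blast
        from mkgood[OF *(2,4) this polys_const q] show ?thesis
          using B_power polys_coeff[OF Pp(1)] by auto
      qed
      then obtain R where R: "good R" and Rmin: "\<And>R'. good R' \<Longrightarrow> degree R \<le> degree R'"
        using ex_has_least_nat[of good _ degree] by blast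
      then obtain U where U: "U \<in> polys" "poly U x * f - poly R x \<in> Q"
        and Rp: "R \<in> polys" "lead_coeff R \<notin> Q" "degree R < degree P" by (auto simp: good_def)
      have degR: "degree R = 0"
      proof (rule ccontr)
        assume "degree R \<noteq> 0"
        then have degR: "degree R > 0" by simp
        \<comment> \<open>The remainder of \<open>P\<close> modulo \<open>R\<close> again represents
          a multiple of \<open>f\<close>, with cofactor \<open>- (A * U)\<close>. By minimality of
          \<open>R\<close> all its coefficients lie in \<open>Q\<close>, so \<open>P\<close> is
          divisible by \<open>R\<close> over the domain up to a factor outside \<open>Q\<close>;
          this contradicts the minimality of \<open>P\<close>.\<close>
        obtain k A R' where *: "A \<in> polys" "R' \<in> polys" "Polynomial.smult (lead_coeff R ^ k) P = A * R + R'"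
          "degree R' < degree R"
          using pseudo_division[OF Rp(1) degR Pp(1)] by auto
        have ev: "lead_coeff R ^ k * poly P x = poly A x * poly R x + poly R' x"
          using arg_cong[OF *(3), of "\<lambda>p. poly p x"] by simp
        have "- (poly A x * (poly U x * f - poly R x)) + - (lead_coeff R ^ k * poly P x) \<in> Q"
          by (intro Q_add Q_minus Q_mult U Pp)
        also have "- (poly A x * (poly U x * f - poly R x)) + - (lead_coeff R ^ k * poly P x)
            = poly (- (A * U)) x * f - poly R' x"
          unfolding ev by (simp add: algebra_simps)
        finally have q: "poly (- (A * U)) x * f - poly R' x \<in> Q" .
        have R'Q: "coeff R' i \<in> Q" for i
        proof (rule ccontr)
          assume "coeff R' i \<notin> Q"
          from mkgood[OF *(2) _ this _ q] obtain R'' where "good R''" "degree R'' \<le> degree R'"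
            using *(1,4) Rp(3) U(1) by (auto intro: polys_minus polys_mult)
          with Rmin *(4) show False by fastforce
        qed
        then have "poly R' x \<in> Q" by (rule poly_mem_Q)
        then have "poly A x * poly R x \<in> Q"
          using Q_diff[OF Q_mult[OF Pp(2), of "lead_coeff R ^ k"], of "poly R' x"] ev by simp
        moreover have "poly R x \<notin> Q" using small[OF Rp(1) _ Rp(3)] Rp(2) by auto
        ultimately have Ax: "poly A x \<in> Q" using Q_prime by blast
        \<comment> \<open>Let \<open>n\<close> be the last index with a coefficient of
          \<open>A\<close> outside \<open>Q\<close>. If \<open>n < degree P\<close>, a truncation of
          \<open>A\<close> is a relation of too small degree. Otherwise
          \<open>n + degree R > degree P\<close>, so the coefficient of \<open>A * R\<close> there
          lies in \<open>Q\<close>, although modulo \<open>Q\<close> it is the product of two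
          elements outside \<open>Q\<close>.\<close>
        have lc: "coeff A i \<in> Q" if "i \<ge> degree P - degree R" for i
        proof (cases "\<forall>i \<ge> degree P - degree R. coeff A i \<in> Q")
          case False
          define S where "S = {i. coeff A i \<notin> Q}"
          have "S \<subseteq> {..degree A}" using Q_zero by (auto simp: S_def intro: le_degree)
          then have fS: "finite S" by (rule finite_subset) simp
          define n where "n = Max S"
          obtain i0 where i0: "i0 \<ge> degree P - degree R" "i0 \<in> S" using False by (auto simp: S_def)
          then have n: "n \<in> S" "n \<ge> i0" unfolding n_def using fS by (auto intro: Max_in)
          have above: "coeff A i \<in> Q" if "i > n" for i
            using that Max_ge[OF fS, of i] by (auto simp: n_def S_def)
          show ?thesis
          proof (cases "n < degree P")
            case True
            obtain i where "coeff A i \<notin> Q" using n by (auto simp: S_def)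
            from truncate_poly[OF *(1) this] obtain A' where A': "A' \<in> polys" "lead_coeff A' \<notin> Q"
              "\<And>i. coeff A i - coeff A' i \<in> Q" by metis
            have "coeff A (degree A') \<notin> Q" using A'(2,3) Q_diff_cong by blast
            then have "degree A' \<le> n" using above not_le by blast
            have "poly (A - A') x \<in> Q" using A' by (intro poly_mem_Q) simp
            then have "poly A' x \<in> Q" using Ax Q_diff_cong by simp
            from small[OF A'(1) this, of "degree A'"] A' \<open>degree A' \<le> n\<close> True show ?thesis by auto
          next
            case False
            have "coeff (A * R + R') (n + degree R) \<in> Q"
            proof -
              have "coeff P (n + degree R) = 0" using False degR by (intro coeff_eq_0) simp
              then have "coeff (Polynomial.smult (lead_coeff R ^ k) P) (n + degree R) = 0" by simp
              then show ?thesis using *(3) Q_zero by simp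
            qed
            then have "coeff (A * R) (n + degree R) \<in> Q"
              using Q_diff[OF _ R'Q[of "n + degree R"]] by fastforce
            moreover have "coeff (A * R) (n + degree R) - coeff A n * lead_coeff R \<in> Q"
            proof -
              have "coeff (A * R) (n + degree R) = (\<Sum>i\<le>n + degree R. coeff A i * coeff R (n + degree R - i))"
                by (simp add: coeff_mult)
              also have "\<dots> = coeff A n * lead_coeff R + (\<Sum>i\<in>{..n + degree R} - {n}. coeff A i * coeff R (n + degree R - i))"
                by (subst sum.remove[of _ n]) auto
              finally have e: "coeff (A * R) (n + degree R) - coeff A n * lead_coeff R =
                (\<Sum>i\<in>{..n + degree R} - {n}. coeff A i * coeff R (n + degree R - i))" by simp
              show ?thesis unfolding e
              proof (rule Q_sum)
                fix i assume i: "i \<in> {..n + degree R} - {n}"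
                show "coeff A i * coeff R (n + degree R - i) \<in> Q"
                proof (cases "i > n")
                  case True
                  then show ?thesis using above Q_mult_right by blast
                next
                  case False
                  then have "coeff R (n + degree R - i) = 0" using i by (intro coeff_eq_0) auto
                  then show ?thesis using Q_zero by simp
                qed
              qed
            qed
            ultimately have "coeff A n * lead_coeff R \<in> Q" using Q_diff_cong by blast
            then show ?thesis using Q_prime n Rp(2) by (auto simp: S_def)
          qed
        qed (use that in blast)
        have "coeff A i \<in> Q" for i
        proof (rule ccontr)
          assume "coeff A i \<notin> Q"
          from truncate_poly[OF *(1) this] obtain A' where A': "A' \<in> polys" "lead_coeff A' \<notin> Q"
            "\<And>i. coeff A i - coeff A' i \<in> Q" by metis
          have "coeff A (degree A') \<notin> Q" using A'(2,3) Q_diff_cong by blast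
          then have "degree A' < degree P" using lc[of "degree A'"] by (meson diff_le_self le_trans not_le)
          have "poly (A - A') x \<in> Q" using A' by (intro poly_mem_Q) simp
          then have "poly A' x \<in> Q" using Ax Q_diff_cong by simp
          from small[OF A'(1) this \<open>degree A' < degree P\<close>, of "degree A'"] A' show False by auto
        qed
        then have "coeff (A * R + R') i \<in> Q" for i
          by (auto simp: coeff_mult intro!: Q_add Q_sum Q_mult_right R'Q)
        then have "coeff (Polynomial.smult (lead_coeff R ^ k) P) (degree P) \<in> Q" using *(3) by simp
        then show False
          using Q_prime[of "lead_coeff R ^ k" "lead_coeff P"] Q_power[OF Rp(2)] Pp by auto
      qed
      then obtain r where r: "R = [:r:]" using degree_eq_zeroE by auto
      have rB: "r \<in> B" "r \<notin> Q" using Rp r polys_coeff[OF Rp(1), of 0] by auto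
      define b where "b = lead_coeff P"
      have b: "b \<in> B" "b \<notin> Q" using Pp polys_coeff by (auto simp: b_def)
      \<comment> \<open>A single element of \<open>B\<close> guards both conditions:
        \<open>b\<close> preserves the degree of \<open>P\<close> under specialization, and
        \<open>r\<close> will force a nonzero value of \<open>f\<close>.\<close>
      have "b * r \<in> B - Q" using b rB B_mult Q_prime by blast
      then obtain \<phi> where \<phi>: "point \<iota> \<phi>" "\<phi> (b * r) \<noteq> 0"
        using N unfolding enough_points_def by blast
      then have br: "\<phi> b \<noteq> 0" "\<phi> r \<noteq> 0" using point_mult[OF \<phi>(1) b(1) rB(1)] by auto
      have "degree (map_poly \<phi> P) = degree P"
        using br(1) by (intro map_poly_degree_eq) (simp add: b_def)
      then obtain \<xi> where \<xi>: "poly (map_poly \<phi> P) \<xi> = 0"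
        using alg_closed_imp_poly_has_root[of "map_poly \<phi> P"] degP by auto
      \<comment> \<open>Every relation \<open>H\<close> reduces modulo \<open>P\<close> to a
        relation of smaller degree, whose coefficients lie in \<open>Q\<close> by minimality of
        \<open>P\<close>. The factor \<open>b ^ k\<close> can then be cancelled because
        \<open>b\<close> has a nonzero value.\<close>
      have kill: "poly (map_poly \<phi> H) \<xi> = 0" if H: "H \<in> polys" "poly H x \<in> Q" for H
      proof -
        obtain k A S where *: "A \<in> polys" "S \<in> polys" "Polynomial.smult (b ^ k) H = A * P + S"
          "degree S < degree P"
          using pseudo_division[OF Pp(1) degP H(1)] unfolding b_def by auto
        have "b ^ k * poly H x = poly A x * poly P x + poly S x"
          using arg_cong[OF *(3), of "\<lambda>p. poly p x"] by simp
        then have "poly S x \<in> Q"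
          using Q_diff[OF Q_mult[OF H(2), of "b ^ k"] Q_mult[OF Pp(2), of "poly A x"]] by simp
        then have "coeff S i \<in> Q" for i using small * by blast
        then have S0: "map_poly \<phi> S = 0"
          using *(2) by (intro poly_eqI) (simp add: coeff_map_poly point_zero[OF \<phi>(1)] point_Q[OF \<phi>(1)] polys_coeff)
        have "map_poly \<phi> (Polynomial.smult (b ^ k) H) = map_poly \<phi> A * map_poly \<phi> P"
          unfolding *(3) using * Pp S0
          by (simp add: point_map_poly_add[OF \<phi>(1)] point_map_poly_mult[OF \<phi>(1)] polys_mult)
        then have "poly (map_poly \<phi> (Polynomial.smult (b ^ k) H)) \<xi> = 0"
          using \<xi> by simp
        then have "\<phi> (b ^ k) * poly (map_poly \<phi> H) \<xi> = 0"
          using H b by (simp add: point_map_poly_smult[OF \<phi>(1)] B_power)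
        moreover have "\<phi> (b ^ k) \<noteq> 0"
        proof (cases k)
          case 0
          have "\<phi> (b * 1) = \<phi> b * \<phi> 1" using point_mult[OF \<phi>(1) b(1) B_one] .
          then show ?thesis using 0 br by auto
        next
          case (Suc k')
          then show ?thesis using point_power_notin[OF \<phi>(1) b(1) br(1)] by simp
        qed
        ultimately show ?thesis by simp
      qed
      obtain \<psi> where \<psi>: "ad.point \<iota> \<psi>"
        "\<And>P. P \<in> polys \<Longrightarrow> \<psi> (poly P x) = poly (map_poly \<phi> P) \<xi>"
        using extend_point[OF \<phi>(1) \<iota> kill] by blast
      have "poly U x * f - r \<in> Q" using U(2) r by simp
      moreover have mem: "r \<in> adjoin x" "poly U x \<in> adjoin x"
        using rB adjoin_supset U(1) by (auto simp: adjoin_def)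
      ultimately have "\<psi> (poly U x * f - r) = 0"
        using f(1) by (intro ad.point_Q[OF \<psi>(1)] ad.B_diff ad.B_mult)
      then have "\<psi> (poly U x) * \<psi> f = \<psi> r"
        using mem f(1) by (simp add: ad.point_diff[OF \<psi>(1)] ad.point_mult[OF \<psi>(1)] ad.B_mult)
      moreover have "\<psi> r = \<phi> r"
        using \<psi>(2)[OF polys_const[OF rB(1)]] by (simp add: map_poly_pCons point_zero[OF \<phi>(1)])
      ultimately show ?thesis using \<psi>(1) br by auto
    qed
  qed
  then show ?thesis by (auto simp: ad.enough_points_def)
qed

end

theorem weak_nullstellensatz:
  fixes \<iota> :: "'k::alg_closed_field \<Rightarrow> 'r::comm_ring_1"
  assumes \<iota>: "\<And>c d. \<iota> (c + d) = \<iota> c + \<iota> d" "\<And>c d. \<iota> (c * d) = \<iota> c * \<iota> d" "\<iota> 1 = 1"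
    and Q: "0 \<in> Q" "\<And>a b. \<lbrakk>a \<in> Q; b \<in> Q\<rbrakk> \<Longrightarrow> a + b \<in> Q" "\<And>a r. a \<in> Q \<Longrightarrow> r * a \<in> Q"
      "1 \<notin> Q" "\<And>a b. a * b \<in> Q \<Longrightarrow> a \<in> Q \<or> b \<in> Q"
    and X: "finite X"
      "\<And>B. \<lbrakk>range \<iota> \<subseteq> B; Q \<subseteq> B; X \<subseteq> B; \<And>a b. \<lbrakk>a \<in> B; b \<in> B\<rbrakk> \<Longrightarrow> a + b \<in> B;
        \<And>a b. \<lbrakk>a \<in> B; b \<in> B\<rbrakk> \<Longrightarrow> a * b \<in> B\<rbrakk> \<Longrightarrow> B = UNIV"
    and f: "f \<notin> Q"
  obtains \<phi> where "\<And>a b. \<phi> (a + b) = \<phi> a + \<phi> b" "\<And>a b. \<phi> (a * b) = \<phi> a * \<phi> b"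
    "\<And>c. \<phi> (\<iota> c) = c" "\<And>q. q \<in> Q \<Longrightarrow> \<phi> q = 0" "\<phi> f \<noteq> 0"
proof -
  have \<iota>0: "\<iota> 0 = 0" using \<iota>(1)[of 0 0] by simp
  have \<iota>m: "\<iota> (- c) = - \<iota> c" for c using \<iota>(1)[of c "- c"] \<iota>0 by (simp add: add_eq_0_iff)
  have "\<exists>B. prime_over_subring B Q \<and> range \<iota> \<subseteq> B \<and> Q \<subseteq> B \<and> X \<subseteq> B
      \<and> prime_over_subring.enough_points B Q \<iota>"
    using X(1)
  proof (induction X rule: finite_induct)
    case empty
    define B where "B = {y. \<exists>c. y - \<iota> c \<in> Q}"
    have Qm: "- a \<in> Q" if "a \<in> Q" for a using Q(3)[OF that, of "-1"] by simp
    interpret prime_over_subring B Q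
    proof
      show "0 \<in> B" using Q(1) \<iota>0 by (auto simp: B_def intro!: exI[of _ 0])
      show "1 \<in> B" using Q(1) \<iota>(3) by (auto simp: B_def intro!: exI[of _ 1])
      fix a b assume a: "a \<in> B"
      then obtain c where c: "a - \<iota> c \<in> Q" by (auto simp: B_def)
      show "- a \<in> B" using Qm[OF c] \<iota>m[of c] by (auto simp: B_def intro!: exI[of _ "- c"])
      assume "b \<in> B"
      then obtain d where d: "b - \<iota> d \<in> Q" by (auto simp: B_def)
      show "a + b \<in> B" using Q(2)[OF c d] \<iota>(1)[of c d]
        by (auto simp: B_def algebra_simps intro!: exI[of _ "c + d"])
      have "b * (a - \<iota> c) + \<iota> c * (b - \<iota> d) \<in> Q" using c d Q(2,3) by blast
      then show "a * b \<in> B" using \<iota>(2)[of c d]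
        by (auto simp: B_def algebra_simps intro!: exI[of _ "c * d"])
    qed (use Q in auto)
    have "\<exists>\<phi>. point \<iota> \<phi> \<and> \<phi> y \<noteq> 0" if y: "y \<in> B" "y \<notin> Q" for y
    proof -
      have uniq: "c = d" if "y - \<iota> c \<in> Q" "y - \<iota> d \<in> Q" for y c d
      proof (rule ccontr)
        assume "c \<noteq> d"
        have "\<iota> (d - c) \<in> Q" using Q_diff[OF that] \<iota>(1)[of d "- c"] \<iota>m[of c] by simp
        then have "\<iota> (inverse (d - c)) * \<iota> (d - c) \<in> Q" by (rule Q_mult)
        then show False using \<open>c \<noteq> d\<close> Q(4) \<iota>(2)[of "inverse (d - c)" "d - c"] \<iota>(3) by simp
      qed
      define \<phi> where "\<phi> y = (THE c. y - \<iota> c \<in> Q)" for y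
      have \<phi>: "\<phi> y = c" if "y - \<iota> c \<in> Q" for y c
        unfolding \<phi>_def using that uniq by blast
      have "point \<iota> \<phi>"
        unfolding point_def
      proof (intro conjI ballI allI)
        fix a b assume "a \<in> B" "b \<in> B"
        then obtain c d where c: "a - \<iota> c \<in> Q" and d: "b - \<iota> d \<in> Q" by (auto simp: B_def)
        have "a + b - \<iota> (c + d) \<in> Q" using Q(2)[OF c d] \<iota>(1)[of c d] by (simp add: algebra_simps)
        then show "\<phi> (a + b) = \<phi> a + \<phi> b" using \<phi> c d by simp
        have "b * (a - \<iota> c) + \<iota> c * (b - \<iota> d) \<in> Q" using c d Q(2,3) by blast
        then have "a * b - \<iota> (c * d) \<in> Q" using \<iota>(2)[of c d] by (simp add: algebra_simps)
        then show "\<phi> (a * b) = \<phi> a * \<phi> b" using \<phi> c d by simp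
      qed (use \<phi> Q(1) \<iota>0 in auto)
      moreover have "\<phi> y \<noteq> 0"
      proof
        assume "\<phi> y = 0"
        obtain c where "y - \<iota> c \<in> Q" using y by (auto simp: B_def)
        with \<phi> \<open>\<phi> y = 0\<close> have "y - \<iota> 0 \<in> Q" by metis
        then show False using y \<iota>0 by simp
      qed
      ultimately show ?thesis by blast
    qed
    moreover have "range \<iota> \<subseteq> B" using Q(1) unfolding B_def by (metis (mono_tags) cancel_comm_monoid_add_class.diff_cancel image_subsetI mem_Collect_eq)
    moreover have "Q \<subseteq> B" using \<iota>0 by (auto simp: B_def intro!: exI[of _ 0])
    ultimately show ?case
      using prime_over_subring_axioms by (auto simp: enough_points_def)
  next
    case (insert x X)
    then obtain B where B: "prime_over_subring B Q" "range \<iota> \<subseteq> B" "Q \<subseteq> B" "X \<subseteq> B"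
      "prime_over_subring.enough_points B Q \<iota>" by blast
    interpret prime_over_subring B Q by (rule B(1))
    show ?case
      using prime_over_adjoin[of x] enough_points_adjoin[OF B(5,2)] adjoin_supset[of x] adjoin_self[of x] B
      by (intro exI[of _ "adjoin x"]) auto
  qed
  then obtain B where B: "prime_over_subring B Q" "range \<iota> \<subseteq> B" "Q \<subseteq> B" "X \<subseteq> B"
    "prime_over_subring.enough_points B Q \<iota>" by blast
  interpret prime_over_subring B Q by (rule B(1))
  have U: "B = UNIV" using X(2)[OF B(2-4)] B_add B_mult by blast
  obtain \<phi> where \<phi>: "point \<iota> \<phi>" "\<phi> f \<noteq> 0"
    using B(5) f unfolding enough_points_def by (auto simp: U)
  show ?thesis
    using \<phi>(1)[unfolded point_def, unfolded U] by (intro that[of \<phi>] \<phi>(2)) auto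
qed

section \<open>Matrices over a field\<close>

lemma mat_assoc:
  "dim_col A = dim_row B \<Longrightarrow> dim_col B = dim_row C \<Longrightarrow> (A :: 'k::semiring_0 mat) * B * C = A * (B * C)"
  by (rule assoc_mult_mat[of _ "dim_row A" "dim_col A" _ "dim_col B" _ "dim_col C"]) auto

lemma mat_add_mult:
  "\<lbrakk>dim_row A = dim_row B; dim_col A = dim_col B; dim_row C = dim_col B\<rbrakk>
    \<Longrightarrow> ((A :: 'k::semiring_0 mat) + B) * C = A * C + B * C"
  by (rule add_mult_distrib_mat[of _ "dim_row A" "dim_col A" _ _ "dim_col C"]) auto

lemma mat_mult_add:
  "\<lbrakk>dim_row A = dim_row B; dim_col A = dim_col B; dim_col C = dim_row B\<rbrakk>
    \<Longrightarrow> (C :: 'k::semiring_0 mat) * (A + B) = C * A + C * B"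
  by (rule mult_add_distrib_mat[of _ "dim_row C" "dim_col C" _ "dim_col A"]) auto

lemma mat_minus_mult:
  "\<lbrakk>dim_row A = dim_row B; dim_col A = dim_col B; dim_row C = dim_col B\<rbrakk>
    \<Longrightarrow> ((A :: 'k::ring mat) - B) * C = A * C - B * C"
  by (rule minus_mult_distrib_mat[of _ "dim_row A" "dim_col A" _ _ "dim_col C"]) auto

lemma mat_mult_minus:
  "\<lbrakk>dim_row A = dim_row B; dim_col A = dim_col B; dim_col C = dim_row B\<rbrakk>
    \<Longrightarrow> (C :: 'k::ring mat) * (A - B) = C * A - C * B"
  by (rule mult_minus_distrib_mat[of _ "dim_row C" "dim_col C" _ "dim_col A"]) auto

lemma mat_one_mult: "dim_row A = n \<Longrightarrow> 1\<^sub>m n * (A :: 'k::semiring_1 mat) = A"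
  and mat_mult_one: "dim_col A = n \<Longrightarrow> (A :: 'k::semiring_1 mat) * 1\<^sub>m n = A"
  by auto

lemma mat_zero_mult: "dim_row A = n \<Longrightarrow> 0\<^sub>m k n * (A :: 'k::semiring_0 mat) = 0\<^sub>m k (dim_col A)"
  and mat_mult_zero: "dim_col A = n \<Longrightarrow> (A :: 'k::semiring_0 mat) * 0\<^sub>m n k = 0\<^sub>m (dim_row A) k"
  by auto

lemma mat_smult_mult: "dim_col A = dim_row B \<Longrightarrow> (c \<cdot>\<^sub>m A) * B = c \<cdot>\<^sub>m ((A :: 'k::comm_semiring_0 mat) * B)"
  and mat_mult_smult: "dim_col A = dim_row B \<Longrightarrow> A * (c \<cdot>\<^sub>m B) = c \<cdot>\<^sub>m ((A :: 'k::comm_semiring_0 mat) * B)"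
  by (auto simp: mult_smult_assoc_mat[of A "dim_row A" "dim_col A"] mult_smult_distrib[of A "dim_row A" "dim_col A"])

lemmas mat_alg = mat_assoc mat_add_mult mat_mult_add mat_minus_mult mat_mult_minus mat_one_mult
  mat_mult_one mat_zero_mult mat_mult_zero mat_smult_mult mat_mult_smult

lemma mat_cancel: "\<lbrakk>A * B = C; dim_col A = dim_row B; dim_col B = dim_row D\<rbrakk>
    \<Longrightarrow> A * (B * D) = C * (D :: 'k::semiring_0 mat)"
  using mat_assoc[of A B D] by simp

lemma mat_vec_assoc: "\<lbrakk>dim_col A = dim_row B; dim_col B = dim_vec v\<rbrakk>
    \<Longrightarrow> (A * B) *\<^sub>v v = A *\<^sub>v (B *\<^sub>v (v :: 'k::semiring_0 vec))"
  by (rule assoc_mult_mat_vec[of _ "dim_row A" "dim_col A" _ "dim_col B"]) auto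

lemma zero_mat_vec: "dim_vec v = m \<Longrightarrow> 0\<^sub>m n m *\<^sub>v (v :: 'k::semiring_0 vec) = 0\<^sub>v n"
  by (intro eq_vecI) (auto simp: scalar_prod_def)

lemma mat_vec_unit: "\<lbrakk>i < dim_row A; j < dim_col A\<rbrakk> \<Longrightarrow> (A *\<^sub>v unit_vec (dim_col A) j) $ i = (A $$ (i, j) :: 'k::semiring_1)"
  by simp

text \<open>Let \<open>A = Q * R\<close> with \<open>R\<close> the Gauss-Jordan form,
  \<open>r\<close> its number of nonzero rows. Then \<open>X\<close> consists of the first
  \<open>r\<close> columns of \<open>Q\<close> and \<open>Y\<close> of the first \<open>r\<close>
  rows of \<open>R\<close>; the rows of \<open>P\<close>, the inverse of \<open>Q\<close>, give
  \<open>X'\<close>, and \<open>Y'\<close> selects the pivot columns.\<close>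

lemma rank_factorization:
  fixes A :: "'k::field mat"
  assumes A: "A \<in> carrier_mat n m"
  obtains r X X' Y Y' where "X \<in> carrier_mat n r" "X' \<in> carrier_mat r n" "Y \<in> carrier_mat r m"
    "Y' \<in> carrier_mat m r" "X' * X = 1\<^sub>m r" "Y * Y' = 1\<^sub>m r" "A = X * Y"
proof -
  define R where "R = gauss_jordan_single A"
  from gauss_jordan_single[OF A R_def[symmetric]] obtain P Q where R: "R \<in> carrier_mat n m"
    "row_echelon_form R" "R = P * A" and PQ: "P \<in> carrier_mat n n" "Q \<in> carrier_mat n n"
    "P * Q = 1\<^sub>m n" "Q * P = 1\<^sub>m n" by metis
  then obtain f where "pivot_fun R f m" by (auto simp: row_echelon_form_def)
  then have f: "\<And>i. i < n \<Longrightarrow> f i \<le> m" "\<And>i j. i < n \<Longrightarrow> j < f i \<Longrightarrow> R $$ (i, j) = 0"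
    "\<And>i. Suc i < n \<Longrightarrow> f (Suc i) > f i \<or> f (Suc i) = m"
    "\<And>i. i < n \<Longrightarrow> f i < m \<Longrightarrow> R $$ (i, f i) = 1"
    "\<And>i i'. i < n \<Longrightarrow> f i < m \<Longrightarrow> i' < n \<Longrightarrow> i' \<noteq> i \<Longrightarrow> R $$ (i', f i) = 0"
    using pivot_funD[of R n f m] R(1) by auto
  define r where "r = (LEAST i. i = n \<or> f i = m)"
  have rn: "r \<le> n" unfolding r_def by (rule Least_le) simp
  have below: "f i < m" if "i < r" for i
    using that not_less_Least[of i "\<lambda>i. i = n \<or> f i = m"] f(1)[of i] rn
    unfolding r_def[symmetric] by auto
  have above: "f i = m" if "r \<le> i" "i < n" for i
    using that
  proof (induction i rule: dec_induct)
    case base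
    then show ?case using LeastI[of "\<lambda>i. i = n \<or> f i = m" n] unfolding r_def[symmetric] by auto
  next
    case (step i)
    then show ?case using f(3)[of i] f(1)[of "Suc i"] by auto
  qed
  have zero: "R $$ (i, j) = 0" if "r \<le> i" "i < n" "j < m" for i j
    using f(2)[of i j] above that by simp
  define X where "X = mat n r (\<lambda>(i, k). Q $$ (i, k))"
  define X' where "X' = mat r n (\<lambda>(k, i). P $$ (k, i))"
  define Y where "Y = mat r m (\<lambda>(k, j). R $$ (k, j))"
  define Y' where "Y' = mat m r (\<lambda>(j, k). if j = f k then 1 else 0 :: 'k)"
  have "X' * X = 1\<^sub>m r"
  proof (rule eq_matI)
    fix i j assume "i < dim_row (1\<^sub>m r :: 'k mat)" "j < dim_col (1\<^sub>m r :: 'k mat)"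
    then have ij: "i < r" "j < r" by auto
    then have "(X' * X) $$ (i, j) = (P * Q) $$ (i, j)"
      using PQ(1,2) rn by (simp add: X'_def X_def scalar_prod_def)
    then show "(X' * X) $$ (i, j) = 1\<^sub>m r $$ (i, j)" using ij rn PQ by simp
  qed (simp_all add: X_def X'_def)
  moreover have "Y * Y' = 1\<^sub>m r"
  proof (rule eq_matI)
    fix i j assume "i < dim_row (1\<^sub>m r :: 'k mat)" "j < dim_col (1\<^sub>m r :: 'k mat)"
    then have ij: "i < r" "j < r" by auto
    then have "(Y * Y') $$ (i, j) = (\<Sum>k = 0..<m. R $$ (i, k) * (if k = f j then 1 else 0))"
      by (simp add: Y'_def Y_def scalar_prod_def)
    also have "\<dots> = R $$ (i, f j)" using below[of j] ij by (subst sum.remove[of _ "f j"]) auto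
    finally show "(Y * Y') $$ (i, j) = 1\<^sub>m r $$ (i, j)"
      using ij rn f(4)[of j] f(5)[of j i] below[of j] by auto
  qed (simp_all add: Y_def Y'_def)
  moreover have "A = X * Y"
  proof -
    have "A = Q * R" using PQ A R(3) by (simp add: mat_cancel[OF PQ(4)])
    also have "\<dots> = X * Y"
    proof (rule eq_matI)
      fix i j assume "i < dim_row (X * Y)" "j < dim_col (X * Y)"
      then have ij: "i < n" "j < m" by (auto simp: X_def Y_def)
      have "(Q * R) $$ (i, j) = (\<Sum>k = 0..<n. Q $$ (i, k) * R $$ (k, j))"
        using PQ(2) R(1) ij by (simp add: scalar_prod_def)
      also have "\<dots> = (\<Sum>k = 0..<r. Q $$ (i, k) * R $$ (k, j))"
        using rn zero ij by (intro sum.mono_neutral_right) auto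
      also have "\<dots> = (X * Y) $$ (i, j)"
        using ij by (simp add: X_def Y_def scalar_prod_def)
      finally show "(Q * R) $$ (i, j) = (X * Y) $$ (i, j)" .
    qed (use PQ R in \<open>auto simp: X_def Y_def\<close>)
    finally show ?thesis .
  qed
  ultimately show ?thesis
    by (intro that[of X r X' Y Y']) (auto simp: X_def X'_def Y_def Y'_def)
qed

text \<open>For a rank factorization \<open>E = X * Y\<close>, cancelling \<open>X\<close> and
  \<open>Y\<close> in \<open>E * E = E\<close> by their one-sided inverses leaves
  \<open>Y * X = 1\<close>.\<close>

lemma split_idempotent:
  fixes E :: "'k::field mat"
  assumes E: "E \<in> carrier_mat n n" "E * E = E"
  obtains e B B' where "B \<in> carrier_mat n e" "B' \<in> carrier_mat e n" "B' * B = 1\<^sub>m e" "B * B' = E"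
proof -
  from rank_factorization[OF E(1)] obtain r X X' Y Y' where
    c: "X \<in> carrier_mat n r" "X' \<in> carrier_mat r n" "Y \<in> carrier_mat r n" "Y' \<in> carrier_mat n r"
    and XY: "X' * X = 1\<^sub>m r" "Y * Y' = 1\<^sub>m r" "E = X * Y" .
  have "X' * (E * E) * Y' = X' * E * Y'" using E by simp
  then have "Y * X = 1\<^sub>m r"
    using c XY by (simp add: XY(3) mat_alg mat_cancel[OF XY(1)])
  then show ?thesis using c XY by (intro that[of X r Y]) auto
qed

lemma mat_eq_if_mult_vec_eq:
  fixes A B :: "'k::comm_semiring_1 mat"
  assumes "A \<in> carrier_mat n m" "B \<in> carrier_mat n m" "\<And>v. v \<in> carrier_vec m \<Longrightarrow> A *\<^sub>v v = B *\<^sub>v v"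
  shows "A = B"
proof (rule eq_matI)
  fix i j assume ij: "i < dim_row B" "j < dim_col B"
  then have "(A *\<^sub>v unit_vec m j) $ i = (B *\<^sub>v unit_vec m j) $ i" using assms by auto
  then show "A $$ (i, j) = B $$ (i, j)"
    using ij assms(1,2) mat_vec_unit[of i A j] mat_vec_unit[of i B j] by simp
qed (use assms in auto)

text \<open>In a rank factorization \<open>B = X * Y\<close> the columns of
  \<open>Y' * Y - 1\<close> are killed by \<open>B\<close>. Injectivity thus makes \<open>Y'\<close>
  a two-sided inverse of \<open>Y\<close>, and \<open>Y' * X'\<close> inverts \<open>B\<close> from
  the left.\<close>

lemma mat_left_inverse:
  fixes B :: "'k::field mat"
  assumes B: "B \<in> carrier_mat n r"
    and inj: "\<And>v. v \<in> carrier_vec r \<Longrightarrow> B *\<^sub>v v = 0\<^sub>v n \<Longrightarrow> v = 0\<^sub>v r"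
  obtains B' where "B' \<in> carrier_mat r n" "B' * B = 1\<^sub>m r"
proof -
  from rank_factorization[OF B] obtain s X X' Y Y' where
    c: "X \<in> carrier_mat n s" "X' \<in> carrier_mat s n" "Y \<in> carrier_mat s r" "Y' \<in> carrier_mat r s"
    and XY: "X' * X = 1\<^sub>m s" "Y * Y' = 1\<^sub>m s" "B = X * Y" .
  have YZ: "Y * (Y' * Y - 1\<^sub>m r) = 0\<^sub>m s r"
    using c by (simp add: mat_alg mat_cancel[OF XY(2)] minus_r_inv_mat)
  have "Y' * Y - 1\<^sub>m r = 0\<^sub>m r r"
  proof (rule mat_eq_if_mult_vec_eq[of _ r r])
    fix v :: "'k vec" assume v: "v \<in> carrier_vec r"
    have "B *\<^sub>v ((Y' * Y - 1\<^sub>m r) *\<^sub>v v) = (X * (Y * (Y' * Y - 1\<^sub>m r))) *\<^sub>v v"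
      using c v XY(3) by (simp add: mat_vec_assoc)
    also have "\<dots> = 0\<^sub>v n" using c v unfolding YZ by (simp add: mat_alg zero_mat_vec)
    finally have "(Y' * Y - 1\<^sub>m r) *\<^sub>v v = 0\<^sub>v r"
      using c v by (intro inj) (auto intro!: mult_mat_vec_carrier)
    then show "(Y' * Y - 1\<^sub>m r) *\<^sub>v v = 0\<^sub>m r r *\<^sub>v v" using v by (simp add: zero_mat_vec)
  qed (use c in auto)
  then have YY: "Y' * Y = 1\<^sub>m r" using c
    by (metis (no_types, lifting) carrier_matD(1,2) eq_matI index_minus_mat(1) index_mult_mat(2,3) index_one_mat(2,3) index_zero_mat(1) right_minus_eq)
  have "(Y' * X') * B = 1\<^sub>m r"
    using c XY YY by (simp add: mat_alg mat_cancel[OF XY(1)])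
  then show ?thesis using c by (intro that[of "Y' * X'"]) auto
qed

lemma mat_right_inverse:
  fixes g :: "'k::field mat"
  assumes g: "g \<in> carrier_mat n m" and f: "f \<in> carrier_mat n k"
    and sub: "\<And>j. j < k \<Longrightarrow> \<exists>v\<in>carrier_vec m. g *\<^sub>v v = col f j"
  obtains h where "h \<in> carrier_mat m k" "g * h = f"
proof -
  from sub obtain v where v: "\<And>j. j < k \<Longrightarrow> v j \<in> carrier_vec m \<and> g *\<^sub>v v j = col f j" by metis
  define h where "h = mat m k (\<lambda>(i, j). v j $ i)"
  have "col h j = v j" if "j < k" for j using v[OF that] that by (auto simp: h_def)
  then have "g * h = f"
    using v g f by (intro mat_col_eqI) (auto simp: h_def col_mult2[of _ n m _ k])
  then show ?thesis by (intro that[of h]) (simp_all add: h_def)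
qed

text \<open>If \<open>n < m\<close>, padding \<open>A\<close> and \<open>B\<close> with zeros to
  square matrices of size \<open>m\<close> does not change \<open>B * A\<close>, but the padded
  \<open>A\<close> has a zero row and hence determinant zero.\<close>

lemma invertible_imp_square:
  fixes A :: "'k::field mat"
  assumes A: "A \<in> carrier_mat n m" and B: "B \<in> carrier_mat m n"
    and AB: "A * B = 1\<^sub>m n" and BA: "B * A = 1\<^sub>m m"
  shows "n = m"
proof -
  have le: False if less: "n < m" and A: "A \<in> carrier_mat n m" and B: "B \<in> carrier_mat m n"
    and BA: "B * A = 1\<^sub>m m" for n m and A B :: "'k mat"
  proof -
    define A' where "A' = mat m m (\<lambda>(i, j). if i < n then A $$ (i, j) else 0)"
    define B' where "B' = mat m m (\<lambda>(i, j). if j < n then B $$ (i, j) else 0)"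
    have "B' * A' = B * A"
    proof (rule eq_matI)
      fix i j assume "i < dim_row (B * A)" "j < dim_col (B * A)"
      then have ij: "i < m" "j < m" using A B by auto
      have "(B' * A') $$ (i, j) = (\<Sum>k = 0..<m. if k < n then B $$ (i, k) * A $$ (k, j) else 0)"
        using ij by (auto simp: A'_def B'_def scalar_prod_def intro!: sum.cong)
      also have "\<dots> = (\<Sum>k = 0..<n. B $$ (i, k) * A $$ (k, j))"
        using less by (intro sum.mono_neutral_cong_right) auto
      also have "\<dots> = (B * A) $$ (i, j)" using A B ij by (simp add: scalar_prod_def)
      finally show "(B' * A') $$ (i, j) = (B * A) $$ (i, j)" .
    qed (use A B in \<open>auto simp: A'_def B'_def\<close>)
    then have "det B' * det A' = 1"
      using det_mult[of B' m A'] BA by (simp add: A'_def B'_def)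
    moreover have "mat\<^sub>r m m (\<lambda>i. if i = n then 0\<^sub>v m else row A' i) = A'"
      by (rule eq_matI) (auto simp: A'_def)
    moreover have "det (mat\<^sub>r m m (\<lambda>i. if i = n then 0\<^sub>v m else row A' i)) = 0"
      using less by (intro det_row_0) (auto simp: A'_def row_def)
    ultimately show False by simp
  qed
  show ?thesis
    using le[OF _ A B BA] le[OF _ B A AB] by (metis linorder_neqE_nat)
qed

section \<open>Modules and homomorphisms\<close>

lemma mem_carrier_mat_iff: "A \<in> carrier_mat n m \<longleftrightarrow> dim_row A = n \<and> dim_col A = m"
  by auto

lemma sum_div_mod:
  fixes f :: "nat \<Rightarrow> nat \<Rightarrow> 'b::comm_monoid_add"
  shows "(\<Sum>r<n * m. f (r div m) (r mod m)) = (\<Sum>i<n. \<Sum>l<m. f i l)"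
proof -
  have "(\<Sum>r = i * m..<i * m + m. f (r div m) (r mod m)) = (\<Sum>l<m. f i l)" for i
  proof -
    have "(\<Sum>r = i * m..<i * m + m. f (r div m) (r mod m)) =
        (\<Sum>l = 0..<m. f ((l + i * m) div m) ((l + i * m) mod m))"
      using sum.shift_bounds_nat_ivl[of "\<lambda>r. f (r div m) (r mod m)" 0 "i * m" m] by (simp add: add.commute)
    also have "\<dots> = (\<Sum>l<m. f i l)" unfolding atLeast0LessThan by (intro sum.cong) auto
    finally show ?thesis .
  qed
  then show ?thesis
    using sum.nat_group[of "\<lambda>r. f (r div m) (r mod m)" m n] by simp
qed

lemma sum_block:
  fixes f :: "nat \<Rightarrow> 'b::comm_monoid_add"
  assumes "i < n"
  shows "(\<Sum>r = 0..<n * m. if r div m = i then f (r mod m) else 0) = (\<Sum>l<m. f l)"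
proof -
  have "(\<Sum>r = 0..<n * m. if r div m = i then f (r mod m) else 0) =
      (\<Sum>j<n. \<Sum>l<m. if j = i then f l else 0)"
    unfolding atLeast0LessThan by (rule sum_div_mod)
  also have "\<dots> = (\<Sum>l<m. f l)"
    using assms by (subst sum.remove[of _ i]) (auto intro!: sum.neutral)
  finally show ?thesis .
qed

context fin_dim_algebra
begin

lemma is_moduleI:
  assumes "\<And>a. \<rho> a \<in> carrier_mat d d" "\<And>a b. \<rho> (a + b) = \<rho> a + \<rho> b"
    "\<And>c a. \<rho> (scale c a) = c \<cdot>\<^sub>m \<rho> a" "\<And>a b. \<rho> (a * b) = \<rho> a * \<rho> b" "\<rho> 1 = 1\<^sub>m d"
  shows "is_module (d, \<rho>)"
  using assms by (simp add: is_module_def)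

context
  fixes M :: "('a, 'k) rep"
  assumes M: "is_module M"
begin

lemma module_carrier: "snd M a \<in> carrier_mat (fst M) (fst M)"
  and module_dim [simp]: "dim_row (snd M a) = fst M" "dim_col (snd M a) = fst M"
  and module_add: "snd M (a + b) = snd M a + snd M b"
  and module_scale: "snd M (scale c a) = c \<cdot>\<^sub>m snd M a"
  and module_mult: "snd M (a * b) = snd M a * snd M b"
  and module_one: "snd M 1 = 1\<^sub>m (fst M)"
  using M by (auto simp: is_module_def split: prod.splits)

end

lemma module_homI:
  "\<lbrakk>f \<in> carrier_mat (fst N) (fst M); \<And>a. f * snd M a = snd N a * f\<rbrakk> \<Longrightarrow> f \<in> module_hom M N"
  by (simp add: module_hom_def)

lemma module_hom_dim: "f \<in> module_hom M N \<Longrightarrow> dim_row f = fst N" "f \<in> module_hom M N \<Longrightarrow> dim_col f = fst M"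
  and module_hom_comm: "f \<in> module_hom M N \<Longrightarrow> f * snd M a = snd N a * f"
  and module_hom_carrier: "f \<in> module_hom M N \<Longrightarrow> f \<in> carrier_mat (fst N) (fst M)"
  by (auto simp: module_hom_def)

lemma module_hom_comp:
  assumes "is_module M" "is_module N" "is_module L" "f \<in> module_hom M N" "g \<in> module_hom N L"
  shows "g * f \<in> module_hom M L"
proof (rule module_homI)
  fix a
  have "g * f * snd M a = g * (snd N a * f)"
    using assms by (simp add: mat_assoc module_hom_dim module_hom_comm[of f M N])
  also have "\<dots> = snd L a * (g * f)"
    using assms by (simp add: mat_assoc[symmetric] module_hom_dim module_hom_comm[of g N L])
  finally show "g * f * snd M a = snd L a * (g * f)" .
qed (use assms in \<open>auto simp: module_hom_dim\<close>)

lemma module_hom_add: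
  assumes "is_module M" "is_module N" "f \<in> module_hom M N" "g \<in> module_hom M N"
  shows "f + g \<in> module_hom M N"
  using assms by (intro module_homI) (auto simp: module_hom_dim mat_alg module_hom_comm)

lemma module_hom_minus:
  assumes "is_module M" "is_module N" "f \<in> module_hom M N" "g \<in> module_hom M N"
  shows "f - g \<in> module_hom M N"
  using assms by (intro module_homI) (auto simp: module_hom_dim mat_alg module_hom_comm)

lemma module_hom_smult:
  assumes "is_module M" "is_module N" "f \<in> module_hom M N"
  shows "c \<cdot>\<^sub>m f \<in> module_hom M N"
  using assms by (intro module_homI) (auto simp: module_hom_dim mat_alg module_hom_comm)

lemma module_hom_one: "is_module M \<Longrightarrow> 1\<^sub>m (fst M) \<in> module_hom M M"
  by (intro module_homI) (auto simp: mat_alg)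

lemma module_hom_zero: "\<lbrakk>is_module M; is_module N\<rbrakk> \<Longrightarrow> 0\<^sub>m (fst N) (fst M) \<in> module_hom M N"
  by (intro module_homI) (auto simp: mat_alg)

lemma mat_image_lift:
  assumes "g \<in> carrier_mat n m" "f \<in> carrier_mat n k" "\<And>j. j < k \<Longrightarrow> col f j \<in> mat_image g"
  obtains h where "h \<in> carrier_mat m k" "g * h = f"
proof -
  have "\<exists>v\<in>carrier_vec m. g *\<^sub>v v = col f j" if "j < k" for j
    using assms(3)[OF that] assms(1) by (auto simp: mat_image_def)
  from mat_right_inverse[OF assms(1,2) this] that show ?thesis by blast
qed

lemma mat_image_fullI:
  fixes g :: "'k mat"
  assumes "g \<in> carrier_mat n m" "h \<in> carrier_mat m n" "g * h = 1\<^sub>m n"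
  shows "mat_image g = carrier_vec n"
proof (intro equalityI subsetI)
  fix v :: "'k vec" assume v: "v \<in> carrier_vec n"
  then have "g *\<^sub>v (h *\<^sub>v v) = v"
    using assms by (simp add: mat_vec_assoc[symmetric])
  then show "v \<in> mat_image g"
    using v assms unfolding mat_image_def by (intro image_eqI[of _ _ "h *\<^sub>v v"]) auto
qed (use assms in \<open>auto simp: mat_image_def\<close>)

lemma projective_module: "projective P \<Longrightarrow> is_module P"
  by (simp add: projective_def)

lemma projective_lift:
  assumes "projective P" "is_module M" "is_module N" "g \<in> module_hom M N" "f \<in> module_hom P N"
    "mat_image g = carrier_vec (fst N)"
  obtains h where "h \<in> module_hom P M" "g * h = f"
  using assms unfolding projective_def by blast

text \<open>The identity of \<open>Q\<close> factors through the sum of \<open>P1\<close> and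
  \<open>P2\<close>, which is expressed here without forming the sum. A map out of \<open>Q\<close>
  is lifted by lifting its composites with \<open>\<beta>1\<close> and \<open>\<beta>2\<close>
  separately. With zero maps for \<open>P2\<close> it covers retracts of one module.\<close>

lemma projective_retract:
  assumes Q: "is_module Q" and P: "projective P1" "projective P2"
    and homs: "\<gamma>1 \<in> module_hom Q P1" "\<beta>1 \<in> module_hom P1 Q" "\<gamma>2 \<in> module_hom Q P2" "\<beta>2 \<in> module_hom P2 Q"
    and id: "\<beta>1 * \<gamma>1 + \<beta>2 * \<gamma>2 = 1\<^sub>m (fst Q)"
  shows "projective Q"
  unfolding projective_def
proof (intro conjI allI impI ballI Q)
  fix M N g f
  assume MN: "is_module M \<and> is_module N" and g: "g \<in> module_hom M N" and f: "f \<in> module_hom Q N"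
    and surj: "mat_image g = carrier_vec (fst N)"
  note mods = MN[THEN conjunct1] MN[THEN conjunct2] Q projective_module[OF P(1)] projective_module[OF P(2)]
  have "f * \<beta>1 \<in> module_hom P1 N" "f * \<beta>2 \<in> module_hom P2 N"
    by (rule module_hom_comp[OF _ _ _ homs(2) f] module_hom_comp[OF _ _ _ homs(4) f]; fact mods)+
  then obtain h1 h2 where h: "h1 \<in> module_hom P1 M" "g * h1 = f * \<beta>1" "h2 \<in> module_hom P2 M" "g * h2 = f * \<beta>2"
    using projective_lift[OF P(1) mods(1,2) g _ surj] projective_lift[OF P(2) mods(1,2) g _ surj] by metis
  have "h1 * \<gamma>1 + h2 * \<gamma>2 \<in> module_hom Q M"
    by (intro module_hom_add module_hom_comp[OF _ _ _ homs(1) h(1)] module_hom_comp[OF _ _ _ homs(3) h(3)] mods)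
  moreover have "g * (h1 * \<gamma>1 + h2 * \<gamma>2) = f"
  proof -
    note d = module_hom_dim[OF g] module_hom_dim[OF f] module_hom_dim[OF h(1)] module_hom_dim[OF h(3)]
      module_hom_dim[OF homs(1)] module_hom_dim[OF homs(2)] module_hom_dim[OF homs(3)] module_hom_dim[OF homs(4)]
    have "g * (h1 * \<gamma>1 + h2 * \<gamma>2) = f * (\<beta>1 * \<gamma>1 + \<beta>2 * \<gamma>2)"
      by (simp add: d mat_mult_add mat_assoc[symmetric] h(2,4))
    then show ?thesis by (simp add: id d mat_alg)
  qed
  ultimately show "\<exists>h\<in>module_hom Q M. g * h = f" by blast
qed

text \<open>The columns of \<open>B\<close> are a basis of a subspace, and \<open>B * B'\<close> is
  a projection onto it. The condition \<open>inv\<close> therefore says that the subspace is stable,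
  and the action is written in the coordinates \<open>B'\<close>.\<close>

lemma submodule:
  assumes F: "is_module F" and B: "B \<in> carrier_mat (fst F) e" "B' \<in> carrier_mat e (fst F)" "B' * B = 1\<^sub>m e"
    and inv: "\<And>a. B * (B' * (snd F a * B)) = snd F a * B"
  shows "is_module (e, \<lambda>a. B' * snd F a * B)" "B \<in> module_hom (e, \<lambda>a. B' * snd F a * B) F"
proof -
  note d = carrier_matD[OF B(1)] carrier_matD[OF B(2)] module_dim[OF F]
  have inv': "B * (B' * (snd F a * (B * X))) = snd F a * (B * X)" if "dim_row X = e" for a X
    using arg_cong[OF inv, of "\<lambda>Y. Y * X" a] d that by (simp only: mat_assoc index_mult_mat)
  show "is_module (e, \<lambda>a. B' * snd F a * B)"
    by (rule is_moduleI) (simp_all only: mem_carrier_mat_iff module_add[OF F] module_scale[OF F] module_mult[OF F]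
      module_one[OF F] mat_alg d inv inv' B(3) index_mult_mat index_add_mat index_smult_mat simp_thms)
  show "B \<in> module_hom (e, \<lambda>a. B' * snd F a * B) F"
    by (rule module_homI) (simp_all only: mem_carrier_mat_iff fst_conv snd_conv mat_alg d inv index_mult_mat simp_thms)
qed

text \<open>As \<open>1 - C * C'\<close> projects onto the kernel of \<open>C'\<close>, the
  condition \<open>inv\<close> says that this kernel is stable; the columns of \<open>C\<close>
  represent a basis of the quotient.\<close>

lemma quotient_module:
  assumes F: "is_module F" and C: "C \<in> carrier_mat (fst F) q" "C' \<in> carrier_mat q (fst F)" "C' * C = 1\<^sub>m q"
    and inv: "\<And>a. C' * (snd F a * (C * C')) = C' * snd F a"
  shows "is_module (q, \<lambda>a. C' * snd F a * C)" "C' \<in> module_hom F (q, \<lambda>a. C' * snd F a * C)"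
proof -
  note d = carrier_matD[OF C(1)] carrier_matD[OF C(2)] module_dim[OF F]
  have inv': "C' * (snd F a * (C * (C' * X))) = C' * (snd F a * X)" if "dim_row X = fst F" for a X
    using arg_cong[OF inv, of "\<lambda>Y. Y * X" a] d that by (simp only: mat_assoc index_mult_mat)
  show "is_module (q, \<lambda>a. C' * snd F a * C)"
    by (rule is_moduleI) (simp_all only: mem_carrier_mat_iff module_add[OF F] module_scale[OF F] module_mult[OF F]
      module_one[OF F] mat_alg d inv' C(3) index_mult_mat index_add_mat index_smult_mat simp_thms)
  show "C' \<in> module_hom F (q, \<lambda>a. C' * snd F a * C)"
    by (rule module_homI) (simp_all only: mem_carrier_mat_iff fst_conv snd_conv mat_alg d inv index_mult_mat simp_thms)
qed

section \<open>Free modules\<close>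

definition basis :: "'a list" where
  "basis = (SOME bs. distinct bs \<and> independent (set bs) \<and> span (set bs) = UNIV)"

definition algebra_dim :: nat where "algebra_dim = length basis"

definition coord :: "'a \<Rightarrow> nat \<Rightarrow> 'k" where
  "coord a l = representation (set basis) a (basis ! l)"

lemma basis: "distinct basis" "independent (set basis)" "span (set basis) = UNIV"
proof -
  obtain S where S: "finite S" "span S = UNIV" using finite_dim by blast
  obtain B where B: "B \<subseteq> S" "independent B" "span B = span S"
    using maximal_independent_subset[of S] span_mono span_span
    by (metis span_superset subset_antisym span_minimal subspace_span)
  then obtain bs where "distinct bs" "set bs = B"
    using S finite_subset finite_distinct_list by metis
  then have "\<exists>bs. distinct bs \<and> independent (set bs) \<and> span (set bs) = UNIV"
    using B S by auto
  from someI_ex[OF this] show "distinct basis" "independent (set basis)" "span (set basis) = UNIV"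
    unfolding basis_def[symmetric] by auto
qed

lemma coord_add: "coord (a + b) l = coord a l + coord b l"
  and coord_scale: "coord (scale c a) l = c * coord a l"
  unfolding coord_def using basis by (auto simp: representation_add representation_scale)

lemma coord_basis: "\<lbrakk>l < algebra_dim; l' < algebra_dim\<rbrakk> \<Longrightarrow> coord (basis ! l') l = (if l = l' then 1 else 0)"
  unfolding coord_def algebra_dim_def
  using basis by (auto simp: representation_basis nth_eq_iff_index_eq)

lemma sum_coord: "a = (\<Sum>l<algebra_dim. scale (coord a l) (basis ! l))"
proof -
  have "a = (\<Sum>b\<in>set basis. scale (representation (set basis) a b) b)"
    using sum_representation_eq[OF basis(2), of a "set basis"] basis by auto
  also have "\<dots> = (\<Sum>l<algebra_dim. scale (coord a l) (basis ! l))"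
    unfolding coord_def algebra_dim_def
    by (rule sum.reindex_bij_betw[symmetric]) (simp add: bij_betw_nth[OF basis(1)])
  finally show ?thesis .
qed

lemma module_entry_coord:
  assumes M: "is_module M" and ij: "i < fst M" "j < fst M"
  shows "snd M a $$ (i, j) = (\<Sum>l<algebra_dim. coord a l * snd M (basis ! l) $$ (i, j))"
proof -
  have zero: "snd M 0 = 0\<^sub>m (fst M) (fst M)"
  proof -
    have "0 \<cdot>\<^sub>m snd M 0 = 0\<^sub>m (fst M) (fst M)" using M by (intro eq_matI) auto
    then show ?thesis using module_scale[OF M, of 0 0] by simp
  qed
  have "snd M (\<Sum>l\<in>L. scale (coord a l) (basis ! l)) $$ (i, j) =
      (\<Sum>l\<in>L. coord a l * snd M (basis ! l) $$ (i, j))" if "finite L" for L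
    using that by (induction L) (use M ij in \<open>auto simp: zero module_add module_scale\<close>)
  from this[of "{..<algebra_dim}"] show ?thesis by (simp flip: sum_coord)
qed

lemma coord_sum: "coord (\<Sum>l\<in>L. f l) k = (\<Sum>l\<in>L. coord (f l) k)"
proof -
  have "coord 0 k = 0" using coord_scale[of 0 0 k] by simp
  then show ?thesis by (induction L rule: infinite_finite_induct) (auto simp: coord_add)
qed

lemma coord_mult: "coord (a * b) k = (\<Sum>l<algebra_dim. coord b l * coord (a * basis ! l) k)"
proof -
  have "a * b = (\<Sum>l<algebra_dim. scale (coord b l) (a * basis ! l))"
    by (subst sum_coord[of b]) (simp add: sum_distrib_left scale_mult_right)
  then show ?thesis by (simp add: coord_sum coord_scale)
qed

text \<open>The index \<open>p\<close> stands for the basis element number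
  \<open>p mod algebra_dim\<close> in the summand number \<open>p div algebra_dim\<close>, and the
  algebra acts by left multiplication. For the zero algebra there are no indices, so division by
  zero never enters.\<close>

definition free :: "nat \<Rightarrow> ('a, 'k) rep" where
  "free n = (n * algebra_dim, \<lambda>a. mat (n * algebra_dim) (n * algebra_dim)
     (\<lambda>(p, q). if p div algebra_dim = q div algebra_dim
        then coord (a * basis ! (q mod algebra_dim)) (p mod algebra_dim) else 0))"

text \<open>The homomorphism from the free module to \<open>M\<close> that sends the generators, the
  columns of \<open>free_gens n\<close>, to the columns of \<open>Y\<close>.\<close>

definition free_map :: "('a, 'k) rep \<Rightarrow> nat \<Rightarrow> 'k mat \<Rightarrow> 'k mat" where
  "free_map M n Y = mat (fst M) (n * algebra_dim)
     (\<lambda>(i, q). (snd M (basis ! (q mod algebra_dim)) * Y) $$ (i, q div algebra_dim))"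

definition free_gens :: "nat \<Rightarrow> 'k mat" where
  "free_gens n = mat (n * algebra_dim) n
     (\<lambda>(p, q). if p div algebra_dim = q then coord 1 (p mod algebra_dim) else 0)"

lemma fst_free: "fst (free n) = n * algebra_dim"
  by (simp add: free_def)

lemma free_map_carrier: "free_map M n Y \<in> carrier_mat (fst M) (n * algebra_dim)"
  by (simp add: free_map_def)

lemma free_gens_carrier: "free_gens n \<in> carrier_mat (n * algebra_dim) n"
  by (simp add: free_gens_def)

lemma div_mod_less: "q < n * m \<Longrightarrow> q div m < (n :: nat)" "q < n * m \<Longrightarrow> q mod m < m"
  by (simp_all add: less_mult_imp_div_less) (metis bot_nat_0.not_eq_extremum mod_less_divisor mult_is_0 not_less_zero)

lemma div_mod_inject: "\<lbrakk>p mod m = q mod m; p div m = q div m\<rbrakk> \<Longrightarrow> p = (q :: nat)"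
  by (metis div_mult_mod_eq)

lemma free_module: "is_module (free n)"
  unfolding free_def
proof (rule is_moduleI; (rule eq_matI)?)
  fix a b i j
  let ?m = "algebra_dim"
  let ?F = "\<lambda>a. mat (n * ?m) (n * ?m) (\<lambda>(p, q). if p div ?m = q div ?m
        then coord (a * basis ! (q mod ?m)) (p mod ?m) else 0)"
  assume "i < dim_row (?F a * ?F b)" "j < dim_col (?F a * ?F b)"
  then have ij: "i < n * ?m" "j < n * ?m" by auto
  have "(?F a * ?F b) $$ (i, j) = (\<Sum>r = 0..<n * ?m. if r div ?m = i div ?m then
      (if i div ?m = j div ?m then coord (b * basis ! (j mod ?m)) (r mod ?m) * coord (a * basis ! (r mod ?m)) (i mod ?m) else 0) else 0)"
    using ij by (auto simp: scalar_prod_def intro!: sum.cong)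
  also have "\<dots> = (\<Sum>l<?m. if i div ?m = j div ?m then coord (b * basis ! (j mod ?m)) l * coord (a * basis ! l) (i mod ?m) else 0)"
    using ij by (intro sum_block div_mod_less)
  also have "\<dots> = ?F (a * b) $$ (i, j)"
    using ij by (auto simp: coord_mult[of a "b * _"] mult.assoc)
  finally show "?F (a * b) $$ (i, j) = (?F a * ?F b) $$ (i, j)" ..
next
  fix i j assume ij: "i < dim_row (1\<^sub>m (n * algebra_dim))" "j < dim_col (1\<^sub>m (n * algebra_dim))"
  then show "mat (n * algebra_dim) (n * algebra_dim) (\<lambda>(p, q). if p div algebra_dim = q div algebra_dim
        then coord (1 * basis ! (q mod algebra_dim)) (p mod algebra_dim) else 0) $$ (i, j) = 1\<^sub>m (n * algebra_dim) $$ (i, j)"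
    using div_mod_less(2)[of i n algebra_dim] div_mod_less(2)[of j n algebra_dim]
    by (auto simp: coord_basis intro: div_mod_inject)
qed (auto simp: coord_add coord_scale distrib_right scale_mult_left)

lemma free_map_hom:
  assumes M: "is_module M" and Y: "Y \<in> carrier_mat (fst M) n"
  shows "free_map M n Y \<in> module_hom (free n) M"
proof (rule module_homI)
  fix a
  let ?m = "algebra_dim"
  show "free_map M n Y * snd (free n) a = snd M a * free_map M n Y"
  proof (rule eq_matI)
    fix i q assume "i < dim_row (snd M a * free_map M n Y)" "q < dim_col (snd M a * free_map M n Y)"
    then have iq: "i < fst M" "q < n * ?m" using M by (auto simp: free_map_def)
    have "(free_map M n Y * snd (free n) a) $$ (i, q) = (\<Sum>r = 0..<n * ?m. if r div ?m = q div ?m then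
      (snd M (basis ! (r mod ?m)) * Y) $$ (i, q div ?m) * coord (a * basis ! (q mod ?m)) (r mod ?m) else 0)"
      using iq by (auto simp: scalar_prod_def free_map_def free_def intro!: sum.cong)
    also have "\<dots> = (\<Sum>l<?m. (snd M (basis ! l) * Y) $$ (i, q div ?m) * coord (a * basis ! (q mod ?m)) l)"
      using iq by (intro sum_block div_mod_less)
    also have "\<dots> = (\<Sum>l<?m. \<Sum>k = 0..<fst M. coord (a * basis ! (q mod ?m)) l * snd M (basis ! l) $$ (i, k) * Y $$ (k, q div ?m))"
      using iq M Y div_mod_less(1)[OF iq(2)]
      by (auto simp: scalar_prod_def sum_distrib_left sum_distrib_right mult_ac intro!: sum.cong)
    also have "\<dots> = (\<Sum>k = 0..<fst M. snd M (a * basis ! (q mod ?m)) $$ (i, k) * Y $$ (k, q div ?m))"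
      using iq M by (subst sum.swap) (auto simp: module_entry_coord[of M i _ "a * _"] sum_distrib_right intro!: sum.cong)
    also have "\<dots> = (snd M (a * basis ! (q mod ?m)) * Y) $$ (i, q div ?m)"
      using iq M Y div_mod_less(1)[OF iq(2)] by (simp add: scalar_prod_def)
    also have "snd M (a * basis ! (q mod ?m)) * Y = snd M a * (snd M (basis ! (q mod ?m)) * Y)"
      using M Y by (simp add: module_mult mat_assoc)
    also have "(snd M a * (snd M (basis ! (q mod ?m)) * Y)) $$ (i, q div ?m) = (snd M a * free_map M n Y) $$ (i, q)"
      using iq M Y div_mod_less(1)[OF iq(2)] by (simp add: scalar_prod_def free_map_def)
    finally show "(free_map M n Y * snd (free n) a) $$ (i, q) = (snd M a * free_map M n Y) $$ (i, q)" .
  qed (use M in \<open>auto simp: free_map_def free_def\<close>)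
qed (simp add: free_map_carrier fst_free)

lemma free_map_gens:
  assumes M: "is_module M" and Y: "Y \<in> carrier_mat (fst M) n"
  shows "free_map M n Y * free_gens n = Y"
proof (rule eq_matI)
  let ?m = "algebra_dim"
  fix i q assume "i < dim_row Y" "q < dim_col Y"
  then have iq: "i < fst M" "q < n" using Y by auto
  have "(free_map M n Y * free_gens n) $$ (i, q) = (\<Sum>r = 0..<n * ?m. if r div ?m = q then
      (snd M (basis ! (r mod ?m)) * Y) $$ (i, q) * coord 1 (r mod ?m) else 0)"
    using iq by (auto simp: scalar_prod_def free_map_def free_gens_def intro!: sum.cong)
  also have "\<dots> = (\<Sum>l<?m. (snd M (basis ! l) * Y) $$ (i, q) * coord 1 l)"
    using iq by (intro sum_block)
  also have "\<dots> = (\<Sum>l<?m. \<Sum>k = 0..<fst M. coord 1 l * snd M (basis ! l) $$ (i, k) * Y $$ (k, q))"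
    using iq M Y by (auto simp: scalar_prod_def sum_distrib_left sum_distrib_right mult_ac intro!: sum.cong)
  also have "\<dots> = (\<Sum>k = 0..<fst M. snd M 1 $$ (i, k) * Y $$ (k, q))"
    using iq M by (subst sum.swap) (auto simp: module_entry_coord[of M i _ 1] sum_distrib_right intro!: sum.cong)
  also have "\<dots> = (snd M 1 * Y) $$ (i, q)"
    using iq M Y by (simp add: scalar_prod_def)
  also have "snd M 1 * Y = Y" using M Y by (simp add: module_one mat_alg)
  finally show "(free_map M n Y * free_gens n) $$ (i, q) = Y $$ (i, q)" .
qed (use Y in \<open>auto simp: free_map_def free_gens_def\<close>)

lemma free_map_natural:
  assumes M: "is_module M" and N: "is_module N" and f: "f \<in> module_hom M N"
    and Y: "Y \<in> carrier_mat (fst M) n"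
  shows "f * free_map M n Y = free_map N n (f * Y)"
proof (rule eq_matI)
  let ?m = "algebra_dim"
  fix i q assume "i < dim_row (free_map N n (f * Y))" "q < dim_col (free_map N n (f * Y))"
  then have iq: "i < fst N" "q < n * ?m" by (auto simp: free_map_def)
  note d = div_mod_less(1)[OF iq(2)] module_hom_dim[OF f] carrier_matD[OF Y] module_dim[OF M] module_dim[OF N]
  have "(f * free_map M n Y) $$ (i, q) = (f * (snd M (basis ! (q mod ?m)) * Y)) $$ (i, q div ?m)"
    using iq d by (simp add: scalar_prod_def free_map_def)
  also have "f * (snd M (basis ! (q mod ?m)) * Y) = snd N (basis ! (q mod ?m)) * (f * Y)"
    using d module_hom_comm[OF f, of "basis ! (q mod ?m)"] by (simp add: mat_assoc[symmetric])
  finally show "(f * free_map M n Y) $$ (i, q) = free_map N n (f * Y) $$ (i, q)"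
    using iq by (simp add: free_map_def)
qed (use module_hom_dim[OF f] in \<open>auto simp: free_map_def\<close>)

lemma free_map_free_gens: "free_map (free n) n (free_gens n) = 1\<^sub>m (fst (free n))"
proof (rule eq_matI)
  let ?m = "algebra_dim"
  fix p q assume "p < dim_row (1\<^sub>m (fst (free n)))" "q < dim_col (1\<^sub>m (fst (free n)))"
  then have pq: "p < n * ?m" "q < n * ?m" by (auto simp: fst_free)
  note d = div_mod_less[OF pq(1)] div_mod_less[OF pq(2)]
  have "free_map (free n) n (free_gens n) $$ (p, q) = (\<Sum>r = 0..<n * ?m. if r div ?m = p div ?m then
      (if p div ?m = q div ?m then coord 1 (r mod ?m) * coord (basis ! (q mod ?m) * basis ! (r mod ?m)) (p mod ?m) else 0) else 0)"
    using pq d by (auto simp: scalar_prod_def free_map_def free_gens_def free_def intro!: sum.cong)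
  also have "\<dots> = (\<Sum>l<?m. if p div ?m = q div ?m then coord 1 l * coord (basis ! (q mod ?m) * basis ! l) (p mod ?m) else 0)"
    using d by (intro sum_block)
  also have "\<dots> = (if p div ?m = q div ?m then coord (basis ! (q mod ?m) * 1) (p mod ?m) else 0)"
    by (simp only: coord_mult[of _ 1]) simp
  also have "\<dots> = 1\<^sub>m (fst (free n)) $$ (p, q)"
    using pq d by (auto simp: coord_basis fst_free intro: div_mod_inject)
  finally show "free_map (free n) n (free_gens n) $$ (p, q) = 1\<^sub>m (fst (free n)) $$ (p, q)" .
qed (auto simp: free_map_def fst_free)

lemma projective_free: "projective (free n)"
  unfolding projective_def
proof (intro conjI allI impI ballI free_module)
  fix M N g f
  assume MN: "is_module M \<and> is_module N" and g: "g \<in> module_hom M N" and f: "f \<in> module_hom (free n) N"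
    and surj: "mat_image g = carrier_vec (fst N)"
  have fc: "f * free_gens n \<in> carrier_mat (fst N) n"
    using module_hom_dim[OF f] free_gens_carrier[of n] by auto
  obtain Y where Y: "Y \<in> carrier_mat (fst M) n" "g * Y = f * free_gens n"
    using mat_image_lift[OF module_hom_carrier[OF g] fc] surj fc by auto
  have "g * free_map M n Y = free_map N n (f * free_gens n)"
    using free_map_natural[of M N g Y n] MN g Y by simp
  also have "\<dots> = f"
    using free_map_natural[OF free_module _ f, of "free_gens n" n] MN free_gens_carrier[of n] module_hom_dim[OF f]
    by (simp add: fst_free free_map_free_gens[unfolded fst_free] mat_alg)
  finally show "\<exists>h\<in>module_hom (free n) M. g * h = f"
    using free_map_hom[of M Y n] MN Y by blast
qed

text \<open>Sending the generators to the unit vectors is onto, so projectivity splits this cover.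
  It exhibits \<open>P\<close> as a direct summand of a free module of rank
  \<open>fst P\<close>.\<close>

lemma projective_section:
  assumes P: "projective P"
  obtains s where "s \<in> module_hom P (free (fst P))" "free_map P (fst P) (1\<^sub>m (fst P)) * s = 1\<^sub>m (fst P)"
proof -
  note M = projective_module[OF P]
  let ?d = "fst P"
  have "mat_image (free_map P ?d (1\<^sub>m ?d)) = carrier_vec ?d"
    by (rule mat_image_fullI[OF free_map_carrier free_gens_carrier]) (simp add: free_map_gens[OF M])
  from projective_lift[OF P free_module M free_map_hom[OF M] module_hom_one[OF M] this]
  show ?thesis using that by auto
qed

end

section \<open>Points of the module scheme\<close>

definition monom_eval :: "('v \<Rightarrow> 'r::comm_ring_1) \<Rightarrow> ('v \<Rightarrow>\<^sub>0 nat) \<Rightarrow> 'r" where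
  "monom_eval s m = (\<Prod>x\<in>Poly_Mapping.keys m. s x ^ Poly_Mapping.lookup m x)"

text \<open>The coefficient map is a parameter so that one theory serves both values in the field,
  with the identity, and substitution of polynomials, with \<open>Const\<close>.\<close>

definition mpoly_eval :: "('k \<Rightarrow> 'r) \<Rightarrow> ('v \<Rightarrow> 'r::comm_ring_1) \<Rightarrow> ('v, 'k::comm_ring_1) mpoly \<Rightarrow> 'r" where
  "mpoly_eval \<iota> s p = (\<Sum>m\<in>Poly_Mapping.keys p. \<iota> (Poly_Mapping.lookup p m) * monom_eval s m)"

lemma monom_eval_superset:
  "\<lbrakk>finite A; Poly_Mapping.keys m \<subseteq> A\<rbrakk> \<Longrightarrow> monom_eval s m = (\<Prod>x\<in>A. s x ^ Poly_Mapping.lookup m x)"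
  unfolding monom_eval_def by (intro prod.mono_neutral_left) (auto simp: in_keys_iff)

lemma monom_eval_add: "monom_eval s (m + n) = monom_eval s m * monom_eval s n"
proof -
  have "Poly_Mapping.keys (m + n) \<subseteq> Poly_Mapping.keys m \<union> Poly_Mapping.keys n"
    by (rule Poly_Mapping.keys_add)
  then show ?thesis
    by (simp add: monom_eval_superset[of "Poly_Mapping.keys m \<union> Poly_Mapping.keys n"]
        lookup_add power_add prod.distrib)
qed

lemma monom_eval_zero: "monom_eval s 0 = 1"
  by (simp add: monom_eval_def)

lemma monom_eval_single: "monom_eval s (Poly_Mapping.single x k) = s x ^ k"
  by (simp add: monom_eval_superset[of "{x}"])

lemma mpoly_expand: "p = (\<Sum>m\<in>Poly_Mapping.keys p. Poly_Mapping.single m (Poly_Mapping.lookup p m))"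
proof (rule poly_mapping_eqI)
  fix n
  have "(\<Sum>m\<in>Poly_Mapping.keys p. Poly_Mapping.lookup (Poly_Mapping.single m (Poly_Mapping.lookup p m)) n)
      = Poly_Mapping.lookup p n"
    by (cases "n \<in> Poly_Mapping.keys p")
      (auto simp: lookup_single when_def in_keys_iff sum.remove[of _ n] intro!: sum.neutral)
  then show "Poly_Mapping.lookup p n =
      Poly_Mapping.lookup (\<Sum>m\<in>Poly_Mapping.keys p. Poly_Mapping.single m (Poly_Mapping.lookup p m)) n"
    by (simp add: lookup_sum)
qed

locale coeff_hom =
  fixes \<iota> :: "'k::comm_ring_1 \<Rightarrow> 'r::comm_ring_1"
  assumes \<iota>_add: "\<iota> (c + d) = \<iota> c + \<iota> d" and \<iota>_mult: "\<iota> (c * d) = \<iota> c * \<iota> d" and \<iota>_one: "\<iota> 1 = 1"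
begin

lemma \<iota>_zero: "\<iota> 0 = 0"
  using \<iota>_add[of 0 0] by simp

lemma eval_superset:
  "\<lbrakk>finite A; Poly_Mapping.keys p \<subseteq> A\<rbrakk>
    \<Longrightarrow> mpoly_eval \<iota> s p = (\<Sum>m\<in>A. \<iota> (Poly_Mapping.lookup p m) * monom_eval s m)"
  unfolding mpoly_eval_def by (intro sum.mono_neutral_left) (auto simp: in_keys_iff \<iota>_zero)

lemma eval_add: "mpoly_eval \<iota> s (p + q) = mpoly_eval \<iota> s p + mpoly_eval \<iota> s q"
proof -
  have "Poly_Mapping.keys (p + q) \<subseteq> Poly_Mapping.keys p \<union> Poly_Mapping.keys q"
    by (rule Poly_Mapping.keys_add)
  then show ?thesis
    by (simp add: eval_superset[of "Poly_Mapping.keys p \<union> Poly_Mapping.keys q"] lookup_add \<iota>_add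
        distrib_right sum.distrib)
qed

lemma eval_single: "mpoly_eval \<iota> s (Poly_Mapping.single m c) = \<iota> c * monom_eval s m"
  by (simp add: eval_superset[of "{m}"])

lemma eval_zero: "mpoly_eval \<iota> s 0 = 0"
  by (simp add: mpoly_eval_def)

lemma eval_sum: "mpoly_eval \<iota> s (sum f A) = (\<Sum>i\<in>A. mpoly_eval \<iota> s (f i))"
  by (induction A rule: infinite_finite_induct) (simp_all add: eval_zero eval_add)

lemma eval_mult: "mpoly_eval \<iota> s (p * q) = mpoly_eval \<iota> s p * mpoly_eval \<iota> s q"
proof -
  have "p * q = (\<Sum>m\<in>Poly_Mapping.keys p. \<Sum>n\<in>Poly_Mapping.keys q.
      Poly_Mapping.single (m + n) (Poly_Mapping.lookup p m * Poly_Mapping.lookup q n))"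
    by (subst mpoly_expand[of p], subst mpoly_expand[of q])
      (simp add: sum_product mult_single)
  then have "mpoly_eval \<iota> s (p * q) = (\<Sum>m\<in>Poly_Mapping.keys p. \<Sum>n\<in>Poly_Mapping.keys q.
      \<iota> (Poly_Mapping.lookup p m * Poly_Mapping.lookup q n) * monom_eval s (m + n))"
    by (simp only: eval_sum eval_single)
  then show ?thesis
    by (simp add: monom_eval_add \<iota>_mult mpoly_eval_def sum_product mult_ac)
qed

lemma eval_one: "mpoly_eval \<iota> s 1 = 1"
  using eval_single[of s 0 1] by (simp add: \<iota>_one monom_eval_zero)

lemma eval_minus: "mpoly_eval \<iota> s (- p) = - mpoly_eval \<iota> s p"
  using eval_add[of s p "- p"] by (simp add: eval_zero add_eq_0_iff)

lemma eval_diff: "mpoly_eval \<iota> s (p - q) = mpoly_eval \<iota> s p - mpoly_eval \<iota> s q"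
  using eval_add[of s p "- q"] by (simp add: eval_minus)

lemma eval_Var: "mpoly_eval \<iota> s (Var x) = s x"
  by (simp add: Var_def eval_single monom_eval_single \<iota>_one)

lemma eval_Const: "mpoly_eval \<iota> s (Const c) = \<iota> c"
  by (simp add: Const_def eval_single monom_eval_zero)

lemma eval_cong:
  assumes "\<And>m x. m \<in> Poly_Mapping.keys p \<Longrightarrow> x \<in> Poly_Mapping.keys m \<Longrightarrow> s x = t x"
  shows "mpoly_eval \<iota> s p = mpoly_eval \<iota> t p"
  unfolding mpoly_eval_def monom_eval_def using assms by (auto intro!: sum.cong prod.cong arg_cong2[of _ _ _ _ "(*)"])

end

interpretation id_hom: coeff_hom "\<lambda>c :: 'k::comm_ring_1. c"
  by standard auto

lemma coeff_hom_Const: "coeff_hom (Const :: 'k::comm_ring_1 \<Rightarrow> ('v, 'k) mpoly)"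
  by standard (auto simp: Const_def single_add mult_single)

interpretation Const_hom: coeff_hom "Const :: 'k::comm_ring_1 \<Rightarrow> ('v, 'k) mpoly"
  by (rule coeff_hom_Const)

lemma Var_power: "Var x ^ k = Poly_Mapping.single (Poly_Mapping.single x k) 1"
  by (induction k) (auto simp: Var_def mult_single single_add[symmetric])

lemma prod_single_one:
  "(\<Prod>x\<in>A. Poly_Mapping.single (f x) (1 :: 'k::comm_ring_1)) = Poly_Mapping.single (\<Sum>x\<in>A. f x :: 'v \<Rightarrow>\<^sub>0 nat) 1"
  by (induction A rule: infinite_finite_induct) (auto simp: mult_single)

lemma mpoly_eval_Var: "mpoly_eval Const Var p = (p :: ('v, 'k::comm_ring_1) mpoly)"
proof -
  have "monom_eval Var m = Poly_Mapping.single m (1 :: 'k)" for m :: "'v \<Rightarrow>\<^sub>0 nat"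
    using mpoly_expand[of m] by (simp add: monom_eval_def Var_power prod_single_one)
  then show ?thesis
    using mpoly_expand[of p] by (simp add: mpoly_eval_def Const_def mult_single)
qed

lemma ring_hom_eq_mpoly_eval:
  fixes \<phi> :: "('v, 'k::comm_ring_1) mpoly \<Rightarrow> 'k"
  assumes "\<And>a b. \<phi> (a + b) = \<phi> a + \<phi> b" "\<And>a b. \<phi> (a * b) = \<phi> a * \<phi> b" "\<And>c. \<phi> (Const c) = c"
  shows "\<phi> p = mpoly_eval (\<lambda>c. c) (\<lambda>x. \<phi> (Var x)) p"
proof -
  have one: "\<phi> 1 = 1" and zero: "\<phi> 0 = 0" using assms(3)[of 1] assms(3)[of 0] by (auto simp: Const_def)
  have sum: "\<phi> (sum f A) = (\<Sum>i\<in>A. \<phi> (f i))" for f :: "('v \<Rightarrow>\<^sub>0 nat) \<Rightarrow> _" and A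
    by (induction A rule: infinite_finite_induct) (auto simp: zero assms)
  have power: "\<phi> (x ^ k) = \<phi> x ^ k" for x k by (induction k) (auto simp: one assms)
  have prod: "\<phi> (prod f A) = (\<Prod>i\<in>A. \<phi> (f i))" for f :: "'v \<Rightarrow> _" and A
    by (induction A rule: infinite_finite_induct) (auto simp: one assms)
  have "\<phi> p = \<phi> (mpoly_eval Const Var p)" by (simp add: mpoly_eval_Var)
  also have "\<dots> = mpoly_eval (\<lambda>c. c) (\<lambda>x. \<phi> (Var x)) p"
    by (simp add: mpoly_eval_def monom_eval_def sum prod power assms)
  finally show ?thesis .
qed

lemma subring_Const_Var:
  assumes "range Const \<subseteq> B" "range Var \<subseteq> B"
    "\<And>a b. \<lbrakk>a \<in> B; b \<in> B\<rbrakk> \<Longrightarrow> a + b \<in> B" "\<And>a b. \<lbrakk>a \<in> B; b \<in> B\<rbrakk> \<Longrightarrow> a * b \<in> B"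
  shows "(p :: ('v, 'k::comm_ring_1) mpoly) \<in> B"
proof -
  have one: "1 \<in> B" and zero: "0 \<in> B" using assms(1) by (auto simp: Const_def image_subset_iff dest: spec[of _ 0] spec[of _ 1])
  have sum: "sum f A \<in> B" if "\<And>i. i \<in> A \<Longrightarrow> f i \<in> B" for f :: "('v \<Rightarrow>\<^sub>0 nat) \<Rightarrow> _" and A
    using that by (induction A rule: infinite_finite_induct) (auto simp: zero assms)
  have power: "x ^ k \<in> B" if "x \<in> B" for x k using that by (induction k) (auto simp: one assms)
  have prod: "prod f A \<in> B" if "\<And>i. f i \<in> B" for f :: "'v \<Rightarrow> _" and A
    using that by (induction A rule: infinite_finite_induct) (auto simp: one assms)
  have "mpoly_eval Const Var p \<in> B"
    unfolding mpoly_eval_def monom_eval_def using assms(1,2)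
    by (intro sum assms(4) prod power) auto
  then show ?thesis by (simp add: mpoly_eval_Var)
qed

context
  fixes V :: "'v set"
begin

interpretation cring "poly_ring_in V :: ('v, 'k::comm_ring_1) mpoly ring"
  by (rule cring_poly_ring_in)

lemma poly_ring_in_ops:
  "x \<otimes>\<^bsub>poly_ring_in V\<^esub> y = x * y" "x \<oplus>\<^bsub>poly_ring_in V\<^esub> y = x + y"
  "\<one>\<^bsub>poly_ring_in V\<^esub> = 1" "\<zero>\<^bsub>poly_ring_in V\<^esub> = 0"
  by (simp_all add: poly_ring_in_def)

lemma poly_ring_in_minus: "x \<in> carrier (poly_ring_in V) \<Longrightarrow> \<ominus>\<^bsub>poly_ring_in V\<^esub> x = - (x :: ('v, 'k::comm_ring_1) mpoly)"
  using minus_equality[of "- x" x] by (auto simp: poly_ring_in_ops) (simp add: poly_ring_in_def)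

lemma poly_ring_in_closed:
  assumes "(p :: ('v, 'k::comm_ring_1) mpoly) \<in> carrier (poly_ring_in V)" "q \<in> carrier (poly_ring_in V)"
  shows "p + q \<in> carrier (poly_ring_in V)" "p * q \<in> carrier (poly_ring_in V)" "- p \<in> carrier (poly_ring_in V)" "p - q \<in> carrier (poly_ring_in V)"
  using add.m_closed[of p q] m_closed[of p q] a_inv_closed[of p] minus_closed[of p q] assms
  by (simp_all add: poly_ring_in_ops a_minus_def poly_ring_in_minus)

lemma poly_ring_in_consts: "(0 :: ('v, 'k::comm_ring_1) mpoly) \<in> carrier (poly_ring_in V)" "(1 :: ('v, 'k) mpoly) \<in> carrier (poly_ring_in V)"
  using zero_closed one_closed by (simp_all add: poly_ring_in_ops)

lemma Const_mem: "Const c \<in> carrier (poly_ring_in V)"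
  by (auto simp: poly_ring_in_def Const_def split: if_splits)

lemma Var_mem: "x \<in> V \<Longrightarrow> Var x \<in> carrier (poly_ring_in V)"
  by (auto simp: poly_ring_in_def Var_def split: if_splits)

lemma poly_ring_in_sum: "(\<And>i. i \<in> I \<Longrightarrow> f i \<in> carrier (poly_ring_in V)) \<Longrightarrow> (sum f I :: ('v, 'k::comm_ring_1) mpoly) \<in> carrier (poly_ring_in V)"
  by (induction I rule: infinite_finite_induct) (auto intro: poly_ring_in_consts poly_ring_in_closed)

lemma poly_ring_in_eval:
  assumes "\<And>x. s x \<in> carrier (poly_ring_in V)"
  shows "mpoly_eval Const s p \<in> (carrier (poly_ring_in V) :: ('v, 'k::comm_ring_1) mpoly set)"
proof -
  have power: "x ^ k \<in> carrier (poly_ring_in V)" if "x \<in> carrier (poly_ring_in V)" for x :: "('v, 'k) mpoly" and k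
    using that by (induction k) (auto intro: poly_ring_in_consts poly_ring_in_closed)
  have prod: "prod f A \<in> carrier (poly_ring_in V)" if "\<And>i. f i \<in> carrier (poly_ring_in V)" for f :: "'w \<Rightarrow> ('v, 'k) mpoly" and A
    using that by (induction A rule: infinite_finite_induct) (auto intro: poly_ring_in_consts poly_ring_in_closed)
  show ?thesis
    unfolding mpoly_eval_def monom_eval_def
    by (intro poly_ring_in_sum poly_ring_in_closed(2) Const_mem prod power assms)
qed

end

section \<open>Primes of quotient rings and generic points\<close>

lemma (in cring) Spec_quotient_vimage:
  assumes I: "ideal I R" and Q: "Q \<in> Spec (R Quot I)"
  shows "primeideal {r \<in> carrier R. I +> r \<in> Q} R" "I \<subseteq> {r \<in> carrier R. I +> r \<in> Q}"
proof -
  interpret I: ideal I R by (rule I)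
  interpret h: ring_hom_ring R "R Quot I" "(+>) I" by (rule I.rcos_ring_hom_ring)
  interpret Q: primeideal Q "R Quot I" using Q by (simp add: Spec_def)
  show "primeideal {r \<in> carrier R. I +> r \<in> Q} R"
    by (rule h.primeideal_vimage[OF is_cring Q.primeideal_axioms])
  have "r \<in> carrier R \<and> I +> r \<in> Q" if r: "r \<in> I" for r
  proof
    show "r \<in> carrier R" by (rule I.Icarr[OF r])
    have "I \<in> Q" using Q.zero_closed unfolding FactRing_def by simp
    then show "I +> r \<in> Q" unfolding I.a_rcos_const[OF r] .
  qed
  then show "I \<subseteq> {r \<in> carrier R. I +> r \<in> Q}" by blast
qed

lemma (in cring) Spec_quotient_image:
  assumes I: "ideal I R" and J: "primeideal J R" "I \<subseteq> J"
  shows "(+>) I ` J \<in> Spec (R Quot I)" "r \<in> carrier R \<Longrightarrow> I +> r \<in> (+>) I ` J \<longleftrightarrow> r \<in> J"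
proof -
  interpret I: ideal I R by (rule I)
  interpret J: primeideal J R by (rule J(1))
  interpret h: ring_hom_ring R "R Quot I" "(+>) I" by (rule I.rcos_ring_hom_ring)
  have idl: "ideal ((+>) I ` J) (R Quot I)"
    by (rule ring_ideal_imp_quot_ideal[OF I J.is_ideal])
  have mem: "I +> r \<in> (+>) I ` J \<longleftrightarrow> r \<in> J" if r: "r \<in> carrier R" for r
  proof -
    have "J = \<Union> ((+>) I ` J)" using ideal_incl_iff[OF I J.is_ideal] J(2) by simp
    then show ?thesis
      using canonical_proj_vimage_mem_iff[OF I _ r, of "(+>) I ` J"]
        additive_subgroup.a_subset[OF ideal.axioms(1)[OF idl]] by simp
  qed
  then show "r \<in> carrier R \<Longrightarrow> I +> r \<in> (+>) I ` J \<longleftrightarrow> r \<in> J" .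
  have surj: "\<exists>r\<in>carrier R. x = I +> r" if "x \<in> carrier (R Quot I)" for x
    using that unfolding FactRing_def A_RCOSETS_def' by auto
  have "primeideal ((+>) I ` J) (R Quot I)"
  proof (rule primeidealI[OF idl I.quotient_is_cring[OF is_cring]])
    show "carrier (R Quot I) \<noteq> (+>) I ` J"
    proof
      assume eq: "carrier (R Quot I) = (+>) I ` J"
      have "x \<in> J" if "x \<in> carrier R" for x
        using h.hom_closed[OF that] mem[OF that] unfolding eq by simp
      then show False using J.I_notcarr J.a_subset by blast
    qed
  next
    fix a b assume "a \<in> carrier (R Quot I)" "b \<in> carrier (R Quot I)"
    then obtain x y where xy: "x \<in> carrier R" "y \<in> carrier R" "a = I +> x" "b = I +> y"
      using surj by meson
    assume "a \<otimes>\<^bsub>R Quot I\<^esub> b \<in> (+>) I ` J"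
    then have "I +> x \<otimes> y \<in> (+>) I ` J" unfolding xy(3,4) using h.hom_mult[OF xy(1,2)] by simp
    then have "x \<otimes> y \<in> J" using mem[OF m_closed[OF xy(1,2)]] by blast
    then have "x \<in> J \<or> y \<in> J" by (rule J.I_prime[OF xy(1,2)])
    then show "a \<in> (+>) I ` J \<or> b \<in> (+>) I ` J" unfolding xy(3,4) by blast
  qed
  then show "(+>) I ` J \<in> Spec (R Quot I)" by (simp add: Spec_def)
qed

lemma Spec_generization:
  assumes "openin (zariski_topology R) U" "Q \<in> U" "\<eta> \<subseteq> Q" "\<eta> \<in> Spec R"
  shows "\<eta> \<in> U"
  using assms by (auto simp: openin_zariski)

text \<open>An open set contains the generizations of its points, so every nonempty open subset of
  \<open>W\<close> contains \<open>\<eta>\<close>; dually, a closed subset of \<open>W\<close> that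
  contains \<open>\<eta>\<close> is all of \<open>W\<close>.\<close>

lemma irreducible_if_generic_point:
  assumes W: "W \<subseteq> Spec R" and \<eta>: "\<eta> \<in> W" "\<And>Q. Q \<in> W \<Longrightarrow> \<eta> \<subseteq> Q"
  shows "connectedin (zariski_topology R) W" "irreducible_space (subtopology (zariski_topology R) W)"
proof -
  let ?X = "zariski_topology R"
  show "connectedin ?X W"
    unfolding connectedin
  proof (intro conjI notI)
    show "W \<subseteq> topspace ?X" using W by simp
    assume "\<exists>E1 E2. openin ?X E1 \<and> openin ?X E2 \<and> W \<subseteq> E1 \<union> E2 \<and> E1 \<inter> E2 \<inter> W = {} \<and> E1 \<inter> W \<noteq> {} \<and> E2 \<inter> W \<noteq> {}"
    then obtain E1 E2 Q1 Q2 where E: "openin ?X E1" "openin ?X E2" "E1 \<inter> E2 \<inter> W = {}"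
      "Q1 \<in> E1" "Q1 \<in> W" "Q2 \<in> E2" "Q2 \<in> W" by blast
    have "\<eta> \<in> Spec R" using \<eta> W by auto
    then have "\<eta> \<in> E1" "\<eta> \<in> E2" using Spec_generization E \<eta> by blast+
    then show False using E \<eta> by auto
  qed
  show "irreducible_space (subtopology ?X W)"
    unfolding irreducible_space_def
  proof (intro conjI allI impI)
    have top: "topspace (subtopology ?X W) = W" using W by auto
    then show "topspace (subtopology ?X W) \<noteq> {}" using \<eta> by auto
    have all: "S = W" if S: "closedin (subtopology ?X W) S" "\<eta> \<in> S" for S
    proof -
      from S(1) obtain K where K: "closedin ?X K" "S = K \<inter> W" by (auto simp: closedin_subtopology)
      then obtain F where "K = {P \<in> Spec R. F \<subseteq> P}" by (auto simp: closedin_zariski)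
      then show ?thesis using K S \<eta> W by blast
    qed
    fix S T assume ST: "closedin (subtopology ?X W) S \<and> closedin (subtopology ?X W) T \<and> S \<union> T = topspace (subtopology ?X W)"
    then have "\<eta> \<in> S \<or> \<eta> \<in> T" using \<eta> top by auto
    then show "S = topspace (subtopology ?X W) \<or> T = topspace (subtopology ?X W)"
      using all ST top by auto
  qed
qed

section \<open>Modules as points of the spectrum of the coordinate ring\<close>

context fin_dim_algebra
begin

abbreviation mod_polys :: "nat \<Rightarrow> ('a \<times> nat \<times> nat, 'k) mpoly set" where
  "mod_polys d \<equiv> carrier (poly_ring_in (mod_vars d))"

definition mod_class :: "nat \<Rightarrow> ('a \<times> nat \<times> nat, 'k) mpoly \<Rightarrow> ('a \<times> nat \<times> nat, 'k) mpoly set" where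
  "mod_class d p = (Idl\<^bsub>poly_ring_in (mod_vars d)\<^esub> (mod_relations d)) +>\<^bsub>poly_ring_in (mod_vars d)\<^esub> p"

lemma mod_var_mem: "\<lbrakk>i < d; j < d\<rbrakk> \<Longrightarrow> Var (a, i, j) \<in> mod_polys d"
  by (intro Var_mem) (simp add: mod_vars_def)

lemma mod_relations_subset: "mod_relations d \<subseteq> mod_polys d"
  unfolding mod_relations_def
  by (auto intro!: poly_ring_in_closed poly_ring_in_sum poly_ring_in_consts mod_var_mem Const_mem)

lemma mod_ideal: "ideal (Idl\<^bsub>poly_ring_in (mod_vars d)\<^esub> (mod_relations d)) (poly_ring_in (mod_vars d))"
  by (intro ring.genideal_ideal cring.axioms(1) cring_poly_ring_in mod_relations_subset)

lemma Spec_mod: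
  assumes Q: "Q \<in> Spec (mod_coordinate_ring d)"
  shows "\<lbrakk>p \<in> mod_polys d; q \<in> mod_polys d; mod_class d p \<in> Q; mod_class d q \<in> Q\<rbrakk> \<Longrightarrow> mod_class d (p + q) \<in> Q"
    and "\<lbrakk>p \<in> mod_polys d; q \<in> mod_polys d; mod_class d p \<in> Q\<rbrakk> \<Longrightarrow> mod_class d (q * p) \<in> Q"
    and "\<lbrakk>p \<in> mod_polys d; q \<in> mod_polys d; mod_class d (p * q) \<in> Q\<rbrakk> \<Longrightarrow> mod_class d p \<in> Q \<or> mod_class d q \<in> Q"
    and "mod_class d 0 \<in> Q" and "mod_class d 1 \<notin> Q"
    and "r \<in> mod_relations d \<Longrightarrow> mod_class d r \<in> Q"
proof -
  note P = cring.Spec_quotient_vimage[OF cring_poly_ring_in mod_ideal Q[unfolded mod_coordinate_ring_def], folded mod_class_def]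
  define J where "J = {r \<in> mod_polys d. mod_class d r \<in> Q}"
  have mem: "r \<in> J \<longleftrightarrow> mod_class d r \<in> Q" if "r \<in> mod_polys d" for r
    using that unfolding J_def by simp
  interpret J: primeideal J "poly_ring_in (mod_vars d)"
    using P(1) unfolding J_def .
  show "mod_class d 0 \<in> Q"
    using additive_subgroup.zero_closed[OF J.additive_subgroup_axioms]
    unfolding poly_ring_in_ops mem[OF poly_ring_in_consts(1)] .
  show "mod_class d 1 \<notin> Q"
  proof
    assume "mod_class d 1 \<in> Q"
    then have "1 \<in> J" by (simp only: mem[OF poly_ring_in_consts(2)])
    then show False using J.one_imp_carrier J.I_notcarr unfolding poly_ring_in_ops by blast
  qed
  show "mod_class d r \<in> Q" if "r \<in> mod_relations d"
  proof -
    have "r \<in> Idl\<^bsub>poly_ring_in (mod_vars d)\<^esub> (mod_relations d)"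
      using ring.genideal_self[OF cring.axioms(1)[OF cring_poly_ring_in] mod_relations_subset] that by blast
    then show ?thesis using P(2) by blast
  qed
  assume p: "p \<in> mod_polys d" and q: "q \<in> mod_polys d"
  show "mod_class d (p + q) \<in> Q" if "mod_class d p \<in> Q" "mod_class d q \<in> Q"
    using additive_subgroup.a_closed[OF J.additive_subgroup_axioms, of p q] that unfolding poly_ring_in_ops
    by (simp only: mem p q poly_ring_in_closed simp_thms)
  show "mod_class d (q * p) \<in> Q" if "mod_class d p \<in> Q"
    using J.I_l_closed[of p q] that unfolding poly_ring_in_ops
    by (simp only: mem p q poly_ring_in_closed simp_thms)
  show "mod_class d p \<in> Q \<or> mod_class d q \<in> Q" if "mod_class d (p * q) \<in> Q"
    using J.I_prime[of p q] that unfolding poly_ring_in_ops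
    by (simp only: mem p q poly_ring_in_closed simp_thms)
qed

definition rep_eval :: "('a \<Rightarrow> 'k mat) \<Rightarrow> ('a \<times> nat \<times> nat, 'k) mpoly \<Rightarrow> 'k" where
  "rep_eval \<rho> p = mpoly_eval (\<lambda>c. c) (\<lambda>(a, i, j). \<rho> a $$ (i, j)) p"

lemma rep_eval_simps:
  "rep_eval \<rho> (p + q) = rep_eval \<rho> p + rep_eval \<rho> q" "rep_eval \<rho> (p * q) = rep_eval \<rho> p * rep_eval \<rho> q"
  "rep_eval \<rho> (p - q) = rep_eval \<rho> p - rep_eval \<rho> q" "rep_eval \<rho> (sum f A) = (\<Sum>x\<in>A. rep_eval \<rho> (f x))"
  "rep_eval \<rho> 0 = 0" "rep_eval \<rho> 1 = 1" "rep_eval \<rho> (- p) = - rep_eval \<rho> p"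
  "rep_eval \<rho> (Var (a, i, j)) = \<rho> a $$ (i, j)" "rep_eval \<rho> (Const c) = c"
  unfolding rep_eval_def
  by (simp_all add: id_hom.eval_add id_hom.eval_mult id_hom.eval_diff id_hom.eval_sum id_hom.eval_zero
      id_hom.eval_one id_hom.eval_minus id_hom.eval_Var id_hom.eval_Const)

lemma rep_eval_relations:
  assumes "is_module (d, \<rho>)" "p \<in> mod_relations d"
  shows "rep_eval \<rho> p = 0"
proof -
  note M = module_carrier[OF assms(1), simplified] module_add[OF assms(1), simplified]
    module_scale[OF assms(1), simplified] module_mult[OF assms(1), simplified] module_one[OF assms(1), simplified]
  have "\<And>a. dim_row (\<rho> a) = d \<and> dim_col (\<rho> a) = d" using M(1) by auto
  then show ?thesis
    using assms(2) unfolding mod_relations_def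
    by (auto simp: rep_eval_simps M scalar_prod_def lessThan_atLeast0 if_distrib[of "rep_eval \<rho>"])
qed

text \<open>Irreducibility of \<open>U\<close> in the Zariski topology on the modules themselves:
  two nonempty basic open subsets of \<open>U\<close> meet.\<close>

definition irreducible_family :: "nat \<Rightarrow> ('a \<Rightarrow> 'k mat) set \<Rightarrow> bool" where
  "irreducible_family d U \<longleftrightarrow> U \<noteq> {} \<and> (\<forall>\<rho>\<in>U. is_module (d, \<rho>)) \<and>
     (\<forall>p\<in>mod_polys d. \<forall>q\<in>mod_polys d. \<forall>\<rho>\<in>U. \<forall>\<sigma>\<in>U. rep_eval \<rho> p \<noteq> 0 \<longrightarrow> rep_eval \<sigma> q \<noteq> 0 \<longrightarrow>
        (\<exists>\<tau>\<in>U. rep_eval \<tau> p \<noteq> 0 \<and> rep_eval \<tau> q \<noteq> 0))"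

text \<open>The ideal of functions that vanish on \<open>U\<close>, which is the generic point of
  the closure of \<open>U\<close>. For a single module it is the corresponding closed point.\<close>

definition generic_point :: "nat \<Rightarrow> ('a \<Rightarrow> 'k mat) set \<Rightarrow> ('a \<times> nat \<times> nat, 'k) mpoly set set" where
  "generic_point d U = mod_class d ` {p \<in> mod_polys d. \<forall>\<rho>\<in>U. rep_eval \<rho> p = 0}"

text \<open>Irreducibility of \<open>U\<close> is exactly primality of its vanishing ideal. The
  ideal contains the relations because the members of \<open>U\<close> are modules, so it descends
  to the coordinate ring.\<close>

lemma generic_point:
  assumes U: "irreducible_family d U"
  shows "generic_point d U \<in> Spec (mod_coordinate_ring d)"
    "p \<in> mod_polys d \<Longrightarrow> mod_class d p \<in> generic_point d U \<longleftrightarrow> (\<forall>\<rho>\<in>U. rep_eval \<rho> p = 0)"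
proof -
  let ?R = "poly_ring_in (mod_vars d) :: ('a \<times> nat \<times> nat, 'k) mpoly ring"
  let ?J = "{p \<in> mod_polys d. \<forall>\<rho>\<in>U. rep_eval \<rho> p = 0}"
  interpret R: cring ?R by (rule cring_poly_ring_in)
  have J: "primeideal ?J ?R"
  proof (rule primeidealI)
    show "ideal ?J ?R"
    proof (intro idealI R.ring_axioms subgroup.intro)
      fix x assume x: "x \<in> ?J"
      then have "inv\<^bsub>add_monoid ?R\<^esub> x = - x"
        using poly_ring_in_minus[of x] unfolding a_inv_def by simp
      then show "inv\<^bsub>add_monoid ?R\<^esub> x \<in> ?J"
        using x poly_ring_in_closed(3)[of x "mod_vars d" x] by (simp only:) (simp add: rep_eval_simps)
    qed (auto simp: rep_eval_simps poly_ring_in_ops poly_ring_in_closed poly_ring_in_consts)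
    obtain \<rho> where "\<rho> \<in> U" using U by (auto simp: irreducible_family_def)
    then have "1 \<notin> ?J" "1 \<in> mod_polys d" by (auto simp: rep_eval_simps poly_ring_in_consts)
    then show "carrier ?R \<noteq> ?J" by blast
    fix a b assume ab: "a \<in> carrier ?R" "b \<in> carrier ?R" "a \<otimes>\<^bsub>?R\<^esub> b \<in> ?J"
    show "a \<in> ?J \<or> b \<in> ?J"
    proof (rule ccontr)
      assume "\<not> (a \<in> ?J \<or> b \<in> ?J)"
      then obtain \<rho> \<sigma> where "\<rho> \<in> U" "\<sigma> \<in> U" "rep_eval \<rho> a \<noteq> 0" "rep_eval \<sigma> b \<noteq> 0" using ab by blast
      with U ab(1,2) obtain \<tau> where "\<tau> \<in> U" "rep_eval \<tau> a \<noteq> 0" "rep_eval \<tau> b \<noteq> 0"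
        unfolding irreducible_family_def by blast
      then show False using ab(3) by (auto simp: rep_eval_simps poly_ring_in_ops)
    qed
  qed (rule cring_poly_ring_in)
  have "mod_relations d \<subseteq> ?J"
    using mod_relations_subset rep_eval_relations U by (auto simp: irreducible_family_def)
  then have sub: "Idl\<^bsub>?R\<^esub> (mod_relations d) \<subseteq> ?J"
    by (rule R.genideal_minimal[OF primeideal.axioms(1)[OF J]])
  note im = R.Spec_quotient_image[OF mod_ideal J sub]
  show "generic_point d U \<in> Spec (mod_coordinate_ring d)"
    using im(1) unfolding generic_point_def mod_class_def[abs_def] mod_coordinate_ring_def .
  show "p \<in> mod_polys d \<Longrightarrow> mod_class d p \<in> generic_point d U \<longleftrightarrow> (\<forall>\<rho>\<in>U. rep_eval \<rho> p = 0)"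
    using im(2)[of p] unfolding generic_point_def mod_class_def[abs_def] by simp
qed

lemma generic_point_subset:
  assumes "irreducible_family d U" "Q \<in> Spec (mod_coordinate_ring d)"
    "\<And>p. \<lbrakk>p \<in> mod_polys d; \<forall>\<rho>\<in>U. rep_eval \<rho> p = 0\<rbrakk> \<Longrightarrow> mod_class d p \<in> Q"
  shows "generic_point d U \<subseteq> Q"
  using assms unfolding generic_point_def by auto

lemma irreducible_family_single: "is_module (d, \<rho>) \<Longrightarrow> irreducible_family d {\<rho>}"
  by (auto simp: irreducible_family_def)

definition basic_open :: "nat \<Rightarrow> ('a \<times> nat \<times> nat, 'k) mpoly \<Rightarrow> ('a \<times> nat \<times> nat, 'k) mpoly set set set" where
  "basic_open d p = {Q \<in> Spec (mod_coordinate_ring d). mod_class d p \<notin> Q}"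

lemma openin_basic_open:
  assumes "p \<in> mod_polys d"
  shows "openin (mod_space d) (basic_open d p)"
proof -
  have "mod_class d p \<in> carrier (mod_coordinate_ring d)"
    unfolding mod_class_def mod_coordinate_ring_def
    using ring_hom_closed[OF ideal.rcos_ring_hom[OF mod_ideal] assms] .
  then show ?thesis
    unfolding mod_space_def openin_zariski basic_open_def
    by (intro exI[of _ "{mod_class d p}"]) auto
qed

lemma basic_open_mem: "Q \<in> basic_open d p \<longleftrightarrow> Q \<in> Spec (mod_coordinate_ring d) \<and> mod_class d p \<notin> Q"
  by (simp add: basic_open_def)

lemma basic_open_mult:
  assumes "p \<in> mod_polys d" "q \<in> mod_polys d"
  shows "basic_open d (p * q) = basic_open d p \<inter> basic_open d q"
proof (intro equalityI subsetI)
  fix Q assume "Q \<in> basic_open d (p * q)"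
  then have Q: "Q \<in> Spec (mod_coordinate_ring d)" "mod_class d (p * q) \<notin> Q" by (auto simp: basic_open_mem)
  then have "mod_class d p \<notin> Q" "mod_class d q \<notin> Q"
    using Spec_mod(2)[OF Q(1) assms] Spec_mod(2)[OF Q(1) assms(2,1)] by (auto simp: mult.commute)
  then show "Q \<in> basic_open d p \<inter> basic_open d q" using Q by (simp add: basic_open_mem)
next
  fix Q assume "Q \<in> basic_open d p \<inter> basic_open d q"
  then show "Q \<in> basic_open d (p * q)" using Spec_mod(3)[OF _ assms, of Q] by (auto simp: basic_open_mem)
qed

lemma generic_point_basic_open:
  "\<lbrakk>irreducible_family d U; p \<in> mod_polys d\<rbrakk> \<Longrightarrow> generic_point d U \<in> basic_open d p \<longleftrightarrow> (\<exists>\<rho>\<in>U. rep_eval \<rho> p \<noteq> 0)"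
  by (simp add: basic_open_mem generic_point)

lemma generic_point_antimono:
  assumes "irreducible_family d U" "irreducible_family d V" "V \<subseteq> U"
  shows "generic_point d U \<subseteq> generic_point d V"
  using assms by (intro generic_point_subset generic_point) (auto simp: generic_point)

text \<open>Both points are specializations of the generic point of \<open>U\<close>, and the set of
  all its specializations is connected.\<close>

lemma connected_component_generic_points:
  assumes U: "irreducible_family d U" "\<rho> \<in> U" "\<sigma> \<in> U"
  shows "connected_component_of (mod_space d) (generic_point d {\<rho>}) (generic_point d {\<sigma>})"
proof -
  let ?W = "{Q \<in> Spec (mod_coordinate_ring d). generic_point d U \<subseteq> Q}"
  have irr: "irreducible_family d {\<rho>}" "irreducible_family d {\<sigma>}"
    using U by (auto intro!: irreducible_family_single simp: irreducible_family_def[of d U])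
  have "connectedin (mod_space d) ?W"
    unfolding mod_space_def using generic_point(1)[OF U(1)]
    by (intro irreducible_if_generic_point[of _ _ "generic_point d U"]) auto
  moreover have "generic_point d {\<rho>} \<in> ?W" "generic_point d {\<sigma>} \<in> ?W"
    using generic_point_antimono[OF U(1) irr(1)] generic_point_antimono[OF U(1) irr(2)]
      generic_point(1)[OF irr(1)] generic_point(1)[OF irr(2)] U by auto
  ultimately show ?thesis by (auto simp: connected_component_of_def)
qed

end

section \<open>Closed points and connected components\<close>

locale alg_closed_algebra = fin_dim_algebra scale
  for scale :: "'k::alg_closed_field \<Rightarrow> 'a::{ring, monoid_mult} \<Rightarrow> 'a"
begin

text \<open>The Nullstellensatz for the domain defined by \<open>Q\<close>, with nonzero element
  \<open>p\<close>. The domain is finitely generated although there is a variable for every element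
  of the algebra: modulo the relations the entries are linear in that element, so the variables of a
  basis suffice.\<close>

lemma closed_point_exists:
  assumes Q: "Q \<in> basic_open d p" and p: "p \<in> mod_polys d"
  obtains \<rho> where "is_module (d, \<rho>)" "rep_eval \<rho> p \<noteq> 0"
    "\<And>q. \<lbrakk>q \<in> mod_polys d; mod_class d q \<in> Q\<rbrakk> \<Longrightarrow> rep_eval \<rho> q = 0"
proof -
  let ?V = "mod_vars d :: ('a \<times> nat \<times> nat) set"
  \<comment> \<open>The polynomial type has variables outside \<open>mod_vars d\<close> as well.
    Substituting zero for them pulls \<open>Q\<close> back to a prime ideal \<open>Q'\<close> of the
    whole ring.\<close>
  define R :: "('a \<times> nat \<times> nat, 'k) mpoly \<Rightarrow> _" where
    "R = mpoly_eval Const (\<lambda>x. if x \<in> ?V then Var x else 0)"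
  have RC: "R q \<in> mod_polys d" for q
    unfolding R_def by (intro poly_ring_in_eval) (auto intro: Var_mem poly_ring_in_consts)
  have RR: "R q = q" if "q \<in> mod_polys d" for q
  proof -
    have "R q = mpoly_eval Const Var q"
      unfolding R_def using that by (intro Const_hom.eval_cong) (auto simp: poly_ring_in_def)
    then show ?thesis by (simp add: mpoly_eval_Var)
  qed
  note Rops = Const_hom.eval_add Const_hom.eval_mult Const_hom.eval_one Const_hom.eval_zero
  have QS: "Q \<in> Spec (mod_coordinate_ring d)" and pQ: "mod_class d p \<notin> Q" using Q by (auto simp: basic_open_mem)
  define Q' where "Q' = {q. mod_class d (R q) \<in> Q}"
  let ?X = "(\<lambda>(a, i, j). Var (a, i, j) :: ('a \<times> nat \<times> nat, 'k) mpoly) ` (set basis \<times> {..<d} \<times> {..<d})"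
  have relQ: "r \<in> Q'" if "r \<in> mod_relations d" for r
    using Spec_mod(6)[OF QS that] RR[of r] subsetD[OF mod_relations_subset that] by (simp add: Q'_def)
  have gen: "B = UNIV" if B: "range Const \<subseteq> B" "Q' \<subseteq> B" "?X \<subseteq> B"
    "\<And>a b. \<lbrakk>a \<in> B; b \<in> B\<rbrakk> \<Longrightarrow> a + b \<in> B" "\<And>a b. \<lbrakk>a \<in> B; b \<in> B\<rbrakk> \<Longrightarrow> a * b \<in> B" for B
  proof -
    have "Var (a, i, j) \<in> B" if ij: "i < d" "j < d" for a i j
    proof -
      let ?S = "{a. Var (a, i, j) \<in> B}"
      have "subspace ?S"
      proof (rule subspaceI)
        have "Var (scale 0 0, i, j) - Const 0 * Var (0, i, j) \<in> mod_relations d"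
          using ij unfolding mod_relations_def by blast
        then have "Var (0, i, j) \<in> Q'" using relQ by (simp add: Const_def)
        then show "0 \<in> ?S" using B(2) by blast
      next
        fix a b assume ab: "a \<in> ?S" "b \<in> ?S"
        have "Var (a + b, i, j) - (Var (a, i, j) + Var (b, i, j)) \<in> mod_relations d"
          using ij unfolding mod_relations_def by blast
        then have "Var (a + b, i, j) - (Var (a, i, j) + Var (b, i, j)) \<in> B" using relQ B(2) by blast
        moreover have "Var (a, i, j) + Var (b, i, j) \<in> B" using ab by (intro B(4)) simp_all
        ultimately have "Var (a + b, i, j) - (Var (a, i, j) + Var (b, i, j)) + (Var (a, i, j) + Var (b, i, j)) \<in> B"
          by (rule B(4))
        then show "a + b \<in> ?S" by simp
      next
        fix c a assume a: "a \<in> ?S"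
        have "Var (scale c a, i, j) - Const c * Var (a, i, j) \<in> mod_relations d"
          using ij unfolding mod_relations_def by blast
        then have "Var (scale c a, i, j) - Const c * Var (a, i, j) \<in> B" using relQ B(2) by blast
        moreover have "Const c \<in> B" using B(1) by blast
        ultimately have "Var (scale c a, i, j) - Const c * Var (a, i, j) + Const c * Var (a, i, j) \<in> B"
          using a by (intro B(4,5)) simp_all
        then show "scale c a \<in> ?S" by simp
      qed
      moreover have "set basis \<subseteq> ?S" using B(3) ij by auto
      ultimately have "span (set basis) \<subseteq> ?S" by (intro span_minimal)
      then show ?thesis using basis(3) by auto
    qed
    moreover have "Var x \<in> B" if "x \<notin> ?V" for x
    proof -
      have "R (Var x) = 0" using that by (simp add: R_def Const_hom.eval_Var)
      then show ?thesis using Spec_mod(4)[OF QS] B(2) by (auto simp: Q'_def)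
    qed
    ultimately have "Var x \<in> B" for x by (cases "x \<in> ?V") (auto simp: mod_vars_def)
    then have "range Var \<subseteq> B" by blast
    then show ?thesis using subring_Const_Var[OF B(1) _ B(4,5)] by blast
  qed
  obtain \<phi> :: "('a \<times> nat \<times> nat, 'k) mpoly \<Rightarrow> 'k" where
    \<phi>: "\<And>a b. \<phi> (a + b) = \<phi> a + \<phi> b" "\<And>a b. \<phi> (a * b) = \<phi> a * \<phi> b"
    "\<And>c. \<phi> (Const c) = c" "\<And>q. q \<in> Q' \<Longrightarrow> \<phi> q = 0" "\<phi> p \<noteq> 0"
  proof (rule weak_nullstellensatz[of Const Q' ?X p])
    show "finite ?X" by simp
    show "B = UNIV" if "range Const \<subseteq> B" "Q' \<subseteq> B" "?X \<subseteq> B"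
      "\<And>a b. \<lbrakk>a \<in> B; b \<in> B\<rbrakk> \<Longrightarrow> a + b \<in> B" "\<And>a b. \<lbrakk>a \<in> B; b \<in> B\<rbrakk> \<Longrightarrow> a * b \<in> B" for B
      using that by (rule gen)
    show "p \<notin> Q'" using pQ RR[OF p] by (simp add: Q'_def)
    show "0 \<in> Q'" using Spec_mod(4)[OF QS] by (simp add: Q'_def R_def Rops)
    show "1 \<notin> Q'" using Spec_mod(5)[OF QS] by (simp add: Q'_def R_def Rops)
    fix a b
    show "a + b \<in> Q'" if "a \<in> Q'" "b \<in> Q'"
      using that Spec_mod(1)[OF QS RC RC] unfolding Q'_def R_def by (simp add: Rops)
    show "a * b \<in> Q' \<Longrightarrow> a \<in> Q' \<or> b \<in> Q'"
      using Spec_mod(3)[OF QS RC RC] unfolding Q'_def R_def by (simp add: Rops)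
  next
    fix a r assume "a \<in> Q'"
    then show "r * a \<in> Q'" using Spec_mod(2)[OF QS RC RC] unfolding Q'_def R_def by (simp add: Rops)
  qed (auto simp: Const_hom.\<iota>_add Const_hom.\<iota>_mult Const_hom.\<iota>_one)
  define \<rho> where "\<rho> a = mat d d (\<lambda>(i, j). \<phi> (Var (a, i, j)))" for a
  have ev: "rep_eval \<rho> q = \<phi> q" if "q \<in> mod_polys d" for q
  proof -
    have "rep_eval \<rho> q = mpoly_eval (\<lambda>c. c) (\<lambda>x. \<phi> (Var x)) q"
      unfolding rep_eval_def
    proof (rule id_hom.eval_cong)
      fix m x assume "m \<in> Poly_Mapping.keys q" "x \<in> Poly_Mapping.keys m"
      then have "x \<in> ?V" using that by (auto simp: poly_ring_in_def)
      then show "(case x of (a, i, j) \<Rightarrow> \<rho> a $$ (i, j)) = \<phi> (Var x)"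
        by (cases x) (simp add: mod_vars_def \<rho>_def)
    qed
    then show ?thesis using ring_hom_eq_mpoly_eval[OF \<phi>(1-3), of q] by simp
  qed
  have rel: "rep_eval \<rho> r = 0" if "r \<in> mod_relations d" for r
    using ev[of r] \<phi>(4)[OF relQ[OF that]] mod_relations_subset that by auto
  have "is_module (d, \<rho>)"
  proof (rule is_moduleI)
    show "\<rho> a \<in> carrier_mat d d" for a by (simp add: \<rho>_def)
    show "\<rho> (a + b) = \<rho> a + \<rho> b" for a b
    proof (rule eq_matI)
      fix i j assume "i < dim_row (\<rho> a + \<rho> b)" "j < dim_col (\<rho> a + \<rho> b)"
      then have ij: "i < d" "j < d" by (auto simp: \<rho>_def)
      then have "Var (a + b, i, j) - (Var (a, i, j) + Var (b, i, j)) \<in> mod_relations d"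
        unfolding mod_relations_def by blast
      from rel[OF this] show "\<rho> (a + b) $$ (i, j) = (\<rho> a + \<rho> b) $$ (i, j)"
        using ij by (simp add: rep_eval_simps) (simp add: \<rho>_def)
    qed (auto simp: \<rho>_def)
    show "\<rho> (scale c a) = c \<cdot>\<^sub>m \<rho> a" for c a
    proof (rule eq_matI)
      fix i j assume "i < dim_row (c \<cdot>\<^sub>m \<rho> a)" "j < dim_col (c \<cdot>\<^sub>m \<rho> a)"
      then have ij: "i < d" "j < d" by (auto simp: \<rho>_def)
      then have "Var (scale c a, i, j) - Const c * Var (a, i, j) \<in> mod_relations d"
        unfolding mod_relations_def by blast
      from rel[OF this] show "\<rho> (scale c a) $$ (i, j) = (c \<cdot>\<^sub>m \<rho> a) $$ (i, j)"
        using ij by (simp add: rep_eval_simps) (simp add: \<rho>_def)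
    qed (auto simp: \<rho>_def)
    show "\<rho> (a * b) = \<rho> a * \<rho> b" for a b
    proof (rule eq_matI)
      fix i j assume "i < dim_row (\<rho> a * \<rho> b)" "j < dim_col (\<rho> a * \<rho> b)"
      then have ij: "i < d" "j < d" by (auto simp: \<rho>_def)
      then have "Var (a * b, i, j) - (\<Sum>l<d. Var (a, i, l) * Var (b, l, j)) \<in> mod_relations d"
        unfolding mod_relations_def by blast
      from rel[OF this] have "\<rho> (a * b) $$ (i, j) = (\<Sum>l<d. \<rho> a $$ (i, l) * \<rho> b $$ (l, j))"
        by (simp add: rep_eval_simps)
      also have "\<dots> = (\<rho> a * \<rho> b) $$ (i, j)"
        using ij by (simp add: \<rho>_def scalar_prod_def lessThan_atLeast0)
      finally show "\<rho> (a * b) $$ (i, j) = (\<rho> a * \<rho> b) $$ (i, j)" .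
    qed (auto simp: \<rho>_def)
    show "\<rho> 1 = 1\<^sub>m d"
    proof (rule eq_matI)
      fix i j assume "i < dim_row (1\<^sub>m d :: 'k mat)" "j < dim_col (1\<^sub>m d :: 'k mat)"
      then have ij: "i < d" "j < d" by auto
      then have "Var (1, i, j) - (if i = j then 1 else 0) \<in> mod_relations d"
        unfolding mod_relations_def by blast
      from rel[OF this] show "\<rho> 1 $$ (i, j) = 1\<^sub>m d $$ (i, j)"
        using ij by (auto simp: rep_eval_simps if_distrib[of "rep_eval \<rho>"])
    qed (auto simp: \<rho>_def)
  qed
  moreover have "rep_eval \<rho> q = 0" if "q \<in> mod_polys d" "mod_class d q \<in> Q" for q
    using ev[OF that(1)] \<phi>(4)[of q] that RR by (simp add: Q'_def)
  ultimately show ?thesis using that[of \<rho>] ev[OF p] \<phi>(5) by simp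
qed

text \<open>Each class \<open>U\<close> of closed points spreads out to the open set of all points with a
  specialization in \<open>U\<close>; these open sets partition the spectrum, hence are also closed.\<close>

lemma components_irreducible:
  assumes cover: "\<And>\<rho>. is_module (d, \<rho>) \<Longrightarrow> \<exists>U\<in>\<U>. \<rho> \<in> U"
    and disjoint: "\<And>U V. \<lbrakk>U \<in> \<U>; V \<in> \<U>; U \<inter> V \<noteq> {}\<rbrakk> \<Longrightarrow> U = V"
    and irr: "\<And>U. U \<in> \<U> \<Longrightarrow> irreducible_family d U"
    and op: "\<And>U \<rho>. \<lbrakk>U \<in> \<U>; \<rho> \<in> U\<rbrakk> \<Longrightarrow> \<exists>g\<in>mod_polys d. rep_eval \<rho> g \<noteq> 0 \<and>
      (\<forall>\<sigma>. is_module (d, \<sigma>) \<longrightarrow> rep_eval \<sigma> g \<noteq> 0 \<longrightarrow> \<sigma> \<in> U)"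
    and Z: "Z \<in> connected_components_of (mod_space d)"
  shows "irreducible_space (subtopology (mod_space d) Z)"
proof -
  let ?X = "mod_space d"
  let ?S = "Spec (mod_coordinate_ring d)"
  have top: "topspace ?X = ?S" by (simp add: mod_space_def)
  \<comment> \<open>\<open>G U\<close> consists of the polynomials whose nonvanishing locus among
    the modules lies in \<open>U\<close>. For a member \<open>U\<close> of the partition,
    \<open>W U\<close> is then the open subset of the spectrum whose closed points are the modules
    in \<open>U\<close>.\<close>
  define G where "G U = {g \<in> mod_polys d. \<forall>\<sigma>. is_module (d, \<sigma>) \<longrightarrow> rep_eval \<sigma> g \<noteq> 0 \<longrightarrow> \<sigma> \<in> U}" for U
  define W where "W U = (\<Union>g\<in>G U. basic_open d g)" for U
  have Wopen: "openin ?X (W U)" for U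
    unfolding W_def by (intro openin_Union) (auto simp: G_def openin_basic_open)
  have Wcover: "\<exists>U\<in>\<U>. Q \<in> W U" if Q: "Q \<in> ?S" for Q
  proof -
    have "Q \<in> basic_open d 1" using Q Spec_mod(5) by (simp add: basic_open_mem)
    from closed_point_exists[OF this poly_ring_in_consts(2)] obtain \<rho> where
      \<rho>: "is_module (d, \<rho>)" "\<And>q. \<lbrakk>q \<in> mod_polys d; mod_class d q \<in> Q\<rbrakk> \<Longrightarrow> rep_eval \<rho> q = 0" by blast
    obtain U where U: "U \<in> \<U>" "\<rho> \<in> U" using cover[OF \<rho>(1)] by blast
    then obtain g where "g \<in> G U" "rep_eval \<rho> g \<noteq> 0" using op[OF U] by (auto simp: G_def)
    then have "Q \<in> W U" using Q \<rho>(2)[of g] by (auto simp: W_def G_def basic_open_mem)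
    with U show ?thesis by blast
  qed
  have Wdisj: "U = V" if UV: "U \<in> \<U>" "V \<in> \<U>" and Q: "Q \<in> W U" "Q \<in> W V" for U V Q
  proof -
    from Q obtain g h where gh: "g \<in> G U" "h \<in> G V" "Q \<in> basic_open d g" "Q \<in> basic_open d h"
      by (auto simp: W_def)
    then have mem: "g \<in> mod_polys d" "h \<in> mod_polys d" by (auto simp: G_def)
    then have "Q \<in> basic_open d (g * h)" using gh by (simp add: basic_open_mult)
    from closed_point_exists[OF this poly_ring_in_closed(2)[OF mem]] obtain \<rho> where
      "is_module (d, \<rho>)" "rep_eval \<rho> (g * h) \<noteq> 0" by blast
    then have "\<rho> \<in> U \<inter> V" using gh by (auto simp: G_def rep_eval_simps)
    then show ?thesis using disjoint[OF UV] by blast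
  qed
  have Wsub: "W U \<subseteq> ?S" for U by (auto simp: W_def basic_open_mem)
  have Wclosed: "closedin ?X (W U)" if U: "U \<in> \<U>" for U
  proof -
    have "?S - W U = \<Union> (W ` (\<U> - {U}))"
    proof (intro equalityI subsetI)
      fix P assume P: "P \<in> ?S - W U"
      then obtain V where "V \<in> \<U>" "P \<in> W V" using Wcover[of P] by blast
      moreover from this P have "V \<noteq> U" by blast
      ultimately show "P \<in> \<Union> (W ` (\<U> - {U}))" by blast
    next
      fix P assume "P \<in> \<Union> (W ` (\<U> - {U}))"
      then obtain V where V: "V \<in> \<U>" "V \<noteq> U" "P \<in> W V" by blast
      then have "P \<notin> W U" using Wdisj[OF V(1) U V(3)] by blast
      then show "P \<in> ?S - W U" using Wsub V(3) by blast
    qed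
    then have "openin ?X (?S - W U)" using Wopen by (metis (no_types, lifting) imageE openin_Union)
    then show ?thesis using Wsub[of U] unfolding closedin_def top by simp
  qed
  from Z obtain Q where Q: "Q \<in> ?S" "Z = connected_component_of_set ?X Q"
    unfolding connected_components_of_def top by auto
  obtain U where U: "U \<in> \<U>" "Q \<in> W U" using Wcover[OF Q(1)] by blast
  note U_irr = irr[OF U(1)]
  let ?\<eta> = "generic_point d U"
  obtain \<rho> where \<rho>: "\<rho> \<in> U" using U_irr by (auto simp: irreducible_family_def)
  obtain g where g: "g \<in> mod_polys d" "rep_eval \<rho> g \<noteq> 0" "g \<in> G U"
    using op[OF U(1) \<rho>] unfolding G_def by blast
  have "?\<eta> \<in> basic_open d g"
    using generic_point_basic_open[OF U_irr g(1)] \<rho> g(2) by blast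
  then have \<eta>W: "?\<eta> \<in> W U" unfolding W_def using g(3) by blast
  \<comment> \<open>If \<open>p\<close> vanished on \<open>U\<close> but not at \<open>P\<close>,
    then \<open>P\<close> would have a closed specialization with \<open>p\<close> and
    \<open>g\<close> both nonzero; this is a module in \<open>U\<close> on which \<open>p\<close>
    does not vanish.\<close>
  have \<eta>sub: "?\<eta> \<subseteq> P" if P: "P \<in> W U" for P
  proof (rule generic_point_subset[OF U_irr])
    show PS: "P \<in> ?S" using P Wsub by blast
    fix p assume p: "p \<in> mod_polys d" "\<forall>\<rho>\<in>U. rep_eval \<rho> p = 0"
    show "mod_class d p \<in> P"
    proof (rule ccontr)
      assume np: "mod_class d p \<notin> P"
      obtain g where g: "g \<in> G U" "P \<in> basic_open d g" using P by (auto simp: W_def)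
      then have mem: "g \<in> mod_polys d" by (simp add: G_def)
      then have "P \<in> basic_open d (p * g)"
        using np g PS p by (simp add: basic_open_mult basic_open_mem)
      from closed_point_exists[OF this poly_ring_in_closed(2)[OF p(1) mem]] obtain \<sigma> where
        "is_module (d, \<sigma>)" "rep_eval \<sigma> (p * g) \<noteq> 0" by blast
      then show False using g p by (auto simp: G_def rep_eval_simps)
    qed
  qed
  note gen = irreducible_if_generic_point[OF Wsub \<eta>W \<eta>sub, folded mod_space_def]
  have "Z = W U"
  proof
    have "connectedin ?X Z" unfolding Q(2) by (rule connectedin_connected_component_of)
    then have "Z \<subseteq> W U \<or> disjnt Z (W U)"
      by (rule connectedin_clopen_cases[OF _ Wclosed[OF U(1)] Wopen])
    moreover have "Q \<in> Z" unfolding Q(2) using Q(1) top by (simp add: connected_component_of_refl)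
    ultimately show "Z \<subseteq> W U" using U by (auto simp: disjnt_def)
    show "W U \<subseteq> Z" unfolding Q(2) by (rule connected_component_of_maximal[OF gen(1) U(2)])
  qed
  then show ?thesis using gen(2) by simp
qed

end

section \<open>Algebras of functions\<close>

text \<open>Polynomial or rational dependence is treated by membership in an algebra of functions,
  which passes from the entries of a matrix to products, determinants and adjugates. By
  \<open>cong\<close> only the values on \<open>X\<close> matter, since matrices have the required
  format only there.\<close>

locale function_algebra =
  fixes X :: "'x set" and \<A> :: "('x \<Rightarrow> 'k::comm_ring_1) set"
  assumes const: "(\<lambda>_. c) \<in> \<A>"
    and add: "\<lbrakk>f \<in> \<A>; g \<in> \<A>\<rbrakk> \<Longrightarrow> (\<lambda>x. f x + g x) \<in> \<A>"
    and mult: "\<lbrakk>f \<in> \<A>; g \<in> \<A>\<rbrakk> \<Longrightarrow> (\<lambda>x. f x * g x) \<in> \<A>"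
    and cong: "\<lbrakk>f \<in> \<A>; \<And>x. x \<in> X \<Longrightarrow> f x = g x\<rbrakk> \<Longrightarrow> g \<in> \<A>"
begin

lemma diff: "\<lbrakk>f \<in> \<A>; g \<in> \<A>\<rbrakk> \<Longrightarrow> (\<lambda>x. f x - g x) \<in> \<A>"
  using add[of f "\<lambda>x. -1 * g x"] mult[of "\<lambda>_. -1" g] const[of "-1"] by simp

lemma sum: "(\<And>i. i \<in> I \<Longrightarrow> f i \<in> \<A>) \<Longrightarrow> (\<lambda>x. \<Sum>i\<in>I. f i x) \<in> \<A>"
  by (induction I rule: infinite_finite_induct) (simp_all add: const add)

lemma prod: "(\<And>i. i \<in> I \<Longrightarrow> f i \<in> \<A>) \<Longrightarrow> (\<lambda>x. \<Prod>i\<in>I. f i x) \<in> \<A>"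
  by (induction I rule: infinite_finite_induct) (simp_all add: const mult)

lemma power: "f \<in> \<A> \<Longrightarrow> (\<lambda>x. f x ^ n) \<in> \<A>"
  by (induction n) (simp_all add: const mult)

definition mat_fun :: "nat \<Rightarrow> nat \<Rightarrow> ('x \<Rightarrow> 'k mat) \<Rightarrow> bool" where
  "mat_fun n m M \<longleftrightarrow> (\<forall>x\<in>X. M x \<in> carrier_mat n m) \<and> (\<forall>i<n. \<forall>j<m. (\<lambda>x. M x $$ (i, j)) \<in> \<A>)"

lemma mat_fun_carrier: "\<lbrakk>mat_fun n m M; x \<in> X\<rbrakk> \<Longrightarrow> M x \<in> carrier_mat n m"
  and mat_fun_entry: "\<lbrakk>mat_fun n m M; i < n; j < m\<rbrakk> \<Longrightarrow> (\<lambda>x. M x $$ (i, j)) \<in> \<A>"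
  by (auto simp: mat_fun_def)

lemma mat_fun_dim: "\<lbrakk>mat_fun n m M; x \<in> X\<rbrakk> \<Longrightarrow> dim_row (M x) = n" "\<lbrakk>mat_fun n m M; x \<in> X\<rbrakk> \<Longrightarrow> dim_col (M x) = m"
  by (auto simp: mat_fun_def)

lemma mat_funI:
  assumes "\<And>x. x \<in> X \<Longrightarrow> M x \<in> carrier_mat n m"
    "\<And>i j. \<lbrakk>i < n; j < m\<rbrakk> \<Longrightarrow> (\<lambda>x. M x $$ (i, j)) \<in> \<A>"
  shows "mat_fun n m M"
  using assms by (simp add: mat_fun_def)

lemma mat_fun_const: "M \<in> carrier_mat n m \<Longrightarrow> mat_fun n m (\<lambda>_. M)"
  by (simp add: mat_fun_def const)

lemma mat_fun_mult:
  assumes M: "mat_fun n k M" and N: "mat_fun k m N"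
  shows "mat_fun n m (\<lambda>x. M x * N x)"
proof (rule mat_funI)
  fix i j assume ij: "i < n" "j < m"
  have "(\<lambda>x. \<Sum>l = 0..<k. M x $$ (i, l) * N x $$ (l, j)) \<in> \<A>"
    using ij by (intro sum mult mat_fun_entry[OF M] mat_fun_entry[OF N]) auto
  then show "(\<lambda>x. (M x * N x) $$ (i, j)) \<in> \<A>"
  proof (rule cong)
    fix x assume "x \<in> X"
    then have "M x \<in> carrier_mat n k" "N x \<in> carrier_mat k m"
      using mat_fun_carrier M N by auto
    then show "(\<Sum>l = 0..<k. M x $$ (i, l) * N x $$ (l, j)) = (M x * N x) $$ (i, j)"
      using ij by (simp add: scalar_prod_def)
  qed
qed (use mat_fun_dim[OF M] mat_fun_dim[OF N] in \<open>auto intro!: carrier_matI\<close>)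

lemma mat_fun_add:
  assumes M: "mat_fun n m M" and N: "mat_fun n m N"
  shows "mat_fun n m (\<lambda>x. M x + N x)"
proof (rule mat_funI)
  fix i j assume ij: "i < n" "j < m"
  show "(\<lambda>x. (M x + N x) $$ (i, j)) \<in> \<A>"
    by (rule cong[OF add[OF mat_fun_entry[OF M ij] mat_fun_entry[OF N ij]]])
      (use mat_fun_dim[OF M] mat_fun_dim[OF N] ij in auto)
qed (use mat_fun_dim[OF M] mat_fun_dim[OF N] in \<open>auto intro!: carrier_matI\<close>)

lemma mat_fun_minus:
  assumes M: "mat_fun n m M" and N: "mat_fun n m N"
  shows "mat_fun n m (\<lambda>x. M x - N x)"
proof (rule mat_funI)
  fix i j assume ij: "i < n" "j < m"
  show "(\<lambda>x. (M x - N x) $$ (i, j)) \<in> \<A>"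
    by (rule cong[OF diff[OF mat_fun_entry[OF M ij] mat_fun_entry[OF N ij]]])
      (use mat_fun_dim[OF M] mat_fun_dim[OF N] ij in auto)
qed (use mat_fun_dim[OF M] mat_fun_dim[OF N] in \<open>auto intro!: carrier_matI\<close>)

lemma mat_fun_smult:
  assumes f: "f \<in> \<A>" and M: "mat_fun n m M"
  shows "mat_fun n m (\<lambda>x. f x \<cdot>\<^sub>m M x)"
proof (rule mat_funI)
  fix i j assume ij: "i < n" "j < m"
  show "(\<lambda>x. (f x \<cdot>\<^sub>m M x) $$ (i, j)) \<in> \<A>"
    by (rule cong[OF mult[OF f mat_fun_entry[OF M ij]]]) (use mat_fun_dim[OF M] ij in auto)
qed (use mat_fun_dim[OF M] in \<open>auto intro!: carrier_matI\<close>)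

lemma det_fun:
  assumes M: "mat_fun n n M"
  shows "(\<lambda>x. det (M x)) \<in> \<A>"
proof -
  have "(\<lambda>x. \<Sum>p | p permutes {0..<n}. signof p * (\<Prod>i = 0..<n. M x $$ (i, p i))) \<in> \<A>"
    using permutes_in_image
    by (intro sum mult const prod mat_fun_entry[OF M]) fastforce+
  then show ?thesis
    by (rule cong) (use mat_fun_dim[OF M] in \<open>auto simp: det_def\<close>)
qed

lemma adj_fun:
  assumes M: "mat_fun n n M"
  shows "mat_fun n n (\<lambda>x. adj_mat (M x))"
proof (rule mat_funI)
  fix i j assume ij: "i < n" "j < n"
  have "mat_fun (n - 1) (n - 1) (\<lambda>x. mat_delete (M x) j i)"
  proof (rule mat_funI)
    fix k l assume kl: "k < n - 1" "l < n - 1"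
    have "(\<lambda>x. M x $$ (if k < j then k else Suc k, if l < i then l else Suc l)) \<in> \<A>"
      using kl by (intro mat_fun_entry[OF M]) auto
    then show "(\<lambda>x. mat_delete (M x) j i $$ (k, l)) \<in> \<A>"
      by (rule cong) (use mat_fun_dim[OF M] kl in \<open>auto simp: mat_delete_def\<close>)
  qed (use mat_fun_dim[OF M] in \<open>auto intro!: carrier_matI simp: mat_delete_def\<close>)
  then have "(\<lambda>x. cofactor (M x) j i) \<in> \<A>"
    unfolding cofactor_def using det_fun by (intro mult const)
  then show "(\<lambda>x. adj_mat (M x) $$ (i, j)) \<in> \<A>"
    by (rule cong) (use mat_fun_dim[OF M] ij in \<open>auto simp: adj_mat_def\<close>)
qed (use mat_fun_dim[OF M] in \<open>auto simp: adj_mat_def\<close>)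

end

lemma polynomial_functions: "function_algebra UNIV {f :: 'k::comm_ring_1 \<Rightarrow> 'k. \<exists>u. \<forall>t. f t = poly u t}"
proof
  fix c :: 'k
  show "(\<lambda>_. c) \<in> {f. \<exists>u. \<forall>t. f t = poly u t}"
    by (auto intro!: exI[of _ "[:c:]"])
next
  fix f g :: "'k \<Rightarrow> 'k"
  assume "f \<in> {f. \<exists>u. \<forall>t. f t = poly u t}" "g \<in> {f. \<exists>u. \<forall>t. f t = poly u t}"
  then obtain u v where "\<And>t. f t = poly u t" "\<And>t. g t = poly v t" by auto
  then show "(\<lambda>t. f t + g t) \<in> {f. \<exists>u. \<forall>t. f t = poly u t}" "(\<lambda>t. f t * g t) \<in> {f. \<exists>u. \<forall>t. f t = poly u t}"
    by (auto intro: exI[of _ "u + v"] exI[of _ "u * v"])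
qed auto

text \<open>Fractions whose denominator is a power of \<open>q\<close>, in cleared form. Two such
  functions are brought to the common denominator with exponent \<open>N + N'\<close>.\<close>

lemma rational_functions:
  fixes q :: "'k::comm_ring_1 \<Rightarrow> 'k" and w :: "'k poly"
  assumes q: "\<And>t. q t = poly w t"
  shows "function_algebra {t. q t \<noteq> 0} {f. \<exists>N u. \<forall>t. q t \<noteq> 0 \<longrightarrow> f t * q t ^ N = poly u t}" (is "function_algebra _ ?A")
proof
  fix c :: 'k
  show "(\<lambda>_. c) \<in> ?A" by (auto intro!: exI[of _ 0] exI[of _ "[:c:]"])
next
  fix f g :: "'k \<Rightarrow> 'k"
  assume "f \<in> ?A" "g \<in> ?A"
  then obtain N u N' v where f: "\<And>t. q t \<noteq> 0 \<Longrightarrow> f t * q t ^ N = poly u t"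
    and g: "\<And>t. q t \<noteq> 0 \<Longrightarrow> g t * q t ^ N' = poly v t" by blast
  have "(f t + g t) * q t ^ (N + N') = poly (u * w ^ N' + v * w ^ N) t" if "q t \<noteq> 0" for t
    by (simp add: q[symmetric] f[OF that, symmetric] g[OF that, symmetric] power_add algebra_simps)
  then show "(\<lambda>t. f t + g t) \<in> ?A" by blast
  have "(f t * g t) * q t ^ (N + N') = poly (u * v) t" if "q t \<noteq> 0" for t
    by (simp add: f[OF that, symmetric] g[OF that, symmetric] power_add algebra_simps)
  then show "(\<lambda>t. f t * g t) \<in> ?A" by blast
qed auto

lemma eval_fun:
  assumes "function_algebra X \<A>" and s: "\<And>m v. \<lbrakk>m \<in> Poly_Mapping.keys p; v \<in> Poly_Mapping.keys m\<rbrakk> \<Longrightarrow> (\<lambda>x. s x v) \<in> \<A>"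
  shows "(\<lambda>x. mpoly_eval (\<lambda>c. c) (s x) p) \<in> \<A>"
proof -
  interpret function_algebra X \<A> by (rule assms(1))
  show ?thesis
    unfolding mpoly_eval_def monom_eval_def using s by (intro sum mult const prod power)
qed

lemma mat_minus_self: "\<lbrakk>dim_row A = n; dim_col A = m\<rbrakk> \<Longrightarrow> A - A = (0\<^sub>m n m :: 'k::ring_1 mat)"
  and mat_minus_zero: "\<lbrakk>dim_row A = n; dim_col A = m\<rbrakk> \<Longrightarrow> A - 0\<^sub>m n m = (A :: 'k::ring_1 mat)"
  and mat_add_zero: "\<lbrakk>dim_row A = n; dim_col A = m\<rbrakk> \<Longrightarrow> A + 0\<^sub>m n m = (A :: 'k::ring_1 mat)"
  and mat_zero_add: "\<lbrakk>dim_row A = n; dim_col A = m\<rbrakk> \<Longrightarrow> 0\<^sub>m n m + A = (A :: 'k::ring_1 mat)"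
  and mat_minus_add: "\<lbrakk>dim_row A = dim_row B; dim_col A = dim_col B\<rbrakk> \<Longrightarrow> A - B + B = (A :: 'k::ring_1 mat)"
  by (auto intro!: eq_matI)

lemmas mat_group = mat_minus_self mat_minus_zero mat_add_zero mat_zero_add mat_minus_add

section \<open>Functions polynomial in the entries of a module\<close>

context fin_dim_algebra
begin

lemma rep_functions: "function_algebra {\<rho>. is_module (d, \<rho>)}
    {F. \<exists>p\<in>mod_polys d. \<forall>\<rho>. is_module (d, \<rho>) \<longrightarrow> F \<rho> = rep_eval \<rho> p}" (is "function_algebra _ ?A")
proof
  fix c show "(\<lambda>_. c) \<in> ?A" by (auto intro!: bexI[of _ "Const c"] simp: rep_eval_simps Const_mem)
next
  fix F G assume "F \<in> ?A" "G \<in> ?A"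
  then obtain p q where "p \<in> mod_polys d" "q \<in> mod_polys d" "\<And>\<rho>. is_module (d, \<rho>) \<Longrightarrow> F \<rho> = rep_eval \<rho> p"
    "\<And>\<rho>. is_module (d, \<rho>) \<Longrightarrow> G \<rho> = rep_eval \<rho> q" by blast
  then have "p + q \<in> mod_polys d" "\<And>\<rho>. is_module (d, \<rho>) \<Longrightarrow> F \<rho> + G \<rho> = rep_eval \<rho> (p + q)"
    "p * q \<in> mod_polys d" "\<And>\<rho>. is_module (d, \<rho>) \<Longrightarrow> F \<rho> * G \<rho> = rep_eval \<rho> (p * q)"
    by (simp_all add: rep_eval_simps poly_ring_in_closed)
  then show "(\<lambda>\<rho>. F \<rho> + G \<rho>) \<in> ?A" "(\<lambda>\<rho>. F \<rho> * G \<rho>) \<in> ?A"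
    by blast+
qed auto

sublocale rf: function_algebra "{\<rho>. is_module (d, \<rho>)}"
    "{F. \<exists>p\<in>mod_polys d. \<forall>\<rho>. is_module (d, \<rho>) \<longrightarrow> F \<rho> = rep_eval \<rho> p}" for d
  by (rule rep_functions)

lemma rep_mat_fun: "rf.mat_fun d d d (\<lambda>\<rho>. \<rho> a)"
proof (rule rf.mat_funI)
  fix i j assume "i < d" "j < d"
  then show "(\<lambda>\<rho>. \<rho> a $$ (i, j)) \<in> {F. \<exists>p\<in>mod_polys d. \<forall>\<rho>. is_module (d, \<rho>) \<longrightarrow> F \<rho> = rep_eval \<rho> p}"
    by (auto intro!: bexI[of _ "Var (a, i, j)"] simp: rep_eval_simps mod_var_mem)
qed (use module_carrier in fastforce)

lemma free_map_fun:
  assumes Y: "rf.mat_fun d d n Y"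
  shows "rf.mat_fun d d (n * algebra_dim) (\<lambda>\<rho>. free_map (d, \<rho>) n (Y \<rho>))"
proof (rule rf.mat_funI)
  fix i q assume iq: "i < d" "q < n * algebra_dim"
  then show "(\<lambda>\<rho>. free_map (d, \<rho>) n (Y \<rho>) $$ (i, q)) \<in> {F. \<exists>p\<in>mod_polys d. \<forall>\<rho>. is_module (d, \<rho>) \<longrightarrow> F \<rho> = rep_eval \<rho> p}"
    using rf.mat_fun_entry[OF rf.mat_fun_mult[OF rep_mat_fun Y] iq(1) div_mod_less(1)[OF iq(2)]]
    by (simp add: free_map_def)
qed (simp add: free_map_def)

lemma free_map_const_fun:
  assumes M: "is_module M" and Y: "rf.mat_fun d (fst M) n Y"
  shows "rf.mat_fun d (fst M) (n * algebra_dim) (\<lambda>\<rho>. free_map M n (Y \<rho>))"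
proof (rule rf.mat_funI)
  fix i q assume iq: "i < fst M" "q < n * algebra_dim"
  then show "(\<lambda>\<rho>. free_map M n (Y \<rho>) $$ (i, q)) \<in> {F. \<exists>p\<in>mod_polys d. \<forall>\<rho>. is_module (d, \<rho>) \<longrightarrow> F \<rho> = rep_eval \<rho> p}"
    using rf.mat_fun_entry[OF rf.mat_fun_mult[OF rf.mat_fun_const[OF module_carrier[OF M]] Y] iq(1) div_mod_less(1)[OF iq(2)]]
    by (simp add: free_map_def)
qed (simp add: free_map_def)

lemma rep_fun_poly:
  assumes "F \<in> {F. \<exists>p\<in>mod_polys d. \<forall>\<rho>. is_module (d, \<rho>) \<longrightarrow> F \<rho> = rep_eval \<rho> p}"
  obtains p where "p \<in> mod_polys d" "\<And>\<rho>. is_module (d, \<rho>) \<Longrightarrow> rep_eval \<rho> p = F \<rho>"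
  using assms by force

section \<open>Kernels of free covers\<close>

definition free_cover :: "nat \<Rightarrow> ('a \<Rightarrow> 'k mat) \<Rightarrow> 'k mat" where
  "free_cover d \<rho> = free_map (d, \<rho>) d (1\<^sub>m d)"

lemma free_cover:
  assumes "is_module (d, \<rho>)"
  shows "free_cover d \<rho> \<in> module_hom (free d) (d, \<rho>)" "free_cover d \<rho> * free_gens d = 1\<^sub>m d"
    "dim_row (free_cover d \<rho>) = d" "dim_col (free_cover d \<rho>) = d * algebra_dim"
    "\<rho> a = free_cover d \<rho> * snd (free d) a * free_gens d"
proof -
  show h: "free_cover d \<rho> \<in> module_hom (free d) (d, \<rho>)" "free_cover d \<rho> * free_gens d = 1\<^sub>m d"
    unfolding free_cover_def using free_map_hom[OF assms, of "1\<^sub>m d" d] free_map_gens[OF assms, of "1\<^sub>m d" d] by auto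
  show d: "dim_row (free_cover d \<rho>) = d" "dim_col (free_cover d \<rho>) = d * algebra_dim"
    unfolding free_cover_def free_map_def by auto
  note df = carrier_matD[OF free_gens_carrier[of d]] module_dim[OF assms, simplified]
  show "\<rho> a = free_cover d \<rho> * snd (free d) a * free_gens d"
    using module_hom_comm[OF h(1), of a] d df by (simp add: mat_assoc h(2) mat_alg)
qed

text \<open>Coordinate projections of a space of dimension \<open>e + d\<close>; their transposes
  are the inclusions. Block matrices are composed from these, so that blocks are extracted by
  multiplication.\<close>

definition left_proj :: "nat \<Rightarrow> nat \<Rightarrow> 'k mat" where
  "left_proj e d = mat e (e + d) (\<lambda>(i, j). if i = j then 1 else 0)"

definition right_proj :: "nat \<Rightarrow> nat \<Rightarrow> 'k mat" where
  "right_proj e d = mat d (e + d) (\<lambda>(i, j). if j = e + i then 1 else 0)"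

lemma proj_dim_simps [simp]:
  "dim_row (left_proj e d) = e" "dim_col (left_proj e d) = e + d"
  "dim_row (right_proj e d) = d" "dim_col (right_proj e d) = e + d"
  by (simp_all add: left_proj_def right_proj_def)

lemma proj_simps:
  "left_proj e d * (left_proj e d)\<^sup>T = 1\<^sub>m e" "right_proj e d * (right_proj e d)\<^sup>T = 1\<^sub>m d"
  "left_proj e d * (right_proj e d)\<^sup>T = 0\<^sub>m e d" "right_proj e d * (left_proj e d)\<^sup>T = 0\<^sub>m d e"
  "(left_proj e d)\<^sup>T * left_proj e d + (right_proj e d)\<^sup>T * right_proj e d = 1\<^sub>m (e + d)"
proof -
  have delta: "(\<Sum>k = 0..<n. (if k = a then 1 else 0) * f k) = (if a < n then f a else 0 :: 'k)" for n a :: nat and f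
  proof -
    have "(\<Sum>k = 0..<n. (if k = a then 1 else 0) * f k) = (\<Sum>k = 0..<n. if k = a then f k else 0)"
      by (intro sum.cong) auto
    then show ?thesis by simp
  qed
  have sym: "(if a = b then 1 else 0 :: 'k) = (if b = a then 1 else 0)" for a b :: nat by simp
  have entries: "i < e \<Longrightarrow> k < e + d \<Longrightarrow> left_proj e d $$ (i, k) = (if k = i then 1 else 0)"
    "j < d \<Longrightarrow> k < e + d \<Longrightarrow> right_proj e d $$ (j, k) = (if k = e + j then 1 else 0)" for i j k
    by (auto simp: left_proj_def right_proj_def)
  show "left_proj e d * (left_proj e d)\<^sup>T = 1\<^sub>m e" "right_proj e d * (right_proj e d)\<^sup>T = 1\<^sub>m d"
    "left_proj e d * (right_proj e d)\<^sup>T = 0\<^sub>m e d" "right_proj e d * (left_proj e d)\<^sup>T = 0\<^sub>m d e"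
    by (rule eq_matI; simp add: scalar_prod_def entries delta)+
  show "(left_proj e d)\<^sup>T * left_proj e d + (right_proj e d)\<^sup>T * right_proj e d = 1\<^sub>m (e + d)"
  proof (rule eq_matI)
    fix i j assume "i < dim_row (1\<^sub>m (e + d) :: 'k mat)" "j < dim_col (1\<^sub>m (e + d) :: 'k mat)"
    then have ij: "i < e + d" "j < e + d" by auto
    have "((left_proj e d)\<^sup>T * left_proj e d) $$ (i, j) = (\<Sum>k = 0..<e. (if k = i then 1 else 0) * (if j = k then 1 else 0))"
      using ij by (simp add: scalar_prod_def entries sym[of i])
    then have 1: "((left_proj e d)\<^sup>T * left_proj e d) $$ (i, j) = (if i < e \<and> j = i then 1 else 0)"
      by (simp only: delta) simp
    have 2: "((right_proj e d)\<^sup>T * right_proj e d) $$ (i, j) = (if e \<le> i \<and> j = i then 1 else 0)"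
    proof (cases "e \<le> i")
      case True
      then obtain i' where i': "i = e + i'" using le_iff_add by blast
      have "((right_proj e d)\<^sup>T * right_proj e d) $$ (i, j) = (\<Sum>k = 0..<d. (if k = i' then 1 else 0) * (if j = e + k then 1 else 0))"
        using ij by (auto simp: scalar_prod_def entries i' intro!: sum.cong)
      then show ?thesis using ij by (simp only: delta) (simp add: i')
    next
      case False
      then show ?thesis using ij by (auto simp: scalar_prod_def entries intro!: sum.neutral)
    qed
    show "((left_proj e d)\<^sup>T * left_proj e d + (right_proj e d)\<^sup>T * right_proj e d) $$ (i, j) = 1\<^sub>m (e + d) $$ (i, j)"
      using ij 1 2 by auto
  qed auto
qed

text \<open>A non-zero determinant of \<open>join_gens e d \<iota>\<close> says that \<open>\<iota>\<close> identifies \<open>K\<^sup>e\<close> with a complement of the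
  span of the free generators. As the free cover is bijective on that span, \<open>kernel_class d \<kappa>\<close>
  consists of the modules whose free cover has a kernel isomorphic to \<open>\<kappa>\<close>.\<close>

definition join_gens :: "nat \<Rightarrow> nat \<Rightarrow> 'k mat \<Rightarrow> 'k mat" where
  "join_gens e d \<iota> = \<iota> * left_proj e d + free_gens d * right_proj e d"

definition kernel_class :: "nat \<Rightarrow> ('a, 'k) rep \<Rightarrow> ('a \<Rightarrow> 'k mat) set" where
  "kernel_class d \<kappa> = {\<rho>. is_module (d, \<rho>) \<and> (\<exists>\<iota>\<in>module_hom \<kappa> (free d).
     det (join_gens (fst \<kappa>) d \<iota>) \<noteq> 0 \<and> free_cover d \<rho> * \<iota> = 0\<^sub>m d (fst \<kappa>))}"

lemma join_gens_dim:
  assumes "fst \<kappa> + d = d * algebra_dim" "dim_row \<iota> = d * algebra_dim" "dim_col \<iota> = fst \<kappa>"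
  shows "dim_row (join_gens (fst \<kappa>) d \<iota>) = d * algebra_dim" "dim_col (join_gens (fst \<kappa>) d \<iota>) = d * algebra_dim"
  using assms free_gens_carrier[of d] by (auto simp: join_gens_def)

lemma join_gens_proj:
  assumes "dim_row \<iota> = d * algebra_dim" "dim_col \<iota> = e"
  shows "join_gens e d \<iota> * (left_proj e d)\<^sup>T = \<iota>" "join_gens e d \<iota> * (right_proj e d)\<^sup>T = free_gens d"
proof -
  note df = carrier_matD[OF free_gens_carrier[of d]] assms
  show "join_gens e d \<iota> * (left_proj e d)\<^sup>T = \<iota>" "join_gens e d \<iota> * (right_proj e d)\<^sup>T = free_gens d"
    using df by (auto simp: join_gens_def mat_alg proj_simps)
qed

lemma det_nonzero_inverse:
  fixes T :: "'k mat"
  assumes "T \<in> carrier_mat n n" "det T \<noteq> 0"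
  shows "(1 / det T) \<cdot>\<^sub>m adj_mat T \<in> carrier_mat n n" "T * ((1 / det T) \<cdot>\<^sub>m adj_mat T) = 1\<^sub>m n"
    "((1 / det T) \<cdot>\<^sub>m adj_mat T) * T = 1\<^sub>m n"
  using adj_mat[OF assms(1)] assms by (auto simp: mat_alg)

text \<open>The projective dimension is an infimum of natural numbers, so a bound by one yields a
  resolution of length at most one. Its terms vanish from index two on, and exactness at
  \<open>P 1\<close> then says that \<open>\<delta> 0\<close> is injective.\<close>

lemma hereditary_resolution:
  assumes her: hereditary and M: "is_module M"
  obtains P0 P1 \<epsilon> \<delta> where "projective P0" "projective P1" "\<epsilon> \<in> module_hom P0 M" "\<delta> \<in> module_hom P1 P0"
    "mat_image \<epsilon> = carrier_vec (fst M)" "mat_image \<delta> = mat_kernel \<epsilon>"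
    "\<And>v. \<lbrakk>v \<in> carrier_vec (fst P1); \<delta> *\<^sub>v v = 0\<^sub>v (fst P0)\<rbrakk> \<Longrightarrow> v = 0\<^sub>v (fst P1)"
proof -
  have "proj_dim M \<le> gl_dim" unfolding gl_dim_def using M by (intro SUP_upper) simp
  then have le: "proj_dim M \<le> 1" using her unfolding hereditary_def by (rule order_trans)
  have "\<exists>n\<le>1. has_projective_resolution M n"
  proof (rule ccontr)
    assume no: "\<not> (\<exists>n\<le>1. has_projective_resolution M n)"
    have "2 \<le> n" if "has_projective_resolution M n" for n
      using that no by (cases "n \<le> 1") auto
    then have "enat 2 \<le> proj_dim M" unfolding proj_dim_def by (intro INF_greatest) simp
    then have "enat 2 \<le> 1" using le by (rule order_trans)
    then show False by (simp add: one_enat_def)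
  qed
  then obtain n where n: "has_projective_resolution M n" "n \<le> 1" by blast
  then obtain P \<epsilon> \<delta> where P: "\<And>i. projective (P i)" "\<And>i. i > n \<Longrightarrow> fst (P i) = 0"
    "\<epsilon> \<in> module_hom (P 0) M" "\<And>i. \<delta> i \<in> module_hom (P (Suc i)) (P i)" "mat_image \<epsilon> = carrier_vec (fst M)"
    "mat_image (\<delta> 0) = mat_kernel \<epsilon>" "\<And>i. mat_image (\<delta> (Suc i)) = mat_kernel (\<delta> i)"
    unfolding has_projective_resolution_def by blast
  have "v = 0\<^sub>v (fst (P 1))" if "v \<in> carrier_vec (fst (P 1))" "\<delta> 0 *\<^sub>v v = 0\<^sub>v (fst (P 0))" for v
  proof -
    have "v \<in> mat_image (\<delta> 1)"
      using that module_hom_dim[OF P(4)[of 0]] P(7)[of 0] by (simp add: mat_kernel_def)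
    then obtain w where w: "w \<in> carrier_vec 0" "v = \<delta> 1 *\<^sub>v w"
      using module_hom_dim[OF P(4)[of 1]] P(2)[of 2] n(2) by (auto simp: mat_image_def numeral_2_eq_2)
    show ?thesis
      using w module_hom_dim[OF P(4)[of 1]] by (intro eq_vecI) (auto simp: scalar_prod_def)
  qed
  then show ?thesis using that[of "P 0" "P 1" \<epsilon> "\<delta> 0"] P by simp
qed

text \<open>Schanuel's argument: the kernel of one projective cover is a direct summand of
  \<open>F \<oplus> P1\<close> for any projective presentation \<open>P1 \<rightarrow> P0 \<rightarrow> M\<close> with injective first map.\<close>

lemma projective_kernel:
  assumes P: "projective P0" "projective P1" "\<epsilon> \<in> module_hom P0 M" "\<delta> \<in> module_hom P1 P0"
      "mat_image \<epsilon> = carrier_vec (fst M)" "mat_image \<delta> = mat_kernel \<epsilon>"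
      "\<And>v. \<lbrakk>v \<in> carrier_vec (fst P1); \<delta> *\<^sub>v v = 0\<^sub>v (fst P0)\<rbrakk> \<Longrightarrow> v = 0\<^sub>v (fst P1)"
    and M: "is_module M" and F: "projective F" "g \<in> module_hom F M" "mat_image g = carrier_vec (fst M)"
    and \<kappa>: "is_module \<kappa>" "B \<in> module_hom \<kappa> F" "B' \<in> carrier_mat (fst \<kappa>) (fst F)" "B' * B = 1\<^sub>m (fst \<kappa>)"
      "g * B = 0\<^sub>m (fst M) (fst \<kappa>)"
      "\<And>h k. \<lbrakk>h \<in> carrier_mat (fst F) k; g * h = 0\<^sub>m (fst M) k\<rbrakk> \<Longrightarrow> B * (B' * h) = h"
  shows "projective \<kappa>"
proof -
  note mods = projective_module[OF P(1)] projective_module[OF P(2)] projective_module[OF F(1)] M \<kappa>(1)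
  obtain u where u: "u \<in> module_hom F P0" "\<epsilon> * u = g"
    using projective_lift[OF F(1) mods(1) M P(3) F(2) P(5)] by blast
  obtain v where v: "v \<in> module_hom P0 F" "g * v = \<epsilon>"
    using projective_lift[OF P(1) mods(3) M F(2) P(3) F(3)] by blast
  obtain \<delta>' where \<delta>': "\<delta>' \<in> carrier_mat (fst P1) (fst P0)" "\<delta>' * \<delta> = 1\<^sub>m (fst P1)"
    using mat_left_inverse[OF module_hom_carrier[OF P(4)] P(7)] by blast
  note d = module_hom_dim[OF P(3)] module_hom_dim[OF P(4)] module_hom_dim[OF F(2)] module_hom_dim[OF \<kappa>(2)]
    module_hom_dim[OF u(1)] module_hom_dim[OF v(1)] carrier_matD[OF \<delta>'(1)] carrier_matD[OF \<kappa>(3)]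
    module_dim[OF mods(1)] module_dim[OF mods(2)] module_dim[OF mods(3)] module_dim[OF mods(4)] module_dim[OF mods(5)]
  have into_\<kappa>: "B' * h \<in> module_hom N \<kappa>" if N: "is_module N" and h: "h \<in> module_hom N F" "g * h = 0\<^sub>m (fst M) (fst N)" for N h
  proof (rule module_homI)
    fix a
    note dh = module_hom_dim[OF h(1)] module_dim[OF N]
    have Bh: "B * (B' * h) = h" using \<kappa>(6)[OF module_hom_carrier[OF h(1)] h(2)] .
    have "B' * h * snd N a = B' * (snd F a * h)"
      using module_hom_comm[OF h(1), of a] d dh by (simp add: mat_assoc)
    also have "\<dots> = B' * (snd F a * (B * (B' * h)))" by (simp add: Bh)
    also have "\<dots> = B' * ((snd F a * B) * (B' * h))"
      using d dh by (simp add: mat_assoc)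
    also have "snd F a * B = B * snd \<kappa> a" by (simp add: module_hom_comm[OF \<kappa>(2)])
    also have "B' * ((B * snd \<kappa> a) * (B' * h)) = (B' * B) * (snd \<kappa> a * (B' * h))"
      using d dh by (simp add: mat_assoc)
    also have "\<dots> = snd \<kappa> a * (B' * h)" unfolding \<kappa>(4) using d dh by (simp add: mat_alg)
    finally show "B' * h * snd N a = snd \<kappa> a * (B' * h)" .
  qed (use d module_hom_dim[OF h(1)] in auto)
  have v\<delta>: "v * \<delta> \<in> module_hom P1 F" by (rule module_hom_comp[OF mods(2,1,3) P(4) v(1)])
  have \<epsilon>\<delta>: "\<epsilon> * \<delta> = 0\<^sub>m (fst M) (fst P1)"
  proof (rule mat_eq_if_mult_vec_eq[of _ "fst M" "fst P1"])
    fix x :: "'k vec" assume x: "x \<in> carrier_vec (fst P1)"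
    then have "\<delta> *\<^sub>v x \<in> mat_kernel \<epsilon>" using P(6) d by (auto simp: mat_image_def)
    then show "\<epsilon> * \<delta> *\<^sub>v x = 0\<^sub>m (fst M) (fst P1) *\<^sub>v x"
      using x d by (simp add: mat_kernel_def mat_vec_assoc zero_mat_vec)
  qed (use d in auto)
  have "g * (v * \<delta>) = 0\<^sub>m (fst M) (fst P1)"
    using d \<epsilon>\<delta> by (simp add: mat_assoc[symmetric] v(2))
  then have \<beta>2: "B' * (v * \<delta>) \<in> module_hom P1 \<kappa>" by (rule into_\<kappa>[OF mods(2) v\<delta>])
  \<comment> \<open>As \<open>v * u\<close> covers the identity of \<open>M\<close>, the difference
    \<open>\<phi>\<close> maps \<open>F\<close> into the kernel of \<open>g\<close>. On
    \<open>\<kappa>\<close> the subtracted part \<open>v * u * B\<close> factors through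
    \<open>P1\<close>, because \<open>u * B\<close> lands in the kernel of
    \<open>\<epsilon>\<close>; adding it back gives the identity of \<open>\<kappa>\<close>.\<close>
  define \<phi> where "\<phi> = 1\<^sub>m (fst F) - v * u"
  have \<phi>: "\<phi> \<in> module_hom F F"
    unfolding \<phi>_def by (intro module_hom_minus module_hom_one module_hom_comp[OF mods(3,1,3) u(1) v(1)] mods)
  have "g * \<phi> = g - g * (v * u)" unfolding \<phi>_def using d by (simp add: mat_alg)
  also have "g * (v * u) = g" using d by (simp add: mat_assoc[symmetric] v(2) u(2))
  finally have "g * \<phi> = 0\<^sub>m (fst M) (fst F)" using d by (simp add: mat_group)
  then have \<beta>1: "B' * \<phi> \<in> module_hom F \<kappa>" by (rule into_\<kappa>[OF mods(3) \<phi>])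
  have uB: "u * B \<in> module_hom \<kappa> P0" by (rule module_hom_comp[OF mods(5,3,1) \<kappa>(2) u(1)])
  have \<epsilon>uB: "\<epsilon> * (u * B) = 0\<^sub>m (fst M) (fst \<kappa>)"
    using d \<kappa>(5) by (simp add: mat_assoc[symmetric] u(2))
  have "\<exists>h\<in>carrier_mat (fst P1) (fst \<kappa>). \<delta> * h = u * B"
  proof -
    have "col (u * B) j \<in> mat_image \<delta>" if j: "j < fst \<kappa>" for j
    proof -
      have "\<epsilon> *\<^sub>v col (u * B) j = col (\<epsilon> * (u * B)) j"
        using d j by (intro col_mult2[symmetric, of _ "fst M" "fst P0" _ "fst \<kappa>"]) auto
      then show ?thesis unfolding P(6) mat_kernel_def using d j \<epsilon>uB by (auto intro!: carrier_vecI)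
    qed
    then show ?thesis
      using mat_image_lift[OF module_hom_carrier[OF P(4)] module_hom_carrier[OF uB]] by blast
  qed
  then obtain h where h: "h \<in> carrier_mat (fst P1) (fst \<kappa>)" "\<delta> * h = u * B" by blast
  have \<gamma>2: "h \<in> module_hom \<kappa> P1"
  proof (rule module_homI[OF h(1)])
    fix a
    note dh = carrier_matD[OF h(1)]
    have "\<delta> * (h * snd \<kappa> a) = snd P0 a * (\<delta> * h)"
      using module_hom_comm[OF uB, of a] d dh by (simp add: mat_assoc[symmetric] h(2))
    also have "\<dots> = \<delta> * (snd P1 a * h)"
      using module_hom_comm[OF P(4), of a] d dh by (simp add: mat_assoc[symmetric])
    finally have "\<delta>' * (\<delta> * (h * snd \<kappa> a)) = \<delta>' * (\<delta> * (snd P1 a * h))" by simp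
    then have "(\<delta>' * \<delta>) * (h * snd \<kappa> a) = (\<delta>' * \<delta>) * (snd P1 a * h)"
      using d dh by (simp add: mat_assoc)
    then show "h * snd \<kappa> a = snd P1 a * h" unfolding \<delta>'(2) using d dh by (simp add: mat_alg)
  qed
  have "B' * \<phi> * B + B' * (v * \<delta>) * h = 1\<^sub>m (fst \<kappa>)"
  proof -
    note dh = carrier_matD[OF h(1)]
    have "B' * \<phi> * B = B' * B - B' * (v * (u * B))"
      unfolding \<phi>_def using d by (simp add: mat_alg)
    moreover have "B' * (v * \<delta>) * h = B' * (v * (u * B))"
      using d dh by (simp add: mat_assoc h(2))
    ultimately show ?thesis unfolding \<kappa>(4) using d by (simp add: mat_group)
  qed
  then show ?thesis
    using projective_retract[OF \<kappa>(1) F(1) P(2) \<kappa>(2) \<beta>1 \<gamma>2 \<beta>2] by simp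
qed

text \<open>The idempotent \<open>E = 1 - c * r\<close>, for the generators \<open>c\<close> and the
  cover \<open>r\<close>, projects onto the kernel of the cover along the span of the generators.
  Splitting it gives a basis \<open>B\<close> of the kernel with coordinates \<open>B'\<close>. The
  matrices with blocks \<open>B\<close>, \<open>c\<close> and \<open>B'\<close>, \<open>r\<close>
  are inverse to each other, which yields both the dimension formula and the nonzero
  determinant.\<close>

lemma mem_kernel_class:
  assumes her: hereditary and \<rho>: "is_module (d, \<rho>)"
  obtains \<kappa> where "projective \<kappa>" "fst \<kappa> + d = d * algebra_dim" "\<rho> \<in> kernel_class d \<kappa>"
proof -
  let ?D = "d * algebra_dim" let ?r = "free_cover d \<rho>" let ?c = "free_gens d" let ?F = "free d"
  note r = free_cover[OF \<rho>]
  note df = r(3,4) carrier_matD[OF free_gens_carrier[of d]] fst_free[of d] module_dim[OF free_module, of d]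
  define E where "E = 1\<^sub>m ?D - ?c * ?r"
  have rE: "?r * E = 0\<^sub>m d ?D"
  proof -
    have "?r * E = ?r - ?r * (?c * ?r)" unfolding E_def using df by (simp add: mat_alg)
    also have "?r * (?c * ?r) = ?r" using df by (simp add: mat_assoc[symmetric] r(2))
    finally show ?thesis using df by (simp add: mat_group)
  qed
  have E: "E \<in> carrier_mat ?D ?D" unfolding E_def using df by (intro carrier_matI) auto
  have Eh: "E * h = h" if "h \<in> carrier_mat ?D k" "?r * h = 0\<^sub>m d k" for h k
  proof -
    have "E * h = h - ?c * (?r * h)" unfolding E_def using df that(1) by (simp add: mat_alg)
    then show ?thesis using df that by (simp add: mat_mult_zero mat_group)
  qed
  have "E * E = E" by (rule Eh[OF E rE])
  from split_idempotent[OF E this] obtain e B B' where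
    B: "B \<in> carrier_mat ?D e" "B' \<in> carrier_mat e ?D" "B' * B = 1\<^sub>m e" "B * B' = E" by blast
  note dB = carrier_matD[OF B(1)] carrier_matD[OF B(2)] df
  have rB: "?r * B = 0\<^sub>m d e"
  proof -
    have "?r * B = ?r * (B * (B' * B))" using dB by (simp add: B(3) mat_alg)
    also have "\<dots> = (?r * E) * B" using dB by (simp add: mat_assoc B(4)[symmetric])
    finally show ?thesis using dB by (simp add: rE mat_alg)
  qed
  have Bc: "B' * ?c = 0\<^sub>m e d"
  proof -
    have "E * ?c = ?c - ?c * (?r * ?c)" unfolding E_def using df by (simp add: mat_alg)
    also have "\<dots> = 0\<^sub>m ?D d" using df by (simp add: r(2) mat_mult_one mat_group)
    finally have Ec: "E * ?c = 0\<^sub>m ?D d" .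
    have "B' * ?c = (B' * B) * (B' * ?c)" unfolding B(3) using dB by (simp add: mat_alg)
    also have "\<dots> = B' * (E * ?c)" using dB by (simp add: mat_assoc B(4)[symmetric])
    finally show ?thesis using dB by (simp add: Ec mat_alg)
  qed
  have BBh: "B * (B' * h) = h" if "h \<in> carrier_mat ?D k" "?r * h = 0\<^sub>m d k" for h k
    using Eh[OF that] dB that(1) by (simp add: mat_assoc[symmetric] B(4))
  define \<kappa> where "\<kappa> = (e, \<lambda>a. B' * snd ?F a * B)"
  have "B * (B' * (snd ?F a * B)) = snd ?F a * B" for a
  proof (rule BBh)
    show "snd ?F a * B \<in> carrier_mat ?D e" using dB by auto
    have "?r * (snd ?F a * B) = \<rho> a * (?r * B)"
      using module_hom_comm[OF r(1), of a] dB module_dim[OF \<rho>, simplified] by (simp add: mat_assoc[symmetric])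
    then show "?r * (snd ?F a * B) = 0\<^sub>m d e" using module_dim[OF \<rho>, simplified] by (simp add: rB mat_alg)
  qed
  then have \<kappa>: "is_module \<kappa>" "B \<in> module_hom \<kappa> ?F"
    unfolding \<kappa>_def using submodule[OF free_module, of B d e B'] B by (simp_all add: fst_free)
  have rsurj: "mat_image ?r = carrier_vec d"
    using mat_image_fullI[OF _ free_gens_carrier r(2)] r(3,4) by auto
  have "projective \<kappa>"
  proof (rule hereditary_resolution[OF her \<rho>])
    fix P0 P1 \<epsilon> \<delta>
    assume P: "projective P0" "projective P1" "\<epsilon> \<in> module_hom P0 (d, \<rho>)" "\<delta> \<in> module_hom P1 P0"
      "mat_image \<epsilon> = carrier_vec (fst (d, \<rho>))" "mat_image \<delta> = mat_kernel \<epsilon>"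
      "\<And>v. \<lbrakk>v \<in> carrier_vec (fst P1); \<delta> *\<^sub>v v = 0\<^sub>v (fst P0)\<rbrakk> \<Longrightarrow> v = 0\<^sub>v (fst P1)"
    show ?thesis
    proof (rule projective_kernel[OF P \<rho> projective_free r(1) _ \<kappa>])
      show "mat_image ?r = carrier_vec (fst (d, \<rho>))" using rsurj by simp
      show "B' \<in> carrier_mat (fst \<kappa>) (fst ?F)" "B' * B = 1\<^sub>m (fst \<kappa>)" "?r * B = 0\<^sub>m (fst (d, \<rho>)) (fst \<kappa>)"
        using B rB by (simp_all add: \<kappa>_def fst_free)
      show "B * (B' * h) = h" if "h \<in> carrier_mat (fst ?F) k" "?r * h = 0\<^sub>m (fst (d, \<rho>)) k" for h k
        using that by (intro BBh[of h k]) (simp_all add: fst_free)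
    qed
  qed
  have fst\<kappa>: "fst \<kappa> = e" by (simp add: \<kappa>_def)
  define S where "S = (left_proj e d)\<^sup>T * B' + (right_proj e d)\<^sup>T * ?r"
  let ?T = "join_gens e d B"
  have Td: "dim_row ?T = ?D" "dim_col ?T = e + d" unfolding join_gens_def using dB by auto
  have Sd: "dim_row S = e + d" "dim_col S = ?D" unfolding S_def using dB by auto
  have TS: "?T * S = 1\<^sub>m ?D"
  proof -
    have "?T * S = (?T * (left_proj e d)\<^sup>T) * B' + (?T * (right_proj e d)\<^sup>T) * ?r"
      unfolding S_def using Td dB by (simp add: mat_alg)
    also have "\<dots> = B * B' + ?c * ?r" using dB by (simp add: join_gens_proj)
    also have "\<dots> = 1\<^sub>m ?D" unfolding B(4) E_def using dB by (simp add: mat_group)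
    finally show ?thesis .
  qed
  have ST: "S * ?T = 1\<^sub>m (e + d)"
  proof -
    have "B' * ?T = (B' * B) * left_proj e d + (B' * ?c) * right_proj e d"
      "?r * ?T = (?r * B) * left_proj e d + (?r * ?c) * right_proj e d"
      unfolding join_gens_def using dB by (simp_all add: mat_mult_add mat_assoc)
    then have ab: "B' * ?T = left_proj e d" "?r * ?T = right_proj e d"
      unfolding B(3) Bc rB r(2) by (simp_all add: mat_zero_mult mat_group)
    have "S * ?T = (left_proj e d)\<^sup>T * (B' * ?T) + (right_proj e d)\<^sup>T * (?r * ?T)"
      unfolding S_def using Td dB by (simp add: mat_add_mult mat_assoc)
    then show ?thesis unfolding ab by (simp add: proj_simps)
  qed
  have sq: "?D = e + d"
    by (rule invertible_imp_square[OF _ _ TS ST]) (use Td Sd in auto)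
  have "det ?T * det S = 1"
    using det_mult[of ?T ?D S] TS Td Sd sq by auto
  then have "det ?T \<noteq> 0" by auto
  then have "\<rho> \<in> kernel_class d \<kappa>"
    using \<rho> \<kappa>(2) rB unfolding kernel_class_def fst\<kappa> by blast
  with \<open>projective \<kappa>\<close> sq that[of \<kappa>] show ?thesis by (simp add: fst\<kappa>)
qed

lemma free_map_zero: "is_module M \<Longrightarrow> free_map M n (0\<^sub>m (fst M) n) = 0\<^sub>m (fst M) (n * algebra_dim)"
  by (intro eq_matI) (auto simp: free_map_def mat_mult_zero div_mod_less(1))

text \<open>If \<open>\<kappa>\<close> is projective, then \<open>\<iota>\<close> deforms polynomially with \<open>\<rho>\<close>: correct the images
  of the generators of a free module over \<open>\<kappa>\<close> by the projection onto the kernel of the cover.\<close>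

lemma kernel_class_open:
  assumes \<kappa>: "projective \<kappa>" "fst \<kappa> + d = d * algebra_dim" and \<rho>: "\<rho> \<in> kernel_class d \<kappa>"
  shows "\<exists>g\<in>mod_polys d. rep_eval \<rho> g \<noteq> 0 \<and>
    (\<forall>\<sigma>. is_module (d, \<sigma>) \<longrightarrow> rep_eval \<sigma> g \<noteq> 0 \<longrightarrow> \<sigma> \<in> kernel_class d \<kappa>)"
proof -
  let ?D = "d * algebra_dim" and ?c = "free_gens d" and ?F = "free d" and ?e = "fst \<kappa>"
  note K = projective_module[OF \<kappa>(1)]
  obtain \<iota> where \<rho>M: "is_module (d, \<rho>)" and \<iota>: "\<iota> \<in> module_hom \<kappa> ?F" "det (join_gens ?e d \<iota>) \<noteq> 0"
    "free_cover d \<rho> * \<iota> = 0\<^sub>m d ?e" using \<rho> by (auto simp: kernel_class_def)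
  obtain s where s: "s \<in> module_hom \<kappa> (free ?e)" "free_map \<kappa> ?e (1\<^sub>m ?e) * s = 1\<^sub>m ?e"
    using projective_section[OF \<kappa>(1)] by blast
  note dims = module_hom_dim[OF \<iota>(1)] module_hom_dim[OF s(1)] carrier_matD[OF free_gens_carrier[of d]]
    fst_free[of d] fst_free[of ?e]
  define Y where "Y \<sigma> = \<iota> - ?c * (free_cover d \<sigma> * \<iota>)" for \<sigma>
  define \<iota>' where "\<iota>' \<sigma> = free_map ?F ?e (Y \<sigma>) * s" for \<sigma>
  have Yc: "Y \<sigma> \<in> carrier_mat ?D ?e" if "is_module (d, \<sigma>)" for \<sigma>
    unfolding Y_def using free_cover(3,4)[OF that] dims by (intro carrier_matI) auto
  have hom: "\<iota>' \<sigma> \<in> module_hom \<kappa> ?F" if "is_module (d, \<sigma>)" for \<sigma>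
    unfolding \<iota>'_def using Yc[OF that]
    by (intro module_hom_comp[OF K free_module free_module s(1)] free_map_hom free_module) (simp add: fst_free)
  have zero: "free_cover d \<sigma> * \<iota>' \<sigma> = 0\<^sub>m d ?e" if \<sigma>: "is_module (d, \<sigma>)" for \<sigma>
  proof -
    note r = free_cover[OF \<sigma>]
    have "free_cover d \<sigma> * Y \<sigma> = free_cover d \<sigma> * \<iota> - (free_cover d \<sigma> * ?c) * (free_cover d \<sigma> * \<iota>)"
      unfolding Y_def using dims r(3,4) by (simp add: mat_mult_minus mat_assoc)
    then have rY: "free_cover d \<sigma> * Y \<sigma> = 0\<^sub>m d ?e"
      unfolding r(2) using dims r(3,4) by (simp add: mat_group)
    have "free_cover d \<sigma> * \<iota>' \<sigma> = (free_cover d \<sigma> * free_map ?F ?e (Y \<sigma>)) * s"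
      unfolding \<iota>'_def using dims r(3,4) free_map_carrier[of ?F ?e "Y \<sigma>"] by (simp add: mat_assoc)
    also have "free_cover d \<sigma> * free_map ?F ?e (Y \<sigma>) = free_map (d, \<sigma>) ?e (0\<^sub>m d ?e)"
      using free_map_natural[OF free_module \<sigma> r(1), of "Y \<sigma>" ?e] Yc[OF \<sigma>] by (simp add: rY fst_free)
    also have "\<dots> = 0\<^sub>m d (?e * algebra_dim)" using free_map_zero[OF \<sigma>, of ?e] by simp
    finally show ?thesis using dims by (simp add: mat_zero_mult)
  qed
  \<comment> \<open>At \<open>\<rho>\<close> the correction term vanishes, so the deformation passes
    through \<open>\<iota>\<close> and its determinant is nonzero there.\<close>
  have at\<rho>: "\<iota>' \<rho> = \<iota>"
  proof -
    have "Y \<rho> = \<iota>" unfolding Y_def \<iota>(3) using dims by (simp add: mat_mult_zero mat_group)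
    then have "\<iota>' \<rho> = (\<iota> * free_map \<kappa> ?e (1\<^sub>m ?e)) * s"
      unfolding \<iota>'_def using free_map_natural[OF K free_module \<iota>(1), of "1\<^sub>m ?e" ?e] dims by (simp add: mat_mult_one)
    also have "\<dots> = \<iota> * (free_map \<kappa> ?e (1\<^sub>m ?e) * s)"
      using dims free_map_carrier[of \<kappa> ?e "1\<^sub>m ?e"] by (simp add: mat_assoc)
    finally show ?thesis unfolding s(2) using dims by (simp add: mat_mult_one)
  qed
  have "rf.mat_fun d d ?D (free_cover d)"
    using free_map_fun[OF rf.mat_fun_const[of "1\<^sub>m d" d d d]] unfolding free_cover_def[abs_def] by simp
  then have "rf.mat_fun d ?D ?e Y"
    unfolding Y_def[abs_def]
    by (intro rf.mat_fun_minus rf.mat_fun_mult[of _ _ d] rf.mat_fun_mult[of _ d ?D] rf.mat_fun_const free_gens_carrier)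
      (use dims in \<open>auto intro!: carrier_matI\<close>)
  then have "rf.mat_fun d ?D (?e * algebra_dim) (\<lambda>\<sigma>. free_map ?F ?e (Y \<sigma>))"
    using free_map_const_fun[OF free_module, of d d ?e Y] by (simp add: fst_free)
  then have "rf.mat_fun d ?D ?e \<iota>'"
    unfolding \<iota>'_def[abs_def] using dims by (intro rf.mat_fun_mult[of _ _ "?e * algebra_dim"] rf.mat_fun_const) auto
  then have "rf.mat_fun d ?D ?D (\<lambda>\<sigma>. join_gens ?e d (\<iota>' \<sigma>))"
    unfolding join_gens_def using \<kappa>(2) dims
    by (intro rf.mat_fun_add rf.mat_fun_mult[of _ _ ?e] rf.mat_fun_const) (auto intro!: carrier_matI)
  from rep_fun_poly[OF rf.det_fun[OF this]] obtain g where g: "g \<in> mod_polys d"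
    "\<And>\<sigma>. is_module (d, \<sigma>) \<Longrightarrow> rep_eval \<sigma> g = det (join_gens ?e d (\<iota>' \<sigma>))" by blast
  show ?thesis
  proof (intro bexI[OF _ g(1)] conjI allI impI)
    show "rep_eval \<rho> g \<noteq> 0" using g(2)[OF \<rho>M] \<iota>(2) at\<rho> by simp
    fix \<sigma> assume "is_module (d, \<sigma>)" "rep_eval \<sigma> g \<noteq> 0"
    then show "\<sigma> \<in> kernel_class d \<kappa>" using hom zero g(2) by (auto simp: kernel_class_def)
  qed
qed

text \<open>The rows of the inverse \<open>S\<close> are the coordinates along
  \<open>\<iota>\<close> and along the generators. A map that kills \<open>\<iota>\<close> and sends
  the generators to the unit vectors can only be the second block, so that block is the free cover
  of every module whose cover kills \<open>\<iota>\<close>.\<close>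

lemma kernel_class_inverse:
  assumes \<kappa>: "is_module \<kappa>" "fst \<kappa> + d = d * algebra_dim" and \<iota>: "\<iota> \<in> module_hom \<kappa> (free d)"
    and det: "det (join_gens (fst \<kappa>) d \<iota>) \<noteq> 0"
  obtains S where "S \<in> carrier_mat (d * algebra_dim) (d * algebra_dim)"
    "S = (1 / det (join_gens (fst \<kappa>) d \<iota>)) \<cdot>\<^sub>m adj_mat (join_gens (fst \<kappa>) d \<iota>)"
    "left_proj (fst \<kappa>) d * (S * \<iota>) = 1\<^sub>m (fst \<kappa>)" "right_proj (fst \<kappa>) d * (S * \<iota>) = 0\<^sub>m d (fst \<kappa>)"
    "right_proj (fst \<kappa>) d * (S * free_gens d) = 1\<^sub>m d"
    "\<iota> * (left_proj (fst \<kappa>) d * S) + free_gens d * (right_proj (fst \<kappa>) d * S) = 1\<^sub>m (d * algebra_dim)"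
    "\<And>\<rho>. \<lbrakk>is_module (d, \<rho>); free_cover d \<rho> * \<iota> = 0\<^sub>m d (fst \<kappa>)\<rbrakk> \<Longrightarrow> free_cover d \<rho> = right_proj (fst \<kappa>) d * S"
proof -
  let ?D = "d * algebra_dim" and ?T = "join_gens (fst \<kappa>) d \<iota>" and ?L = "left_proj (fst \<kappa>) d"
    and ?R = "right_proj (fst \<kappa>) d" and ?c = "free_gens d"
  note d = module_hom_dim[OF \<iota>] fst_free[of d] carrier_matD[OF free_gens_carrier[of d]]
  have Td: "dim_row ?T = ?D" "dim_col ?T = ?D" using join_gens_dim[OF \<kappa>(2)] d by auto
  define S where "S = (1 / det ?T) \<cdot>\<^sub>m adj_mat ?T"
  have S: "S \<in> carrier_mat ?D ?D" "?T * S = 1\<^sub>m ?D" "S * ?T = 1\<^sub>m ?D"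
    unfolding S_def by (rule det_nonzero_inverse[OF _ det]; use Td in auto)+
  note dS = d Td carrier_matD[OF S(1)]
  have T: "?T * ?L\<^sup>T = \<iota>" "?T * ?R\<^sup>T = ?c" using join_gens_proj[of \<iota> d "fst \<kappa>"] d by auto
  have "S * \<iota> = (S * ?T) * ?L\<^sup>T" "S * ?c = (S * ?T) * ?R\<^sup>T"
    using dS \<kappa>(2) by (simp_all add: mat_assoc T)
  then have SL: "S * \<iota> = ?L\<^sup>T" "S * ?c = ?R\<^sup>T" unfolding S(3) using \<kappa>(2) by (simp_all add: mat_one_mult)
  show ?thesis
  proof (rule that[OF S(1) S_def])
    show "?L * (S * \<iota>) = 1\<^sub>m (fst \<kappa>)" "?R * (S * \<iota>) = 0\<^sub>m d (fst \<kappa>)" "?R * (S * ?c) = 1\<^sub>m d"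
      unfolding SL by (simp_all add: proj_simps)
    have "?T * S = \<iota> * (?L * S) + ?c * (?R * S)"
      unfolding join_gens_def[of _ _ \<iota>] using dS \<kappa>(2) by (simp add: mat_add_mult mat_assoc)
    then show "\<iota> * (?L * S) + ?c * (?R * S) = 1\<^sub>m ?D" using S(2) by simp
    fix \<rho> assume \<rho>: "is_module (d, \<rho>)" and z: "free_cover d \<rho> * \<iota> = 0\<^sub>m d (fst \<kappa>)"
    note r = free_cover[OF \<rho>]
    have "free_cover d \<rho> * ?T = (free_cover d \<rho> * \<iota>) * ?L + (free_cover d \<rho> * ?c) * ?R"
      unfolding join_gens_def[of _ _ \<iota>] using dS r(3,4) by (simp add: mat_mult_add mat_assoc)
    then have rT: "free_cover d \<rho> * ?T = ?R" unfolding z r(2) by (simp add: mat_zero_mult mat_group)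
    have "free_cover d \<rho> = free_cover d \<rho> * (?T * S)" unfolding S(2) using r(4) by (simp add: mat_mult_one)
    also have "\<dots> = ?R * S" using dS r(3,4) by (simp add: mat_assoc[symmetric] rT)
    finally show "free_cover d \<rho> = ?R * S" .
  qed
qed

text \<open>Here \<open>\<nu>\<close> is the quotient of the free module by the image of
  \<open>\<iota>\<close>, with the classes of the generators as basis. The formula recovers the
  module from \<open>\<iota>\<close> and is rational in \<open>\<iota>\<close>, as required for
  families of embeddings.\<close>

lemma kernel_class_mem_iff:
  assumes \<kappa>: "is_module \<kappa>" "fst \<kappa> + d = d * algebra_dim" and \<iota>: "\<iota> \<in> module_hom \<kappa> (free d)"
    and det: "det (join_gens (fst \<kappa>) d \<iota>) \<noteq> 0"
    and S: "S = (1 / det (join_gens (fst \<kappa>) d \<iota>)) \<cdot>\<^sub>m adj_mat (join_gens (fst \<kappa>) d \<iota>)"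
  defines "\<nu> \<equiv> \<lambda>a. right_proj (fst \<kappa>) d * S * snd (free d) a * free_gens d"
  shows "\<nu> \<in> kernel_class d \<kappa>"
    "\<lbrakk>is_module (d, \<rho>); free_cover d \<rho> * \<iota> = 0\<^sub>m d (fst \<kappa>)\<rbrakk> \<Longrightarrow> \<rho> = \<nu>"
proof -
  let ?D = "d * algebra_dim" and ?L = "left_proj (fst \<kappa>) d" and ?c = "free_gens d" and ?F = "free d"
  define r where "r = right_proj (fst \<kappa>) d * S"
  obtain Sc: "S \<in> carrier_mat ?D ?D" and L: "?L * (S * \<iota>) = 1\<^sub>m (fst \<kappa>)" and r0: "right_proj (fst \<kappa>) d * (S * \<iota>) = 0\<^sub>m d (fst \<kappa>)"
    and rc: "right_proj (fst \<kappa>) d * (S * ?c) = 1\<^sub>m d" and one: "\<iota> * (?L * S) + ?c * r = 1\<^sub>m ?D"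
    and uniq: "\<And>\<rho>. \<lbrakk>is_module (d, \<rho>); free_cover d \<rho> * \<iota> = 0\<^sub>m d (fst \<kappa>)\<rbrakk> \<Longrightarrow> free_cover d \<rho> = r"
    using kernel_class_inverse[OF \<kappa> \<iota> det] unfolding r_def S by metis
  note d = module_hom_dim[OF \<iota>] fst_free[of d] carrier_matD[OF free_gens_carrier[of d]] carrier_matD[OF Sc] \<kappa>(2)
    module_dim[OF free_module, of d] module_dim[OF \<kappa>(1)]
  have rd: "dim_row r = d" "dim_col r = ?D" unfolding r_def using d by auto
  have r: "r * \<iota> = 0\<^sub>m d (fst \<kappa>)" "r * ?c = 1\<^sub>m d"
    unfolding r_def using d r0 rc by (simp_all add: mat_assoc)
  have "r * (snd ?F a * (?c * r)) = r * snd ?F a" for a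
  proof -
    have "r * (snd ?F a * (\<iota> * (?L * S))) = r * ((snd ?F a * \<iota>) * (?L * S))"
      using d rd by (simp add: mat_assoc)
    also have "snd ?F a * \<iota> = \<iota> * snd \<kappa> a" using module_hom_comm[OF \<iota>] by simp
    also have "r * ((\<iota> * snd \<kappa> a) * (?L * S)) = (r * \<iota>) * (snd \<kappa> a * (?L * S))"
      using d rd by (simp add: mat_assoc)
    also have "\<dots> = 0\<^sub>m d ?D" unfolding r(1) using d by (simp add: mat_zero_mult)
    finally have z: "r * (snd ?F a * (\<iota> * (?L * S))) = 0\<^sub>m d ?D" .
    have "r * snd ?F a = r * (snd ?F a * (\<iota> * (?L * S) + ?c * r))"
      unfolding one using d rd by (simp add: mat_mult_one)
    also have "\<dots> = r * (snd ?F a * (\<iota> * (?L * S))) + r * (snd ?F a * (?c * r))"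
      using d rd by (simp add: mat_mult_add)
    finally show ?thesis unfolding z using d rd by (simp add: mat_group)
  qed
  then have M: "is_module (d, \<lambda>a. r * snd ?F a * ?c)" and hom: "r \<in> module_hom ?F (d, \<lambda>a. r * snd ?F a * ?c)"
    using quotient_module[OF free_module, of ?c d d r] d rd r(2) by (auto intro: carrier_matI)
  have \<nu>: "\<nu> = (\<lambda>a. r * snd ?F a * ?c)" by (simp add: \<nu>_def r_def)
  have "free_cover d \<nu> = r"
    using free_map_natural[OF free_module M hom, of ?c d] free_gens_carrier[of d] rd d
    unfolding free_cover_def \<nu> free_map_free_gens r(2) by (simp add: mat_mult_one)
  then show "\<nu> \<in> kernel_class d \<kappa>"
    using M \<iota> det r(1) unfolding kernel_class_def \<nu> by auto
  show "\<rho> = \<nu>" if "is_module (d, \<rho>)" "free_cover d \<rho> * \<iota> = 0\<^sub>m d (fst \<kappa>)"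
    using free_cover(5)[OF that(1)] uniq[OF that] unfolding \<nu> by (auto simp: fun_eq_iff)
qed

text \<open>Both \<open>\<kappa>\<close> and \<open>\<mu>\<close> are isomorphic to the kernel of
  the cover of \<open>\<rho>\<close>, hence to each other by \<open>h\<close>. Composition with
  \<open>h\<close> turns embeddings of \<open>\<mu>\<close> into embeddings of
  \<open>\<kappa>\<close> with the same image.\<close>

lemma kernel_class_subset:
  assumes \<kappa>: "is_module \<kappa>" "fst \<kappa> + d = d * algebra_dim" and \<mu>: "is_module \<mu>" "fst \<mu> + d = d * algebra_dim"
    and \<rho>: "\<rho> \<in> kernel_class d \<kappa>" "\<rho> \<in> kernel_class d \<mu>"
  shows "kernel_class d \<mu> \<subseteq> kernel_class d \<kappa>"
proof
  let ?D = "d * algebra_dim" and ?e = "fst \<kappa>" and ?c = "free_gens d" and ?F = "free d"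
  let ?L = "left_proj ?e d" and ?R = "right_proj ?e d"
  have e: "fst \<mu> = ?e" using \<kappa>(2) \<mu>(2) by simp
  obtain \<iota> j where \<rho>M: "is_module (d, \<rho>)" and \<iota>: "\<iota> \<in> module_hom \<kappa> ?F" "det (join_gens ?e d \<iota>) \<noteq> 0"
    "free_cover d \<rho> * \<iota> = 0\<^sub>m d ?e" and j: "j \<in> module_hom \<mu> ?F" "det (join_gens ?e d j) \<noteq> 0"
    "free_cover d \<rho> * j = 0\<^sub>m d ?e" using \<rho> by (auto simp: kernel_class_def e)
  obtain S where S: "S \<in> carrier_mat ?D ?D" "?L * (S * \<iota>) = 1\<^sub>m ?e"
    "\<iota> * (?L * S) + ?c * (?R * S) = 1\<^sub>m ?D" "free_cover d \<rho> = ?R * S"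
    using kernel_class_inverse[OF \<kappa> \<iota>(1,2)] \<rho>M \<iota>(3) by metis
  obtain S' where S': "S' \<in> carrier_mat ?D ?D" "?L * (S' * j) = 1\<^sub>m ?e"
    "j * (?L * S') + ?c * (?R * S') = 1\<^sub>m ?D" "free_cover d \<rho> = ?R * S'"
    using kernel_class_inverse[OF \<mu> j(1)] j(2) \<rho>M j(3) unfolding e by metis
  note d = module_hom_dim[OF \<iota>(1)] module_hom_dim[OF j(1)] e fst_free[of d] carrier_matD[OF free_gens_carrier[of d]]
    carrier_matD[OF S(1)] carrier_matD[OF S'(1)] \<kappa>(2) module_dim[OF free_module, of d] module_dim[OF \<kappa>(1)] module_dim[OF \<mu>(1)]
  define h where "h = ?L * (S' * \<iota>)"
  define h' where "h' = ?L * (S * j)"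
  have hd: "dim_row h = ?e" "dim_col h = ?e" "dim_row h' = ?e" "dim_col h' = ?e"
    unfolding h_def h'_def using d by auto
  have jh: "j * h = \<iota>"
  proof -
    have "\<iota> = (j * (?L * S') + ?c * (?R * S')) * \<iota>" unfolding S'(3) using d by (simp add: mat_one_mult)
    also have "\<dots> = j * h + ?c * (free_cover d \<rho> * \<iota>)"
      unfolding h_def S'(4) using d by (simp add: mat_add_mult mat_assoc)
    also have "\<dots> = j * h" unfolding \<iota>(3) using d hd by (simp add: mat_mult_zero mat_group)
    finally show ?thesis by simp
  qed
  have \<iota>h: "\<iota> * h' = j"
  proof -
    have "j = (\<iota> * (?L * S) + ?c * (?R * S)) * j" unfolding S(3) using d by (simp add: mat_one_mult)
    also have "\<dots> = \<iota> * h' + ?c * (free_cover d \<rho> * j)"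
      unfolding h'_def S(4) using d by (simp add: mat_add_mult mat_assoc)
    also have "\<dots> = \<iota> * h'" unfolding j(3) using d hd by (simp add: mat_mult_zero mat_group)
    finally show ?thesis by simp
  qed
  have hh: "h * h' = 1\<^sub>m ?e"
  proof -
    have "h * h' = ?L * (S' * (\<iota> * h'))" unfolding h_def using d hd by (simp add: mat_assoc)
    then show ?thesis unfolding \<iota>h S'(2) .
  qed
  have hom: "h \<in> module_hom \<kappa> \<mu>"
  proof (rule module_homI)
    fix a
    have "j * (h * snd \<kappa> a) = \<iota> * snd \<kappa> a" using d hd by (simp add: mat_assoc[symmetric] jh)
    also have "\<dots> = snd ?F a * \<iota>" by (rule module_hom_comm[OF \<iota>(1)])
    also have "\<dots> = (snd ?F a * j) * h" unfolding jh[symmetric] using d hd by (simp add: mat_assoc)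
    also have "\<dots> = j * (snd \<mu> a * h)"
      unfolding module_hom_comm[OF j(1), symmetric] using d hd by (simp add: mat_assoc)
    finally have "?L * (S' * (j * (h * snd \<kappa> a))) = ?L * (S' * (j * (snd \<mu> a * h)))" by simp
    then have "(?L * (S' * j)) * (h * snd \<kappa> a) = (?L * (S' * j)) * (snd \<mu> a * h)"
      using d hd by (simp add: mat_assoc)
    then show "h * snd \<kappa> a = snd \<mu> a * h" unfolding S'(2) using d hd by (simp add: mat_one_mult)
  qed (use hd e in \<open>auto intro: carrier_matI\<close>)
  fix \<sigma> assume "\<sigma> \<in> kernel_class d \<mu>"
  then obtain k where \<sigma>M: "is_module (d, \<sigma>)" and k: "k \<in> module_hom \<mu> ?F" "det (join_gens ?e d k) \<noteq> 0"
    "free_cover d \<sigma> * k = 0\<^sub>m d ?e" by (auto simp: kernel_class_def e)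
  note dk = module_hom_dim[OF k(1)] free_cover(3,4)[OF \<sigma>M]
  have kh: "k * h \<in> module_hom \<kappa> ?F" by (rule module_hom_comp[OF \<kappa>(1) \<mu>(1) free_module hom k(1)])
  have "free_cover d \<sigma> * (k * h) = (free_cover d \<sigma> * k) * h" using d hd dk by (simp add: mat_assoc)
  then have z: "free_cover d \<sigma> * (k * h) = 0\<^sub>m d ?e" unfolding k(3) using hd by (simp add: mat_zero_mult)
  \<comment> \<open>The block diagonal matrix of \<open>h'\<close> and an identity. It carries
    \<open>join_gens\<close> for \<open>k * h\<close> to \<open>join_gens\<close> for
    \<open>k\<close>, so the determinant for \<open>k * h\<close> is a factor of a nonzero
    one.\<close>
  define H where "H = ?L\<^sup>T * (h' * ?L) + ?R\<^sup>T * ?R"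
  have Hd: "dim_row H = ?D" "dim_col H = ?D" unfolding H_def using hd \<kappa>(2) by auto
  have Td: "dim_row (join_gens ?e d (k * h)) = ?D" "dim_col (join_gens ?e d (k * h)) = ?D"
    using join_gens_dim[OF \<kappa>(2), of "k * h"] d dk hd by auto
  have jp: "join_gens ?e d (k * h) * ?L\<^sup>T = k * h" "join_gens ?e d (k * h) * ?R\<^sup>T = ?c"
    using join_gens_proj[of "k * h" d ?e] d dk hd by auto
  have "join_gens ?e d (k * h) * H = (join_gens ?e d (k * h) * ?L\<^sup>T) * (h' * ?L) + (join_gens ?e d (k * h) * ?R\<^sup>T) * ?R"
    unfolding H_def using Td hd \<kappa>(2) by (simp add: mat_mult_add mat_assoc)
  also have "\<dots> = k * ((h * h') * ?L) + ?c * ?R"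
    unfolding jp using d dk hd by (simp add: mat_assoc)
  also have "\<dots> = join_gens ?e d k" unfolding hh join_gens_def by (simp add: mat_one_mult)
  finally have "join_gens ?e d (k * h) * H = join_gens ?e d k" .
  moreover have "det (join_gens ?e d (k * h) * H) = det (join_gens ?e d (k * h)) * det H"
    by (rule det_mult[OF carrier_matI carrier_matI]) (simp_all only: Td Hd)
  ultimately have "det (join_gens ?e d (k * h)) * det H = det (join_gens ?e d k)" by simp
  then have "det (join_gens ?e d (k * h)) \<noteq> 0" using k(2) by auto
  then show "\<sigma> \<in> kernel_class d \<kappa>" using \<sigma>M kh z by (auto simp: kernel_class_def)
qed

end

section \<open>Hereditary algebras are geometrically irreducible\<close>

context alg_closed_algebra
begin

text \<open>Two points of a kernel class are joined by the image of an open subset of the line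
  through the corresponding embeddings \<open>\<iota>\<close>.\<close>

lemma kernel_class_irreducible:
  assumes \<kappa>: "is_module \<kappa>" "fst \<kappa> + d = d * algebra_dim" and ne: "kernel_class d \<kappa> \<noteq> {}"
  shows "irreducible_family d (kernel_class d \<kappa>)"
  unfolding irreducible_family_def
proof (intro conjI ne ballI impI)
  show "is_module (d, \<rho>)" if "\<rho> \<in> kernel_class d \<kappa>" for \<rho> using that by (simp add: kernel_class_def)
  let ?D = "d * algebra_dim" and ?e = "fst \<kappa>"
  fix p q \<rho> \<sigma>
  assume pq: "p \<in> mod_polys d" "q \<in> mod_polys d" and \<rho>: "\<rho> \<in> kernel_class d \<kappa>" and \<sigma>: "\<sigma> \<in> kernel_class d \<kappa>"
    and p\<rho>: "rep_eval \<rho> p \<noteq> 0" and q\<sigma>: "rep_eval \<sigma> q \<noteq> 0"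
  obtain \<iota>0 where \<rho>M: "is_module (d, \<rho>)" and \<iota>0: "\<iota>0 \<in> module_hom \<kappa> (free d)" "det (join_gens ?e d \<iota>0) \<noteq> 0"
    "free_cover d \<rho> * \<iota>0 = 0\<^sub>m d ?e" using \<rho> by (auto simp: kernel_class_def)
  obtain \<iota>1 where \<sigma>M: "is_module (d, \<sigma>)" and \<iota>1: "\<iota>1 \<in> module_hom \<kappa> (free d)" "det (join_gens ?e d \<iota>1) \<noteq> 0"
    "free_cover d \<sigma> * \<iota>1 = 0\<^sub>m d ?e" using \<sigma> by (auto simp: kernel_class_def)
  define \<iota> where "\<iota> t = (1 - t) \<cdot>\<^sub>m \<iota>0 + t \<cdot>\<^sub>m \<iota>1" for t
  define T where "T t = join_gens ?e d (\<iota> t)" for t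
  define S where "S t = (1 / det (T t)) \<cdot>\<^sub>m adj_mat (T t)" for t
  define \<nu> where "\<nu> t a = right_proj ?e d * S t * snd (free d) a * free_gens d" for t a
  note d = module_hom_dim[OF \<iota>0(1)] module_hom_dim[OF \<iota>1(1)] fst_free[of d]
  have \<iota>hom: "\<iota> t \<in> module_hom \<kappa> (free d)" for t
    unfolding \<iota>_def by (intro module_hom_add module_hom_smult \<kappa>(1) free_module \<iota>0 \<iota>1)
  have \<iota>01: "\<iota> 0 = \<iota>0" "\<iota> 1 = \<iota>1" unfolding \<iota>_def using d by (auto intro!: eq_matI)
  have mem: "\<nu> t \<in> kernel_class d \<kappa>" if "det (T t) \<noteq> 0" for t
    using kernel_class_mem_iff(1)[OF \<kappa> \<iota>hom _ S_def[unfolded T_def]] that unfolding \<nu>_def[abs_def] T_def by blast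
  have \<nu>0: "\<nu> 0 = \<rho>"
    using kernel_class_mem_iff(2)[OF \<kappa> \<iota>hom[of 0] _ S_def[unfolded T_def] \<rho>M] \<iota>0 unfolding \<nu>_def[abs_def] \<iota>01 by simp
  have \<nu>1: "\<nu> 1 = \<sigma>"
    using kernel_class_mem_iff(2)[OF \<kappa> \<iota>hom[of 1] _ S_def[unfolded T_def] \<sigma>M] \<iota>1 unfolding \<nu>_def[abs_def] \<iota>01 by simp
  have Tfun: "function_algebra.mat_fun X \<A> ?D ?D T"
    if "function_algebra X \<A>" "(\<lambda>t. t) \<in> \<A>" for X and \<A> :: "('k \<Rightarrow> 'k) set"
  proof -
    interpret function_algebra X \<A> by (rule that(1))
    have "mat_fun ?D ?e \<iota>"
      unfolding \<iota>_def[abs_def]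
      by (intro mat_fun_add mat_fun_smult diff const that(2) mat_fun_const) (use d in auto)
    then show ?thesis
      unfolding T_def[abs_def] join_gens_def using \<kappa>(2) free_gens_carrier[of d]
      by (intro mat_fun_add mat_fun_mult[of _ ?e] mat_fun_mult[of _ d] mat_fun_const) (auto intro!: carrier_matI)
  qed
  interpret P: function_algebra UNIV "{f :: 'k \<Rightarrow> 'k. \<exists>u. \<forall>t. f t = poly u t}" by (rule polynomial_functions)
  have "(\<lambda>t. t) \<in> {f :: 'k \<Rightarrow> 'k. \<exists>u. \<forall>t. f t = poly u t}" by (auto intro!: exI[of _ "[:0, 1:]"])
  from P.det_fun[OF Tfun[OF polynomial_functions this]] obtain w where w: "\<And>t. det (T t) = poly w t" by auto
  let ?A = "{f. \<exists>N u. \<forall>t. det (T t) \<noteq> 0 \<longrightarrow> f t * det (T t) ^ N = poly u t}"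
  interpret R: function_algebra "{t. det (T t) \<noteq> 0}" ?A by (rule rational_functions[OF w])
  have t: "(\<lambda>t. t) \<in> ?A" by (auto intro!: exI[of _ 0] exI[of _ "[:0, 1:]"])
  have "\<exists>N u. \<forall>t. det (T t) \<noteq> 0 \<longrightarrow> 1 / det (T t) * det (T t) ^ N = poly u t"
    by (intro exI[of _ 1] exI[of _ 1]) auto
  then have inv: "(\<lambda>t. 1 / det (T t)) \<in> ?A" by simp
  have Sfun: "R.mat_fun ?D ?D S"
    unfolding S_def[abs_def] by (intro R.mat_fun_smult inv R.adj_fun Tfun[OF R.function_algebra_axioms t])
  have \<nu>fun: "R.mat_fun d d (\<lambda>t. \<nu> t a)" for a
    unfolding \<nu>_def using \<kappa>(2) free_gens_carrier[of d] module_carrier[OF free_module, of d a]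
    by (intro R.mat_fun_mult[of _ ?D] R.mat_fun_const Sfun) (auto simp: fst_free intro!: carrier_matI)
  have ev: "\<exists>N u. \<forall>t. det (T t) \<noteq> 0 \<longrightarrow> rep_eval (\<nu> t) p * det (T t) ^ N = poly u t" if p: "p \<in> mod_polys d" for p
  proof -
    have "(\<lambda>t. rep_eval (\<nu> t) p) \<in> ?A"
      unfolding rep_eval_def
    proof (rule eval_fun[OF R.function_algebra_axioms])
      fix m v assume "m \<in> Poly_Mapping.keys p" "v \<in> Poly_Mapping.keys m"
      then have "v \<in> mod_vars d" using p by (auto simp: poly_ring_in_def)
      then obtain a i j where "v = (a, i, j)" "i < d" "j < d" by (auto simp: mod_vars_def)
      then show "(\<lambda>t. case v of (a, i, j) \<Rightarrow> \<nu> t a $$ (i, j)) \<in> ?A"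
        using R.mat_fun_entry[OF \<nu>fun[of a]] by simp
    qed
    then show ?thesis by simp
  qed
  obtain N u where u: "\<And>t. det (T t) \<noteq> 0 \<Longrightarrow> rep_eval (\<nu> t) p * det (T t) ^ N = poly u t" using ev[OF pq(1)] by blast
  obtain N' v where v: "\<And>t. det (T t) \<noteq> 0 \<Longrightarrow> rep_eval (\<nu> t) q * det (T t) ^ N' = poly v t" using ev[OF pq(2)] by blast
  have T01: "det (T 0) \<noteq> 0" "det (T 1) \<noteq> 0" using \<iota>0(2) \<iota>1(2) by (auto simp: T_def \<iota>01)
  have "poly u 0 \<noteq> 0"
    using p\<rho> T01(1) unfolding u[OF T01(1), symmetric] \<nu>0 by simp
  moreover have "poly v 1 \<noteq> 0"
    using q\<sigma> T01(2) unfolding v[OF T01(2), symmetric] \<nu>1 by simp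
  moreover have "poly w 0 \<noteq> 0"
    using T01(1) unfolding w .
  \<comment> \<open>The three polynomials are nonzero by their values at 0, 1 and 0. At a common
    nonroot the embedding is admissible and both \<open>p\<close> and \<open>q\<close> are nonzero
    on the module that it defines.\<close>
  ultimately have "u * v * w \<noteq> 0" by auto
  then have "finite {t. poly (u * v * w) t = 0}" by (rule poly_roots_finite)
  from ex_new_if_finite[OF infinite_UNIV_alg_closed this] obtain t where "poly (u * v * w) t \<noteq> 0" by blast
  then have t: "poly u t \<noteq> 0" "poly v t \<noteq> 0" "poly w t \<noteq> 0" by simp_all
  then have dt: "det (T t) \<noteq> 0" unfolding w by simp
  have "rep_eval (\<nu> t) p \<noteq> 0" "rep_eval (\<nu> t) q \<noteq> 0"
    using u[OF dt] v[OF dt] t(1,2) by (metis mult_zero_left)+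
  then show "\<exists>\<tau>\<in>kernel_class d \<kappa>. rep_eval \<tau> p \<noteq> 0 \<and> rep_eval \<tau> q \<noteq> 0"
    using mem[OF dt] by blast
qed

theorem hereditary_imp_geometrically_irreducible:
  assumes hereditary
  shows geometrically_irreducible
  unfolding geometrically_irreducible_def
proof (intro allI ballI)
  fix d Z assume Z: "Z \<in> connected_components_of (mod_space d)"
  \<comment> \<open>The dimension condition makes the matrices \<open>join_gens\<close> square, and
    empty classes are left out because an irreducible family is nonempty.\<close>
  let ?U = "{kernel_class d \<kappa> | \<kappa>. projective \<kappa> \<and> fst \<kappa> + d = d * algebra_dim \<and> kernel_class d \<kappa> \<noteq> {}}"
  show "irreducible_space (subtopology (mod_space d) Z)"
  proof (rule components_irreducible[of d ?U, OF _ _ _ _ Z])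
    show "\<exists>U\<in>?U. \<rho> \<in> U" if \<rho>: "is_module (d, \<rho>)" for \<rho>
    proof -
      obtain \<kappa> where "projective \<kappa>" "fst \<kappa> + d = d * algebra_dim" "\<rho> \<in> kernel_class d \<kappa>"
        by (rule mem_kernel_class[OF assms \<rho>])
      then show ?thesis by (intro bexI[of _ "kernel_class d \<kappa>"] CollectI exI[of _ \<kappa>]) auto
    qed
  next
    fix U V assume U: "U \<in> ?U"
    then obtain \<kappa> where \<kappa>: "U = kernel_class d \<kappa>" "projective \<kappa>" "fst \<kappa> + d = d * algebra_dim" "kernel_class d \<kappa> \<noteq> {}"
      unfolding mem_Collect_eq by (elim exE conjE)
    note \<kappa>M = projective_module[OF \<kappa>(2)]
    show "irreducible_family d U"
      unfolding \<kappa>(1) by (rule kernel_class_irreducible[OF \<kappa>M \<kappa>(3,4)])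
    show "\<exists>g\<in>mod_polys d. rep_eval \<rho> g \<noteq> 0 \<and> (\<forall>\<sigma>. is_module (d, \<sigma>) \<longrightarrow> rep_eval \<sigma> g \<noteq> 0 \<longrightarrow> \<sigma> \<in> U)"
      if "\<rho> \<in> U" for \<rho>
      using that unfolding \<kappa>(1) by (rule kernel_class_open[OF \<kappa>(2,3)])
    assume V: "V \<in> ?U" and ne: "U \<inter> V \<noteq> {}"
    from V obtain \<mu> where \<mu>: "V = kernel_class d \<mu>" "projective \<mu>" "fst \<mu> + d = d * algebra_dim"
      unfolding mem_Collect_eq by (elim exE conjE)
    note \<mu>M = projective_module[OF \<mu>(2)]
    obtain \<rho> where \<rho>: "\<rho> \<in> kernel_class d \<kappa>" "\<rho> \<in> kernel_class d \<mu>"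
      using ne unfolding \<kappa>(1) \<mu>(1) by blast
    show "U = V"
      unfolding \<kappa>(1) \<mu>(1)
      by (rule equalityI kernel_class_subset[OF \<mu>M \<mu>(3) \<kappa>M \<kappa>(3) \<rho>(2,1)] kernel_class_subset[OF \<kappa>M \<kappa>(3) \<mu>M \<mu>(3) \<rho>])+
  qed
qed

end

section \<open>Dimensions of subspaces\<close>

context vector_space
begin

text \<open>In this group of lemmas the ambient space may be infinite-dimensional, and the finite
  set \<open>T\<close> witnesses finite dimension of the subspaces. The application is to functions
  on pairs of natural numbers.\<close>

lemma finite_basis:
  assumes "S \<subseteq> span T" "finite T"
  obtains B where "finite B" "B \<subseteq> S" "independent B" "S \<subseteq> span B" "card B = dim S"
proof -
  obtain B where B: "B \<subseteq> S" "independent B" "S \<subseteq> span B" "card B = dim S" using basis_exists[of S] by blast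
  moreover have "finite B" using independent_span_bound[OF assms(2) B(2)] B(1) assms(1) by blast
  ultimately show ?thesis using that by blast
qed

lemma dim_mono_finite:
  assumes "S \<subseteq> S'" "S' \<subseteq> span T" "finite T"
  shows "dim S \<le> dim S'"
proof -
  obtain B where "finite B" "B \<subseteq> S'" "independent B" "S' \<subseteq> span B" "card B = dim S'"
    by (rule finite_basis[OF assms(2,3)])
  then show ?thesis using dim_le_card[of S B] assms(1) by auto
qed

lemma extend_basis_finite:
  assumes "S \<subseteq> S'" "S' \<subseteq> span T" "finite T"
  obtains B B' where "finite B'" "B \<subseteq> B'" "B \<subseteq> S" "B' \<subseteq> S'" "independent B'" "S \<subseteq> span B" "S' \<subseteq> span B'"
    "card B = dim S" "card B' = dim S'"
proof -
  obtain B where B: "B \<subseteq> S" "independent B" "S \<subseteq> span B" "card B = dim S" using basis_exists[of S] by blast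
  obtain B' where B': "B \<subseteq> B'" "B' \<subseteq> S'" "independent B'" "S' \<subseteq> span B'"
    using maximal_independent_subset_extend[of B S'] B assms(1) by blast
  have "finite B'" using independent_span_bound[OF assms(3) B'(3)] B'(2) assms(2) by blast
  moreover have "card B' = dim S'" by (rule basis_card_eq_dim[OF B'(2,4,3)])
  ultimately show ?thesis using that[of B' B] B B' by blast
qed

lemma dim_strict_mono_finite:
  assumes "subspace S" "S \<subset> S'" "S' \<subseteq> span T" "finite T"
  shows "dim S < dim S'"
proof -
  obtain B B' where B: "finite B'" "B \<subseteq> B'" "B \<subseteq> S" "B' \<subseteq> S'" "independent B'" "S \<subseteq> span B"
    "S' \<subseteq> span B'" "card B = dim S" "card B' = dim S'"
    by (rule extend_basis_finite[OF psubset_imp_subset[OF assms(2)] assms(3,4)])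
  have "B \<noteq> B'"
  proof
    assume "B = B'"
    then have "S' \<subseteq> S" using B span_minimal[OF B(3) assms(1)] by blast
    then show False using assms(2) by blast
  qed
  then have "card B < card B'" using B by (intro psubset_card_mono) auto
  then show ?thesis using B by simp
qed

text \<open>The coordinates of \<open>x\<close> with respect to \<open>B'\<close> are supported in
  \<open>B\<close> and also in its complement, hence are all zero.\<close>

lemma span_disjoint:
  assumes B: "independent B'" "B \<subseteq> B'" and x: "x \<in> span B" "x \<in> span (B' - B)"
  shows "x = 0"
proof -
  have "representation B' x b = 0" for b
  proof (cases "b \<in> B")
    case True
    have "representation B' x = representation (B' - B) x"
      by (rule representation_extend[OF B(1) x(2)]) (rule Diff_subset)
    then show ?thesis using True representation_ne_zero[of "B' - B" x b] by auto
  next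
    case False
    have "representation B' x = representation B x"
      by (rule representation_extend[OF B(1) x(1) B(2)])
    then show ?thesis using False representation_ne_zero[of B x b] by auto
  qed
  then show ?thesis
    using sum_nonzero_representation_eq[OF B(1), of x] x(1) span_mono[OF B(2)] by auto
qed

lemma independent_Un_if_span_disjoint:
  assumes fin: "finite C" "finite W" and ind: "independent C" "independent W"
    and disj: "\<And>x. \<lbrakk>x \<in> span C; x \<in> span W\<rbrakk> \<Longrightarrow> x = 0"
  shows "independent (C \<union> W)" "C \<inter> W = {}"
proof -
  show CW: "C \<inter> W = {}"
  proof (rule ccontr)
    assume "C \<inter> W \<noteq> {}"
    then obtain x where x: "x \<in> C" "x \<in> W" by blast
    then have "x = 0" using disj[OF span_base span_base] by blast
    then show False using x ind(1) dependent_zero by blast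
  qed
  show "independent (C \<union> W)"
  proof (rule independent_if_scalars_zero)
    fix u x assume s: "(\<Sum>x\<in>C \<union> W. scale (u x) x) = 0" and x: "x \<in> C \<union> W"
    have eq: "(\<Sum>x\<in>C. scale (u x) x) + (\<Sum>x\<in>W. scale (u x) x) = 0"
      using s by (simp only: sum.union_disjoint[OF fin CW])
    have W: "(\<Sum>x\<in>W. scale (u x) x) \<in> span W" by (intro span_sum span_scale span_base)
    have C: "(\<Sum>x\<in>C. scale (u x) x) \<in> span C" by (intro span_sum span_scale span_base)
    have "(\<Sum>x\<in>C. scale (u x) x) = - (\<Sum>x\<in>W. scale (u x) x)" using eq by (simp only: add_eq_0_iff2)
    then have "(\<Sum>x\<in>C. scale (u x) x) \<in> span W" using span_neg[OF W] by (simp only:)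
    from disj[OF C this] have C0: "(\<Sum>x\<in>C. scale (u x) x) = 0" .
    then have "(\<Sum>x\<in>W. scale (u x) x) = 0" using eq by simp
    then show "u x = 0"
      using x independentD[OF ind(1) fin(1) subset_refl C0] independentD[OF ind(2) fin(2) subset_refl] by blast
  qed (use fin in simp)
qed

text \<open>Rank and nullity for the restriction of \<open>f\<close> to \<open>S\<close>: a basis of
  the kernel is extended to a basis of \<open>S\<close>, and \<open>f\<close> maps the added vectors
  bijectively onto a basis of the image.\<close>

lemma dim_kernel_image:
  assumes f: "Vector_Spaces.linear scale scale f" and S: "subspace S" "S \<subseteq> span T" "finite T"
  shows "dim S = dim {x \<in> S. f x = 0} + dim (f ` S)"
proof -
  interpret f: Vector_Spaces.linear scale scale f by (rule f)
  interpret p: vector_space_pair scale scale by unfold_locales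
  let ?N = "{x \<in> S. f x = 0}"
  obtain B B' where B: "finite B'" "B \<subseteq> B'" "B \<subseteq> ?N" "B' \<subseteq> S" "independent B'" "?N \<subseteq> span B" "S \<subseteq> span B'"
    "card B = dim ?N" "card B' = dim S"
    by (rule extend_basis_finite[of ?N S T]) (use S in auto)
  let ?C = "B' - B"
  have CS: "span ?C \<subseteq> S" using B(4) S(1) by (intro span_minimal) auto
  have zero: "x = 0" if x: "x \<in> span ?C" "f x = 0" for x
  proof -
    have "x \<in> span B" using x CS B(6) by blast
    then show ?thesis by (rule span_disjoint[OF B(5,2) _ x(1)])
  qed
  have inj: "inj_on f (span ?C)"
  proof (rule inj_onI)
    fix x y assume xy: "x \<in> span ?C" "y \<in> span ?C" "f x = f y"
    have "f (x - y) = 0" unfolding f.diff xy(3) by (rule diff_self)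
    then have "x - y = 0" by (rule zero[OF span_diff[OF xy(1,2)]])
    then show "x = y" by (simp only: right_minus_eq)
  qed
  have ind: "independent (f ` ?C)"
    by (rule p.linear_independent_injective_image[OF f independent_mono[OF B(5)] inj]) (rule Diff_subset)
  have "f ` S \<subseteq> span (f ` ?C)"
  proof
    fix y assume "y \<in> f ` S"
    then have "y \<in> f ` span B'" using B(7) by blast
    then have "y \<in> span (f ` B')" using p.linear_span_image[OF f, of B'] by simp
    also have "span (f ` B') \<subseteq> span (f ` ?C)"
    proof (rule span_minimal)
      show "f ` B' \<subseteq> span (f ` ?C)"
      proof
        fix z assume "z \<in> f ` B'"
        then obtain b where b: "b \<in> B'" "z = f b" by blast
        show "z \<in> span (f ` ?C)"
        proof (cases "b \<in> B")
          case True
          then have "z = 0" using B(3) b by blast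
          then show ?thesis by (simp only: span_zero)
        next
          case False
          then show ?thesis using b by (intro span_base) blast
        qed
      qed
    qed (rule subspace_span)
    finally show "y \<in> span (f ` ?C)" .
  qed
  moreover have "f ` ?C \<subseteq> f ` S" using B(4) by blast
  ultimately have "card (f ` ?C) = dim (f ` S)" using ind by (intro basis_card_eq_dim)
  moreover have "card (f ` ?C) = card ?C"
    by (rule card_image[OF inj_on_subset[OF inj span_superset]])
  moreover have "card ?C + card B = card B'"
    using B(1,2) by (simp add: card_Diff_subset finite_subset card_mono)
  ultimately show ?thesis using B(8,9) by simp
qed

lemma dim_image_le_finite:
  assumes "Vector_Spaces.linear scale scale f" "subspace S" "S \<subseteq> span T" "finite T"
  shows "dim (f ` S) \<le> dim S"
  using dim_kernel_image[OF assms] by simp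

lemma dim_less_by_two_maps:
  assumes f: "Vector_Spaces.linear scale scale f" and g: "Vector_Spaces.linear scale scale g"
    and S: "subspace S" "S \<subseteq> span T" and S': "subspace S'" "S' \<subseteq> span T" and T: "finite T"
    and f_less: "f ` S \<subset> f ` S'" and g_le: "g ` {x \<in> S. f x = 0} \<subseteq> g ` {x \<in> S'. f x = 0}"
    and ker: "\<And>x. \<lbrakk>x \<in> S; f x = 0; g x = 0\<rbrakk> \<Longrightarrow> x \<in> S'"
  shows "dim S < dim S'"
proof -
  interpret f: Vector_Spaces.linear scale scale f by (rule f)
  interpret g: Vector_Spaces.linear scale scale g by (rule g)
  have sub: "subspace {x \<in> U. f x = 0}" if "subspace U" for U
    using that by (auto simp: subspace_def f.add f.scale f.zero)
  have span: "h ` U \<subseteq> span (h ` T)" if "Vector_Spaces.linear scale scale h" "U \<subseteq> span T" for h U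
  proof -
    interpret h: Vector_Spaces.linear scale scale h by (rule that(1))
    show ?thesis using that(2) by (auto simp: h.span_image)
  qed
  let ?K = "{x \<in> S. f x = 0}" and ?K' = "{x \<in> S'. f x = 0}"
  have K: "subspace ?K" "?K \<subseteq> span T" "subspace ?K'" "?K' \<subseteq> span T" using sub S S' by auto
  have "dim (f ` S) < dim (f ` S')"
    by (rule dim_strict_mono_finite[OF f.subspace_image[OF S(1)] f_less span[OF f S'(2)] finite_imageI[OF T]])
  moreover have "dim (g ` ?K) \<le> dim (g ` ?K')"
    by (rule dim_mono_finite[OF g_le span[OF g K(4)] finite_imageI[OF T]])
  moreover have "dim {x \<in> ?K. g x = 0} \<le> dim {x \<in> ?K'. g x = 0}"
    by (rule dim_mono_finite[OF _ _ T]) (use ker S'(2) in auto)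
  ultimately show ?thesis
    using dim_kernel_image[OF f S T] dim_kernel_image[OF f S' T] dim_kernel_image[OF g K(1,2) T]
      dim_kernel_image[OF g K(3,4) T] by linarith
qed

end

section \<open>Dimensions of homomorphism spaces\<close>

text \<open>Matrices of a fixed format are coded as functions on indices, so that the theory of
  vector spaces over a type applies.\<close>

interpretation fun_vs: vector_space "\<lambda>c (h :: 'i \<Rightarrow> 'k::field) i. c * h i"
  by unfold_locales (auto simp: fun_eq_iff algebra_simps)

lemma sum_fun_apply: "sum f A i = (\<Sum>a\<in>A. f a i)"
  for f :: "'a \<Rightarrow> 'i \<Rightarrow> 'b::comm_monoid_add"
  by (induction A rule: infinite_finite_induct) simp_all

definition box_funs :: "nat \<Rightarrow> nat \<Rightarrow> (nat \<times> nat \<Rightarrow> 'k::field) set" where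
  "box_funs n d = {h. \<forall>i j. \<not> (i < n \<and> j < d) \<longrightarrow> h (i, j) = 0}"

definition mat_fun_of :: "'k::field mat \<Rightarrow> nat \<times> nat \<Rightarrow> 'k" where
  "mat_fun_of A = (\<lambda>(i, j). if i < dim_row A \<and> j < dim_col A then A $$ (i, j) else 0)"

lemma mat_mat_fun_of: "A \<in> carrier_mat n d \<Longrightarrow> mat n d (mat_fun_of A) = A"
  by (intro eq_matI) (auto simp: mat_fun_of_def)

lemma mat_fun_of_mat: "h \<in> box_funs n d \<Longrightarrow> mat_fun_of (mat n d h) = h"
  by (auto simp: mat_fun_of_def box_funs_def fun_eq_iff)

lemma mat_fun_of_box: "A \<in> carrier_mat n d \<Longrightarrow> mat_fun_of A \<in> box_funs n d"
  by (auto simp: mat_fun_of_def box_funs_def)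

lemma mat_add_fun: "mat n d (\<lambda>i. g i + h i) = mat n d g + mat n d h"
  and mat_smult_fun: "mat n d (\<lambda>i. c * h i) = c \<cdot>\<^sub>m mat n d h"
  by (auto intro!: eq_matI)

lemma mat_fun_of_add: "\<lbrakk>A \<in> carrier_mat n d; B \<in> carrier_mat n d\<rbrakk> \<Longrightarrow> mat_fun_of (A + B) = (\<lambda>i. mat_fun_of A i + mat_fun_of B i)"
  and mat_fun_of_smult: "mat_fun_of (c \<cdot>\<^sub>m A) = (\<lambda>i. c * mat_fun_of A i)"
  by (auto simp: mat_fun_of_def fun_eq_iff)

lemma subspace_box_funs: "fun_vs.subspace (box_funs n d)"
  by (rule fun_vs.subspaceI) (auto simp: box_funs_def)

lemma box_funs_finite_span:
  obtains T :: "(nat \<times> nat \<Rightarrow> 'k::field) set" where "finite T" "box_funs n d \<subseteq> fun_vs.span T"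
proof -
  define \<delta> where "\<delta> p = (\<lambda>q. if q = p then 1 else 0 :: 'k)" for p :: "nat \<times> nat"
  let ?I = "{..<n} \<times> {..<d}"
  have "h \<in> fun_vs.span (\<delta> ` ?I)" if h: "h \<in> box_funs n d" for h
  proof -
    have "(\<Sum>p\<in>?I. (\<lambda>q. h p * \<delta> p q)) \<in> fun_vs.span (\<delta> ` ?I)"
      by (intro fun_vs.span_sum fun_vs.span_scale fun_vs.span_base) simp
    moreover have "(\<Sum>p\<in>?I. (\<lambda>q. h p * \<delta> p q)) = h"
    proof
      fix q
      have "(\<Sum>p\<in>?I. (\<lambda>q. h p * \<delta> p q)) q = (\<Sum>p\<in>?I. if p = q then h p else 0)"
        unfolding sum_fun_apply \<delta>_def by (intro sum.cong) auto
      also have "\<dots> = h q" using h by (cases q) (auto simp: box_funs_def)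
      finally show "(\<Sum>p\<in>?I. (\<lambda>q. h p * \<delta> p q)) q = h q" .
    qed
    ultimately show ?thesis by simp
  qed
  then show ?thesis by (intro that[of "\<delta> ` ?I"]) auto
qed

context fin_dim_algebra
begin

definition hom_funs :: "('a, 'k) rep \<Rightarrow> ('a, 'k) rep \<Rightarrow> (nat \<times> nat \<Rightarrow> 'k) set" where
  "hom_funs M N = {h \<in> box_funs (fst N) (fst M). mat (fst N) (fst M) h \<in> module_hom M N}"

definition hom_dim :: "('a, 'k) rep \<Rightarrow> ('a, 'k) rep \<Rightarrow> nat" where
  "hom_dim M N = fun_vs.dim (hom_funs M N)"

lemma subspace_hom_funs: "\<lbrakk>is_module M; is_module N\<rbrakk> \<Longrightarrow> fun_vs.subspace (hom_funs M N)"
proof (rule fun_vs.subspaceI)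
  assume MN: "is_module M" "is_module N"
  have "mat (fst N) (fst M) (\<lambda>_. 0) = (0\<^sub>m (fst N) (fst M) :: 'k mat)" by (intro eq_matI) auto
  then show "0 \<in> hom_funs M N"
    using module_hom_zero[OF MN] by (simp add: hom_funs_def box_funs_def zero_fun_def)
  show "g + h \<in> hom_funs M N" if "g \<in> hom_funs M N" "h \<in> hom_funs M N" for g h
    using that module_hom_add[OF MN] by (simp add: hom_funs_def box_funs_def plus_fun_def mat_add_fun)
  show "(\<lambda>i. c * h i) \<in> hom_funs M N" if "h \<in> hom_funs M N" for c h
    using that module_hom_smult[OF MN] by (simp add: hom_funs_def box_funs_def mat_smult_fun)
qed

lemma hom_funs_subset_box: "hom_funs M N \<subseteq> box_funs (fst N) (fst M)"
  by (auto simp: hom_funs_def)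

lemma mat_fun_of_hom: "A \<in> module_hom M N \<Longrightarrow> mat_fun_of A \<in> hom_funs M N"
  using module_hom_carrier[of A M N] by (simp add: hom_funs_def mat_fun_of_box mat_mat_fun_of)

text \<open>The action is linear in the algebra element, so commuting with a basis is enough. This
  turns the condition into a finite system of linear equations, to which minors can be
  applied.\<close>

lemma hom_funs_basisI:
  assumes M: "is_module M" and N: "is_module N" and h: "h \<in> box_funs (fst N) (fst M)"
    and comm: "\<And>l i j. \<lbrakk>l < algebra_dim; i < fst N; j < fst M\<rbrakk> \<Longrightarrow>
      (\<Sum>k<fst M. h (i, k) * snd M (basis ! l) $$ (k, j)) = (\<Sum>k<fst N. snd N (basis ! l) $$ (i, k) * h (k, j))"
  shows "h \<in> hom_funs M N"
proof -
  have "mat (fst N) (fst M) h \<in> module_hom M N"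
  proof (rule module_homI)
    fix a
    show "mat (fst N) (fst M) h * snd M a = snd N a * mat (fst N) (fst M) h"
    proof (rule eq_matI)
      fix i j assume "i < dim_row (snd N a * mat (fst N) (fst M) h)" "j < dim_col (snd N a * mat (fst N) (fst M) h)"
      then have ij: "i < fst N" "j < fst M" using M N by auto
      have "(mat (fst N) (fst M) h * snd M a) $$ (i, j) = (\<Sum>k<fst M. h (i, k) * snd M a $$ (k, j))"
        using ij M by (simp add: scalar_prod_def lessThan_atLeast0)
      also have "\<dots> = (\<Sum>k<fst M. \<Sum>l<algebra_dim. coord a l * (h (i, k) * snd M (basis ! l) $$ (k, j)))"
        using ij by (simp add: module_entry_coord[OF M, of _ _ a] sum_distrib_left mult_ac)
      also have "\<dots> = (\<Sum>l<algebra_dim. coord a l * (\<Sum>k<fst M. h (i, k) * snd M (basis ! l) $$ (k, j)))"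
        by (subst sum.swap) (simp add: sum_distrib_left)
      also have "\<dots> = (\<Sum>l<algebra_dim. coord a l * (\<Sum>k<fst N. snd N (basis ! l) $$ (i, k) * h (k, j)))"
        using ij comm by simp
      also have "\<dots> = (\<Sum>k<fst N. \<Sum>l<algebra_dim. coord a l * (snd N (basis ! l) $$ (i, k) * h (k, j)))"
        by (subst sum.swap) (simp add: sum_distrib_left)
      also have "\<dots> = (\<Sum>k<fst N. snd N a $$ (i, k) * h (k, j))"
        using ij by (simp add: module_entry_coord[OF N, of _ _ a] sum_distrib_right mult.assoc)
      also have "\<dots> = (snd N a * mat (fst N) (fst M) h) $$ (i, j)"
        using ij N by (simp add: scalar_prod_def lessThan_atLeast0)
      finally show "(mat (fst N) (fst M) h * snd M a) $$ (i, j) = (snd N a * mat (fst N) (fst M) h) $$ (i, j)" .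
    qed (use M N in auto)
  qed simp
  then show ?thesis using h by (simp add: hom_funs_def)
qed

text \<open>A complement \<open>W\<close> of the space of homomorphisms out of \<open>\<rho>\<close> remains transversal to the
  space of homomorphisms out of \<open>\<sigma>\<close> as long as a suitable minor does not vanish.\<close>

lemma hom_dim_upper_semicontinuous:
  assumes \<rho>: "is_module (d, \<rho>)" and N: "is_module N"
  shows "\<exists>f\<in>mod_polys d. rep_eval \<rho> f \<noteq> 0 \<and>
    (\<forall>\<sigma>. is_module (d, \<sigma>) \<longrightarrow> rep_eval \<sigma> f \<noteq> 0 \<longrightarrow> hom_dim (d, \<sigma>) N \<le> hom_dim (d, \<rho>) N)"
proof -
  let ?n = "fst N"
  obtain T :: "(nat \<times> nat \<Rightarrow> 'k) set" where T: "finite T" "box_funs ?n d \<subseteq> fun_vs.span T" using box_funs_finite_span by blast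
  have sub: "hom_funs (d, \<sigma>) N \<subseteq> box_funs ?n d" for \<sigma> using hom_funs_subset_box[of "(d, \<sigma>)" N] by simp
  obtain B B' where B: "finite B'" "B \<subseteq> B'" "B \<subseteq> hom_funs (d, \<rho>) N" "B' \<subseteq> box_funs ?n d" "fun_vs.independent B'"
    "hom_funs (d, \<rho>) N \<subseteq> fun_vs.span B" "box_funs ?n d \<subseteq> fun_vs.span B'"
    "card B = fun_vs.dim (hom_funs (d, \<rho>) N)" "card B' = fun_vs.dim (box_funs ?n d :: (nat \<times> nat \<Rightarrow> 'k) set)"
    by (rule fun_vs.extend_basis_finite[OF sub T(2,1)])
  define W where "W = B' - B"
  have W: "finite W" "W \<subseteq> box_funs ?n d" using B by (auto simp: W_def)
  have Wind: "fun_vs.independent W" unfolding W_def by (rule fun_vs.independent_mono[OF B(5) Diff_subset])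
  obtain ws where ws: "distinct ws" "set ws = W" using finite_distinct_list[OF W(1)] by blast
  let ?r = "length ws"
  obtain xs where xs: "set xs = {..<algebra_dim} \<times> {..<?n} \<times> {..<d}"
    using finite_list[of "{..<algebra_dim} \<times> {..<?n} \<times> {..<d}"] by auto
  define D where "D \<sigma> h = (\<lambda>(l, i, j). (\<Sum>k<d. h (i, k) * \<sigma> (basis ! l) $$ (k, j)) - (\<Sum>k<?n. snd N (basis ! l) $$ (i, k) * h (k, j)))"
    for \<sigma> h
  have Dmem: "h \<in> hom_funs (d, \<sigma>) N" if "is_module (d, \<sigma>)" "h \<in> box_funs ?n d" "\<And>p. p \<in> set xs \<Longrightarrow> D \<sigma> h p = 0" for \<sigma> h
  proof (rule hom_funs_basisI[OF that(1) N])
    fix l i j assume "l < algebra_dim" "i < ?n" "j < fst (d, \<sigma>)"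
    then have "D \<sigma> h (l, i, j) = 0" using that(3)[of "(l, i, j)"] xs by simp
    then show "(\<Sum>k<fst (d, \<sigma>). h (i, k) * snd (d, \<sigma>) (basis ! l) $$ (k, j)) = (\<Sum>k<?n. snd N (basis ! l) $$ (i, k) * h (k, j))"
      by (simp add: D_def)
  qed (use that(2) in simp)
  have Dzero: "D \<sigma> h p = 0" if h: "h \<in> hom_funs (d, \<sigma>) N" and p: "p \<in> set xs" and \<sigma>: "is_module (d, \<sigma>)" for \<sigma> h p
  proof -
    obtain l i j where lij: "p = (l, i, j)" "i < ?n" "j < d" using p xs by auto
    have "(mat ?n d h * \<sigma> (basis ! l)) $$ (i, j) = (snd N (basis ! l) * mat ?n d h) $$ (i, j)"
      using module_hom_comm[of "mat ?n d h" "(d, \<sigma>)" N "basis ! l"] h by (simp add: hom_funs_def)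
    then show ?thesis
      using lij module_dim[OF \<sigma>, of "basis ! l"] module_dim[OF N, of "basis ! l"]
      by (simp add: D_def scalar_prod_def lessThan_atLeast0)
  qed
  \<comment> \<open>The columns are the defects \<open>D\<close> of the basis vectors of
    \<open>W\<close>, that is, their failure to commute with the action. At \<open>\<rho>\<close>
    the matrix is injective because \<open>W\<close> contains no nonzero homomorphism; a left
    inverse \<open>G\<close> at \<open>\<rho>\<close> selects the polynomial
    \<open>det (G * A \<sigma>)\<close> that keeps it injective.\<close>
  define A where "A \<sigma> = mat (length xs) ?r (\<lambda>(p, q). D \<sigma> (ws ! q) (xs ! p))" for \<sigma>
  define comb where "comb u = (\<Sum>w\<in>W. (\<lambda>i. u w * w i))" for u
  have comb_eq: "comb u i = (\<Sum>q<?r. u (ws ! q) * (ws ! q) i)" for u i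
  proof -
    have "comb u i = (\<Sum>w\<in>W. u w * w i)" unfolding comb_def by (simp only: sum_fun_apply)
    also have "\<dots> = (\<Sum>q<?r. u (ws ! q) * (ws ! q) i)"
      using sum.reindex_bij_betw[OF bij_betw_nth[OF ws(1) refl ws(2)[symmetric]], of "\<lambda>w. u w * w i"] by simp
    finally show ?thesis .
  qed
  have Dcomb: "D \<sigma> (comb u) p = (\<Sum>q<?r. D \<sigma> (ws ! q) p * u (ws ! q))" for \<sigma> u p
  proof -
    obtain l i j where p: "p = (l, i, j)" by (cases p)
    have "(\<Sum>k<d. comb u (i, k) * \<sigma> (basis ! l) $$ (k, j)) =
        (\<Sum>q<?r. (\<Sum>k<d. (ws ! q) (i, k) * \<sigma> (basis ! l) $$ (k, j)) * u (ws ! q))"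
      unfolding comb_eq sum_distrib_right by (subst sum.swap) (simp add: mult_ac)
    moreover have "(\<Sum>k<?n. snd N (basis ! l) $$ (i, k) * comb u (k, j)) =
        (\<Sum>q<?r. (\<Sum>k<?n. snd N (basis ! l) $$ (i, k) * (ws ! q) (k, j)) * u (ws ! q))"
      unfolding comb_eq sum_distrib_right sum_distrib_left by (subst sum.swap) (simp add: mult_ac)
    ultimately show ?thesis by (simp add: D_def p sum_subtractf left_diff_distrib)
  qed
  have Avec: "A \<sigma> *\<^sub>v vec ?r (\<lambda>q. u (ws ! q)) = vec (length xs) (\<lambda>p. D \<sigma> (comb u) (xs ! p))" for \<sigma> u
    by (intro eq_vecI) (auto simp: A_def scalar_prod_def Dcomb lessThan_atLeast0)
  have comb_span: "comb u \<in> fun_vs.span W" for u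
    unfolding comb_def by (intro fun_vs.span_sum fun_vs.span_scale fun_vs.span_base)
  have comb_box: "comb u \<in> box_funs ?n d" for u
    using comb_span[of u] fun_vs.span_minimal[OF W(2) subspace_box_funs] by blast
  have comb_zero: "u w = 0" if "comb u = 0" "w \<in> W" for u w
    using fun_vs.independentD[OF Wind W(1) subset_refl, of u w] that by (simp add: comb_def)
  have "v = 0\<^sub>v ?r" if v: "v \<in> carrier_vec ?r" and z: "A \<rho> *\<^sub>v v = 0\<^sub>v (length xs)" for v
  proof -
    define u where "u w = (if w \<in> W then v $ (SOME q. q < ?r \<and> ws ! q = w) else 0)" for w
    have uq: "u (ws ! q) = v $ q" if "q < ?r" for q
    proof -
      have "(SOME q'. q' < ?r \<and> ws ! q' = ws ! q) = q"
        using that ws(1) by (intro some_equality) (auto simp: nth_eq_iff_index_eq)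
      then show ?thesis using that ws(2) by (auto simp: u_def)
    qed
    have "vec ?r (\<lambda>q. u (ws ! q)) = v" using v uq by (intro eq_vecI) auto
    then have Dv: "vec (length xs) (\<lambda>p. D \<rho> (comb u) (xs ! p)) = 0\<^sub>v (length xs)"
      unfolding Avec[of \<rho> u, symmetric] using z by simp
    have "D \<rho> (comb u) p = 0" if p: "p \<in> set xs" for p
    proof -
      obtain k where k: "k < length xs" "p = xs ! k" using p unfolding in_set_conv_nth by blast
      show ?thesis using arg_cong[OF Dv, of "\<lambda>v. v $ k"] k by simp
    qed
    then have "comb u \<in> hom_funs (d, \<rho>) N" by (rule Dmem[OF \<rho> comb_box])
    then have "comb u \<in> fun_vs.span B" using B(6) by blast
    then have c0: "comb u = 0" using comb_span[of u] unfolding W_def by (rule fun_vs.span_disjoint[OF B(5,2)])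
    show ?thesis
    proof (rule eq_vecI)
      fix q assume "q < dim_vec (0\<^sub>v ?r :: 'k vec)"
      then have q: "q < ?r" by simp
      have "ws ! q \<in> W" using nth_mem[OF q] ws(2) by simp
      then show "v $ q = 0\<^sub>v ?r $ q" using comb_zero[OF c0] uq[OF q] q by simp
    qed (use v in simp)
  qed
  then obtain G where G: "G \<in> carrier_mat ?r (length xs)" "G * A \<rho> = 1\<^sub>m ?r"
    using mat_left_inverse[of "A \<rho>" "length xs" ?r] by (auto simp: A_def)
  have Afun: "rf.mat_fun d (length xs) ?r A"
  proof (rule rf.mat_funI)
    fix p q assume pq: "p < length xs" "q < ?r"
    obtain l i j where lij: "xs ! p = (l, i, j)" "i < ?n" "j < d" using nth_mem[OF pq(1)] unfolding xs by auto
    have "(\<lambda>\<sigma>. D \<sigma> (ws ! q) (xs ! p)) \<in> {F. \<exists>p\<in>mod_polys d. \<forall>\<rho>. is_module (d, \<rho>) \<longrightarrow> F \<rho> = rep_eval \<rho> p}"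
      unfolding D_def lij(1) split_conv
      by (intro rf.diff rf.sum rf.mult rf.const rf.mat_fun_entry[OF rep_mat_fun] lij(3)) simp_all
    then show "(\<lambda>\<sigma>. A \<sigma> $$ (p, q)) \<in> {F. \<exists>p\<in>mod_polys d. \<forall>\<rho>. is_module (d, \<rho>) \<longrightarrow> F \<rho> = rep_eval \<rho> p}"
      using pq by (simp add: A_def)
  qed (simp add: A_def)
  from rep_fun_poly[OF rf.det_fun[OF rf.mat_fun_mult[OF rf.mat_fun_const[OF G(1)] Afun]]]
  obtain f where f: "f \<in> mod_polys d" "\<And>\<sigma>. is_module (d, \<sigma>) \<Longrightarrow> rep_eval \<sigma> f = det (G * A \<sigma>)" by blast
  show ?thesis
  proof (intro bexI[OF _ f(1)] conjI allI impI)
    show "rep_eval \<rho> f \<noteq> 0" using f(2)[OF \<rho>] G(2) by simp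
    fix \<sigma> assume \<sigma>: "is_module (d, \<sigma>)" and nz: "rep_eval \<sigma> f \<noteq> 0"
    have GA: "G * A \<sigma> \<in> carrier_mat ?r ?r" using G by (auto simp: A_def)
    obtain S where S: "S \<in> carrier_mat ?r ?r" "S * (G * A \<sigma>) = 1\<^sub>m ?r"
      using det_nonzero_inverse[OF GA] nz f(2)[OF \<sigma>] by metis
    obtain C where C: "finite C" "C \<subseteq> hom_funs (d, \<sigma>) N" "fun_vs.independent C" "hom_funs (d, \<sigma>) N \<subseteq> fun_vs.span C"
      "card C = fun_vs.dim (hom_funs (d, \<sigma>) N)"
      by (rule fun_vs.finite_basis[OF subset_trans[OF sub T(2)] T(1)])
    have disj: "x = 0" if x: "x \<in> fun_vs.span C" "x \<in> fun_vs.span W" for x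
    proof -
      have xh: "x \<in> hom_funs (d, \<sigma>) N"
        using x(1) fun_vs.span_minimal[OF C(2) subspace_hom_funs[OF \<sigma> N]] by blast
      obtain u where u: "x = comb u"
        using x(2) unfolding fun_vs.span_finite[OF W(1)] comb_def by blast
      have "vec (length xs) (\<lambda>p. D \<sigma> (comb u) (xs ! p)) = 0\<^sub>v (length xs)"
        using Dzero[OF xh _ \<sigma>] unfolding u by (intro eq_vecI) auto
      then have z: "A \<sigma> *\<^sub>v vec ?r (\<lambda>q. u (ws ! q)) = 0\<^sub>v (length xs)" by (simp add: Avec)
      have Ad: "dim_row (A \<sigma>) = length xs" "dim_col (A \<sigma>) = ?r" by (auto simp: A_def)
      have "vec ?r (\<lambda>q. u (ws ! q)) = (S * (G * A \<sigma>)) *\<^sub>v vec ?r (\<lambda>q. u (ws ! q))"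
        unfolding S(2) by simp
      also have "\<dots> = S *\<^sub>v (G *\<^sub>v (A \<sigma> *\<^sub>v vec ?r (\<lambda>q. u (ws ! q))))"
        using S(1) G(1) Ad by (simp add: mat_vec_assoc)
      also have "\<dots> = 0\<^sub>v ?r" unfolding z using S(1) G(1) by (intro eq_vecI) (auto simp: scalar_prod_def)
      finally have v0: "vec ?r (\<lambda>q. u (ws ! q)) = 0\<^sub>v ?r" .
      have "u (ws ! q) = 0" if "q < ?r" for q
        using arg_cong[OF v0, of "\<lambda>v. v $ q"] that by simp
      then show "x = 0" unfolding u by (auto simp: fun_eq_iff comb_eq)
    qed
    note CW = fun_vs.independent_Un_if_span_disjoint[OF C(1) W(1) C(3) Wind disj]
    have "C \<union> W \<subseteq> fun_vs.span B'" using C(2) W(2) sub B(7) by blast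
    then have "card (C \<union> W) \<le> card B'" using fun_vs.independent_span_bound[OF B(1) CW(1)] by blast
    moreover have "card (C \<union> W) = card C + card W" by (rule card_Un_disjoint[OF C(1) W(1) CW(2)])
    moreover have "card B' = card B + card W"
      unfolding W_def using B(1,2) by (simp add: card_Diff_subset finite_subset card_mono)
    ultimately show "hom_dim (d, \<sigma>) N \<le> hom_dim (d, \<rho>) N" by (simp add: hom_dim_def C(5) B(8))
  qed
qed

lemma linear_right_mult:
  assumes X: "dim_row X = d"
  shows "Vector_Spaces.linear (\<lambda>c (h :: nat \<times> nat \<Rightarrow> 'k) i. c * h i) (\<lambda>c h i. c * h i)
    (\<lambda>h. mat_fun_of (mat n d h * X))"
proof -
  have "mat_fun_of (mat n d (g + h) * X) = mat_fun_of (mat n d g * X) + mat_fun_of (mat n d h * X)" for g h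
  proof -
    have "mat n d (g + h) * X = mat n d g * X + mat n d h * X"
      using X by (simp add: plus_fun_def mat_add_fun mat_add_mult)
    moreover have "mat n d g * X \<in> carrier_mat n (dim_col X)" "mat n d h * X \<in> carrier_mat n (dim_col X)" by auto
    ultimately show ?thesis using mat_fun_of_add by (simp add: plus_fun_def)
  qed
  moreover have "mat_fun_of (mat n d (\<lambda>i. c * h i) * X) = (\<lambda>i. c * mat_fun_of (mat n d h * X) i)" for c h
    using X by (simp add: mat_smult_fun mat_smult_mult mat_fun_of_smult)
  ultimately show ?thesis
    by (simp add: Vector_Spaces.linear_iff fun_vs.vector_space_axioms)
qed

text \<open>Precomposition with \<open>\<theta>\<close> maps the homomorphisms out of
  \<open>M'\<close> onto those out of \<open>M\<close>, a preimage of \<open>g\<close> being the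
  composite of \<open>g\<close> with \<open>\<theta>'\<close>.\<close>

lemma hom_dim_le_if_iso:
  assumes M: "is_module M" "is_module M'" "is_module N" and \<theta>: "\<theta> \<in> module_hom M M'" "\<theta>' \<in> module_hom M' M"
    "\<theta>' * \<theta> = 1\<^sub>m (fst M)"
  shows "hom_dim M N \<le> hom_dim M' N"
proof -
  let ?f = "\<lambda>h. mat_fun_of (mat (fst N) (fst M') h * \<theta>)"
  note d = module_hom_dim[OF \<theta>(1)] module_hom_dim[OF \<theta>(2)]
  have lin: "Vector_Spaces.linear (\<lambda>c (h :: nat \<times> nat \<Rightarrow> 'k) i. c * h i) (\<lambda>c h i. c * h i) ?f"
    by (rule linear_right_mult[OF d(1)])
  obtain T :: "(nat \<times> nat \<Rightarrow> 'k) set" where T: "finite T" "box_funs (fst N) (fst M') \<subseteq> fun_vs.span T"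
    by (rule box_funs_finite_span)
  obtain T' :: "(nat \<times> nat \<Rightarrow> 'k) set" where T': "finite T'" "box_funs (fst N) (fst M) \<subseteq> fun_vs.span T'"
    by (rule box_funs_finite_span)
  have im: "?f ` hom_funs M' N \<subseteq> box_funs (fst N) (fst M)"
  proof (rule image_subsetI)
    fix h
    show "?f h \<in> box_funs (fst N) (fst M)"
      by (rule mat_fun_of_box, rule carrier_matI) (simp_all only: index_mult_mat dim_row_mat d)
  qed
  have "hom_funs M N \<subseteq> ?f ` hom_funs M' N"
  proof
    fix g assume g: "g \<in> hom_funs M N"
    let ?B = "mat (fst N) (fst M) g"
    have B: "?B \<in> module_hom M N" "mat_fun_of ?B = g"
      using g mat_fun_of_mat[of g "fst N" "fst M"] unfolding hom_funs_def by blast+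
    have B\<theta>: "?B * \<theta>' \<in> module_hom M' N" by (rule module_hom_comp[OF M(2,1,3) \<theta>(2) B(1)])
    have "?f (mat_fun_of (?B * \<theta>')) = mat_fun_of (?B * \<theta>' * \<theta>)"
      unfolding mat_mat_fun_of[OF module_hom_carrier[OF B\<theta>]] ..
    also have "?B * \<theta>' * \<theta> = ?B" using d by (simp add: mat_assoc \<theta>(3) mat_mult_one)
    finally have "g = ?f (mat_fun_of (?B * \<theta>'))" unfolding B(2) ..
    then show "g \<in> ?f ` hom_funs M' N" using mat_fun_of_hom[OF B\<theta>] by (rule image_eqI)
  qed
  then have "fun_vs.dim (hom_funs M N) \<le> fun_vs.dim (?f ` hom_funs M' N)"
    by (rule fun_vs.dim_mono_finite[OF _ subset_trans[OF im T'(2)] T'(1)])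
  also have "\<dots> \<le> fun_vs.dim (hom_funs M' N)"
    by (rule fun_vs.dim_image_le_finite[OF lin subspace_hom_funs[OF M(2,3)] subset_trans[OF hom_funs_subset_box T(2)] T(1)])
  finally show ?thesis unfolding hom_dim_def .
qed

lemma module_hom_inverse:
  assumes MN: "is_module M" "is_module N" and J: "J \<in> module_hom M N" "J' \<in> carrier_mat (fst M) (fst N)"
    and inv: "J' * J = 1\<^sub>m (fst M)" "J * J' = 1\<^sub>m (fst N)"
  shows "J' \<in> module_hom N M"
proof (rule module_homI[OF J(2)])
  fix a
  note d = module_hom_dim[OF J(1)] carrier_matD[OF J(2)] module_dim[OF MN(1)] module_dim[OF MN(2)]
  have "J' * snd N a = J' * (snd N a * (J * J'))" unfolding inv using d by (simp add: mat_mult_one)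
  also have "\<dots> = J' * ((snd N a * J) * J')" using d by (simp add: mat_assoc)
  also have "\<dots> = (J' * J) * (snd M a * J')"
    unfolding module_hom_comm[OF J(1), symmetric] using d by (simp add: mat_assoc)
  also have "\<dots> = snd M a * J'" unfolding inv using d by (simp add: mat_one_mult)
  finally show "J' * snd N a = snd M a * J'" .
qed

section \<open>Extensions of modules\<close>

text \<open>A Hochschild 1-cocycle with values in the linear maps from \<open>N\<close> to
  \<open>M\<close>. It is the condition under which \<open>\<xi>\<close> can serve as the upper
  right block of a block triangular representation with diagonal blocks \<open>M\<close> and
  \<open>N\<close>.\<close>

definition is_cocycle :: "('a, 'k) rep \<Rightarrow> ('a, 'k) rep \<Rightarrow> ('a \<Rightarrow> 'k mat) \<Rightarrow> bool" where
  "is_cocycle M N \<xi> \<longleftrightarrow> (\<forall>a. \<xi> a \<in> carrier_mat (fst M) (fst N)) \<and> (\<forall>a b. \<xi> (a + b) = \<xi> a + \<xi> b) \<and>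
     (\<forall>c a. \<xi> (scale c a) = c \<cdot>\<^sub>m \<xi> a) \<and> (\<forall>a b. \<xi> (a * b) = snd M a * \<xi> b + \<xi> a * snd N b)"

text \<open>\<open>M\<close> is the submodule and \<open>N\<close> the quotient of \<open>extension M N \<xi>\<close>.\<close>

definition extension :: "('a, 'k) rep \<Rightarrow> ('a, 'k) rep \<Rightarrow> ('a \<Rightarrow> 'k mat) \<Rightarrow> ('a, 'k) rep" where
  "extension M N \<xi> = (fst M + fst N, \<lambda>a.
     (left_proj (fst M) (fst N))\<^sup>T * (snd M a * left_proj (fst M) (fst N) + \<xi> a * right_proj (fst M) (fst N)) +
     (right_proj (fst M) (fst N))\<^sup>T * (snd N a * right_proj (fst M) (fst N)))"

lemma fst_extension: "fst (extension M N \<xi>) = fst M + fst N"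
  by (simp add: extension_def)

lemma proj_cancel:
  "dim_row X = e \<Longrightarrow> left_proj e d * ((left_proj e d)\<^sup>T * X) = X"
  "dim_row X = d \<Longrightarrow> right_proj e d * ((right_proj e d)\<^sup>T * X) = X"
  "dim_row X = d \<Longrightarrow> left_proj e d * ((right_proj e d)\<^sup>T * X) = 0\<^sub>m e (dim_col X)"
  "dim_row X = e \<Longrightarrow> right_proj e d * ((left_proj e d)\<^sup>T * X) = 0\<^sub>m d (dim_col X)"
  using mat_cancel[OF proj_simps(1), of e d X] mat_cancel[OF proj_simps(2), of e d X]
    mat_cancel[OF proj_simps(3), of e d X] mat_cancel[OF proj_simps(4), of e d X]
  by (auto simp: mat_one_mult mat_zero_mult)

lemma cocycle_zero: "\<lbrakk>is_module M; is_module N\<rbrakk> \<Longrightarrow> is_cocycle M N (\<lambda>_. 0\<^sub>m (fst M) (fst N))"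
  by (auto simp: is_cocycle_def mat_zero_mult mat_mult_zero mat_group)

context
  fixes M N :: "('a, 'k) rep" and \<xi> :: "'a \<Rightarrow> 'k mat"
  assumes M: "is_module M" and N: "is_module N" and \<xi>: "is_cocycle M N \<xi>"
begin

lemma cocycle_dim: "dim_row (\<xi> a) = fst M" "dim_col (\<xi> a) = fst N"
  and cocycle_add: "\<xi> (a + b) = \<xi> a + \<xi> b"
  and cocycle_scale: "\<xi> (scale c a) = c \<cdot>\<^sub>m \<xi> a"
  and cocycle_mult: "\<xi> (a * b) = snd M a * \<xi> b + \<xi> a * snd N b"
  using \<xi> by (auto simp: is_cocycle_def)

lemma cocycle_one: "\<xi> 1 = 0\<^sub>m (fst M) (fst N)"
proof -
  note d = cocycle_dim module_dim[OF M] module_dim[OF N]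
  have eq: "\<xi> 1 = \<xi> 1 + \<xi> 1"
    using cocycle_mult[of 1 1] d by (simp add: module_one[OF M] module_one[OF N] mat_one_mult mat_mult_one)
  then have "\<xi> 1 $$ (i, j) = 0" if "i < fst M" "j < fst N" for i j
  proof -
    have "\<xi> 1 $$ (i, j) = \<xi> 1 $$ (i, j) + \<xi> 1 $$ (i, j)"
      using arg_cong[OF eq, of "\<lambda>X. X $$ (i, j)"] that d by (simp only: index_add_mat)
    then show ?thesis by (simp only: add_cancel_right_right)
  qed
  then show ?thesis using d by (intro eq_matI) auto
qed

lemma cocycle_smult: "is_cocycle M N (\<lambda>a. t \<cdot>\<^sub>m \<xi> a)"
  unfolding is_cocycle_def
proof (intro conjI allI)
  note d = cocycle_dim module_dim[OF M] module_dim[OF N]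
  fix a b c
  show "t \<cdot>\<^sub>m \<xi> a \<in> carrier_mat (fst M) (fst N)" by (rule carrier_matI) (simp_all add: d)
  show "t \<cdot>\<^sub>m \<xi> (a + b) = t \<cdot>\<^sub>m \<xi> a + t \<cdot>\<^sub>m \<xi> b"
    unfolding cocycle_add by (rule add_smult_distrib_left_mat[of _ "fst M" "fst N"]; rule carrier_matI) (simp_all add: d)
  show "t \<cdot>\<^sub>m \<xi> (scale c a) = c \<cdot>\<^sub>m (t \<cdot>\<^sub>m \<xi> a)"
    unfolding cocycle_scale by (rule eq_matI) auto
  have "t \<cdot>\<^sub>m \<xi> (a * b) = t \<cdot>\<^sub>m (snd M a * \<xi> b) + t \<cdot>\<^sub>m (\<xi> a * snd N b)"
    unfolding cocycle_mult by (rule add_smult_distrib_left_mat[of _ "fst M" "fst N"]; rule carrier_matI) (simp_all add: d)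
  then show "t \<cdot>\<^sub>m \<xi> (a * b) = snd M a * (t \<cdot>\<^sub>m \<xi> b) + t \<cdot>\<^sub>m \<xi> a * snd N b"
    by (simp add: d mat_mult_smult mat_smult_mult)
qed

end

lemma mat_eq_projI:
  assumes "dim_row X = dim_row Y" "dim_col X = e + d" "dim_col Y = e + d"
    "X * (left_proj e d)\<^sup>T = Y * (left_proj e d)\<^sup>T" "X * (right_proj e d)\<^sup>T = Y * (right_proj e d)\<^sup>T"
  shows "X = Y"
proof -
  have *: "Z = (Z * (left_proj e d)\<^sup>T) * left_proj e d + (Z * (right_proj e d)\<^sup>T) * right_proj e d" if "dim_col Z = e + d" for Z
  proof -
    have "Z = Z * ((left_proj e d)\<^sup>T * left_proj e d + (right_proj e d)\<^sup>T * right_proj e d)"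
      unfolding proj_simps using that by (simp add: mat_mult_one)
    also have "\<dots> = (Z * (left_proj e d)\<^sup>T) * left_proj e d + (Z * (right_proj e d)\<^sup>T) * right_proj e d"
      using that by (simp add: mat_mult_add mat_assoc)
    finally show ?thesis .
  qed
  show ?thesis using *[OF assms(2)] *[OF assms(3)] assms(4,5) by simp
qed

lemma mat_add4:
  "\<lbrakk>dim_row A = n; dim_row B = n; dim_row C' = n; dim_row D = n; dim_col A = m; dim_col B = m; dim_col C' = m; dim_col D = m\<rbrakk>
    \<Longrightarrow> (A + B) + (C' + D) = (A + C') + (B + (D :: 'k mat))"
  by (rule eq_matI) (auto simp: algebra_simps)

context
  fixes M N :: "('a, 'k) rep" and \<xi> :: "'a \<Rightarrow> 'k mat"
  assumes M: "is_module M" and N: "is_module N" and \<xi>: "is_cocycle M N \<xi>"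
begin

lemma extension_dim: "dim_row (snd (extension M N \<xi>) a) = fst M + fst N" "dim_col (snd (extension M N \<xi>) a) = fst M + fst N"
  by (simp_all add: extension_def)

lemma extension_simps:
  "snd (extension M N \<xi>) a * (left_proj (fst M) (fst N))\<^sup>T = (left_proj (fst M) (fst N))\<^sup>T * snd M a"
  "snd (extension M N \<xi>) a * (right_proj (fst M) (fst N))\<^sup>T =
    (left_proj (fst M) (fst N))\<^sup>T * \<xi> a + (right_proj (fst M) (fst N))\<^sup>T * snd N a"
  "right_proj (fst M) (fst N) * snd (extension M N \<xi>) a = snd N a * right_proj (fst M) (fst N)"
proof -
  note d = cocycle_dim[OF M N \<xi>] module_dim[OF M] module_dim[OF N]
  show "snd (extension M N \<xi>) a * (left_proj (fst M) (fst N))\<^sup>T = (left_proj (fst M) (fst N))\<^sup>T * snd M a"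
    by (simp add: extension_def d mat_alg proj_simps mat_group)
  show "snd (extension M N \<xi>) a * (right_proj (fst M) (fst N))\<^sup>T =
    (left_proj (fst M) (fst N))\<^sup>T * \<xi> a + (right_proj (fst M) (fst N))\<^sup>T * snd N a"
    by (simp add: extension_def d mat_alg proj_simps mat_group)
  show "right_proj (fst M) (fst N) * snd (extension M N \<xi>) a = snd N a * right_proj (fst M) (fst N)"
    by (simp add: extension_def d mat_alg proj_cancel mat_group)
qed

lemma extension_module: "is_module (extension M N \<xi>)"
proof -
  let ?E = "snd (extension M N \<xi>)" let ?L = "(left_proj (fst M) (fst N))\<^sup>T" let ?R = "(right_proj (fst M) (fst N))\<^sup>T"
  note d = cocycle_dim[OF M N \<xi>] module_dim[OF M] module_dim[OF N] extension_dim
  have "is_module (fst M + fst N, ?E)"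
  proof (rule is_moduleI)
    fix a b c
    show "?E a \<in> carrier_mat (fst M + fst N) (fst M + fst N)" by (rule carrier_matI) (simp_all add: d)
    show "?E (a + b) = ?E a + ?E b"
    proof (rule mat_eq_projI[where e = "fst M" and d = "fst N"])
      show "?E (a + b) * ?L = (?E a + ?E b) * ?L"
        by (simp add: d mat_add_mult extension_simps module_add[OF M] mat_mult_add)
      have "?E (a + b) * ?R = (?L * \<xi> a + ?L * \<xi> b) + (?R * snd N a + ?R * snd N b)"
        by (simp add: d extension_simps module_add[OF N] cocycle_add[OF M N \<xi>] mat_mult_add)
      also have "\<dots> = (?L * \<xi> a + ?R * snd N a) + (?L * \<xi> b + ?R * snd N b)"
        by (rule mat_add4) (simp_all add: d)
      also have "\<dots> = (?E a + ?E b) * ?R" by (simp add: d mat_add_mult extension_simps)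
      finally show "?E (a + b) * ?R = (?E a + ?E b) * ?R" .
    qed (simp_all add: d)
    show "?E (scale c a) = c \<cdot>\<^sub>m ?E a"
    proof (rule mat_eq_projI[where e = "fst M" and d = "fst N"])
      show "?E (scale c a) * ?L = c \<cdot>\<^sub>m ?E a * ?L"
        by (simp add: d mat_smult_mult mat_mult_smult extension_simps module_scale[OF M])
      have "?E (scale c a) * ?R = c \<cdot>\<^sub>m (?L * \<xi> a) + c \<cdot>\<^sub>m (?R * snd N a)"
        by (simp add: d extension_simps module_scale[OF N] cocycle_scale[OF M N \<xi>] mat_mult_smult)
      also have "\<dots> = c \<cdot>\<^sub>m (?L * \<xi> a + ?R * snd N a)"
        by (rule add_smult_distrib_left_mat[symmetric, of _ "fst M + fst N" "fst N"]; rule carrier_matI) (simp_all add: d)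
      also have "\<dots> = c \<cdot>\<^sub>m ?E a * ?R" by (simp add: d mat_smult_mult extension_simps)
      finally show "?E (scale c a) * ?R = c \<cdot>\<^sub>m ?E a * ?R" .
    qed (simp_all add: d)
    show "?E (a * b) = ?E a * ?E b"
    proof (rule mat_eq_projI[where e = "fst M" and d = "fst N"])
      have "?E a * ?E b * ?L = ?E a * (?L * snd M b)" by (simp add: d mat_assoc extension_simps)
      also have "\<dots> = (?E a * ?L) * snd M b" by (rule mat_assoc[symmetric]) (simp_all add: d)
      also have "\<dots> = ?E (a * b) * ?L" by (simp add: d extension_simps module_mult[OF M] mat_assoc)
      finally show "?E (a * b) * ?L = ?E a * ?E b * ?L" ..
      have "?E a * ?E b * ?R = (?E a * ?L) * \<xi> b + (?E a * ?R) * snd N b"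
        by (simp add: d mat_assoc extension_simps(2)[of b] mat_mult_add)
      also have "\<dots> = ?L * (snd M a * \<xi> b) + (?L * (\<xi> a * snd N b) + ?R * (snd N a * snd N b))"
        by (simp add: d extension_simps mat_assoc mat_add_mult)
      also have "\<dots> = (?L * (snd M a * \<xi> b) + ?L * (\<xi> a * snd N b)) + ?R * (snd N a * snd N b)"
        by (rule eq_matI) (simp_all only: d index_add_mat index_mult_mat index_transpose_mat proj_dim_simps add.assoc)
      also have "\<dots> = ?E (a * b) * ?R"
        by (simp add: d extension_simps cocycle_mult[OF M N \<xi>] module_mult[OF N] mat_mult_add)
      finally show "?E (a * b) * ?R = ?E a * ?E b * ?R" ..
    qed (simp_all add: d)
    show "?E 1 = 1\<^sub>m (fst M + fst N)"
    proof (rule mat_eq_projI[where e = "fst M" and d = "fst N"])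
      show "?E 1 * ?L = 1\<^sub>m (fst M + fst N) * ?L" by (simp add: d extension_simps module_one[OF M] mat_one_mult mat_mult_one)
      show "?E 1 * ?R = 1\<^sub>m (fst M + fst N) * ?R"
        by (simp add: d extension_simps module_one[OF N] cocycle_one[OF M N \<xi>] mat_one_mult mat_mult_one mat_mult_zero mat_group)
    qed (simp_all add: d)
  qed
  then show ?thesis by (simp add: extension_def)
qed

lemma extension_left_hom: "(left_proj (fst M) (fst N))\<^sup>T \<in> module_hom M (extension M N \<xi>)"
  by (rule module_homI[OF carrier_matI]) (simp_all add: extension_simps fst_extension)

lemma extension_right_hom: "right_proj (fst M) (fst N) \<in> module_hom (extension M N \<xi>) N"
  by (rule module_homI[OF carrier_matI]) (simp_all add: extension_simps fst_extension)

text \<open>A homomorphism out of an extension is a homomorphism \<open>A1\<close> on the submodule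
  together with a linear map \<open>A2\<close> on the complement whose failure to commute is
  compensated by \<open>A1 * \<xi> a\<close>. For \<open>K = M\<close> and \<open>A1 = 1\<close> the
  condition says that \<open>\<xi>\<close> is a coboundary.\<close>

lemma extension_homI:
  assumes K: "is_module K" and A1: "A1 \<in> module_hom M K" and A2: "A2 \<in> carrier_mat (fst K) (fst N)"
    "\<And>a. A1 * \<xi> a + A2 * snd N a = snd K a * A2"
  shows "A1 * left_proj (fst M) (fst N) + A2 * right_proj (fst M) (fst N) \<in> module_hom (extension M N \<xi>) K"
proof (rule module_homI)
  let ?E = "snd (extension M N \<xi>)" let ?L = "(left_proj (fst M) (fst N))\<^sup>T" let ?R = "(right_proj (fst M) (fst N))\<^sup>T"
  let ?A = "A1 * left_proj (fst M) (fst N) + A2 * right_proj (fst M) (fst N)"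
  note d = cocycle_dim[OF M N \<xi>] module_dim[OF M] module_dim[OF N] extension_dim module_dim[OF K]
    module_hom_dim[OF A1] carrier_matD[OF A2(1)]
  have AL: "?A * ?L = A1" "?A * ?R = A2" using d by (simp_all add: mat_alg proj_simps mat_group)
  fix a
  show "?A * ?E a = snd K a * ?A"
  proof (rule mat_eq_projI[where e = "fst M" and d = "fst N"])
    have "?A * ?E a * ?L = (?A * ?L) * snd M a" using d by (simp only: mat_assoc extension_simps index_add_mat index_mult_mat index_transpose_mat proj_dim_simps)
    also have "\<dots> = snd K a * (?A * ?L)" unfolding AL by (rule module_hom_comm[OF A1])
    also have "\<dots> = snd K a * ?A * ?L" using d by (simp only: mat_assoc index_add_mat index_mult_mat index_transpose_mat proj_dim_simps)
    finally show "?A * ?E a * ?L = snd K a * ?A * ?L" .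
    have "?A * ?E a * ?R = ?A * (?L * \<xi> a + ?R * snd N a)" using d by (simp only: mat_assoc extension_simps index_add_mat index_mult_mat index_transpose_mat proj_dim_simps)
    also have "\<dots> = (?A * ?L) * \<xi> a + (?A * ?R) * snd N a" using d by (simp only: mat_assoc mat_mult_add index_add_mat index_mult_mat index_transpose_mat proj_dim_simps)
    also have "\<dots> = snd K a * (?A * ?R)" unfolding AL by (rule A2(2))
    also have "\<dots> = snd K a * ?A * ?R" using d by (simp only: mat_assoc index_add_mat index_mult_mat index_transpose_mat proj_dim_simps)
    finally show "?A * ?E a * ?R = snd K a * ?A * ?R" .
  qed (use d in simp_all)
qed (use module_hom_dim[OF A1] A2 in \<open>auto simp: fst_extension intro!: carrier_matI\<close>)

lemma extension_homD:
  assumes K: "is_module K" and A: "A \<in> module_hom (extension M N \<xi>) K"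
  shows "A * (left_proj (fst M) (fst N))\<^sup>T \<in> module_hom M K"
    "A * (left_proj (fst M) (fst N))\<^sup>T * \<xi> a + A * (right_proj (fst M) (fst N))\<^sup>T * snd N a =
      snd K a * (A * (right_proj (fst M) (fst N))\<^sup>T)"
proof -
  let ?E = "snd (extension M N \<xi>)" let ?L = "(left_proj (fst M) (fst N))\<^sup>T" let ?R = "(right_proj (fst M) (fst N))\<^sup>T"
  note d = cocycle_dim[OF M N \<xi>] module_dim[OF M] module_dim[OF N] extension_dim module_dim[OF K]
    module_hom_dim[OF A, unfolded fst_extension]
  show "A * ?L \<in> module_hom M K"
    by (rule module_hom_comp[OF M extension_module K extension_left_hom A])
  have "A * ?L * \<xi> a + A * ?R * snd N a = A * (?E a * ?R)"
    unfolding extension_simps using d by (simp add: mat_assoc mat_mult_add)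
  also have "\<dots> = (A * ?E a) * ?R" using d by (simp add: mat_assoc)
  also have "\<dots> = snd K a * (A * ?R)" unfolding module_hom_comm[OF A] using d by (simp add: mat_assoc)
  finally show "A * ?L * \<xi> a + A * ?R * snd N a = snd K a * (A * ?R)" .
qed

end

definition direct_sum :: "('a, 'k) rep \<Rightarrow> ('a, 'k) rep \<Rightarrow> ('a, 'k) rep" where
  "direct_sum M N = extension M N (\<lambda>_. 0\<^sub>m (fst M) (fst N))"

lemma direct_sum:
  assumes M: "is_module M" and N: "is_module N"
  shows "is_module (direct_sum M N)" "fst (direct_sum M N) = fst M + fst N"
    "(left_proj (fst M) (fst N))\<^sup>T \<in> module_hom M (direct_sum M N)"
    "right_proj (fst M) (fst N) \<in> module_hom (direct_sum M N) N"
    "left_proj (fst M) (fst N) \<in> module_hom (direct_sum M N) M"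
    "(right_proj (fst M) (fst N))\<^sup>T \<in> module_hom N (direct_sum M N)"
proof -
  note z = cocycle_zero[OF M N]
  note d = module_dim[OF M] module_dim[OF N] extension_dim
  show "is_module (direct_sum M N)" "fst (direct_sum M N) = fst M + fst N"
    "(left_proj (fst M) (fst N))\<^sup>T \<in> module_hom M (direct_sum M N)"
    "right_proj (fst M) (fst N) \<in> module_hom (direct_sum M N) N"
    unfolding direct_sum_def
    by (rule extension_module[OF M N z] fst_extension extension_left_hom[OF M N z] extension_right_hom[OF M N z])+
  have "1\<^sub>m (fst M) * left_proj (fst M) (fst N) + 0\<^sub>m (fst M) (fst N) * right_proj (fst M) (fst N)
      \<in> module_hom (extension M N (\<lambda>_. 0\<^sub>m (fst M) (fst N))) M"
    by (rule extension_homI[OF M N z M module_hom_one[OF M]]) (simp_all add: d mat_one_mult mat_zero_mult mat_mult_zero mat_group)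
  then show "left_proj (fst M) (fst N) \<in> module_hom (direct_sum M N) M"
    unfolding direct_sum_def by (simp add: mat_one_mult mat_zero_mult mat_group)
  show "(right_proj (fst M) (fst N))\<^sup>T \<in> module_hom N (direct_sum M N)"
    unfolding direct_sum_def
    by (rule module_homI[OF carrier_matI])
      (simp_all add: extension_simps[OF M N z] fst_extension d mat_mult_zero mat_group)
qed

lemma projective_direct_sum:
  assumes "projective P" "projective Q"
  shows "projective (direct_sum P Q)"
proof -
  note PQ = projective_module[OF assms(1)] projective_module[OF assms(2)]
  show ?thesis
    by (rule projective_retract[OF direct_sum(1)[OF PQ] assms direct_sum(5,3,4,6)[OF PQ]])
      (simp add: direct_sum(2)[OF PQ] proj_simps)
qed

text \<open>Splitting the idempotent \<open>1 - j * j'\<close> gives a basis \<open>C\<close> of the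
  kernel of \<open>j'\<close>, a linear complement of the image of \<open>j\<close>. In the basis
  formed by \<open>j\<close> and \<open>C\<close> the action on \<open>F\<close> is block
  triangular, and \<open>\<xi>\<close> is its upper right block.\<close>

lemma sub_quotient:
  assumes F: "is_module F" and M: "is_module M" and j: "j \<in> module_hom M F" "j' \<in> carrier_mat (fst M) (fst F)" "j' * j = 1\<^sub>m (fst M)"
  obtains Q \<xi> C C' where "is_module Q" "is_cocycle M Q \<xi>" "C \<in> carrier_mat (fst F) (fst Q)" "C' \<in> module_hom F Q"
    "C' * C = 1\<^sub>m (fst Q)" "C' * j = 0\<^sub>m (fst Q) (fst M)" "j' * C = 0\<^sub>m (fst M) (fst Q)" "j * j' + C * C' = 1\<^sub>m (fst F)"
    "\<forall>a. snd F a * C = j * \<xi> a + C * snd Q a" "\<forall>a. \<xi> a = j' * (snd F a * C)"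
proof -
  define E where "E = 1\<^sub>m (fst F) - j * j'"
  note d0 = module_hom_dim[OF j(1)] carrier_matD[OF j(2)] module_dim[OF F] module_dim[OF M]
  have E: "E \<in> carrier_mat (fst F) (fst F)" unfolding E_def by (rule carrier_matI) (simp_all add: d0)
  have Ej: "E * j = 0\<^sub>m (fst F) (fst M)"
  proof -
    have "E * j = j - j * (j' * j)" unfolding E_def by (simp add: d0 mat_minus_mult mat_one_mult mat_assoc)
    then show ?thesis unfolding j(3) by (simp add: d0 mat_mult_one mat_group)
  qed
  have jE: "j' * E = 0\<^sub>m (fst M) (fst F)"
  proof -
    have "j' * E = j' - (j' * j) * j'" unfolding E_def by (simp add: d0 mat_mult_minus mat_mult_one mat_assoc)
    then show ?thesis unfolding j(3) by (simp add: d0 mat_one_mult mat_group)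
  qed
  have "E * E = E - (E * j) * j'"
    by (subst (2) E_def) (simp add: d0 carrier_matD[OF E] mat_mult_minus mat_mult_one mat_assoc)
  then have "E * E = E" unfolding Ej by (simp add: d0 carrier_matD[OF E] mat_zero_mult mat_group)
  obtain q C C' where
    C: "C \<in> carrier_mat (fst F) q" "C' \<in> carrier_mat q (fst F)" "C' * C = 1\<^sub>m q" "C * C' = E"
    by (rule split_idempotent[OF E \<open>E * E = E\<close>])
  note d = d0 carrier_matD[OF C(1)] carrier_matD[OF C(2)]
  have C'j: "C' * j = 0\<^sub>m q (fst M)"
  proof -
    have "C' * j = (C' * C) * (C' * j)" unfolding C(3) using d by (simp add: mat_one_mult)
    also have "\<dots> = C' * ((C * C') * j)" using d by (simp add: mat_assoc)
    finally show ?thesis unfolding C(4) Ej using d by (simp add: mat_mult_zero)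
  qed
  have j'C: "j' * C = 0\<^sub>m (fst M) q"
  proof -
    have "j' * C = (j' * C) * (C' * C)" unfolding C(3) using d by (simp add: mat_mult_one)
    also have "\<dots> = (j' * (C * C')) * C" using d by (simp add: mat_assoc)
    finally show ?thesis unfolding C(4) jE using d by (simp add: mat_zero_mult)
  qed
  have one: "j * j' + C * C' = 1\<^sub>m (fst F)" unfolding C(4) E_def by (rule eq_matI) (simp_all add: d)
  have CFj: "C' * (snd F a * j) = 0\<^sub>m q (fst M)" for a
  proof -
    have "C' * (snd F a * j) = (C' * j) * snd M a"
      unfolding module_hom_comm[OF j(1), symmetric] using d by (simp add: mat_assoc)
    then show ?thesis unfolding C'j using d by (simp add: mat_zero_mult)
  qed
  define Q where "Q = (q, \<lambda>a. C' * snd F a * C)"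
  have inv: "C' * (snd F a * (C * C')) = C' * snd F a" for a
  proof -
    have "C' * (snd F a * (C * C')) = C' * snd F a - (C' * (snd F a * j)) * j'"
      unfolding C(4) E_def using d by (simp add: mat_mult_minus mat_mult_one mat_assoc)
    then show ?thesis unfolding CFj using d by (simp add: mat_zero_mult mat_group)
  qed
  have Q: "is_module Q" "C' \<in> module_hom F Q"
    unfolding Q_def by (rule quotient_module[OF F C(1-3) inv])+
  define \<xi> where "\<xi> a = j' * (snd F a * C)" for a
  have FC: "snd F a * C = j * \<xi> a + C * snd Q a" for a
  proof -
    have "snd F a * C = (j * j' + C * C') * (snd F a * C)" unfolding one using d by (simp add: mat_one_mult)
    also have "\<dots> = j * \<xi> a + C * snd Q a"
      unfolding \<xi>_def Q_def using d by (simp add: mat_add_mult mat_assoc)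
    finally show ?thesis .
  qed
  have \<xi>: "is_cocycle M Q \<xi>"
    unfolding is_cocycle_def
  proof (intro conjI allI)
    fix a b c
    show "\<xi> a \<in> carrier_mat (fst M) (fst Q)" unfolding \<xi>_def Q_def using d by (intro carrier_matI) simp_all
    show "\<xi> (a + b) = \<xi> a + \<xi> b" unfolding \<xi>_def module_add[OF F] using d by (simp add: mat_add_mult mat_mult_add)
    show "\<xi> (scale c a) = c \<cdot>\<^sub>m \<xi> a" unfolding \<xi>_def module_scale[OF F] using d by (simp add: mat_smult_mult mat_mult_smult)
    have "\<xi> (a * b) = j' * (snd F a * (snd F b * C))" unfolding \<xi>_def module_mult[OF F] using d by (simp add: mat_assoc)
    also have "\<dots> = j' * (snd F a * (j * \<xi> b + C * snd Q b))" unfolding FC ..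
    also have "\<dots> = j' * ((snd F a * j) * \<xi> b) + (j' * (snd F a * C)) * snd Q b"
      using d unfolding \<xi>_def Q_def by (simp add: mat_mult_add mat_assoc)
    also have "j' * ((snd F a * j) * \<xi> b) = (j' * j) * (snd M a * \<xi> b)"
      unfolding module_hom_comm[OF j(1), symmetric] using d unfolding \<xi>_def by (simp add: mat_assoc)
    also have "\<dots> = snd M a * \<xi> b" unfolding j(3) using d by (simp add: mat_one_mult)
    finally show "\<xi> (a * b) = snd M a * \<xi> b + \<xi> a * snd Q b" unfolding \<xi>_def .
  qed
  show ?thesis
    by (rule that[OF Q(1) \<xi> _ Q(2) _ _ _ one allI[OF FC] allI[OF \<xi>_def]]) (use C C'j j'C in \<open>simp_all add: Q_def\<close>)
qed

section \<open>Approximations and projective resolutions\<close>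

text \<open>One more copy of \<open>\<sigma>\<close> is added to \<open>F\<close> for each
  \<open>h\<close>, with \<open>h\<close> as the new component of the embedding. The projection to
  this copy extends \<open>h\<close>, and the earlier maps extend through the projection to
  \<open>F\<close>. The start \<open>P0\<close> makes the embedding injective.\<close>

lemma finite_approximation:
  assumes W: "is_module W" and \<sigma>: "projective \<sigma>" and P0: "projective P0" "j0 \<in> module_hom W P0"
      "j0' \<in> carrier_mat (fst W) (fst P0)" "j0' * j0 = 1\<^sub>m (fst W)"
    and K: "finite K" "K \<subseteq> module_hom W \<sigma>"
  shows "\<exists>F j j'. projective F \<and> j \<in> module_hom W F \<and> j' \<in> carrier_mat (fst W) (fst F) \<and> j' * j = 1\<^sub>m (fst W) \<and>
    (\<forall>h\<in>K. \<exists>k\<in>module_hom F \<sigma>. k * j = h)"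
  using K
proof (induction K rule: finite_induct)
  case empty
  then show ?case using P0 by blast
next
  case (insert h K)
  note S = projective_module[OF \<sigma>]
  obtain F j j' where F: "projective F" "j \<in> module_hom W F" "j' \<in> carrier_mat (fst W) (fst F)" "j' * j = 1\<^sub>m (fst W)"
    "\<forall>h\<in>K. \<exists>k\<in>module_hom F \<sigma>. k * j = h" using insert by auto
  note FM = projective_module[OF F(1)]
  note ds = direct_sum[OF FM S]
  let ?L = "left_proj (fst F) (fst \<sigma>)" and ?R = "right_proj (fst F) (fst \<sigma>)"
  have h: "h \<in> module_hom W \<sigma>" using insert by simp
  define J where "J = ?L\<^sup>T * j + ?R\<^sup>T * h"
  note d = module_hom_dim[OF F(2)] module_hom_dim[OF h] carrier_matD[OF F(3)]
  have J: "J \<in> module_hom W (direct_sum F \<sigma>)"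
    unfolding J_def by (intro module_hom_add W ds(1) module_hom_comp[OF W FM ds(1) F(2) ds(3)] module_hom_comp[OF W S ds(1) h ds(6)])
  note dJ = d module_hom_dim[OF J] ds(2)
  have LJ: "?L * J = j" unfolding J_def using d by (simp add: mat_mult_add proj_cancel mat_group)
  have RJ: "?R * J = h" unfolding J_def using d by (simp add: mat_mult_add proj_cancel mat_group)
  show ?case
  proof (intro exI conjI)
    show "projective (direct_sum F \<sigma>)" by (rule projective_direct_sum[OF F(1) \<sigma>])
    show "J \<in> module_hom W (direct_sum F \<sigma>)" by (rule J)
    show "j' * ?L \<in> carrier_mat (fst W) (fst (direct_sum F \<sigma>))" using dJ by (intro carrier_matI) simp_all
    have "j' * ?L * J = j' * (?L * J)" using dJ by (simp add: mat_assoc)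
    then show "j' * ?L * J = 1\<^sub>m (fst W)" unfolding LJ F(4) .
    show "\<forall>g\<in>insert h K. \<exists>k\<in>module_hom (direct_sum F \<sigma>) \<sigma>. k * J = g"
    proof
      fix g assume "g \<in> insert h K"
      then consider "g = h" | "g \<in> K" by blast
      then show "\<exists>k\<in>module_hom (direct_sum F \<sigma>) \<sigma>. k * J = g"
      proof cases
        case 1
        then show ?thesis using RJ ds(4) by blast
      next
        case 2
        then obtain k where k: "k \<in> module_hom F \<sigma>" "k * j = g" using F(5) by blast
        have "k * ?L * J = k * (?L * J)" using dJ module_hom_dim[OF k(1)] by (simp add: mat_assoc)
        then show ?thesis
          unfolding LJ k(2) using module_hom_comp[OF ds(1) FM S ds(5) k(1)] by blast
      qed
    qed
  qed
qed

text \<open>The homomorphisms that extend along \<open>j\<close> form a subspace, so it is enough to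
  extend a finite basis of the homomorphisms from \<open>W\<close> to
  \<open>\<sigma>\<close>.\<close>

lemma left_approximation:
  assumes W: "is_module W" and \<sigma>: "projective \<sigma>" and P0: "projective P0" "j0 \<in> module_hom W P0"
      "j0' \<in> carrier_mat (fst W) (fst P0)" "j0' * j0 = 1\<^sub>m (fst W)"
  obtains F j j' where "projective F" "j \<in> module_hom W F" "j' \<in> carrier_mat (fst W) (fst F)" "j' * j = 1\<^sub>m (fst W)"
    "\<forall>h\<in>module_hom W \<sigma>. \<exists>k\<in>module_hom F \<sigma>. k * j = h"
proof -
  note S = projective_module[OF \<sigma>]
  let ?n = "fst \<sigma>" and ?w = "fst W"
  obtain T :: "(nat \<times> nat \<Rightarrow> 'k) set" where T: "finite T" "box_funs ?n ?w \<subseteq> fun_vs.span T" by (rule box_funs_finite_span)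
  obtain C where C: "finite C" "C \<subseteq> hom_funs W \<sigma>" "fun_vs.independent C" "hom_funs W \<sigma> \<subseteq> fun_vs.span C" "card C = fun_vs.dim (hom_funs W \<sigma>)"
    by (rule fun_vs.finite_basis[OF subset_trans[OF hom_funs_subset_box T(2)] T(1)])
  have "finite (mat ?n ?w ` C)" "mat ?n ?w ` C \<subseteq> module_hom W \<sigma>" using C(1,2) by (auto simp: hom_funs_def)
  from finite_approximation[OF W \<sigma> P0 this] obtain F j j' where F: "projective F" "j \<in> module_hom W F"
    "j' \<in> carrier_mat (fst W) (fst F)" "j' * j = 1\<^sub>m (fst W)" "\<forall>h\<in>mat ?n ?w ` C. \<exists>k\<in>module_hom F \<sigma>. k * j = h" by blast
  note FM = projective_module[OF F(1)]
  note d = module_hom_dim[OF F(2)]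
  let ?S = "{g. \<exists>k\<in>module_hom F \<sigma>. k * j = mat ?n ?w g}"
  have "fun_vs.subspace ?S"
  proof (rule fun_vs.subspaceI)
    have "0\<^sub>m ?n (fst F) * j = mat ?n ?w 0" using d by (intro eq_matI) (auto simp: scalar_prod_def)
    then show "0 \<in> ?S" using module_hom_zero[OF FM S] by blast
  next
    fix g h assume "g \<in> ?S" "h \<in> ?S"
    then obtain k l where kl: "k \<in> module_hom F \<sigma>" "k * j = mat ?n ?w g" "l \<in> module_hom F \<sigma>" "l * j = mat ?n ?w h" by blast
    have "(k + l) * j = mat ?n ?w g + mat ?n ?w h"
      using d module_hom_dim[OF kl(1)] module_hom_dim[OF kl(3)] by (simp add: mat_add_mult kl)
    also have "\<dots> = mat ?n ?w (g + h)" by (simp add: plus_fun_def mat_add_fun)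
    finally show "g + h \<in> ?S" using module_hom_add[OF FM S kl(1,3)] by blast
  next
    fix c h assume "h \<in> ?S"
    then obtain k where k: "k \<in> module_hom F \<sigma>" "k * j = mat ?n ?w h" by blast
    have "(c \<cdot>\<^sub>m k) * j = c \<cdot>\<^sub>m mat ?n ?w h"
      using d module_hom_dim[OF k(1)] by (simp add: mat_smult_mult k)
    also have "\<dots> = mat ?n ?w (\<lambda>i. c * h i)" by (simp add: mat_smult_fun)
    finally show "(\<lambda>i. c * h i) \<in> ?S" using module_hom_smult[OF FM S k(1)] by blast
  qed
  moreover have "C \<subseteq> ?S" using F(5) by blast
  ultimately have sp: "fun_vs.span C \<subseteq> ?S" by (intro fun_vs.span_minimal)
  have "\<exists>k\<in>module_hom F \<sigma>. k * j = h" if h: "h \<in> module_hom W \<sigma>" for h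
  proof -
    have "mat_fun_of h \<in> ?S" using mat_fun_of_hom[OF h] C(4) sp by blast
    then show ?thesis using mat_mat_fun_of[OF module_hom_carrier[OF h]] by simp
  qed
  then show ?thesis by (intro that[OF F(1-4)] ballI)
qed

lemma exact_imp_comp_zero:
  assumes A: "A \<in> carrier_mat n m" and B: "B \<in> carrier_mat m k" and im: "mat_image B \<subseteq> mat_kernel A"
  shows "A * B = 0\<^sub>m n k"
proof (rule mat_eq_if_mult_vec_eq[of _ n k])
  fix x :: "'k vec" assume x: "x \<in> carrier_vec k"
  then have "B *\<^sub>v x \<in> mat_kernel A" using im B by (auto simp: mat_image_def)
  then show "A * B *\<^sub>v x = 0\<^sub>m n k *\<^sub>v x"
    using x A B by (simp add: mat_kernel_def mat_vec_assoc zero_mat_vec)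
qed (use A B in auto)

lemma zero_module_projective: "projective (0, \<lambda>_. 0\<^sub>m 0 0)"
proof -
  have Z: "is_module (0, \<lambda>_. 0\<^sub>m 0 0)" by (rule is_moduleI) (auto intro!: eq_matI)
  show ?thesis
    unfolding projective_def
  proof (intro conjI Z allI impI ballI)
    fix M N g f assume MN: "is_module M \<and> is_module N" and g: "g \<in> module_hom M N" and f: "f \<in> module_hom (0, \<lambda>_. 0\<^sub>m 0 0) N"
    have "0\<^sub>m (fst M) 0 \<in> module_hom (0, \<lambda>_. 0\<^sub>m 0 0) M" using module_hom_zero[OF Z, of M] MN by simp
    moreover have "g * 0\<^sub>m (fst M) 0 = f"
      using module_hom_dim[OF g] module_hom_dim[OF f] by (intro eq_matI) auto
    ultimately show "\<exists>h\<in>module_hom (0, \<lambda>_. 0\<^sub>m 0 0) M. g * h = f" by blast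
  qed
qed

text \<open>If the last map splits, the term before it is the direct sum of the last term and a
  complement \<open>Q\<close>. This complement is projective as a summand and maps injectively to
  the next term with the same image, so it can end the resolution.\<close>

lemma shorten_resolution:
  assumes P: "\<And>i. projective (P i)" "\<And>i. i > Suc (Suc N) \<Longrightarrow> fst (P i) = 0"
      "\<epsilon> \<in> module_hom (P 0) M" "\<And>i. \<delta> i \<in> module_hom (P (Suc i)) (P i)" "mat_image \<epsilon> = carrier_vec (fst M)"
      "mat_image (\<delta> 0) = mat_kernel \<epsilon>" "\<And>i. mat_image (\<delta> (Suc i)) = mat_kernel (\<delta> i)"
    and r: "r \<in> module_hom (P (Suc N)) (P (Suc (Suc N)))" "r * \<delta> (Suc N) = 1\<^sub>m (fst (P (Suc (Suc N))))"
  shows "has_projective_resolution M (Suc N)"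
proof -
  note PM = projective_module[OF P(1)]
  let ?B = "\<delta> (Suc N)" and ?P1 = "P (Suc N)" and ?P2 = "P (Suc (Suc N))" and ?P0 = "P N"
  obtain Q \<xi> C C' where Q: "is_module Q" "is_cocycle ?P2 Q \<xi>" "C \<in> carrier_mat (fst ?P1) (fst Q)" "C' \<in> module_hom ?P1 Q"
    "C' * C = 1\<^sub>m (fst Q)" "C' * ?B = 0\<^sub>m (fst Q) (fst ?P2)" "r * C = 0\<^sub>m (fst ?P2) (fst Q)" "?B * r + C * C' = 1\<^sub>m (fst ?P1)"
    "\<forall>a. snd ?P1 a * C = ?B * \<xi> a + C * snd Q a" "\<forall>a. \<xi> a = r * (snd ?P1 a * C)"
    by (rule sub_quotient[OF PM PM P(4)[of "Suc N"] module_hom_carrier[OF r(1)] r(2)])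
  note d = module_hom_dim[OF P(4)[of N]] module_hom_dim[OF P(4)[of "Suc N"]] module_hom_dim[OF r(1)] carrier_matD[OF Q(3)]
    module_hom_dim[OF Q(4)] module_dim[OF PM] module_dim[OF Q(1)]
  \<comment> \<open>The complement spanned by \<open>C\<close> is the kernel of the homomorphism
    \<open>r\<close>, hence a submodule; therefore the cocycle \<open>\<xi>\<close>
    vanishes.\<close>
  have Chom: "C \<in> module_hom Q ?P1"
  proof (rule module_homI[OF Q(3)])
    fix a
    have "\<xi> a = (r * snd ?P1 a) * C" unfolding spec[OF Q(10)] using d by (simp add: mat_assoc)
    also have "\<dots> = snd ?P2 a * (r * C)" unfolding module_hom_comm[OF r(1)] using d by (simp add: mat_assoc)
    also have "\<dots> = 0\<^sub>m (fst ?P2) (fst Q)" unfolding Q(7) using d by (simp add: mat_mult_zero)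
    finally have "snd ?P1 a * C = ?B * 0\<^sub>m (fst ?P2) (fst Q) + C * snd Q a" using spec[OF Q(9), of a] by simp
    then show "C * snd Q a = snd ?P1 a * C" using d by (simp add: mat_mult_zero mat_group)
  qed
  have Qproj: "projective Q"
  proof (rule projective_retract[OF Q(1) P(1) P(1) Chom Q(4) module_hom_zero[OF Q(1) PM] module_hom_zero[OF PM Q(1)]])
    show "C' * C + 0\<^sub>m (fst Q) (fst ?P1) * 0\<^sub>m (fst ?P1) (fst Q) = 1\<^sub>m (fst Q)"
      unfolding Q(5) by (simp add: mat_group)
  qed
  have \<delta>B: "\<delta> N * ?B = 0\<^sub>m (fst ?P0) (fst ?P2)"
    by (rule exact_imp_comp_zero[of _ _ "fst ?P1"]) (use d P(7)[of N] in \<open>auto intro: carrier_matI\<close>)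
  have \<delta>CC: "\<delta> N * C * C' = \<delta> N"
  proof -
    have "\<delta> N = \<delta> N * (?B * r + C * C')" unfolding Q(8) using d by (simp add: mat_mult_one)
    also have "\<dots> = (\<delta> N * ?B) * r + \<delta> N * C * C'" using d by (simp add: mat_mult_add mat_assoc)
    finally show ?thesis unfolding \<delta>B using d by (simp add: mat_zero_mult mat_group)
  qed
  have \<delta>C: "\<delta> N * C \<in> module_hom Q ?P0" by (rule module_hom_comp[OF Q(1) PM PM Chom P(4)])
  have im: "mat_image (\<delta> N * C) = mat_image (\<delta> N)"
  proof (intro equalityI subsetI)
    fix y assume "y \<in> mat_image (\<delta> N * C)"
    then obtain v where v: "v \<in> carrier_vec (fst Q)" "y = \<delta> N *\<^sub>v (C *\<^sub>v v)" using d by (auto simp: mat_image_def mat_vec_assoc)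
    have "C *\<^sub>v v \<in> carrier_vec (fst ?P1)" using d by (intro carrier_vecI) simp
    then show "y \<in> mat_image (\<delta> N)" unfolding mat_image_def v(2) using d by (intro imageI) simp
  next
    fix y assume "y \<in> mat_image (\<delta> N)"
    then obtain v where v: "v \<in> carrier_vec (fst ?P1)" "y = \<delta> N * C * C' *\<^sub>v v" using d \<delta>CC by (auto simp: mat_image_def)
    then have "y = (\<delta> N * C) *\<^sub>v (C' *\<^sub>v v)" using d by (simp add: mat_vec_assoc)
    moreover have "C' *\<^sub>v v \<in> carrier_vec (dim_col (\<delta> N * C))" using d by (intro carrier_vecI) simp
    ultimately show "y \<in> mat_image (\<delta> N * C)" unfolding mat_image_def by blast
  qed
  have ker: "mat_kernel (\<delta> N * C) = {0\<^sub>v (fst Q)}"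
  proof (intro equalityI subsetI)
    fix v assume "v \<in> mat_kernel (\<delta> N * C)"
    then have v: "v \<in> carrier_vec (fst Q)" "\<delta> N *\<^sub>v (C *\<^sub>v v) = 0\<^sub>v (fst ?P0)" using d by (auto simp: mat_kernel_def mat_vec_assoc)
    have "C *\<^sub>v v \<in> mat_image ?B" unfolding P(7) mat_kernel_def using v d by (auto intro: carrier_vecI)
    then obtain u where u: "u \<in> carrier_vec (fst ?P2)" "C *\<^sub>v v = ?B *\<^sub>v u" using d by (auto simp: mat_image_def)
    have "v = (C' * C) *\<^sub>v v" unfolding Q(5) using v by simp
    also have "\<dots> = C' *\<^sub>v (?B *\<^sub>v u)" using d v u by (simp add: mat_vec_assoc)
    also have "\<dots> = (C' * ?B) *\<^sub>v u" using d u by (simp add: mat_vec_assoc)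
    also have "\<dots> = 0\<^sub>v (fst Q)" unfolding Q(6) using u by (simp add: zero_mat_vec)
    finally show "v \<in> {0\<^sub>v (fst Q)}" by simp
  next
    fix v :: "'k vec" assume "v \<in> {0\<^sub>v (fst Q)}"
    then show "v \<in> mat_kernel (\<delta> N * C)" using d by (auto simp: mat_kernel_def scalar_prod_def intro!: eq_vecI)
  qed
  define P' where "P' i = (if i \<le> N then P i else if i = Suc N then Q else (0, \<lambda>_. 0\<^sub>m 0 0))" for i
  define \<delta>' where "\<delta>' i = (if i < N then \<delta> i else if i = N then \<delta> N * C else 0\<^sub>m (fst (P' i)) 0)" for i
  have P': "projective (P' i)" for i using P(1) Qproj zero_module_projective by (simp add: P'_def)
  have im0: "mat_image (0\<^sub>m n 0 :: 'k mat) = {0\<^sub>v n}" for n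
  proof -
    have "mat_image (0\<^sub>m n 0 :: 'k mat) = (\<lambda>v. 0\<^sub>v n) ` (carrier_vec 0 :: 'k vec set)"
      unfolding mat_image_def by (intro image_cong) (simp_all add: zero_mat_vec del: carrier_vec_dim_vec)
    then show ?thesis using image_constant[OF zero_carrier_vec[of 0], of "0\<^sub>v n :: 'k vec"] by simp
  qed
  show ?thesis
    unfolding has_projective_resolution_def
  proof (intro exI conjI allI impI)
    show "projective (P' i)" for i by (rule P')
    show "fst (P' i) = 0" if "Suc N < i" for i using that by (simp add: P'_def)
    show "\<epsilon> \<in> module_hom (P' 0) M" using P(3) by (simp add: P'_def)
    show "\<delta>' i \<in> module_hom (P' (Suc i)) (P' i)" for i
    proof (cases i N rule: linorder_cases)
      case less
      then show ?thesis using P(4)[of i] by (simp add: P'_def \<delta>'_def)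
    next
      case equal
      then show ?thesis using \<delta>C by (simp add: P'_def \<delta>'_def)
    next
      case greater
      have "0\<^sub>m (fst (P' i)) (fst (P' (Suc i))) \<in> module_hom (P' (Suc i)) (P' i)"
        by (rule module_hom_zero[OF projective_module[OF P'] projective_module[OF P']])
      then show ?thesis using greater by (simp add: P'_def \<delta>'_def)
    qed
    show "mat_image \<epsilon> = carrier_vec (fst M)" by (rule P(5))
    show "mat_image (\<delta>' 0) = mat_kernel \<epsilon>" using P(6) im by (cases "N = 0") (auto simp: \<delta>'_def)
    show "mat_image (\<delta>' (Suc i)) = mat_kernel (\<delta>' i)" for i
    proof (cases i N rule: linorder_cases)
      case less
      then show ?thesis using P(7)[of i] im by (cases "Suc i = N") (auto simp: \<delta>'_def)
    next
      case equal
      then show ?thesis using ker im0[of "fst Q"] by (simp add: \<delta>'_def P'_def)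
    next
      case greater
      have "mat_kernel (\<delta>' i) = {0\<^sub>v 0}"
        using greater by (auto simp: \<delta>'_def mat_kernel_def intro!: eq_vecI)
      then show ?thesis using greater im0[of 0] by (simp add: \<delta>'_def P'_def)
    qed
  qed
qed

section \<open>Comparison of homomorphism spaces along two filtrations\<close>

lemma hom_funs_eq_image: "hom_funs M N = mat_fun_of ` module_hom M N"
proof (intro equalityI subsetI)
  fix h assume "h \<in> hom_funs M N"
  then have "h \<in> box_funs (fst N) (fst M)" "mat (fst N) (fst M) h \<in> module_hom M N" by (auto simp: hom_funs_def)
  then show "h \<in> mat_fun_of ` module_hom M N" using mat_fun_of_mat[of h] by (metis image_eqI)
next
  fix h assume "h \<in> mat_fun_of ` module_hom M N"
  then show "h \<in> hom_funs M N" using mat_fun_of_hom by (elim imageE) simp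
qed

lemma mat_fun_of_eq_zero:
  assumes "A \<in> carrier_mat n d" "mat_fun_of A = 0"
  shows "A = 0\<^sub>m n d"
proof -
  have "A = mat n d (mat_fun_of A)" using mat_mat_fun_of[OF assms(1)] ..
  then show ?thesis unfolding assms(2) by (auto intro!: eq_matI)
qed

text \<open>The homomorphism spaces to \<open>P\<close> are compared through the filtrations of the two modules with
  factors \<open>P\<close>, \<open>W\<close>, \<open>Q\<close>. The identity of \<open>P\<close> extends to the direct sum but not to the extension by
  the non-split class \<open>\<eta>\<close>.\<close>

lemma hom_dim_extension_less:
  assumes P: "is_module P" and W: "is_module W" and Q: "is_module Q" and F: "is_module F"
    and j: "j \<in> module_hom W F" and \<xi>: "is_cocycle W Q \<xi>"
    and D: "D \<in> carrier_mat (fst F) (fst Q)" "\<forall>a. snd F a * D = j * \<xi> a + D * snd Q a"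
    and approx: "\<forall>h\<in>module_hom W P. \<exists>k\<in>module_hom F P. k * j = h"
    and \<eta>: "is_cocycle P W \<eta>" "is_cocycle P (direct_sum W Q) (\<lambda>a. \<eta> a * left_proj (fst W) (fst Q))"
    and nonsplit: "\<not> (\<exists>A\<in>carrier_mat (fst P) (fst W). \<forall>a. \<eta> a + A * snd W a = snd P a * A)"
  shows "hom_dim (extension P (direct_sum W Q) (\<lambda>a. \<eta> a * left_proj (fst W) (fst Q))) P <
    hom_dim (direct_sum P (extension W Q \<xi>)) P"
proof -
  let ?p = "fst P" and ?w = "fst W" and ?m = "fst Q"
  let ?n = "?p + (?w + ?m)"
  let ?l = "left_proj ?w ?m :: 'k mat" and ?r = "right_proj ?w ?m :: 'k mat"
  let ?L = "left_proj ?p (?w + ?m) :: 'k mat" and ?R = "right_proj ?p (?w + ?m) :: 'k mat"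
  let ?E = "extension W Q \<xi>" and ?S = "direct_sum W Q"
  define x where "x = direct_sum P ?E"
  define z where "z = extension P ?S (\<lambda>a. \<eta> a * ?l)"
  note S = direct_sum[OF W Q]
  have E: "is_module ?E" by (rule extension_module[OF W Q \<xi>])
  have x: "is_module x" "fst x = ?n" unfolding x_def using direct_sum(1,2)[OF P E] by (simp_all add: fst_extension)
  have z: "is_module z" "fst z = ?n" unfolding z_def using extension_module[OF P S(1) \<eta>(2)] by (simp_all add: fst_extension S(2))
  note d = module_dim[OF P] module_dim[OF W] module_dim[OF Q] module_dim[OF F] module_hom_dim[OF j] carrier_matD[OF D(1)]
    cocycle_dim[OF W Q \<xi>] cocycle_dim[OF P W \<eta>(1)] S(2)
  have eq3: "X = Y" if "dim_row X = dim_row Y" "dim_col X = ?n" "dim_col Y = ?n" "X * ?L\<^sup>T = Y * ?L\<^sup>T"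
    "X * (?R\<^sup>T * ?l\<^sup>T) = Y * (?R\<^sup>T * ?l\<^sup>T)" "X * (?R\<^sup>T * ?r\<^sup>T) = Y * (?R\<^sup>T * ?r\<^sup>T)" for X Y :: "'k mat"
  proof (rule mat_eq_projI[OF that(1-4)])
    show "X * ?R\<^sup>T = Y * ?R\<^sup>T"
      by (rule mat_eq_projI[of _ _ ?w ?m]) (use that in \<open>simp_all add: mat_assoc\<close>)
  qed
  \<comment> \<open>Out of \<open>x\<close> the block \<open>B1\<close> on \<open>P\<close> is free;
    the blocks on \<open>W\<close> and \<open>Q\<close> are coupled only through
    \<open>\<xi>\<close>.\<close>
  have build: "\<exists>A\<in>module_hom x P. A * ?L\<^sup>T = B1 \<and> A * (?R\<^sup>T * ?l\<^sup>T) = B2 \<and> A * (?R\<^sup>T * ?r\<^sup>T) = B3"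
    if B: "B1 \<in> module_hom P P" "B2 \<in> module_hom W P" "B3 \<in> carrier_mat ?p ?m" "\<And>a. B2 * \<xi> a + B3 * snd Q a = snd P a * B3"
    for B1 B2 B3
  proof -
    note dB = d module_hom_dim[OF B(1)] module_hom_dim[OF B(2)] carrier_matD[OF B(3)]
    define B' where "B' = B2 * ?l + B3 * ?r"
    have B': "B' \<in> module_hom ?E P" unfolding B'_def by (rule extension_homI[OF W Q \<xi> P B(2-4)])
    have dB': "dim_row B' = ?p" "dim_col B' = ?w + ?m" using module_hom_dim[OF B'] by (simp_all add: fst_extension)
    have dE: "dim_row (snd ?E a) = ?w + ?m" for a using module_dim[OF E] by (simp add: fst_extension)
    have "B1 * 0\<^sub>m ?p (fst ?E) + B' * snd ?E a = snd P a * B'" for a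
      using module_hom_comm[OF B', of a] dB dB' by (simp add: mat_mult_zero mat_group fst_extension)
    from extension_homI[OF P E cocycle_zero[OF P E] P B(1) module_hom_carrier[OF B'] this]
    have A: "B1 * ?L + B' * ?R \<in> module_hom x P" unfolding x_def direct_sum_def fst_extension .
    have "(B1 * ?L + B' * ?R) * ?L\<^sup>T = B1" "(B1 * ?L + B' * ?R) * ?R\<^sup>T = B'"
      using dB dB' by (simp_all add: mat_add_mult mat_assoc proj_simps mat_mult_one mat_mult_zero mat_group)
    moreover have "B' * ?l\<^sup>T = B2" "B' * ?r\<^sup>T = B3"
      unfolding B'_def using dB by (simp_all add: mat_add_mult mat_assoc proj_simps mat_mult_one mat_mult_zero mat_group)
    moreover have "(B1 * ?L + B' * ?R) * (?R\<^sup>T * X) = (B1 * ?L + B' * ?R) * ?R\<^sup>T * X" if "dim_row X = ?w + ?m" for X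
      using dB dB' that by (simp add: mat_assoc)
    ultimately show ?thesis using A by (intro bexI[of _ "B1 * ?L + B' * ?R"]) simp_all
  qed
  \<comment> \<open>Out of \<open>z\<close> the block on \<open>W\<close> is coupled to the block on
    \<open>P\<close> through \<open>\<eta>\<close>, whereas the block on \<open>Q\<close> is a
    homomorphism by itself.\<close>
  have zD: "A * ?L\<^sup>T \<in> module_hom P P"
    "A * ?L\<^sup>T * \<eta> a + A * (?R\<^sup>T * ?l\<^sup>T) * snd W a = snd P a * (A * (?R\<^sup>T * ?l\<^sup>T))"
    "A * (?R\<^sup>T * ?r\<^sup>T) * snd Q a = snd P a * (A * (?R\<^sup>T * ?r\<^sup>T))" if A: "A \<in> module_hom z P" for A a
  proof -
    note hD = extension_homD[OF P S(1) \<eta>(2) P A[unfolded z_def], unfolded S(2)]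
    show "A * ?L\<^sup>T \<in> module_hom P P" by (rule hD(1))
    note dA = d module_hom_dim[OF A, unfolded z(2)] module_dim[OF S(1)]
    have eq: "(A * ?L\<^sup>T) * ((\<eta> a * ?l) * X) + (A * ?R\<^sup>T) * (snd ?S a * X) = snd P a * (A * (?R\<^sup>T * X))"
      if "dim_row X = ?w + ?m" for X
    proof -
      have "(A * ?L\<^sup>T) * ((\<eta> a * ?l) * X) + (A * ?R\<^sup>T) * (snd ?S a * X) =
          (A * ?L\<^sup>T * (\<eta> a * ?l) + A * ?R\<^sup>T * snd ?S a) * X"
        using dA that by (simp add: mat_add_mult mat_assoc)
      also have "\<dots> = snd P a * (A * (?R\<^sup>T * X))" unfolding hD(2) using dA that by (simp add: mat_assoc)
      finally show ?thesis .
    qed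
    have "\<eta> a * ?l * ?l\<^sup>T = \<eta> a" "\<eta> a * ?l * ?r\<^sup>T = 0\<^sub>m ?p ?m" using d by (simp_all add: mat_assoc proj_simps mat_mult_one mat_mult_zero)
    then show "A * ?L\<^sup>T * \<eta> a + A * (?R\<^sup>T * ?l\<^sup>T) * snd W a = snd P a * (A * (?R\<^sup>T * ?l\<^sup>T))"
      "A * (?R\<^sup>T * ?r\<^sup>T) * snd Q a = snd P a * (A * (?R\<^sup>T * ?r\<^sup>T))"
      using eq[of "?l\<^sup>T"] eq[of "?r\<^sup>T"] dA module_hom_comm[OF S(3), of a] module_hom_comm[OF S(6), of a]
      by (simp_all add: mat_assoc mat_mult_zero mat_group)
  qed
  \<comment> \<open>\<open>f\<close> takes the block on \<open>P\<close> and \<open>g\<close> the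
    block on \<open>W\<close>; a map in both kernels is determined by its block on
    \<open>Q\<close>.\<close>
  define f where "f h = mat_fun_of (mat ?p ?n h * ?L\<^sup>T)" for h
  define g where "g h = mat_fun_of (mat ?p ?n h * (?R\<^sup>T * ?l\<^sup>T))" for h
  have car: "A \<in> carrier_mat ?p ?n" if "A \<in> module_hom x P \<or> A \<in> module_hom z P" for A
    using that module_hom_carrier[of A x P] module_hom_carrier[of A z P] by (auto simp: x z)
  have fA: "f (mat_fun_of A) = mat_fun_of (A * ?L\<^sup>T)" "g (mat_fun_of A) = mat_fun_of (A * (?R\<^sup>T * ?l\<^sup>T))"
    if "A \<in> module_hom x P \<or> A \<in> module_hom z P" for A
    unfolding f_def g_def mat_mat_fun_of[OF car[OF that]] by simp_all
  have zero: "mat_fun_of (0\<^sub>m ?p n) = 0" for n by (auto simp: mat_fun_of_def fun_eq_iff)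
  have f0: "A * ?L\<^sup>T = 0\<^sub>m ?p ?p" if "A \<in> module_hom x P \<or> A \<in> module_hom z P" "f (mat_fun_of A) = 0" for A
    by (rule mat_fun_of_eq_zero) (use fA(1)[OF that(1)] that(2) car[OF that(1)] in \<open>auto intro: carrier_matI\<close>)
  have g0: "A * (?R\<^sup>T * ?l\<^sup>T) = 0\<^sub>m ?p ?w" if "A \<in> module_hom x P \<or> A \<in> module_hom z P" "g (mat_fun_of A) = 0" for A
    by (rule mat_fun_of_eq_zero) (use fA(2)[OF that(1)] that(2) car[OF that(1)] in \<open>auto intro: carrier_matI\<close>)
  obtain T :: "(nat \<times> nat \<Rightarrow> 'k) set" where T: "finite T" "box_funs ?p ?n \<subseteq> fun_vs.span T" by (rule box_funs_finite_span)
  have "fun_vs.dim (hom_funs z P) < fun_vs.dim (hom_funs x P)"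
  proof (rule fun_vs.dim_less_by_two_maps[OF _ _ _ _ _ _ T(1)])
    show "Vector_Spaces.linear (\<lambda>c (h :: nat \<times> nat \<Rightarrow> 'k) i. c * h i) (\<lambda>c h i. c * h i) f"
      "Vector_Spaces.linear (\<lambda>c (h :: nat \<times> nat \<Rightarrow> 'k) i. c * h i) (\<lambda>c h i. c * h i) g"
      unfolding f_def g_def by (rule linear_right_mult; simp)+
    show "fun_vs.subspace (hom_funs z P)" "fun_vs.subspace (hom_funs x P)"
      by (rule subspace_hom_funs; fact z x P)+
    show "hom_funs z P \<subseteq> fun_vs.span T" "hom_funs x P \<subseteq> fun_vs.span T"
      using T(2) hom_funs_subset_box[of z P] hom_funs_subset_box[of x P] by (simp_all add: x z)
    show "f ` hom_funs z P \<subset> f ` hom_funs x P"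
    proof (intro psubsetI notI)
      show "f ` hom_funs z P \<subseteq> f ` hom_funs x P"
      proof
        fix y assume "y \<in> f ` hom_funs z P"
        then obtain A where A: "A \<in> module_hom z P" "y = mat_fun_of (A * ?L\<^sup>T)" by (auto simp: hom_funs_eq_image fA)
        have "0\<^sub>m ?p ?w * \<xi> a + 0\<^sub>m ?p ?m * snd Q a = snd P a * 0\<^sub>m ?p ?m" for a
          using d by (simp add: mat_zero_mult mat_mult_zero mat_group)
        from build[OF zD(1)[OF A(1)] module_hom_zero[OF W P] _ this]
        obtain A' where "A' \<in> module_hom x P" "A' * ?L\<^sup>T = A * ?L\<^sup>T" by auto
        then show "y \<in> f ` hom_funs x P"
          unfolding hom_funs_eq_image image_image A(2) using fA(1)[of A'] by (intro image_eqI[of _ _ A']) simp_all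
      qed
      assume eq: "f ` hom_funs z P = f ` hom_funs x P"
      have "0\<^sub>m ?p ?w * \<xi> a + 0\<^sub>m ?p ?m * snd Q a = snd P a * 0\<^sub>m ?p ?m" for a
        using d by (simp add: mat_zero_mult mat_mult_zero mat_group)
      from build[OF module_hom_one[OF P] module_hom_zero[OF W P] _ this]
      obtain A' where A': "A' \<in> module_hom x P" "A' * ?L\<^sup>T = 1\<^sub>m ?p" by auto
      have "mat_fun_of (1\<^sub>m ?p) \<in> f ` hom_funs x P"
        unfolding hom_funs_eq_image image_image using fA(1)[of A'] A' by (intro image_eqI[of _ _ A']) simp_all
      then have "mat_fun_of (1\<^sub>m ?p) \<in> f ` hom_funs z P" unfolding eq .
      then obtain A where A: "A \<in> module_hom z P" "mat_fun_of (1\<^sub>m ?p) = mat_fun_of (A * ?L\<^sup>T)" by (auto simp: hom_funs_eq_image fA)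
      have "A * ?L\<^sup>T \<in> carrier_mat ?p ?p" using module_hom_carrier[OF zD(1)[OF A(1)]] .
      from mat_mat_fun_of[OF this] mat_mat_fun_of[OF module_hom_carrier[OF module_hom_one[OF P]]] have A1: "A * ?L\<^sup>T = 1\<^sub>m ?p"
        unfolding A(2) by simp
      have "\<eta> a + (A * (?R\<^sup>T * ?l\<^sup>T)) * snd W a = snd P a * (A * (?R\<^sup>T * ?l\<^sup>T))" for a
        using zD(2)[OF A(1), of a] d by (simp add: A1 mat_one_mult)
      moreover have "A * (?R\<^sup>T * ?l\<^sup>T) \<in> carrier_mat ?p ?w" using car[of A] A(1) by (auto intro: carrier_matI)
      ultimately show False using nonsplit by blast
    qed
    show "g ` {h \<in> hom_funs z P. f h = 0} \<subseteq> g ` {h \<in> hom_funs x P. f h = 0}"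
    proof
      fix y assume "y \<in> g ` {h \<in> hom_funs z P. f h = 0}"
      then obtain A where A: "A \<in> module_hom z P" "f (mat_fun_of A) = 0" "y = g (mat_fun_of A)" by (auto simp: hom_funs_eq_image)
      let ?A = "A * (?R\<^sup>T * ?l\<^sup>T)"
      have cA: "?A \<in> carrier_mat ?p ?w" using car[of A] A(1) by (auto intro: carrier_matI)
      have "?A * snd W a = snd P a * ?A" for a
        using zD(2)[OF A(1), of a] f0[of A] A(1,2) d carrier_matD[OF cA] by (simp add: mat_zero_mult mat_group)
      then have hA: "?A \<in> module_hom W P" using cA by (intro module_homI)
      \<comment> \<open>Once the block on \<open>P\<close> is zero, the block on \<open>W\<close> is
        a homomorphism, and the approximation property extends it to \<open>k\<close> on
        \<open>F\<close>. The values \<open>k * D\<close> on the complement of \<open>W\<close> in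
        \<open>F\<close> are the block on \<open>Q\<close> that completes it to a homomorphism out
        of \<open>x\<close>.\<close>
      then obtain k where k: "k \<in> module_hom F P" "k * j = ?A" using approx by blast
      note dk = d module_hom_dim[OF k(1)]
      have "?A * \<xi> a + k * D * snd Q a = snd P a * (k * D)" for a
      proof -
        have "?A * \<xi> a + k * D * snd Q a = k * (snd F a * D)"
          unfolding k(2)[symmetric] spec[OF D(2)] using dk by (simp add: mat_mult_add mat_assoc)
        also have "\<dots> = (k * snd F a) * D" using dk by (simp add: mat_assoc)
        finally show ?thesis unfolding module_hom_comm[OF k(1)] using dk by (simp add: mat_assoc)
      qed
      from build[OF module_hom_zero[OF P P] hA carrier_matI this] dk
      obtain A' where A': "A' \<in> module_hom x P" "A' * ?L\<^sup>T = 0\<^sub>m ?p ?p" "A' * (?R\<^sup>T * ?l\<^sup>T) = ?A" by auto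
      show "y \<in> g ` {h \<in> hom_funs x P. f h = 0}"
        using A' fA[of A'] fA(2)[of A] A(1) unfolding A(3) hom_funs_eq_image
        by (intro image_eqI[of _ _ "mat_fun_of A'"]) (simp_all add: zero)
    qed
    show "h \<in> hom_funs x P" if h: "h \<in> hom_funs z P" "f h = 0" "g h = 0" for h
    proof -
      obtain A where A: "A \<in> module_hom z P" "h = mat_fun_of A" using h(1) by (auto simp: hom_funs_eq_image)
      have 0: "A * ?L\<^sup>T = 0\<^sub>m ?p ?p" "A * (?R\<^sup>T * ?l\<^sup>T) = 0\<^sub>m ?p ?w" using f0[of A] g0[of A] A h by auto
      let ?A = "A * (?R\<^sup>T * ?r\<^sup>T)"
      have cA: "?A \<in> carrier_mat ?p ?m" using car[of A] A(1) by (auto intro: carrier_matI)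
      have "0\<^sub>m ?p ?w * \<xi> a + ?A * snd Q a = snd P a * ?A" for a
        using zD(3)[OF A(1), of a] d carrier_matD[OF cA] by (simp add: mat_zero_mult mat_group)
      from build[OF module_hom_zero[OF P P] module_hom_zero[OF W P] cA this]
      obtain A' where A': "A' \<in> module_hom x P" "A' * ?L\<^sup>T = 0\<^sub>m ?p ?p" "A' * (?R\<^sup>T * ?l\<^sup>T) = 0\<^sub>m ?p ?w" "A' * (?R\<^sup>T * ?r\<^sup>T) = ?A"
        by auto
      have "A' = A"
        by (rule eq3) (use car[of A] car[of A'] A(1) A' 0 in \<open>auto dest: carrier_matD\<close>)
      then show ?thesis using A'(1) mat_fun_of_hom A(2) by simp
    qed
  qed
  then show ?thesis unfolding hom_dim_def x_def z_def .
qed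

end

context alg_closed_algebra
begin

section \<open>Degenerations of extensions\<close>

interpretation pf: function_algebra UNIV "{f :: 'k \<Rightarrow> 'k. \<exists>u. \<forall>t. f t = poly u t}"
  by (rule polynomial_functions)

text \<open>The family is an image of the affine line: a polynomial in the entries pulls back to a
  polynomial in \<open>t\<close>, and two nonzero polynomials over an infinite field have a common
  nonroot.\<close>

lemma polynomial_family_irreducible:
  assumes mod: "\<And>t. is_module (d, \<rho> t)" and fn: "\<And>a. pf.mat_fun d d (\<lambda>t. \<rho> t a)"
  shows "irreducible_family d (range \<rho>)"
proof -
  have ev: "\<exists>u. \<forall>t. rep_eval (\<rho> t) p = poly u t" if p: "p \<in> mod_polys d" for p
  proof -
    have "(\<lambda>t. rep_eval (\<rho> t) p) \<in> {f. \<exists>u. \<forall>t. f t = poly u t}"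
      unfolding rep_eval_def
    proof (rule eval_fun[OF polynomial_functions])
      fix m v assume "m \<in> Poly_Mapping.keys p" "v \<in> Poly_Mapping.keys m"
      then have "v \<in> mod_vars d" using p by (auto simp: poly_ring_in_def)
      then obtain a i j where "v = (a, i, j)" "i < d" "j < d" by (auto simp: mod_vars_def)
      then show "(\<lambda>t. case v of (a, i, j) \<Rightarrow> \<rho> t a $$ (i, j)) \<in> {f. \<exists>u. \<forall>t. f t = poly u t}"
        using pf.mat_fun_entry[OF fn[of a]] by simp
    qed
    then show ?thesis by simp
  qed
  show ?thesis
    unfolding irreducible_family_def
  proof (intro conjI ballI impI)
    show "range \<rho> \<noteq> {}" by simp
    show "is_module (d, \<sigma>)" if "\<sigma> \<in> range \<rho>" for \<sigma> using that mod by auto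
    fix p q \<sigma> \<tau> assume pq: "p \<in> mod_polys d" "q \<in> mod_polys d" and \<sigma>\<tau>: "\<sigma> \<in> range \<rho>" "\<tau> \<in> range \<rho>"
      and ne: "rep_eval \<sigma> p \<noteq> 0" "rep_eval \<tau> q \<noteq> 0"
    obtain u where u: "\<And>t. rep_eval (\<rho> t) p = poly u t" using ev[OF pq(1)] by blast
    obtain v where v: "\<And>t. rep_eval (\<rho> t) q = poly v t" using ev[OF pq(2)] by blast
    have "u * v \<noteq> 0" using \<sigma>\<tau> ne u v by auto
    then have "finite {t. poly (u * v) t = 0}" by (rule poly_roots_finite)
    from ex_new_if_finite[OF infinite_UNIV_alg_closed this] obtain t where "poly (u * v) t \<noteq> 0" by blast
    then show "\<exists>\<upsilon>\<in>range \<rho>. rep_eval \<upsilon> p \<noteq> 0 \<and> rep_eval \<upsilon> q \<noteq> 0"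
      using u v by (intro bexI[of _ "\<rho> t"]) auto
  qed
qed

lemma extension_fun:
  assumes d: "\<And>t. fst (M t) = e" "\<And>t. fst (N t) = d"
    and M: "pf.mat_fun e e (\<lambda>t. snd (M t) a)" and N: "pf.mat_fun d d (\<lambda>t. snd (N t) a)"
    and \<xi>: "pf.mat_fun e d (\<lambda>t. \<xi> t a)"
  shows "pf.mat_fun (e + d) (e + d) (\<lambda>t. snd (extension (M t) (N t) (\<xi> t)) a)"
proof -
  have c: "pf.mat_fun e (e + d) (\<lambda>_. left_proj e d)" "pf.mat_fun d (e + d) (\<lambda>_. right_proj e d)"
    "pf.mat_fun (e + d) e (\<lambda>_. (left_proj e d)\<^sup>T)" "pf.mat_fun (e + d) d (\<lambda>_. (right_proj e d)\<^sup>T)"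
    by (rule pf.mat_fun_const; rule carrier_matI; simp)+
  show ?thesis
    unfolding extension_def d snd_conv
    by (rule pf.mat_fun_add[OF pf.mat_fun_mult[OF c(3) pf.mat_fun_add[OF pf.mat_fun_mult[OF M c(1)] pf.mat_fun_mult[OF \<xi> c(2)]]]
      pf.mat_fun_mult[OF c(4) pf.mat_fun_mult[OF N c(2)]]])
qed

lemma smult_cocycle_fun: "\<lbrakk>is_module M; is_module N; is_cocycle M N \<xi>\<rbrakk> \<Longrightarrow> pf.mat_fun (fst M) (fst N) (\<lambda>t. t \<cdot>\<^sub>m \<xi> a)"
  by (rule pf.mat_fun_smult[OF _ pf.mat_fun_const]) (auto simp: cocycle_dim intro!: carrier_matI exI[of _ "[:0, 1:]"])

text \<open>Scaling the cocycles by \<open>t\<close> gives two lines of modules, \<open>x t\<close>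
  and \<open>z t\<close>. They meet at \<open>t = 0\<close> in the direct sum of all three modules
  and end at the given ones for \<open>t = 1\<close>.\<close>

lemma connected_to_direct_sum:
  assumes P: "is_module P" and W: "is_module W" and Q: "is_module Q" and \<xi>: "is_cocycle W Q \<xi>"
    and \<eta>: "is_cocycle P (direct_sum W Q) \<eta>"
  defines "d \<equiv> fst P + (fst W + fst Q)"
  shows "connected_component_of (mod_space d) (generic_point d {snd (direct_sum P (extension W Q \<xi>))})
    (generic_point d {snd (extension P (direct_sum W Q) \<eta>)})"
proof -
  note S = direct_sum[OF W Q]
  have const: "pf.mat_fun (fst M) (fst M) (\<lambda>_. snd M a)" if "is_module M" for M a
    by (rule pf.mat_fun_const[OF module_carrier[OF that]])
  have smult0: "(\<lambda>a. 0 \<cdot>\<^sub>m \<zeta> a) = (\<lambda>_. 0\<^sub>m (fst M) (fst N))" and smult1: "(\<lambda>a. 1 \<cdot>\<^sub>m \<zeta> a) = \<zeta>"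
    if "is_module M" "is_module N" "is_cocycle M N \<zeta>" for M N \<zeta>
    using cocycle_dim[OF that] by (auto intro!: eq_matI simp: fun_eq_iff)
  let ?y = "direct_sum P (direct_sum W Q)"
  define x where "x t = direct_sum P (extension W Q (\<lambda>a. t \<cdot>\<^sub>m \<xi> a))" for t
  define z where "z t = extension P (direct_sum W Q) (\<lambda>a. t \<cdot>\<^sub>m \<eta> a)" for t
  have E: "is_module (extension W Q (\<lambda>a. t \<cdot>\<^sub>m \<xi> a))" for t
    by (rule extension_module[OF W Q cocycle_smult[OF W Q \<xi>]])
  have fx: "fst (x t) = d" and fz: "fst (z t) = d" for t
    by (simp_all add: x_def z_def d_def direct_sum_def fst_extension)
  have x01: "x 0 = ?y" "x 1 = direct_sum P (extension W Q \<xi>)" and z01: "z 0 = ?y" "z 1 = extension P (direct_sum W Q) \<eta>"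
    unfolding x_def z_def smult0[OF W Q \<xi>] smult1[OF W Q \<xi>] smult0[OF P S(1) \<eta>] smult1[OF P S(1) \<eta>]
    by (simp_all add: direct_sum_def)
  have "is_module (x t)" "is_module (z t)" for t
    unfolding x_def z_def by (rule direct_sum(1)[OF P E] extension_module[OF P S(1) cocycle_smult[OF P S(1) \<eta>]])+
  then have mods: "is_module (d, snd (x t))" "is_module (d, snd (z t))" for t
    by (metis fx fz prod.collapse)+
  have "pf.mat_fun d d (\<lambda>t. snd (x t) a)" for a
  proof -
    have "pf.mat_fun (fst W + fst Q) (fst W + fst Q) (\<lambda>t. snd (extension W Q (\<lambda>a. t \<cdot>\<^sub>m \<xi> a)) a)"
      by (rule extension_fun[OF refl refl const[OF W] const[OF Q] smult_cocycle_fun[OF W Q \<xi>]])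
    from extension_fun[OF refl fst_extension const[OF P] this, of "\<lambda>_ _. 0\<^sub>m (fst P) (fst W + fst Q)"]
    show ?thesis
      unfolding x_def d_def by (simp add: direct_sum_def fst_extension pf.mat_fun_const)
  qed
  from polynomial_family_irreducible[OF mods(1) this]
  have 1: "connected_component_of (mod_space d) (generic_point d {snd (x 1)}) (generic_point d {snd (x 0)})"
    by (rule connected_component_generic_points) auto
  have "pf.mat_fun d d (\<lambda>t. snd (z t) a)" for a
    unfolding z_def d_def
    using extension_fun[OF refl S(2) const[OF P] const[OF S(1), unfolded S(2)] smult_cocycle_fun[OF P S(1) \<eta>, unfolded S(2)]] .
  from polynomial_family_irreducible[OF mods(2) this]
  have 2: "connected_component_of (mod_space d) (generic_point d {snd (z 0)}) (generic_point d {snd (z 1)})"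
    by (rule connected_component_generic_points) auto
  show ?thesis using connected_component_of_trans[OF 1 2[unfolded z01, folded x01(1)]] unfolding x01(2) .
qed

text \<open>The common component is irreducible, so the neighbourhoods \<open>p \<noteq> 0\<close>
  and \<open>q \<noteq> 0\<close> of the two points meet in it, and the nonempty open set
  \<open>p * q \<noteq> 0\<close> contains a closed point.\<close>

lemma geometrically_irreducible_meet:
  assumes gi: geometrically_irreducible and \<rho>\<sigma>: "is_module (d, \<rho>)" "is_module (d, \<sigma>)"
    and conn: "connected_component_of (mod_space d) (generic_point d {\<rho>}) (generic_point d {\<sigma>})"
    and p: "p \<in> mod_polys d" "rep_eval \<rho> p \<noteq> 0" and q: "q \<in> mod_polys d" "rep_eval \<sigma> q \<noteq> 0"
  obtains \<tau> where "is_module (d, \<tau>)" "rep_eval \<tau> p \<noteq> 0" "rep_eval \<tau> q \<noteq> 0"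
proof -
  let ?X = "mod_space d" and ?x = "generic_point d {\<rho>}" and ?y = "generic_point d {\<sigma>}"
  define Z where "Z = connected_component_of_set ?X ?x"
  have top: "topspace ?X = Spec (mod_coordinate_ring d)" by (simp add: mod_space_def)
  have x: "?x \<in> basic_open d p" and y: "?y \<in> basic_open d q"
    using generic_point_basic_open[OF irreducible_family_single[OF \<rho>\<sigma>(1)] p(1)] p(2)
      generic_point_basic_open[OF irreducible_family_single[OF \<rho>\<sigma>(2)] q(1)] q(2) by auto
  have xX: "?x \<in> topspace ?X" using x unfolding top by (simp add: basic_open_mem)
  have "Z \<in> connected_components_of ?X"
    unfolding Z_def using xX by (simp add: connected_component_in_connected_components_of)
  then have irr: "irreducible_space (subtopology ?X Z)" using gi unfolding geometrically_irreducible_def by blast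
  have xZ: "?x \<in> Z" and yZ: "?y \<in> Z"
    unfolding Z_def using conn connected_component_of_refl[of ?X ?x] xX by auto
  have Z: "topspace (subtopology ?X Z) = Z"
    using connected_component_of_subset_topspace[of ?X ?x] by (auto simp: Z_def)
  have cl: "closedin (subtopology ?X Z) (Z - basic_open d g)" if "g \<in> mod_polys d" for g
  proof -
    have "openin (subtopology ?X Z) (Z \<inter> basic_open d g)"
      by (rule openin_subtopology_Int2[OF openin_basic_open[OF that]])
    moreover have "Z - Z \<inter> basic_open d g = Z - basic_open d g" by blast
    ultimately show ?thesis using closedin_diff[OF closedin_topspace, of "subtopology ?X Z"] unfolding Z by metis
  qed
  have "(Z - basic_open d p) \<union> (Z - basic_open d q) \<noteq> Z"
  proof
    assume "(Z - basic_open d p) \<union> (Z - basic_open d q) = Z"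
    then have "Z - basic_open d p = Z \<or> Z - basic_open d q = Z"
      using irr cl[OF p(1)] cl[OF q(1)] unfolding irreducible_space_def Z by blast
    then show False using xZ yZ x y by blast
  qed
  then obtain \<omega> where "\<omega> \<in> basic_open d (p * q)" unfolding basic_open_mult[OF p(1) q(1)] by blast
  moreover have "p * q \<in> mod_polys d" by (rule poly_ring_in_closed(2)[OF p(1) q(1)])
  ultimately obtain \<tau> where "is_module (d, \<tau>)" "rep_eval \<tau> (p * q) \<noteq> 0"
    by (rule closed_point_exists)
  then show ?thesis using that by (simp add: rep_eval_simps)
qed

text \<open>Where \<open>g\<close> does not vanish, a section of the free cover of \<open>x\<close> followed by the free cover of \<open>\<tau>\<close>
  is an isomorphism.\<close>

lemma projective_iso_open:
  assumes x: "projective x" and d: "fst x = d" and N: "is_module N"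
  obtains g where "g \<in> mod_polys d" "rep_eval (snd x) g \<noteq> 0"
    "\<forall>\<tau>. is_module (d, \<tau>) \<longrightarrow> rep_eval \<tau> g \<noteq> 0 \<longrightarrow> hom_dim x N \<le> hom_dim (d, \<tau>) N"
proof -
  obtain s where s: "s \<in> module_hom x (free d)" "free_map x d (1\<^sub>m d) * s = 1\<^sub>m d"
    by (rule projective_section[OF x, unfolded d])
  note X = projective_module[OF x]
  have xd: "(d, snd x) = x" using d by (metis prod.collapse)
  have sc: "s \<in> carrier_mat (d * algebra_dim) d" using module_hom_carrier[OF s(1)] by (simp add: fst_free d)
  have "rf.mat_fun d d (d * algebra_dim) (free_cover d)"
    unfolding free_cover_def[abs_def] by (rule free_map_fun[OF rf.mat_fun_const[OF one_carrier_mat]])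
  from rf.det_fun[OF rf.mat_fun_mult[OF this rf.mat_fun_const[OF sc]]]
  obtain g where g: "g \<in> mod_polys d" "\<And>\<rho>. is_module (d, \<rho>) \<Longrightarrow> rep_eval \<rho> g = det (free_cover d \<rho> * s)"
    by (rule rep_fun_poly) blast
  show ?thesis
  proof (intro that[OF g(1)] allI impI)
    have "is_module (d, snd x)" unfolding xd by (rule X)
    from g(2)[OF this] show "rep_eval (snd x) g \<noteq> 0" by (simp add: free_cover_def xd s(2))
  next
    fix \<tau> assume "is_module (d, \<tau>)" "rep_eval \<tau> g \<noteq> 0"
    note \<tau> = this
    let ?\<theta> = "free_cover d \<tau> * s"
    have \<theta>: "?\<theta> \<in> module_hom x (d, \<tau>)" by (rule module_hom_comp[OF X free_module \<tau>(1) s(1) free_cover(1)[OF \<tau>(1)]])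
    have c: "?\<theta> \<in> carrier_mat d d" using module_hom_carrier[OF \<theta>] by (simp add: d)
    have "det ?\<theta> \<noteq> 0" using \<tau>(2) unfolding g(2)[OF \<tau>(1)] .
    note inv = det_nonzero_inverse[OF c this]
    have "(1 / det ?\<theta>) \<cdot>\<^sub>m adj_mat ?\<theta> \<in> module_hom (d, \<tau>) x"
      by (rule module_hom_inverse[OF X \<tau>(1) \<theta>]) (use inv d in simp_all)
    from hom_dim_le_if_iso[OF X \<tau>(1) N \<theta> this] inv(3) d
    show "hom_dim x N \<le> hom_dim (d, \<tau>) N" by simp
  qed
qed

text \<open>The core of the converse, for one exact piece of a resolution with injective
  \<open>B\<close>. If no retraction exists, \<open>P1\<close> is a nonsplit extension of the
  cokernel of \<open>B\<close>, and irreducibility yields two contradictory comparisons of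
  dimensions of homomorphism spaces into \<open>P2\<close>.\<close>

lemma retraction_exists:
  assumes gi: geometrically_irreducible
    and P: "projective P0" "projective P1" "projective P2" and B: "B \<in> module_hom P2 P1" and \<delta>: "\<delta> \<in> module_hom P1 P0"
    and inj: "\<And>v. \<lbrakk>v \<in> carrier_vec (fst P2); B *\<^sub>v v = 0\<^sub>v (fst P1)\<rbrakk> \<Longrightarrow> v = 0\<^sub>v (fst P2)"
    and exact: "mat_image B = mat_kernel \<delta>"
  shows "\<exists>r\<in>module_hom P1 P2. r * B = 1\<^sub>m (fst P2)"
proof (rule ccontr)
  assume contra: "\<not> ?thesis"
  note PM = projective_module[OF P(1)] projective_module[OF P(2)] projective_module[OF P(3)]
  obtain B' where B': "B' \<in> carrier_mat (fst P2) (fst P1)" "B' * B = 1\<^sub>m (fst P2)"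
    by (rule mat_left_inverse[OF module_hom_carrier[OF B] inj])
  obtain W \<eta> C C' where W: "is_module W" "is_cocycle P2 W \<eta>" "C \<in> carrier_mat (fst P1) (fst W)" "C' \<in> module_hom P1 W"
    "C' * C = 1\<^sub>m (fst W)" "C' * B = 0\<^sub>m (fst W) (fst P2)" "B' * C = 0\<^sub>m (fst P2) (fst W)" "B * B' + C * C' = 1\<^sub>m (fst P1)"
    "\<forall>a. snd P1 a * C = B * \<eta> a + C * snd W a" "\<forall>a. \<eta> a = B' * (snd P1 a * C)"
    by (rule sub_quotient[OF PM(2,3) B B'])
  note d = module_dim[OF PM(1)] module_dim[OF PM(2)] module_dim[OF PM(3)] module_hom_dim[OF B] module_hom_dim[OF \<delta>]
    carrier_matD[OF B'(1)] carrier_matD[OF W(3)] module_hom_dim[OF W(4)] cocycle_dim[OF PM(3) W(1,2)] module_dim[OF W(1)]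
  have \<delta>B: "\<delta> * B = 0\<^sub>m (fst P0) (fst P2)"
    by (rule exact_imp_comp_zero[OF module_hom_carrier[OF \<delta>] module_hom_carrier[OF B] equalityD1[OF exact]])
  \<comment> \<open>The map induced by \<open>\<delta>\<close> on the cokernel \<open>W\<close> of
    \<open>B\<close>. It is injective because the kernel of \<open>\<delta>\<close> is the image of
    \<open>B\<close>, and it provides the projective module into which \<open>W\<close>
    embeds.\<close>
  define i where "i = \<delta> * C"
  have i: "i \<in> module_hom W P0"
  proof (rule module_homI)
    fix a
    have "snd P0 a * i = (snd P0 a * \<delta>) * C" unfolding i_def using d by (simp add: mat_assoc)
    also have "\<dots> = \<delta> * (snd P1 a * C)" unfolding module_hom_comm[OF \<delta>, symmetric] using d by (simp add: mat_assoc)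
    also have "\<dots> = (\<delta> * B) * \<eta> a + i * snd W a" unfolding spec[OF W(9)] i_def using d by (simp add: mat_mult_add mat_assoc)
    finally show "i * snd W a = snd P0 a * i" unfolding \<delta>B using d by (simp add: i_def mat_zero_mult mat_group)
  qed (use d in \<open>auto simp: i_def intro: carrier_matI\<close>)
  have "v = 0\<^sub>v (fst W)" if v: "v \<in> carrier_vec (fst W)" "i *\<^sub>v v = 0\<^sub>v (fst P0)" for v
  proof -
    have "C *\<^sub>v v \<in> mat_image B"
      unfolding exact mat_kernel_def using v d by (auto simp: i_def mat_vec_assoc intro: carrier_vecI)
    then obtain u where u: "u \<in> carrier_vec (fst P2)" "C *\<^sub>v v = B *\<^sub>v u" using d by (auto simp: mat_image_def)
    have "v = (C' * C) *\<^sub>v v" unfolding W(5) using v by simp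
    also have "\<dots> = C' *\<^sub>v (B *\<^sub>v u)" using d v u by (simp add: mat_vec_assoc)
    also have "\<dots> = (C' * B) *\<^sub>v u" using d u by (simp add: mat_vec_assoc)
    finally show ?thesis unfolding W(6) using u by (simp add: zero_mat_vec)
  qed
  then obtain i' where i': "i' \<in> carrier_mat (fst W) (fst P0)" "i' * i = 1\<^sub>m (fst W)"
    by (rule mat_left_inverse[OF module_hom_carrier[OF i]])
  obtain F j j' where F: "projective F" "j \<in> module_hom W F" "j' \<in> carrier_mat (fst W) (fst F)" "j' * j = 1\<^sub>m (fst W)"
    "\<forall>h\<in>module_hom W P2. \<exists>k\<in>module_hom F P2. k * j = h"
    by (rule left_approximation[OF W(1) P(3,1) i i'])
  note FM = projective_module[OF F(1)]
  obtain Q \<xi> D D' where Q: "is_module Q" "is_cocycle W Q \<xi>" "D \<in> carrier_mat (fst F) (fst Q)" "D' \<in> module_hom F Q"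
    "D' * D = 1\<^sub>m (fst Q)" "D' * j = 0\<^sub>m (fst Q) (fst W)" "j' * D = 0\<^sub>m (fst W) (fst Q)" "j * j' + D * D' = 1\<^sub>m (fst F)"
    "\<forall>a. snd F a * D = j * \<xi> a + D * snd Q a" "\<forall>a. \<xi> a = j' * (snd F a * D)"
    by (rule sub_quotient[OF FM W(1) F(2-4)])
  let ?l = "left_proj (fst W) (fst Q) :: 'k mat" and ?r = "right_proj (fst W) (fst Q) :: 'k mat"
  let ?E = "extension W Q \<xi>" and ?S = "direct_sum W Q"
  note d' = d module_hom_dim[OF F(2)] carrier_matD[OF F(3)] carrier_matD[OF Q(3)] module_hom_dim[OF Q(4)] module_dim[OF FM]
    module_dim[OF Q(1)] cocycle_dim[OF W(1) Q(1,2)]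
  note S = direct_sum[OF W(1) Q(1)]
  have E: "is_module ?E" "fst ?E = fst W + fst Q" by (rule extension_module[OF W(1) Q(1,2)], rule fst_extension)
  \<comment> \<open>In the basis formed by \<open>j\<close> and \<open>D\<close> the module
    \<open>F\<close> becomes the extension of \<open>Q\<close> by \<open>W\<close> with class
    \<open>\<xi>\<close>. This isomorphic copy replaces \<open>F\<close> below, so that both modules
    appear with factors \<open>P2\<close>, \<open>W\<close>, \<open>Q\<close>.\<close>
  have Eproj: "projective ?E"
  proof -
    define J where "J = j * ?l + D * ?r"
    define J' where "J' = ?l\<^sup>T * j' + ?r\<^sup>T * D'"
    have J: "J \<in> module_hom ?E F"
      unfolding J_def by (rule extension_homI[OF W(1) Q(1,2) FM F(2) Q(3)]) (simp add: spec[OF Q(9)])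
    have J'c: "J' \<in> carrier_mat (fst ?E) (fst F)" unfolding J'_def E(2) by (rule carrier_matI) (simp_all add: d')
    have "J' * J = ?l\<^sup>T * (j' * J) + ?r\<^sup>T * (D' * J)"
      unfolding J'_def using d' module_hom_dim[OF J] by (simp add: mat_add_mult mat_assoc)
    also have "j' * J = (j' * j) * ?l + (j' * D) * ?r" unfolding J_def using d' by (simp add: mat_mult_add mat_assoc)
    also have "\<dots> = ?l" unfolding F(4) Q(7) by (simp add: mat_one_mult mat_zero_mult mat_group)
    also have "D' * J = (D' * j) * ?l + (D' * D) * ?r" unfolding J_def using d' by (simp add: mat_mult_add mat_assoc)
    also have "\<dots> = ?r" unfolding Q(5,6) by (simp add: mat_one_mult mat_zero_mult mat_group)
    finally have J'J: "J' * J = 1\<^sub>m (fst ?E)" unfolding proj_simps E(2) .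
    have "J * J' = j * (?l * J') + D * (?r * J')"
      unfolding J_def using d' carrier_matD[OF J'c] by (simp add: mat_add_mult mat_assoc E(2))
    also have "?l * J' = j'" unfolding J'_def using d' by (simp add: mat_mult_add proj_cancel mat_group)
    also have "?r * J' = D'" unfolding J'_def using d' by (simp add: mat_mult_add proj_cancel mat_group)
    finally have JJ': "J * J' = 1\<^sub>m (fst F)" unfolding Q(8) .
    have J': "J' \<in> module_hom F ?E" by (rule module_hom_inverse[OF E(1) FM J J'c J'J JJ'])
    show ?thesis
    proof (rule projective_retract[OF E(1) F(1) F(1) J J' module_hom_zero[OF E(1) FM] module_hom_zero[OF FM E(1)]])
      show "J' * J + 0\<^sub>m (fst ?E) (fst F) * 0\<^sub>m (fst F) (fst ?E) = 1\<^sub>m (fst ?E)"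
        unfolding J'J by (simp add: mat_group)
    qed
  qed
  \<comment> \<open>The class \<open>\<eta>\<close> pulled back along the projection from
    \<open>W \<oplus> Q\<close> to \<open>W\<close>; the extension that it defines is the direct sum
    of \<open>P1\<close> and \<open>Q\<close> in other coordinates.\<close>
  let ?\<eta> = "\<lambda>a. \<eta> a * ?l"
  have \<eta>': "is_cocycle P2 ?S ?\<eta>"
    unfolding is_cocycle_def S(2)
  proof (intro conjI allI)
    fix a b c
    show "\<eta> a * ?l \<in> carrier_mat (fst P2) (fst W + fst Q)" using d by (intro carrier_matI) simp_all
    show "\<eta> (a + b) * ?l = \<eta> a * ?l + \<eta> b * ?l" unfolding cocycle_add[OF PM(3) W(1,2)] using d by (simp add: mat_add_mult)
    show "\<eta> (scale c a) * ?l = c \<cdot>\<^sub>m (\<eta> a * ?l)" unfolding cocycle_scale[OF PM(3) W(1,2)] using d by (simp add: mat_smult_mult)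
    have "\<eta> (a * b) * ?l = snd P2 a * (\<eta> b * ?l) + \<eta> a * (snd W b * ?l)"
      unfolding cocycle_mult[OF PM(3) W(1,2)] using d by (simp add: mat_add_mult mat_assoc)
    then show "\<eta> (a * b) * ?l = snd P2 a * (\<eta> b * ?l) + \<eta> a * ?l * snd ?S b"
      using d module_dim[OF S(1)] S(2) by (simp add: module_hom_comm[OF S(5), symmetric] mat_assoc)
  qed
  have nonsplit: "\<not> (\<exists>A\<in>carrier_mat (fst P2) (fst W). \<forall>a. \<eta> a + A * snd W a = snd P2 a * A)"
  proof
    assume "\<exists>A\<in>carrier_mat (fst P2) (fst W). \<forall>a. \<eta> a + A * snd W a = snd P2 a * A"
    then obtain A where A: "A \<in> carrier_mat (fst P2) (fst W)" "\<And>a. \<eta> a + A * snd W a = snd P2 a * A" by blast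
    \<comment> \<open>A trivialization \<open>A\<close> of the cocycle measures how far the linear
      retraction \<open>B'\<close> is from a homomorphism; adding \<open>A * C'\<close> corrects it
      without changing it on the image of \<open>B\<close>.\<close>
    define r where "r = B' + A * C'"
    note dA = d carrier_matD[OF A(1)]
    have rd: "dim_row r = fst P2" "dim_col r = fst P1" unfolding r_def using dA by simp_all
    have "r * B = B' * B + A * (C' * B)" unfolding r_def using dA by (simp add: mat_add_mult mat_assoc)
    then have rB: "r * B = 1\<^sub>m (fst P2)" unfolding B'(2) W(6) using dA by (simp add: mat_mult_zero mat_group)
    have "r * C = B' * C + A * (C' * C)" unfolding r_def using dA by (simp add: mat_add_mult mat_assoc)
    then have rC: "r * C = A" unfolding W(5,7) using dA by (simp add: mat_mult_one mat_group)
    have dec: "X = (X * B) * B' + (X * C) * C'" if "dim_col X = fst P1" for X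
    proof -
      have "X = X * (B * B' + C * C')" unfolding W(8) using that by (simp add: mat_mult_one)
      then show ?thesis using that d by (simp add: mat_mult_add mat_assoc)
    qed
    have "r \<in> module_hom P1 P2"
    proof (rule module_homI)
      fix a
      have "(r * snd P1 a) * B = r * (snd P1 a * B)" using rd d by (simp add: mat_assoc)
      also have "\<dots> = (r * B) * snd P2 a" unfolding module_hom_comm[OF B, symmetric] using rd d by (simp add: mat_assoc)
      also have "\<dots> = (snd P2 a * r) * B" using rB rd d by (simp add: mat_assoc mat_one_mult mat_mult_one)
      finally have 1: "(r * snd P1 a) * B = (snd P2 a * r) * B" .
      have "(r * snd P1 a) * C = (r * B) * \<eta> a + (r * C) * snd W a"
        using rd d by (simp add: mat_assoc spec[OF W(9)] mat_mult_add)
      also have "\<dots> = snd P2 a * A" unfolding rB rC using d A(2)[of a] by (simp add: mat_one_mult)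
      also have "\<dots> = (snd P2 a * r) * C" using rd d rC by (simp add: mat_assoc)
      finally have 2: "(r * snd P1 a) * C = (snd P2 a * r) * C" .
      show "r * snd P1 a = snd P2 a * r"
        using dec[of "r * snd P1 a"] dec[of "snd P2 a * r"] rd d unfolding 1 2 by simp
    qed (use rd in \<open>auto intro: carrier_matI\<close>)
    then show False using contra rB by blast
  qed
  let ?x = "direct_sum P2 ?E" and ?z = "extension P2 ?S ?\<eta>" and ?d = "fst P2 + (fst W + fst Q)"
  have fst_x: "fst ?x = ?d" and fst_z: "fst ?z = ?d" by (simp_all add: direct_sum_def fst_extension)
  have eq_x: "(?d, snd ?x) = ?x" and eq_z: "(?d, snd ?z) = ?z"
    by (rule prod_eqI; simp only: fst_conv snd_conv fst_x fst_z)+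
  have x: "is_module (?d, snd ?x)" unfolding eq_x by (rule direct_sum(1)[OF PM(3) E(1)])
  have z: "is_module (?d, snd ?z)" unfolding eq_z by (rule extension_module[OF PM(3) S(1) \<eta>'])
  have less: "hom_dim ?z P2 < hom_dim ?x P2"
    by (rule hom_dim_extension_less[OF PM(3) W(1) Q(1) FM F(2) Q(2,3,9) F(5) W(2) \<eta>' nonsplit])
  obtain g where g: "g \<in> mod_polys ?d" "rep_eval (snd ?x) g \<noteq> 0"
    "\<forall>\<tau>. is_module (?d, \<tau>) \<longrightarrow> rep_eval \<tau> g \<noteq> 0 \<longrightarrow> hom_dim ?x P2 \<le> hom_dim (?d, \<tau>) P2"
    by (rule projective_iso_open[OF projective_direct_sum[OF P(3) Eproj] fst_x PM(3)])
  obtain f where f: "f \<in> mod_polys ?d" "rep_eval (snd ?z) f \<noteq> 0"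
    "\<forall>\<tau>. is_module (?d, \<tau>) \<longrightarrow> rep_eval \<tau> f \<noteq> 0 \<longrightarrow> hom_dim (?d, \<tau>) P2 \<le> hom_dim ?z P2"
    using hom_dim_upper_semicontinuous[OF z PM(3), unfolded eq_z] by (elim bexE conjE) (rule that)
  \<comment> \<open>For this module \<open>g\<close> bounds the dimension of the homomorphisms into
    \<open>P2\<close> from below by that of \<open>?x\<close>, and \<open>f\<close> bounds it from
    above by that of \<open>?z\<close>.\<close>
  obtain \<tau> where \<tau>: "is_module (?d, \<tau>)" "rep_eval \<tau> g \<noteq> 0" "rep_eval \<tau> f \<noteq> 0"
    by (rule geometrically_irreducible_meet[OF gi x z connected_to_direct_sum[OF PM(3) W(1) Q(1,2) \<eta>'] g(1,2) f(1,2)])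
  have "hom_dim (?d, \<tau>) P2 \<le> hom_dim ?z P2" by (rule mp[OF mp[OF spec[OF f(3)] \<tau>(1)] \<tau>(3)])
  with mp[OF mp[OF spec[OF g(3)] \<tau>(1)] \<tau>(2)] have "hom_dim ?x P2 \<le> hom_dim ?z P2" by (rule le_trans)
  from leD[OF this] less show False by (rule notE)
qed

text \<open>The terms beyond the end of the resolution are zero, so exactness makes the last map
  injective; the retraction that then exists splits off the last term.\<close>

lemma geometrically_irreducible_shorten_resolution:
  assumes gi: geometrically_irreducible and M: "has_projective_resolution M (Suc (Suc N))"
  shows "has_projective_resolution M (Suc N)"
proof -
  obtain P \<epsilon> \<delta> where P: "\<And>i. projective (P i)" "\<And>i. i > Suc (Suc N) \<Longrightarrow> fst (P i) = 0"
    "\<epsilon> \<in> module_hom (P 0) M" "\<And>i. \<delta> i \<in> module_hom (P (Suc i)) (P i)" "mat_image \<epsilon> = carrier_vec (fst M)"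
    "mat_image (\<delta> 0) = mat_kernel \<epsilon>" "\<And>i. mat_image (\<delta> (Suc i)) = mat_kernel (\<delta> i)"
    using M unfolding has_projective_resolution_def by blast
  have "v = 0\<^sub>v (fst (P (Suc (Suc N))))"
    if v: "v \<in> carrier_vec (fst (P (Suc (Suc N))))" "\<delta> (Suc N) *\<^sub>v v = 0\<^sub>v (fst (P (Suc N)))" for v
  proof -
    have "v \<in> mat_image (\<delta> (Suc (Suc N)))"
      unfolding P(7) mat_kernel_def using v module_hom_dim[OF P(4)[of "Suc N"]] by simp
    then obtain u where u: "v = \<delta> (Suc (Suc N)) *\<^sub>v u" "u \<in> carrier_vec 0"
      using module_hom_dim[OF P(4)[of "Suc (Suc N)"]] P(2)[of "Suc (Suc (Suc N))"] by (auto simp: mat_image_def)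
    show ?thesis
      unfolding u(1) using u(2) module_hom_dim[OF P(4)[of "Suc (Suc N)"]] P(2)[of "Suc (Suc (Suc N))"]
      by (intro eq_vecI) (simp_all add: scalar_prod_def)
  qed
  from retraction_exists[OF gi P(1) P(1) P(1) P(4) P(4) this P(7)]
  obtain r where r: "r \<in> module_hom (P (Suc N)) (P (Suc (Suc N)))" "r * \<delta> (Suc N) = 1\<^sub>m (fst (P (Suc (Suc N))))" by blast
  show ?thesis by (rule shorten_resolution[OF P r])
qed

theorem geometrically_irreducible_imp_hereditary:
  assumes gi: geometrically_irreducible and fin: "gl_dim < \<infinity>"
  shows hereditary
proof -
  have "proj_dim M \<le> 1" if M: "is_module M" for M
  proof -
    have "proj_dim M \<le> gl_dim" unfolding gl_dim_def using M by (intro SUP_upper) simp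
    then have "proj_dim M < \<infinity>" using fin by (rule le_less_trans)
    \<comment> \<open>The infimum over the empty set is infinite, so a finite global dimension
      forces every module to have some finite resolution.\<close>
    moreover have "proj_dim M = \<infinity>" if "{n. has_projective_resolution M n} = {}"
      unfolding proj_dim_def that by (simp only: image_empty Inf_empty top_enat_def)
    ultimately obtain n where "has_projective_resolution M n" by (metis Collect_empty_eq less_irrefl)
    then have "\<exists>m\<le>1. has_projective_resolution M m"
    proof (induction n)
      case (Suc n)
      \<comment> \<open>Lengths 0 and 1 are already admissible. A length \<open>Suc n\<close> of at
        least two shortens to \<open>n\<close>, that is, \<open>N = n - 1\<close>, and the induction
        hypothesis applies.\<close>
      then show ?case
        using geometrically_irreducible_shorten_resolution[OF gi, of M "n - 1"] by (cases n) auto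
    qed auto
    then obtain m where "m \<le> 1" "has_projective_resolution M m" by blast
    then show ?thesis
      unfolding proj_dim_def by (intro INF_lower2[of m]) (auto simp: one_enat_def)
  qed
  then show ?thesis unfolding hereditary_def gl_dim_def by (intro SUP_least) simp
qed

end

theorem corollary1p4:
  fixes scale :: "'k::alg_closed_field \<Rightarrow> 'a::{ring, monoid_mult} \<Rightarrow> 'a"
  assumes "fin_dim_algebra scale"
    and "fin_dim_algebra.gl_dim scale < \<infinity>"
  shows "fin_dim_algebra.geometrically_irreducible scale \<longleftrightarrow> fin_dim_algebra.hereditary scale"
proof -
  interpret alg_closed_algebra scale
    by (rule alg_closed_algebra.intro[OF assms(1)])
  show ?thesis
    using geometrically_irreducible_imp_hereditary[OF _ assms(2)] hereditary_imp_geometrically_irreducible by blast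
qed

end
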